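(* Let $\sigma$ be a real-valued $C^1$ function on the equator $\partial\Omega$ of the upper unit hemisphere $\Omega$, and let $\lambda_1(\sigma)\le\lambda_2(\sigma)\le\cdots$ be the Robin eigenvalues (with multiplicity). There exists a constant $C=C(\sigma)>0$ such that all Robin eigenvalues belong to the union of intervals $$\bigcup_{\ell=0}^\infty \Lambda_\ell,\qquad \Lambda_\ell=\bigl(\ell(\ell+1)-C\sqrt{\ell+1},\ \ell(\ell+1)+C\sqrt{\ell+1}\bigr).$$ Moreover, for all sufficiently large $\ell$, the total number of Robin eigenvalues (counting multiplicities) in $\bigcup_{k=0}^{\ell-1}\Lambda_k$ is $L:=\ell(\ell+1)/2$, and there are exactly $\ell+1$ Robin eigenvalues (counting multiplicities) in $\Lambda_\ell$. Thus, for all sufficiently large $\ell$, the eigenvalues in $\Lambda_\ell$ are $\lambda_{L+k}(\sigma)$ with $k=1,\dots,\ell+1$.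
   Context: $\Omega$ is the two-dimensional upper unit hemisphere with spherical coordinates $\theta\in[0,\pi/2]$ (polar angle, $\theta=0$ the North pole) and $\varphi\in(-\pi,\pi]$ (azimuthal angle); its boundary $\partial\Omega$ is the equator $\theta=\pi/2$. $L^2(\Omega)$ is taken with respect to $\sin\theta\,d\theta\,d\varphi$. The Robin eigenvalues are the eigenvalues $\lambda$ of the problem $-\Delta u=\lambda u$ on $\Omega$, $\frac{\partial u}{\partial n}+\sigma u=0$ on $\partial\Omega$, where $\Delta=\frac1{\sin\theta}\frac{\partial}{\partial\theta}\sin\theta\frac{\partial}{\partial\theta}+\frac1{\sin^2\theta}\frac{\partial^2}{\partial\varphi^2}$ is the Laplace–Beltrami operator and $\frac{\partial u}{\partial n}=\frac{\partial u}{\partial\theta}$ at $\theta=\pi/2$. Precisely, they are the eigenvalues of the self-adjoint operator $H[\sigma]$ in $L^2(\Omega)$ associated with the closed lower semibounded quadratic form $$h[\sigma](u)=\int_\Omega|\nabla u|^2dx+\int_{-\pi}^\pi\sigma(\varphi)|u(\pi/2,\varphi)|^2d\varphi,\qquad u\in W^1_2(\Omega),$$ where $\int_\Omega|\nabla u|^2dx=\int_{-\pi}^\pi\int_0^{\pi/2}\bigl(|\partial_\theta u|^2+\frac{1}{\sin^2\theta}|\partial_\varphi u|^2\bigr)\sin\theta\,d\theta\,d\varphi$, $W_2^1(\Omega)$ is the Sobolev space of $u\in L^2(\Omega)$ with finite Dirichlet integral, and $u(\pi/2,\cdot)$ is the boundary trace. They are enumerated in non-decreasing order, repeated according to multiplicity,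 and tend to $\infty$. *)

theory Defs
  imports "HOL-Analysis.Analysis" "HOL-Library.Extended_Nat"
begin

text \<open>
  Points of the closed upper unit hemisphere are written in spherical coordinates
  \<open>(\<theta>, \<phi>)\<close>.  Functions on the hemisphere have type \<open>real \<times> real \<Rightarrow> complex\<close>; only their values
  on \<open>hemi_dom\<close> matter, and elements of the space \<open>L\<^sup>2\<close> are represented by Borel functions that are
  identified when equal almost everywhere.
\<close>

definition hemi_dom :: "(real \<times> real) set" where
  "hemi_dom = {0..pi/2} \<times> {-pi<..pi}"

definition hemi :: "(real \<times> real) measure" where
  "hemi = density lborel (\<lambda>x. ennreal (indicator hemi_dom x * sin (fst x)))"

definition sphere_point :: "real \<times> real \<Rightarrow> real \<times> real \<times> real" where
  "sphere_point = (\<lambda>(\<theta>, \<phi>). (sin \<theta> * cos \<phi>, sin \<theta> * sin \<phi>, cos \<theta>))"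

definition L2 :: "(real \<times> real \<Rightarrow> complex) set" where
  "L2 = {u \<in> borel_measurable borel. integrable hemi (\<lambda>x. (cmod (u x))\<^sup>2)}"

definition L2_inner :: "(real \<times> real \<Rightarrow> complex) \<Rightarrow> (real \<times> real \<Rightarrow> complex) \<Rightarrow> complex" where
  "L2_inner u v = (LINT x|hemi. u x * cnj (v x))"

definition C1 :: "('a::real_normed_vector \<Rightarrow> 'b::real_normed_vector) \<Rightarrow> bool" where
  "C1 f \<longleftrightarrow> (\<exists>f'. (\<forall>x. (f has_derivative blinfun_apply (f' x)) (at x)) \<and> continuous_on UNIV f')"

text \<open>
  Test functions for the weak derivatives with respect to \<open>\<theta>\<close> and \<open>\<phi>\<close>.  They are
  \<open>2\<pi>\<close>-periodic in \<open>\<phi>\<close>, because the meridian \<open>\<phi> = \<pi>\<close> lies inside the hemisphere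
  (so that a function in \<open>W21\<close> cannot jump across it), and they vanish near the equator and near the
  pole, where the coordinates degenerate.  Excluding the pole does not change the Sobolev space: in
  dimension two a single point is removable for functions with square integrable gradient.
\<close>

definition test_function :: "(real \<times> real \<Rightarrow> real) \<Rightarrow> bool" where
  "test_function \<psi> \<longleftrightarrow> C1 \<psi> \<and> (\<forall>\<theta> \<phi>. \<psi> (\<theta>, \<phi> + 2 * pi) = \<psi> (\<theta>, \<phi>)) \<and>
     (\<exists>\<epsilon>>0. \<forall>\<theta> \<phi>. \<theta> < \<epsilon> \<or> pi/2 - \<epsilon> < \<theta> \<longrightarrow> \<psi> (\<theta>, \<phi>) = 0)"

definition has_weak_dtheta ::
    "(real \<times> real \<Rightarrow> complex) \<Rightarrow> (real \<times> real \<Rightarrow> complex) \<Rightarrow> bool" where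
  "has_weak_dtheta u p \<longleftrightarrow> (\<forall>\<psi>. test_function \<psi> \<longrightarrow>
     (LINT x:hemi_dom|lborel. frechet_derivative \<psi> (at x) (1, 0) *\<^sub>R u x) =
     - (LINT x:hemi_dom|lborel. \<psi> x *\<^sub>R p x))"

definition has_weak_dphi ::
    "(real \<times> real \<Rightarrow> complex) \<Rightarrow> (real \<times> real \<Rightarrow> complex) \<Rightarrow> bool" where
  "has_weak_dphi u q \<longleftrightarrow> (\<forall>\<psi>. test_function \<psi> \<longrightarrow>
     (LINT x:hemi_dom|lborel. frechet_derivative \<psi> (at x) (0, 1) *\<^sub>R u x) =
     - (LINT x:hemi_dom|lborel. \<psi> x *\<^sub>R q x))"

definition W21 :: "(real \<times> real \<Rightarrow> complex) set" where
  "W21 = {u \<in> L2. (\<exists>p\<in>L2. has_weak_dtheta u p) \<and>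
     (\<exists>q. (\<lambda>x. q x / of_real (sin (fst x))) \<in> L2 \<and> has_weak_dphi u q)}"

text \<open>Weak derivatives are unique almost everywhere on \<open>hemi_dom\<close>, so the choices are harmless.\<close>

definition weak_dtheta :: "(real \<times> real \<Rightarrow> complex) \<Rightarrow> real \<times> real \<Rightarrow> complex" where
  "weak_dtheta u = (SOME p. p \<in> L2 \<and> has_weak_dtheta u p)"

definition weak_dphi :: "(real \<times> real \<Rightarrow> complex) \<Rightarrow> real \<times> real \<Rightarrow> complex" where
  "weak_dphi u =
     (SOME q. (\<lambda>x. q x / of_real (sin (fst x))) \<in> L2 \<and> has_weak_dphi u q)"

definition dirichlet :: "(real \<times> real \<Rightarrow> complex) \<Rightarrow> (real \<times> real \<Rightarrow> complex) \<Rightarrow> complex" where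
  "dirichlet u v = (LINT x|hemi. weak_dtheta u x * cnj (weak_dtheta v x) +
     weak_dphi u x * cnj (weak_dphi v x) / of_real ((sin (fst x))\<^sup>2))"

definition W21_norm :: "(real \<times> real \<Rightarrow> complex) \<Rightarrow> real" where
  "W21_norm u = sqrt (Re (L2_inner u u + dirichlet u u))"

text \<open>
  The boundary trace on the equator: the continuous extension to \<open>W21\<close> of the restriction map on
  functions that are \<open>C\<^sup>1\<close> up to the boundary (restrictions of \<open>C\<^sup>1\<close> functions on 3-space).
\<close>

definition C1_hemi :: "(real \<times> real \<Rightarrow> complex) set" where
  "C1_hemi = {F \<circ> sphere_point | F. C1 F}"

definition has_trace :: "(real \<times> real \<Rightarrow> complex) \<Rightarrow> (real \<Rightarrow> complex) \<Rightarrow> bool" where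
  "has_trace u g \<longleftrightarrow> g \<in> borel_measurable borel \<and>
     set_integrable lborel {-pi<..pi} (\<lambda>\<phi>. (cmod (g \<phi>))\<^sup>2) \<and>
     (\<exists>w. (\<forall>n. w n \<in> C1_hemi) \<and>
        (\<lambda>n. W21_norm (\<lambda>x. w n x - u x)) \<longlonglongrightarrow> 0 \<and>
        (\<lambda>n. LINT \<phi>:{-pi<..pi}|lborel. (cmod (w n (pi/2, \<phi>) - g \<phi>))\<^sup>2) \<longlonglongrightarrow> 0)"

definition trace_eq :: "(real \<times> real \<Rightarrow> complex) \<Rightarrow> real \<Rightarrow> complex" where
  "trace_eq u = (SOME g. has_trace u g)"

text \<open>
  The equator is parametrised by \<open>\<phi>\<close>; the Robin parameter \<open>\<sigma>\<close> is a \<open>2\<pi>\<close>-periodic function.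
  \<open>robin_form\<close> is the sesquilinear form whose diagonal \<open>robin_form \<sigma> u u\<close> is the quadratic form,
  and \<open>robin_op_rel\<close> is the graph of the operator in \<open>L\<^sup>2\<close> associated with it.
\<close>

definition robin_form :: "(real \<Rightarrow> real) \<Rightarrow>
    (real \<times> real \<Rightarrow> complex) \<Rightarrow> (real \<times> real \<Rightarrow> complex) \<Rightarrow> complex" where
  "robin_form \<sigma> u v = dirichlet u v +
     (LINT \<phi>:{-pi<..pi}|lborel. of_real (\<sigma> \<phi>) * trace_eq u \<phi> * cnj (trace_eq v \<phi>))"

definition robin_op_rel :: "(real \<Rightarrow> real) \<Rightarrow>
    (real \<times> real \<Rightarrow> complex) \<Rightarrow> (real \<times> real \<Rightarrow> complex) \<Rightarrow> bool" where
  "robin_op_rel \<sigma> u f \<longleftrightarrow> u \<in> W21 \<and> f \<in> L2 \<and> (\<forall>v\<in>W21. robin_form \<sigma> u v = L2_inner f v)"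

definition robin_eigenspace :: "(real \<Rightarrow> real) \<Rightarrow> real \<Rightarrow> (real \<times> real \<Rightarrow> complex) set" where
  "robin_eigenspace \<sigma> \<mu> = {u. robin_op_rel \<sigma> u (\<lambda>x. of_real \<mu> * u x)}"

definition is_robin_eigenvalue :: "(real \<Rightarrow> real) \<Rightarrow> real \<Rightarrow> bool" where
  "is_robin_eigenvalue \<sigma> \<mu> \<longleftrightarrow> (\<exists>u\<in>robin_eigenspace \<sigma> \<mu>. \<not> (AE x in hemi. u x = 0))"

definition L2_independent :: "nat \<Rightarrow> (nat \<Rightarrow> real \<times> real \<Rightarrow> complex) \<Rightarrow> bool" where
  "L2_independent n us \<longleftrightarrow>
     (\<forall>c. (AE x in hemi. (\<Sum>i<n. c i * us i x) = 0) \<longrightarrow> (\<forall>i<n. c i = 0))"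

text \<open>The dimension of the eigenspace in \<open>L\<^sup>2\<close>; it is \<open>0\<close> iff \<open>\<mu>\<close> is not an eigenvalue.\<close>

definition robin_mult :: "(real \<Rightarrow> real) \<Rightarrow> real \<Rightarrow> enat" where
  "robin_mult \<sigma> \<mu> =
     (SUP n\<in>{n. \<exists>us. (\<forall>i<n. us i \<in> robin_eigenspace \<sigma> \<mu>) \<and> L2_independent n us}. enat n)"

text \<open>The sum of the multiplicities of all eigenvalues in \<open>I\<close>.\<close>

definition robin_count :: "(real \<Rightarrow> real) \<Rightarrow> real set \<Rightarrow> enat" where
  "robin_count \<sigma> I = (SUP A\<in>{A. finite A \<and> A \<subseteq> I}. \<Sum>\<mu>\<in>A. robin_mult \<sigma> \<mu>)"

text \<open>
  The \<open>k\<close>-th eigenvalue, \<open>k \<ge> 1\<close>, in non-decreasing order and repeated according to multiplicity: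
  the smallest \<open>t\<close> such that at least \<open>k\<close> eigenvalues are at most \<open>t\<close>.
\<close>

definition robin_ev :: "(real \<Rightarrow> real) \<Rightarrow> nat \<Rightarrow> real" where
  "robin_ev \<sigma> k = Inf {t. enat k \<le> robin_count \<sigma> {..t}}"

definition cluster :: "real \<Rightarrow> nat \<Rightarrow> real set" where
  "cluster C l = {real (l * (l + 1)) - C * sqrt (real (l + 1)) <..<
                  real (l * (l + 1)) + C * sqrt (real (l + 1))}"

end

theory Submission
  imports Defs "HOL-Library.Diagonal_Subsequence"
begin

text \<open>
  The Neumann eigenfunctions are spherical harmonics of degree \<open>l\<close> and order \<open>m\<close> with \<open>l - \<bar>m\<bar>\<close>
  even, so the Neumann eigenvalue \<open>l (l + 1)\<close> has multiplicity \<open>l + 1\<close>.  A Rellich identity bounds the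
  boundary value of the normalised latitudinal factor, \<open>f (\<pi>/2)\<^sup>2 \<le> 8 \<surd>(l + 1) / \<surd>(l - \<bar>m\<bar> + 1)\<close>.
  Different \<open>m\<close> are orthogonal on the equator, so by Cauchy--Schwarz the boundary form is controlled,
  mode by mode, through \<open>\<Sum>\<^sub>l f\<^sub>l\<^sub>m (\<pi>/2)\<^sup>2 / \<bar>l (l + 1) - t\<bar>\<close>.  When \<open>t\<close> has distance at least
  \<open>C \<surd>(l + 1)\<close> from every \<open>l (l + 1)\<close>, this sum is \<open>O (C\<^sup>-\<^sup>1\<^sup>/\<^sup>4)\<close> uniformly in \<open>m\<close> and \<open>t\<close>.  For
  large \<open>C\<close> the boundary form is therefore at most half of the form of \<open>\<bar>- \<Delta> - t\<bar>\<close>, which excludes \<open>t\<close>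
  as an eigenvalue and, by the variational principle, fixes the number of eigenvalues below \<open>t\<close> to be the
  number of Neumann eigenvalues below \<open>t\<close>.
\<close>

text \<open>The width \<open>sqrt (l + 1)\<close> comes from the sectoral harmonics,
  \<open>\<bar>m\<bar>\<close> close to \<open>l\<close>: they concentrate at the equator, and their
  normalised squared boundary value has order \<open>sqrt l\<close>. Since \<sigma> may couple all
  orders \<open>m\<close>, single eigenvalues are not followed; only the number of them below a gap
  is compared with the unperturbed one. The other obstacle is the weak setting: an element of
  \<open>W21\<close> is known only through test functions that vanish near the equator and the pole,
  and its trace only through C1 approximations. The explicit eigenfunctions bridge both. They are
  polynomials in the ambient coordinates, hence C1. Green's identity against them holds for every
  element of \<open>W21\<close>, because the Neumann condition lets the cutoff at the equator be
  removed. With completeness it follows that partial sums converge in the norm of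
  \<open>W21\<close>. Approximation by C1 functions, uniqueness of weak gradients, compactness of
  the embedding and existence of traces all come from this one family, without mollifiers or
  regularity theory.\<close>

section \<open>Homogeneous linear systems and diagonal subsequences\<close>

text \<open>The source of all dimension counts below: among more vectors than conditions, some
  nontrivial combination satisfies every orthogonality condition.\<close>

lemma homogeneous_system_solvable:
  fixes M :: "nat \<Rightarrow> 'i \<Rightarrow> 'a::field"
  assumes "finite J" "k < card J"
  shows "\<exists>c. (\<exists>j\<in>J. c j \<noteq> 0) \<and> (\<forall>i<k. (\<Sum>j\<in>J. c j * M i j) = 0)"
  using assms
proof (induction k arbitrary: J M)
  case 0
  then obtain j where "j \<in> J" by fastforce
  then show ?case by (intro exI[of _ "\<lambda>_. 1"]) auto
next
  case (Suc k)
  show ?case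
  proof (cases "\<forall>j\<in>J. M k j = 0")
    case True
    obtain c where c: "\<exists>j\<in>J. c j \<noteq> 0" "\<forall>i<k. (\<Sum>j\<in>J. c j * M i j) = 0"
      using Suc.IH[of J M] Suc.prems by auto
    then show ?thesis using True by (intro exI[of _ c]) (auto simp: less_Suc_eq)
  next
    case False
    then obtain p where p: "p \<in> J" "M k p \<noteq> 0" by auto
    \<comment> \<open>Gaussian elimination: equation \<open>k\<close> is solved for the unknown
      \<open>p\<close>, whose coefficient is not 0, and the result is substituted into the other
      equations. The value of \<open>c'\<close> at \<open>p\<close> below restores equation
      \<open>k\<close>.\<close>
    define M' where "M' i j = M i j - M i p * M k j / M k p" for i j
    have "finite (J - {p})" "k < card (J - {p})" using Suc.prems p by auto
    then obtain c where c: "\<exists>j\<in>J - {p}. c j \<noteq> 0" "\<forall>i<k. (\<Sum>j\<in>J - {p}. c j * M' i j) = 0"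
      using Suc.IH[of "J - {p}" M'] by blast
    define s where "s = (\<Sum>j\<in>J - {p}. c j * M k j)"
    define c' where "c' = c(p := - s / M k p)"
    have sum: "(\<Sum>j\<in>J. c' j * M i j) = - s / M k p * M i p + (\<Sum>j\<in>J - {p}. c j * M i j)" for i
    proof -
      have "(\<Sum>j\<in>J. c' j * M i j) = c' p * M i p + (\<Sum>j\<in>J - {p}. c' j * M i j)"
        using p Suc.prems by (subst sum.remove[of J p]) auto
      also have "(\<Sum>j\<in>J - {p}. c' j * M i j) = (\<Sum>j\<in>J - {p}. c j * M i j)"
        by (intro sum.cong) (auto simp: c'_def)
      finally show ?thesis by (simp add: c'_def)
    qed
    have "(\<Sum>j\<in>J. c' j * M i j) = 0" if "i < Suc k" for i
    proof (cases "i = k")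
      case True
      then show ?thesis unfolding sum using p by (simp add: s_def)
    next
      case False
      then have "i < k" using that by simp
      then have "0 = (\<Sum>j\<in>J - {p}. c j * M' i j)" using c by simp
      also have "\<dots> = (\<Sum>j\<in>J - {p}. c j * M i j) - (\<Sum>j\<in>J - {p}. c j * M k j) * (M i p / M k p)"
        unfolding M'_def sum_distrib_right sum_subtractf[symmetric]
        by (intro sum.cong) (auto simp: field_simps)
      finally show ?thesis unfolding sum s_def[symmetric] by simp
    qed
    moreover have "\<exists>j\<in>J. c' j \<noteq> 0" using c by (auto simp: c'_def)
    ultimately show ?thesis by blast
  qed
qed

text \<open>Cantor's diagonal argument along the enumeration \<open>from_nat\<close> of the index
  type: stage \<open>k\<close> makes coordinate \<open>from_nat k\<close> converge, and from index
  \<open>Suc k\<close> on the diagonal sequence is a subsequence of that stage. It supplies the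
  compactness for \<open>bounded_form_Cauchy_subseq\<close>.\<close>

lemma bounded_coordinates_convergent_subseq:
  fixes f :: "nat \<Rightarrow> 'i::countable \<Rightarrow> complex"
  assumes "\<And>n i. cmod (f n i) \<le> K"
  shows "\<exists>r. strict_mono r \<and> (\<forall>i. convergent (\<lambda>n. f (r n) i))"
proof -
  let ?P = "\<lambda>k (r::nat\<Rightarrow>nat). convergent (\<lambda>n. f (r n) (from_nat k))"
  interpret subseqs ?P
  proof (unfold convergent_def, unfold subseqs_def, auto)
    fix k :: nat and s :: "nat \<Rightarrow> nat" assume s: "strict_mono s"
    have "bounded (range (\<lambda>n. f (s n) (from_nat k)))"
      using assms by (auto simp: bounded_iff)
    then obtain l r where "strict_mono (r::nat\<Rightarrow>nat)" "((\<lambda>n. f (s n) (from_nat k)) \<circ> r) \<longlonglongrightarrow> l"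
      using bounded_imp_convergent_subsequence by blast
    then show "\<exists>r. strict_mono r \<and> (\<exists>L. (\<lambda>n. f (s (r n)) (from_nat k)) \<longlonglongrightarrow> L)"
      by (auto simp: o_def)
  qed
  have P: "?P k (diagseq \<circ> (+) (Suc k))" for k
  proof (rule diagseq_holds)
    fix r s :: "nat \<Rightarrow> nat" and n
    assume r: "strict_mono r" and "convergent (\<lambda>k. f (s k) (from_nat n))"
    then show "convergent (\<lambda>k. f ((s \<circ> r) k) (from_nat n))"
      using LIMSEQ_subseq_LIMSEQ[OF _ r] by (fastforce simp: convergent_def o_def)
  qed
  have that: "?P k diagseq" for k
  proof -
    obtain L where "(\<lambda>n. f (diagseq (n + Suc k)) (from_nat k)) \<longlonglongrightarrow> L"
      using P[of k] unfolding convergent_def o_def add.commute[of _ "Suc k"] by blast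
    from LIMSEQ_offset[OF this] show ?thesis unfolding convergent_def by blast
  qed
  then have "convergent (\<lambda>n. f (diagseq n) i)" for i
    using that[of "to_nat i"] by simp
  then show ?thesis using subseq_diagseq by blast
qed

section \<open>Hermitian forms on spaces of functions\<close>

definition lin_closed :: "('x \<Rightarrow> complex) set \<Rightarrow> bool" where
  "lin_closed W \<longleftrightarrow> (\<lambda>x. 0) \<in> W \<and> (\<forall>u\<in>W. \<forall>v\<in>W. \<forall>a b. (\<lambda>x. a * u x + b * v x) \<in> W)"

text \<open>Vectors are functions rather than classes modulo null functions. Forms are therefore at
  most semidefinite, and limits are determined only up to vectors on which the forms vanish.\<close>

locale hermitian =
  fixes W :: "('x \<Rightarrow> complex) set" and B :: "('x \<Rightarrow> complex) \<Rightarrow> ('x \<Rightarrow> complex) \<Rightarrow> complex"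
  assumes lin: "lin_closed W"
    and left: "\<lbrakk>u \<in> W; v \<in> W; w \<in> W\<rbrakk> \<Longrightarrow> B (\<lambda>x. a * u x + b * v x) w = a * B u w + b * B v w"
    and sym: "\<lbrakk>u \<in> W; v \<in> W\<rbrakk> \<Longrightarrow> B v u = cnj (B u v)"
begin

abbreviation q where "q u \<equiv> Re (B u u)"

lemma zero_mem: "(\<lambda>x. 0) \<in> W" and comb_mem: "\<lbrakk>u \<in> W; v \<in> W\<rbrakk> \<Longrightarrow> (\<lambda>x. a * u x + b * v x) \<in> W"
  using lin by (auto simp: lin_closed_def)

lemma add_mem: "\<lbrakk>u \<in> W; v \<in> W\<rbrakk> \<Longrightarrow> (\<lambda>x. u x + v x) \<in> W"
  using comb_mem[of u v 1 1] by simp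
lemma diff_mem: "\<lbrakk>u \<in> W; v \<in> W\<rbrakk> \<Longrightarrow> (\<lambda>x. u x - v x) \<in> W"
  using comb_mem[of u v 1 "-1"] by simp
lemma scale_mem: "u \<in> W \<Longrightarrow> (\<lambda>x. a * u x) \<in> W"
  using comb_mem[of u u a 0] by simp

lemma sum_mem: "(\<And>i. i \<in> A \<Longrightarrow> u i \<in> W) \<Longrightarrow> (\<lambda>x. \<Sum>i\<in>A. c i * u i x) \<in> W"
proof (induction A rule: infinite_finite_induct)
  case (insert i A)
  then show ?case using comb_mem[of "u i" "\<lambda>x. \<Sum>i\<in>A. c i * u i x" "c i" 1] by simp
qed (auto intro: zero_mem)

lemma right: "\<lbrakk>u \<in> W; v \<in> W; w \<in> W\<rbrakk> \<Longrightarrow> B w (\<lambda>x. a * u x + b * v x) = cnj a * B w u + cnj b * B w v"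
  using left[of u v w a b] sym[of u w] sym[of v w] sym[OF comb_mem[of u v a b], of w]
  by simp

lemma add_left: "\<lbrakk>u \<in> W; v \<in> W; w \<in> W\<rbrakk> \<Longrightarrow> B (\<lambda>x. u x + v x) w = B u w + B v w"
  using left[of u v w 1 1] by simp
lemma add_right: "\<lbrakk>u \<in> W; v \<in> W; w \<in> W\<rbrakk> \<Longrightarrow> B w (\<lambda>x. u x + v x) = B w u + B w v"
  using right[of u v w 1 1] by simp
lemma diff_left: "\<lbrakk>u \<in> W; v \<in> W; w \<in> W\<rbrakk> \<Longrightarrow> B (\<lambda>x. u x - v x) w = B u w - B v w"
  using left[of u v w 1 "-1"] by simp
lemma diff_right: "\<lbrakk>u \<in> W; v \<in> W; w \<in> W\<rbrakk> \<Longrightarrow> B w (\<lambda>x. u x - v x) = B w u - B w v"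
  using right[of u v w 1 "-1"] by simp
lemma scale_left: "\<lbrakk>u \<in> W; w \<in> W\<rbrakk> \<Longrightarrow> B (\<lambda>x. a * u x) w = a * B u w"
  using left[of u u w a 0] by simp
lemma scale_right: "\<lbrakk>u \<in> W; w \<in> W\<rbrakk> \<Longrightarrow> B w (\<lambda>x. a * u x) = cnj a * B w u"
  using right[of u u w a 0] by simp
lemma zero_left: "w \<in> W \<Longrightarrow> B (\<lambda>x. 0) w = 0"
  using left[of w w w 0 0] by simp
lemma zero_right: "w \<in> W \<Longrightarrow> B w (\<lambda>x. 0) = 0"
  using right[of w w w 0 0] by simp

lemma sum_left: "(\<And>i. i \<in> A \<Longrightarrow> u i \<in> W) \<Longrightarrow> w \<in> W \<Longrightarrow>
    B (\<lambda>x. \<Sum>i\<in>A. c i * u i x) w = (\<Sum>i\<in>A. c i * B (u i) w)"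
proof (induction A rule: infinite_finite_induct)
  case (insert i A)
  then show ?case
    using left[of "u i" "\<lambda>x. \<Sum>i\<in>A. c i * u i x" w "c i" 1] sum_mem[of A u c] by simp
qed (auto intro: zero_left)

lemma sum_right: "(\<And>i. i \<in> A \<Longrightarrow> u i \<in> W) \<Longrightarrow> w \<in> W \<Longrightarrow>
    B w (\<lambda>x. \<Sum>i\<in>A. c i * u i x) = (\<Sum>i\<in>A. cnj (c i) * B w (u i))"
proof (induction A rule: infinite_finite_induct)
  case (insert i A)
  then show ?case
    using right[of "u i" "\<lambda>x. \<Sum>i\<in>A. c i * u i x" w "c i" 1] sum_mem[of A u c] by simp
qed (auto intro: zero_right)

lemma diag_real: "u \<in> W \<Longrightarrow> B u u = of_real (q u)"
  using sym[of u u] by (metis Reals_cnj_iff of_real_Re)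

lemma Re_sym: "\<lbrakk>u \<in> W; v \<in> W\<rbrakk> \<Longrightarrow> Re (B v u) = Re (B u v)"
  using sym[of u v] by simp

lemma q_add: "\<lbrakk>u \<in> W; v \<in> W\<rbrakk> \<Longrightarrow> q (\<lambda>x. u x + v x) = q u + 2 * Re (B u v) + q v"
  by (simp add: add_left add_right add_mem Re_sym)

lemma q_diff: "\<lbrakk>u \<in> W; v \<in> W\<rbrakk> \<Longrightarrow> q (\<lambda>x. u x - v x) = q u - 2 * Re (B u v) + q v"
  by (simp add: diff_left diff_right diff_mem Re_sym)

lemma q_scale: "u \<in> W \<Longrightarrow> q (\<lambda>x. a * u x) = (cmod a)\<^sup>2 * q u"
proof -
  assume u: "u \<in> W"
  have "B (\<lambda>x. a * u x) (\<lambda>x. a * u x) = (a * cnj a) * B u u"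
    using u by (simp add: scale_left scale_right scale_mem)
  also have "a * cnj a = of_real ((cmod a)\<^sup>2)" by (simp only: complex_norm_square)
  finally show ?thesis by simp
qed

lemma parallelogram: "\<lbrakk>u \<in> W; v \<in> W\<rbrakk> \<Longrightarrow> q (\<lambda>x. u x + v x) + q (\<lambda>x. u x - v x) = 2 * q u + 2 * q v"
  by (simp add: q_add q_diff)

end

locale pos_hermitian = hermitian +
  assumes pos: "u \<in> W \<Longrightarrow> 0 \<le> Re (B u u)"
begin

lemma cauchy_schwarz:
  assumes u: "u \<in> W" and v: "v \<in> W"
  shows "(cmod (B u v))\<^sup>2 \<le> q u * q v"
proof -
  define c where "c = B u v"
  \<comment> \<open>Subtracting the multiple \<open>of_real s * c\<close> of \<open>v\<close>, which
    carries the phase of \<open>B u v\<close>, makes the cross term real; what remains is a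
    quadratic inequality in the real number \<open>s\<close>.\<close>
  have *: "0 \<le> q u - 2 * s * (cmod c)\<^sup>2 + s\<^sup>2 * (cmod c)\<^sup>2 * q v" for s :: real
  proof -
    have "0 \<le> q (\<lambda>x. u x - (of_real s * c) * v x)"
      using pos[OF diff_mem[OF u scale_mem[OF v]]] .
    also have "\<dots> = q u - 2 * Re (B u (\<lambda>x. (of_real s * c) * v x)) + (cmod (of_real s * c))\<^sup>2 * q v"
      using q_diff[OF u scale_mem[OF v]] q_scale[OF v] by simp
    also have "B u (\<lambda>x. (of_real s * c) * v x) = of_real s * (cnj c * c)"
      by (subst scale_right[OF v u]) (simp add: c_def)
    also have "cnj c * c = of_real ((cmod c)\<^sup>2)"
      by (metis complex_norm_square mult.commute)
    finally show ?thesis by (simp add: norm_mult power_mult_distrib algebra_simps)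
  qed
  show ?thesis
  proof (cases "q v = 0")
    case True
    have "(cmod c)\<^sup>2 = 0"
    proof (rule ccontr)
      assume n: "(cmod c)\<^sup>2 \<noteq> 0"
      \<comment> \<open>A null vector \<open>v\<close> leaves an inequality that is affine in
        \<open>s\<close>; this \<open>s\<close> makes its right side equal to -1.\<close>
      have "0 \<le> q u - 2 * ((q u + 1) / (2 * (cmod c)\<^sup>2)) * (cmod c)\<^sup>2"
        using *[of "(q u + 1) / (2 * (cmod c)\<^sup>2)"] True by simp
      then show False using n by simp
    qed
    then show ?thesis using True by (simp add: c_def)
  next
    case False
    then have "q v > 0" using pos[OF v] by simp
    have "0 \<le> q u - 2 * (1 / q v) * (cmod c)\<^sup>2 + (1 / q v)\<^sup>2 * (cmod c)\<^sup>2 * q v" by (rule *)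
    also have "\<dots> = q u - (cmod c)\<^sup>2 / q v"
      using False by (simp add: power2_eq_square field_simps)
    finally show ?thesis using \<open>q v > 0\<close> by (simp add: c_def field_simps)
  qed
qed

lemma null_left: "\<lbrakk>u \<in> W; v \<in> W; q u = 0\<rbrakk> \<Longrightarrow> B u v = 0"
  using cauchy_schwarz[of u v] by simp

lemma q_diff_le: "\<lbrakk>u \<in> W; v \<in> W\<rbrakk> \<Longrightarrow> q (\<lambda>x. u x - v x) \<le> 2 * q u + 2 * q v"
  using parallelogram[of u v] pos[OF add_mem[of u v]] by linarith

lemma tendsto_left:
  assumes "\<And>n. u n \<in> W" "w \<in> W" "v \<in> W" "(\<lambda>n. q (\<lambda>x. u n x - w x)) \<longlonglongrightarrow> 0"
  shows "(\<lambda>n. B (u n) v) \<longlonglongrightarrow> B w v"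
proof -
  have "(\<lambda>n. sqrt (q (\<lambda>x. u n x - w x) * q v)) \<longlonglongrightarrow> sqrt (0 * q v)"
    by (intro tendsto_intros assms)
  then have "(\<lambda>n. sqrt (q (\<lambda>x. u n x - w x) * q v)) \<longlonglongrightarrow> 0" by simp
  then have "(\<lambda>n. B (u n) v - B w v) \<longlonglongrightarrow> 0"
  proof (rule Lim_null_comparison[rotated])
    show "\<forall>\<^sub>F n in sequentially. cmod (B (u n) v - B w v) \<le> sqrt (q (\<lambda>x. u n x - w x) * q v)"
      using cauchy_schwarz[OF diff_mem] assms
      by (intro always_eventually allI real_le_rsqrt) (simp add: diff_left[symmetric])
  qed
  then show ?thesis by (simp add: LIM_zero_iff)
qed

text \<open>Expand around the limits: the product of the two errors is handled by Cauchy--Schwarz,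
  and the other terms by continuity in one argument.\<close>

lemma tendsto_both:
  assumes "\<And>n. u n \<in> W" "w \<in> W" "(\<lambda>n. q (\<lambda>x. u n x - w x)) \<longlonglongrightarrow> 0"
    and "\<And>n. v n \<in> W" "z \<in> W" "(\<lambda>n. q (\<lambda>x. v n x - z x)) \<longlonglongrightarrow> 0"
  shows "(\<lambda>n. B (u n) (v n)) \<longlonglongrightarrow> B w z"
proof -
  have "(\<lambda>n. sqrt (q (\<lambda>x. u n x - w x) * q (\<lambda>x. v n x - z x))) \<longlonglongrightarrow> sqrt (0 * 0)"
    by (intro tendsto_intros assms)
  then have "(\<lambda>n. sqrt (q (\<lambda>x. u n x - w x) * q (\<lambda>x. v n x - z x))) \<longlonglongrightarrow> 0" by simp
  then have 1: "(\<lambda>n. B (\<lambda>x. u n x - w x) (\<lambda>x. v n x - z x)) \<longlonglongrightarrow> 0"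
  proof (rule Lim_null_comparison[rotated])
    show "\<forall>\<^sub>F n in sequentially. cmod (B (\<lambda>x. u n x - w x) (\<lambda>x. v n x - z x))
        \<le> sqrt (q (\<lambda>x. u n x - w x) * q (\<lambda>x. v n x - z x))"
      using cauchy_schwarz[OF diff_mem diff_mem] assms
      by (intro always_eventually allI real_le_rsqrt) simp
  qed
  have 2: "(\<lambda>n. B (u n) z) \<longlonglongrightarrow> B w z" by (rule tendsto_left) (use assms in auto)
  have "(\<lambda>n. cnj (B (v n) w)) \<longlonglongrightarrow> cnj (B z w)"
    by (intro tendsto_cnj tendsto_left) (use assms in auto)
  then have 3: "(\<lambda>n. B w (v n)) \<longlonglongrightarrow> B w z"
    using sym[OF assms(4,2)] sym[OF assms(5,2)] by simp
  have "(\<lambda>n. B (\<lambda>x. u n x - w x) (\<lambda>x. v n x - z x) + B (u n) z + B w (v n) - B w z)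
     \<longlonglongrightarrow> 0 + B w z + B w z - B w z"
    by (intro tendsto_intros 1 2 3)
  moreover have "B (\<lambda>x. u n x - w x) (\<lambda>x. v n x - z x) + B (u n) z + B w (v n) - B w z = B (u n) (v n)" for n
    using assms by (simp add: diff_left diff_right diff_mem)
  ultimately show ?thesis by simp
qed

lemma q_tendsto:
  assumes "\<And>n. u n \<in> W" "w \<in> W" "(\<lambda>n. q (\<lambda>x. u n x - w x)) \<longlonglongrightarrow> 0"
  shows "(\<lambda>n. q (u n)) \<longlonglongrightarrow> q w"
  by (intro tendsto_Re tendsto_both assms)

end

lemma hermitian_comb:
  assumes "hermitian W A" "hermitian W B"
  shows "hermitian W (\<lambda>u v. A u v + of_real s * B u v)"
proof -
  interpret A: hermitian W A by fact
  interpret B: hermitian W B by fact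
  show ?thesis
  proof
    show "lin_closed W" by (rule A.lin)
    show "A v u + of_real s * B v u = cnj (A u v + of_real s * B u v)" if "u \<in> W" "v \<in> W" for u v
      using A.sym[OF that] B.sym[OF that] by simp
  qed (simp add: A.left B.left algebra_simps)
qed

lemma hermitian_subspace:
  assumes "hermitian W B" "V \<subseteq> W" "lin_closed V"
  shows "hermitian V B"
proof -
  interpret hermitian W B by fact
  show ?thesis using assms(2,3) by (intro hermitian.intro) (blast intro: left sym)+
qed

section \<open>Eigenvalue counting for perturbed forms\<close>

text \<open>The abstract Neumann problem: \<open>ip\<close> is the inner product, \<open>D\<close>
  the Dirichlet form, and \<open>D_e\<close> the weak eigenvalue equation of \<open>e j\<close>. The
  finite sets \<open>J n\<close> exhaust the indices by growing eigenvalue, so that partial sums are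
  finite. \<open>total\<close> speaks about both forms because a vector orthogonal to all
  \<open>e j\<close> is a null function, not literally 0; \<open>complete\<close> is completeness of
  the form domain.\<close>

locale spectral_basis = ip: pos_hermitian W ip + D: pos_hermitian W D
  for W :: "('x \<Rightarrow> complex) set" and ip D +
  fixes e :: "'i::countable \<Rightarrow> 'x \<Rightarrow> complex" and lam :: "'i \<Rightarrow> real" and J :: "nat \<Rightarrow> 'i set"
  assumes e_mem: "e j \<in> W"
    and orth: "ip (e i) (e j) = (if i = j then 1 else 0)"
    and D_e: "u \<in> W \<Longrightarrow> D u (e j) = of_real (lam j) * ip u (e j)"
    and fin: "finite (J n)"
    and J_mono: "m \<le> n \<Longrightarrow> J m \<subseteq> J n"
    and J_exhaust: "\<exists>n. j \<in> J n"
    and lam_large: "\<exists>n. \<forall>j. j \<notin> J n \<longrightarrow> R \<le> lam j"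
    and total: "\<lbrakk>u \<in> W; \<And>j. ip u (e j) = 0\<rbrakk> \<Longrightarrow> Re (ip u u) = 0 \<and> Re (D u u) = 0"
    and complete: "\<lbrakk>\<And>n. X n \<in> W;
        \<And>\<epsilon>::real. \<epsilon> > 0 \<Longrightarrow> \<exists>N::nat. \<forall>m\<ge>N. \<forall>n\<ge>N. ip.q (\<lambda>x. X m x - X n x) + D.q (\<lambda>x. X m x - X n x) < \<epsilon>\<rbrakk>
      \<Longrightarrow> \<exists>w\<in>W. (\<lambda>n. ip.q (\<lambda>x. X n x - w x)) \<longlonglongrightarrow> 0 \<and> (\<lambda>n. D.q (\<lambda>x. X n x - w x)) \<longlonglongrightarrow> 0"
begin

definition P :: "nat \<Rightarrow> ('x \<Rightarrow> complex) \<Rightarrow> 'x \<Rightarrow> complex" where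
  "P n u = (\<lambda>x. \<Sum>j\<in>J n. ip u (e j) * e j x)"

definition Q :: "nat \<Rightarrow> ('x \<Rightarrow> complex) \<Rightarrow> 'x \<Rightarrow> complex" where
  "Q n u = (\<lambda>x. u x - P n u x)"

lemma P_mem: "P n u \<in> W"
  unfolding P_def by (intro ip.sum_mem e_mem)

lemma Q_mem: "u \<in> W \<Longrightarrow> Q n u \<in> W"
  unfolding Q_def by (intro ip.diff_mem P_mem)

lemma PQ_eq: "u = (\<lambda>x. P n u x + Q n u x)"
  by (simp add: Q_def)

lemma ip_P: "ip (P n u) (e k) = (if k \<in> J n then ip u (e k) else 0)"
  unfolding P_def
  by (simp add: ip.sum_left e_mem orth fin if_distrib[of "\<lambda>z. _ * z"] cong: if_cong)

lemma ip_Q: "u \<in> W \<Longrightarrow> ip (Q n u) (e k) = (if k \<in> J n then 0 else ip u (e k))"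
  unfolding Q_def by (simp add: ip.diff_left P_mem e_mem ip_P)

lemma ip_QP: "u \<in> W \<Longrightarrow> ip (Q n u) (P n v) = 0"
  unfolding P_def[of n v] by (simp add: ip.sum_right e_mem Q_mem ip_Q)

lemma D_QP: "u \<in> W \<Longrightarrow> D (Q n u) (P n v) = 0"
  unfolding P_def[of n v] by (simp add: D.sum_right e_mem Q_mem ip_Q D_e)

lemma ip_PQ: "u \<in> W \<Longrightarrow> ip (P n v) (Q n u) = 0"
  using ip.sym[of "Q n u" "P n v"] by (simp add: ip_QP Q_mem P_mem)

lemma D_PQ: "u \<in> W \<Longrightarrow> D (P n v) (Q n u) = 0"
  using D.sym[of "Q n u" "P n v"] by (simp add: D_QP Q_mem P_mem)

lemma q_P: "u \<in> W \<Longrightarrow> ip.q (P n u) = (\<Sum>j\<in>J n. (cmod (ip u (e j)))\<^sup>2)"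
proof -
  assume u: "u \<in> W"
  have "ip (P n u) (P n u) = (\<Sum>j\<in>J n. of_real ((cmod (ip u (e j)))\<^sup>2))"
    apply (subst (2) P_def)
    apply (subst ip.sum_right)
      apply (simp_all add: e_mem P_mem ip_P)
    apply (intro sum.cong refl)
    by (metis complex_norm_square mult.commute of_real_power)
  then show ?thesis by simp
qed

lemma Dq_P: "u \<in> W \<Longrightarrow> D.q (P n u) = (\<Sum>j\<in>J n. lam j * (cmod (ip u (e j)))\<^sup>2)"
proof -
  assume u: "u \<in> W"
  have "D (P n u) (P n u) = (\<Sum>j\<in>J n. of_real (lam j * (cmod (ip u (e j)))\<^sup>2))"
    apply (subst (2) P_def)
    apply (subst D.sum_right)
      apply (simp_all add: e_mem P_mem D_e ip_P)
    apply (intro sum.cong refl)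
    by (metis (no_types, lifting) complex_norm_square mult.commute mult.left_commute of_real_power)
  then show ?thesis by simp
qed

lemma q_split: "u \<in> W \<Longrightarrow> ip.q u = ip.q (P n u) + ip.q (Q n u)"
  using ip.q_add[OF P_mem Q_mem, of u n u n] ip_PQ[of u n u] by (simp flip: PQ_eq)

lemma Dq_split: "u \<in> W \<Longrightarrow> D.q u = D.q (P n u) + D.q (Q n u)"
  using D.q_add[OF P_mem Q_mem, of u n u n] D_PQ[of u n u] by (simp flip: PQ_eq)

text \<open>The energies of the partial sums increase and stay below that of \<open>u\<close>, and
  by Pythagoras their differences are squared distances. So the partial sums are Cauchy. Their limit
  \<open>w\<close> has the same coordinates as \<open>u\<close>, and \<open>total\<close> shows that
  \<open>u - w\<close> is null for both forms.\<close>

lemma approx: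
  assumes u: "u \<in> W"
  shows "(\<lambda>n. ip.q (Q n u)) \<longlonglongrightarrow> 0" "(\<lambda>n. D.q (Q n u)) \<longlonglongrightarrow> 0"
proof -
  define a where "a n = ip.q (P n u) + D.q (P n u)" for n
  have diff: "ip.q (\<lambda>x. P m u x - P n u x) + D.q (\<lambda>x. P m u x - P n u x) = a m - a n" if "n \<le> m" for m n
  proof -
    have PP: "P n (P m u) = P n u"
      unfolding P_def[of n "P m u"] P_def[of n u] ip_P using J_mono[OF that] by (intro ext sum.cong) auto
    then have QQ: "Q n (P m u) = (\<lambda>x. P m u x - P n u x)" by (simp add: Q_def)
    show ?thesis
      using q_split[OF P_mem, of m u n] Dq_split[OF P_mem, of m u n] unfolding PP QQ a_def by simp
  qed
  have a_mono: "a n \<le> a m" if "n \<le> m" for m n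
    using diff[OF that] ip.pos[OF ip.diff_mem[OF P_mem P_mem], of m u n u] D.pos[OF ip.diff_mem[OF P_mem P_mem], of m u n u] by simp
  have "a n \<le> ip.q u + D.q u" for n
    using q_split[OF u, of n] Dq_split[OF u, of n] ip.pos[OF Q_mem[OF u], of n] D.pos[OF Q_mem[OF u], of n]
    by (simp add: a_def)
  then have "convergent a"
    using a_mono by (intro Bseq_mono_convergent BseqI'[of _ "ip.q u + D.q u"])
      (auto simp: abs_of_nonneg a_def ip.pos D.pos P_mem add_nonneg_nonneg)
  then have "Cauchy a" by (simp add: Cauchy_convergent_iff)
  have cauchy: "\<exists>N::nat. \<forall>m\<ge>N. \<forall>n\<ge>N. ip.q (\<lambda>x. P m u x - P n u x) + D.q (\<lambda>x. P m u x - P n u x) < \<epsilon>" if \<epsilon>: "\<epsilon> > 0" for \<epsilon> :: real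
  proof -
    obtain N where N: "\<And>m n. \<lbrakk>m \<ge> N; n \<ge> N\<rbrakk> \<Longrightarrow> \<bar>a m - a n\<bar> < \<epsilon>"
      using CauchyD[OF \<open>Cauchy a\<close> \<epsilon>] by auto
    have "ip.q (\<lambda>x. P m u x - P n u x) + D.q (\<lambda>x. P m u x - P n u x) < \<epsilon>" if mn: "m \<ge> N" "n \<ge> N" for m n
    proof (cases "n \<le> m")
      case True
      then show ?thesis using N[OF mn] diff[OF True] by simp
    next
      case False
      then have le: "m \<le> n" by simp
      have "ip.q (\<lambda>x. P m u x - P n u x) = ip.q (\<lambda>x. P n u x - P m u x)" "D.q (\<lambda>x. P m u x - P n u x) = D.q (\<lambda>x. P n u x - P m u x)"
        by (simp_all add: ip.q_diff D.q_diff P_mem ip.Re_sym[of "P m u" "P n u"] D.Re_sym[of "P m u" "P n u"])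
      then show ?thesis using N[OF mn(2,1)] diff[OF le] by simp
    qed
    then show ?thesis by blast
  qed
  have "\<exists>w\<in>W. (\<lambda>n. ip.q (\<lambda>x. P n u x - w x)) \<longlonglongrightarrow> 0 \<and> (\<lambda>n. D.q (\<lambda>x. P n u x - w x)) \<longlonglongrightarrow> 0"
    by (rule complete) (rule P_mem, rule cauchy)
  then obtain w where w: "w \<in> W" "(\<lambda>n. ip.q (\<lambda>x. P n u x - w x)) \<longlonglongrightarrow> 0" "(\<lambda>n. D.q (\<lambda>x. P n u x - w x)) \<longlonglongrightarrow> 0"
    by blast
  have uw: "(\<lambda>x. u x - w x) \<in> W" by (intro ip.diff_mem u w)
  have "ip (\<lambda>x. u x - w x) (e j) = 0" for j
  proof -
    obtain N where N: "j \<in> J N" using J_exhaust by blast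
    have "\<forall>\<^sub>F n in sequentially. ip (P n u) (e j) = ip u (e j)"
      using N J_mono by (intro eventually_sequentiallyI[of N]) (auto simp: ip_P)
    then have "(\<lambda>n. ip (P n u) (e j)) \<longlonglongrightarrow> ip u (e j)" by (rule tendsto_eventually)
    moreover have "(\<lambda>n. ip (P n u) (e j)) \<longlonglongrightarrow> ip w (e j)" by (intro ip.tendsto_left P_mem w e_mem)
    ultimately have "ip u (e j) = ip w (e j)" by (rule LIMSEQ_unique)
    then show ?thesis using u w by (simp add: ip.diff_left e_mem)
  qed
  then have z: "ip.q (\<lambda>x. u x - w x) = 0" "D.q (\<lambda>x. u x - w x) = 0" using total[OF uw] by auto
  have Qeq: "Q n u = (\<lambda>x. (u x - w x) - (P n u x - w x))" for n by (simp add: Q_def)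
  have Pw: "(\<lambda>x. P n u x - w x) \<in> W" for n by (intro ip.diff_mem P_mem w)
  have le: "ip.q (Q n u) \<le> 2 * ip.q (\<lambda>x. P n u x - w x)" "D.q (Q n u) \<le> 2 * D.q (\<lambda>x. P n u x - w x)" for n
    unfolding Qeq using ip.q_diff_le[OF uw Pw[of n]] D.q_diff_le[OF uw Pw[of n]] z by simp_all
  have l: "(\<lambda>n. 2 * ip.q (\<lambda>x. P n u x - w x)) \<longlonglongrightarrow> 0" "(\<lambda>n. 2 * D.q (\<lambda>x. P n u x - w x)) \<longlonglongrightarrow> 0"
    using tendsto_mult[OF tendsto_const[of 2] w(2)] tendsto_mult[OF tendsto_const[of 2] w(3)] by simp_all
  show "(\<lambda>n. ip.q (Q n u)) \<longlonglongrightarrow> 0"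
    by (rule tendsto_sandwich[OF _ _ tendsto_const l(1)]) (use le Q_mem[OF u] ip.pos in auto)
  show "(\<lambda>n. D.q (Q n u)) \<longlonglongrightarrow> 0"
    by (rule tendsto_sandwich[OF _ _ tendsto_const l(2)]) (use le Q_mem[OF u] D.pos in auto)
qed

lemma P_tendsto:
  assumes "u \<in> W"
  shows "(\<lambda>n. ip.q (P n u)) \<longlonglongrightarrow> ip.q u" "(\<lambda>n. D.q (P n u)) \<longlonglongrightarrow> D.q u"
proof -
  have "(\<lambda>n. ip.q u - ip.q (Q n u)) \<longlonglongrightarrow> ip.q u - 0" "(\<lambda>n. D.q u - D.q (Q n u)) \<longlonglongrightarrow> D.q u - 0"
    by (intro tendsto_intros approx assms)+
  moreover have "ip.q u - ip.q (Q n u) = ip.q (P n u)" "D.q u - D.q (Q n u) = D.q (P n u)" for n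
    using q_split[OF assms, of n] Dq_split[OF assms, of n] by simp_all
  ultimately show "(\<lambda>n. ip.q (P n u)) \<longlonglongrightarrow> ip.q u" "(\<lambda>n. D.q (P n u)) \<longlonglongrightarrow> D.q u"
    by simp_all
qed

text \<open>Each partial sum of \<open>Q n u\<close> involves only modes outside \<open>J n\<close>,
  where the inequality holds coefficient by coefficient; it survives the limit.\<close>

lemma tail_bound:
  assumes u: "u \<in> W" and L: "\<And>j. j \<notin> J n \<Longrightarrow> L \<le> lam j"
  shows "L * ip.q (Q n u) \<le> D.q (Q n u)"
proof (rule LIMSEQ_le)
  show "(\<lambda>m. L * ip.q (P m (Q n u))) \<longlonglongrightarrow> L * ip.q (Q n u)"
    by (intro tendsto_intros P_tendsto Q_mem u)
  show "(\<lambda>m. D.q (P m (Q n u))) \<longlonglongrightarrow> D.q (Q n u)"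
    by (intro P_tendsto Q_mem u)
  show "\<exists>N. \<forall>m\<ge>N. L * ip.q (P m (Q n u)) \<le> D.q (P m (Q n u))"
    unfolding q_P[OF Q_mem[OF u]] Dq_P[OF Q_mem[OF u]] sum_distrib_left
    using L by (intro exI allI impI sum_mono) (auto simp: ip_Q u intro: mult_right_mono)
qed

text \<open>When \<open>t\<close> separates the two parts of the spectrum, this is the form of \<open>\<bar>D - t\<bar>\<close>.\<close>

definition A :: "nat \<Rightarrow> real \<Rightarrow> ('x \<Rightarrow> complex) \<Rightarrow> real" where
  "A l t u = (D.q (Q l u) - t * ip.q (Q l u)) - (D.q (P l u) - t * ip.q (P l u))"

text \<open>The number \<open>t\<close> lies in a spectral gap of \<open>D\<close>, with exactly the
  indices of \<open>J l\<close> below it. The margin \<delta> is uniform so that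
  \<open>A l t\<close> dominates a positive multiple of \<open>ip\<close>.\<close>

definition separates :: "nat \<Rightarrow> real \<Rightarrow> bool" where
  "separates l t \<longleftrightarrow> (\<exists>\<delta>>0. (\<forall>j\<in>J l. lam j \<le> t - \<delta>) \<and> (\<forall>j. j \<notin> J l \<longrightarrow> t + \<delta> \<le> lam j))"

lemma A_lower:
  assumes "separates l t"
  obtains \<delta> where "\<delta> > 0" "\<And>u. u \<in> W \<Longrightarrow> \<delta> * ip.q u \<le> A l t u"
proof -
  obtain \<delta> where \<delta>: "\<delta> > 0" "\<And>j. j \<in> J l \<Longrightarrow> lam j \<le> t - \<delta>" "\<And>j. j \<notin> J l \<Longrightarrow> t + \<delta> \<le> lam j"
    using assms by (auto simp: separates_def)
  have "\<delta> * ip.q u \<le> A l t u" if u: "u \<in> W" for u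
  proof -
    have "(t + \<delta>) * ip.q (Q l u) \<le> D.q (Q l u)" by (rule tail_bound) (use u \<delta> in auto)
    moreover have "D.q (P l u) \<le> (t - \<delta>) * ip.q (P l u)"
      unfolding q_P[OF u] Dq_P[OF u] sum_distrib_left
      using \<delta> by (intro sum_mono mult_right_mono) auto
    ultimately show ?thesis unfolding A_def q_split[OF u, of l] by (simp add: algebra_simps)
  qed
  then show ?thesis using that \<delta>(1) by blast
qed

end

section \<open>Eigenvectors of the perturbed form below a gap\<close>

text \<open>\<open>B_bound\<close> is the KLMN condition with relative bound 1/2:
  \<open>D + B\<close> is bounded below, and its energy together with \<open>ip\<close> controls
  \<open>D\<close>.\<close>

locale form_setting = spectral_basis W ip D e lam J + B: hermitian W B
  for W :: "('x \<Rightarrow> complex) set" and ip D B and e :: "'i::countable \<Rightarrow> 'x \<Rightarrow> complex" and lam J +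
  assumes B_bound: "\<exists>K\<ge>0. \<forall>u\<in>W. \<bar>B.q u\<bar> \<le> (D.q u + K * ip.q u) / 2"
begin

text \<open>Because 1/2 is below 1, the form \<open>D + B - t\<close> keeps the sign of
  \<open>D - t\<close> on the low and on the high spectral subspace.\<close>

definition gap :: "nat \<Rightarrow> real \<Rightarrow> bool" where
  "gap l t \<longleftrightarrow> separates l t \<and> (\<forall>u\<in>W. \<bar>B.q u\<bar> \<le> A l t u / 2)"

definition eig :: "real \<Rightarrow> ('x \<Rightarrow> complex) \<Rightarrow> bool" where
  "eig \<mu> u \<longleftrightarrow> u \<in> W \<and> (\<forall>v\<in>W. D u v + B u v = of_real \<mu> * ip u v)"

definition esys :: "nat \<Rightarrow> (nat \<Rightarrow> 'x \<Rightarrow> complex) \<Rightarrow> (nat \<Rightarrow> real) \<Rightarrow> bool" where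
  "esys n us \<mu>s \<longleftrightarrow> (\<forall>i<n. eig (\<mu>s i) (us i)) \<and>
     (\<forall>i<n. \<forall>k<n. ip (us i) (us k) = (if i = k then 1 else 0))"

text \<open>Testing the eigenvalue equation with \<open>Q l u - P l u\<close> turns \<open>D - t\<close> into \<open>\<bar>D - t\<bar>\<close>.\<close>

theorem gap_no_eigenvalue:
  assumes g: "gap l t" and e: "eig t u"
  shows "ip.q u = 0"
proof -
  have u: "u \<in> W" using e by (simp add: eig_def)
  define lo hi where "lo = P l u" and "hi = Q l u"
  have W: "lo \<in> W" "hi \<in> W" using u by (auto simp: lo_def hi_def P_mem Q_mem)
  have u_eq: "u = (\<lambda>x. lo x + hi x)" unfolding lo_def hi_def by (rule PQ_eq)
  have z: "D lo hi = 0" "D hi lo = 0" "ip lo hi = 0" "ip hi lo = 0"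
    using u by (simp_all add: lo_def hi_def D_PQ D_QP ip_PQ ip_QP)
  define v where "v = (\<lambda>x. hi x - lo x)"
  have v: "v \<in> W" unfolding v_def by (intro ip.diff_mem W)
  have "Re (D u v) - t * Re (ip u v) = A l t u"
  proof -
    have "D u v = D lo v + D hi v" "ip u v = ip lo v + ip hi v"
      by (subst u_eq, use W v in \<open>simp add: D.add_left ip.add_left\<close>)+
    moreover have "D lo v = - D lo lo" "D hi v = D hi hi" "ip lo v = - ip lo lo" "ip hi v = ip hi hi"
      using W by (simp_all add: v_def D.diff_right ip.diff_right z)
    ultimately have "D u v = D hi hi - D lo lo" "ip u v = ip hi hi - ip lo lo" by simp_all
    then have *: "Re (D u v) = D.q hi - D.q lo" "Re (ip u v) = ip.q hi - ip.q lo" by simp_all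
    show ?thesis
      unfolding A_def lo_def[symmetric] hi_def[symmetric] * by (simp add: algebra_simps)
  qed
  moreover have "Re (D u v) + Re (B u v) = t * Re (ip u v)"
    using e v unfolding eig_def by (metis Re_complex_of_real complex_Re_of_int mult_zero_left of_real_eq_iff plus_complex.sel(1) times_complex.sel(1) Im_complex_of_real diff_zero)
  \<comment> \<open>The mixed terms \<open>B lo hi\<close> and \<open>- B hi lo\<close> have
    opposite real parts by Hermitian symmetry, so only the diagonal terms remain, and each of these
    is bounded by the gap.\<close>
  moreover have "Re (B u v) = B.q hi - B.q lo"
  proof -
    have "B u v = B lo v + B hi v"
      by (subst u_eq, use W v in \<open>simp add: B.add_left\<close>)
    then show ?thesis using W B.Re_sym[of lo hi] by (simp add: v_def B.diff_right)
  qed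
  moreover have "\<bar>B.q hi\<bar> \<le> A l t hi / 2" "\<bar>B.q lo\<bar> \<le> A l t lo / 2"
    using g W by (auto simp: gap_def)
  moreover have "A l t hi + A l t lo = A l t u"
  proof -
    have "P l hi = (\<lambda>x. 0)" "Q l hi = hi"
      using u by (auto simp: hi_def P_def[of l "Q l u"] ip_Q Q_def[of l "Q l u"])
    moreover have PP: "P l lo = lo"
      unfolding lo_def P_def[of l "P l u"] ip_P by (simp add: P_def)
    moreover have "Q l lo = (\<lambda>x. 0)" by (simp add: Q_def PP)
    ultimately show ?thesis
      unfolding A_def lo_def[symmetric] hi_def[symmetric]
      by (simp add: ip.zero_left D.zero_left ip.zero_mem)
  qed
  ultimately have "A l t u \<le> 0" by linarith
  moreover obtain \<delta> where "\<delta> > 0" "\<And>u. u \<in> W \<Longrightarrow> \<delta> * ip.q u \<le> A l t u"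
    using A_lower g by (auto simp: gap_def)
  ultimately have "\<delta> > 0" "\<delta> * ip.q u \<le> 0" using u by force+
  then show ?thesis using ip.pos[OF u] by (simp add: mult_le_0_iff)
qed

lemma q_orthonormal_sum:
  fixes n :: nat
  assumes us: "\<And>i. i < n \<Longrightarrow> us i \<in> W"
    and o: "\<And>i k. i < n \<Longrightarrow> k < n \<Longrightarrow> ip (us i) (us k) = (if i = k then 1 else 0)"
  shows "i < n \<Longrightarrow> ip (us i) (\<lambda>x. \<Sum>i<n. c i * us i x) = cnj (c i)"
    and "ip.q (\<lambda>x. \<Sum>i<n. c i * us i x) = (\<Sum>i<n. (cmod (c i))\<^sup>2)"
proof -
  show *: "ip (us i) (\<lambda>x. \<Sum>i<n. c i * us i x) = cnj (c i)" if "i < n" for i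
  proof -
    have "ip (us i) (\<lambda>x. \<Sum>i<n. c i * us i x) = (\<Sum>k<n. cnj (c k) * ip (us i) (us k))"
      using us that by (intro ip.sum_right) auto
    also have "\<dots> = (\<Sum>k<n. if k = i then cnj (c i) else 0)"
      by (intro sum.cong) (auto simp: o that)
    finally show ?thesis using that by simp
  qed
  have "ip (\<lambda>x. \<Sum>i<n. c i * us i x) (\<lambda>x. \<Sum>i<n. c i * us i x) = (\<Sum>i<n. c i * cnj (c i))"
    using us by (subst ip.sum_left) (auto intro!: ip.sum_mem sum.cong simp: *)
  also have "\<dots> = of_real (\<Sum>i<n. (cmod (c i))\<^sup>2)"
    by (simp only: complex_norm_square of_real_sum)
  finally show "ip.q (\<lambda>x. \<Sum>i<n. c i * us i x) = (\<Sum>i<n. (cmod (c i))\<^sup>2)" by simp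
qed

text \<open>With more eigenvectors than elements of \<open>J l\<close>, some nonzero combination is
  orthogonal to all low modes. There \<open>D - t\<close> equals \<open>A l t\<close> and
  \<open>B\<close> takes away at most half of it, so the energy exceeds \<open>t\<close>; but a
  combination of orthonormal eigenvectors with eigenvalues at most \<open>t\<close> has energy at
  most \<open>t\<close>.\<close>

theorem esys_card_le:
  assumes g: "gap l t" and es: "esys n us \<mu>s" and le: "\<And>i. i < n \<Longrightarrow> \<mu>s i \<le> t"
  shows "n \<le> card (J l)"
proof (rule ccontr)
  assume "\<not> n \<le> card (J l)"
  then have n: "card (J l) < card {..<n}" by simp
  obtain f where f: "bij_betw f {..<card (J l)} (J l)"
    using ex_bij_betw_nat_finite[OF fin[of l]] atLeast0LessThan by metis
  obtain c where c: "\<exists>j\<in>{..<n}. c j \<noteq> 0"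
      "\<And>i. i < card (J l) \<Longrightarrow> (\<Sum>j<n. c j * ip (us j) (e (f i))) = 0"
    using homogeneous_system_solvable[OF _ n, of "\<lambda>i j. ip (us j) (e (f i))"] by blast
  define u where "u = (\<lambda>x. \<Sum>j<n. c j * us j x)"
  have us: "\<And>i. i < n \<Longrightarrow> us i \<in> W" and o: "\<And>i k. i < n \<Longrightarrow> k < n \<Longrightarrow> ip (us i) (us k) = (if i = k then 1 else 0)"
    and ev: "\<And>i v. i < n \<Longrightarrow> v \<in> W \<Longrightarrow> D (us i) v + B (us i) v = of_real (\<mu>s i) * ip (us i) v"
    using es by (auto simp: esys_def eig_def)
  have u: "u \<in> W" unfolding u_def using us by (intro ip.sum_mem) auto
  have "ip u (e k) = 0" if "k \<in> J l" for k
  proof -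
    have "k \<in> f ` {..<card (J l)}" using f that by (simp add: bij_betw_def)
    then obtain i where "i < card (J l)" "k = f i" by auto
    moreover have "ip u (e k) = (\<Sum>j<n. c j * ip (us j) (e k))"
      unfolding u_def using us by (intro ip.sum_left) (auto simp: e_mem)
    ultimately show ?thesis using c(2)[of i] by simp
  qed
  then have P0: "P l u = (\<lambda>x. 0)" by (simp add: P_def)
  then have "A l t u = D.q u - t * ip.q u" by (simp add: A_def Q_def ip.zero_left D.zero_left ip.zero_mem)
  moreover have "\<bar>B.q u\<bar> \<le> A l t u / 2" using g u by (auto simp: gap_def)
  moreover obtain \<delta> where \<delta>: "\<delta> > 0" "\<delta> * ip.q u \<le> A l t u"
    using A_lower g u by (metis gap_def)
  moreover have q: "ip.q u = (\<Sum>i<n. (cmod (c i))\<^sup>2)"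
    unfolding u_def by (rule q_orthonormal_sum) (use us o in auto)
  moreover have "D.q u + B.q u \<le> t * ip.q u"
  proof -
    have "D u u + B u u = (\<Sum>i<n. c i * D (us i) u) + (\<Sum>i<n. c i * B (us i) u)"
      unfolding u_def using us
      by (intro arg_cong2[where f="(+)"] D.sum_left B.sum_left) (auto intro: ip.sum_mem)
    also have "\<dots> = (\<Sum>i<n. c i * (of_real (\<mu>s i) * ip (us i) u))"
      unfolding sum.distrib[symmetric] distrib_left[symmetric] by (intro sum.cong) (auto simp: ev u)
    also have "\<dots> = (\<Sum>i<n. c i * (of_real (\<mu>s i) * cnj (c i)))"
      unfolding u_def by (intro sum.cong) (auto simp: q_orthonormal_sum(1) us o)
    also have "\<dots> = of_real (\<Sum>i<n. \<mu>s i * (cmod (c i))\<^sup>2)"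
      by (simp only: of_real_sum of_real_mult complex_norm_square mult.left_commute)
    finally have "D.q u + B.q u = (\<Sum>i<n. \<mu>s i * (cmod (c i))\<^sup>2)"
      by (metis Re_complex_of_real plus_complex.sel(1))
    also have "\<dots> \<le> t * ip.q u"
      unfolding q sum_distrib_left by (intro sum_mono mult_right_mono) (use le in auto)
    finally show ?thesis .
  qed
  ultimately have "A l t u \<le> 0" by linarith
  moreover have "ip.q u > 0"
    using c(1) unfolding q by (auto intro!: sum_pos2)
  ultimately show False using \<delta> mult_pos_pos[of \<delta> "ip.q u"] by linarith
qed

lemma form_lower_bound:
  obtains K where "K \<ge> 0" "\<And>u. u \<in> W \<Longrightarrow> \<bar>B.q u\<bar> \<le> (D.q u + K * ip.q u) / 2"
    "\<And>u. u \<in> W \<Longrightarrow> D.q u \<le> 2 * (D.q u + B.q u) + K * ip.q u"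
    "\<And>u. u \<in> W \<Longrightarrow> - K * ip.q u \<le> D.q u + B.q u"
proof -
  obtain K where K: "K \<ge> 0" "\<And>u. u \<in> W \<Longrightarrow> \<bar>B.q u\<bar> \<le> (D.q u + K * ip.q u) / 2"
    using B_bound by auto
  have "D.q u \<le> 2 * (D.q u + B.q u) + K * ip.q u" "- K * ip.q u \<le> D.q u + B.q u" if "u \<in> W" for u
    using K(2)[OF that] D.pos[OF that] mult_nonneg_nonneg[OF K(1) ip.pos[OF that]] by (auto simp: abs_le_iff field_simps)
  then show ?thesis using that K by blast
qed

text \<open>The abstract form of Rellich's compactness theorem. Finitely many coordinates converge
  along a diagonal subsequence; the remaining modes have large \<open>lam\<close>, so a bound on
  \<open>D\<close> makes their share of \<open>ip\<close> small.\<close>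

lemma bounded_form_Cauchy_subseq:
  fixes X :: "nat \<Rightarrow> 'x \<Rightarrow> complex"
  assumes X: "\<And>n. X n \<in> W" "\<And>n. ip.q (X n) \<le> 1" "\<And>n. D.q (X n) \<le> R"
  obtains r where "strict_mono r"
    "\<And>\<epsilon>::real. \<epsilon> > 0 \<Longrightarrow> \<exists>N::nat. \<forall>m\<ge>N. \<forall>n\<ge>N. ip.q (\<lambda>x. X (r m) x - X (r n) x) < \<epsilon>"
proof -
  have "cmod (ip (X n) (e j)) \<le> 1" for n j
  proof -
    have "(cmod (ip (X n) (e j)))\<^sup>2 \<le> ip.q (X n) * ip.q (e j)"
      by (rule ip.cauchy_schwarz[OF X(1) e_mem])
    also have "\<dots> \<le> 1" using X(2)[of n] by (simp add: orth)
    finally show ?thesis by (simp add: abs_square_le_1[of "cmod _", simplified])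
  qed
  then obtain r where r: "strict_mono r" "\<And>j. convergent (\<lambda>n. ip (X (r n)) (e j))"
    using bounded_coordinates_convergent_subseq[of "\<lambda>n j. ip (X n) (e j)" 1] by blast
  have "\<exists>N::nat. \<forall>m\<ge>N. \<forall>n\<ge>N. ip.q (\<lambda>x. X (r m) x - X (r n) x) < \<epsilon>" if \<epsilon>: "\<epsilon> > 0" for \<epsilon> :: real
  proof -
    \<comment> \<open>A difference of two terms has \<open>D\<close>-energy at most
      \<open>4 * R\<close>, and this \<open>L\<close> satisfies
      \<open>4 * R < L * (\<epsilon> / 2)\<close>.\<close>
    define L where "L = 8 * (\<bar>R\<bar> + 1) / \<epsilon>"
    have L: "L > 0" using \<epsilon> by (simp add: L_def add_nonneg_pos)
    obtain M where M: "\<And>j. j \<notin> J M \<Longrightarrow> L \<le> lam j" using lam_large[of L] by blast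
    \<comment> \<open>If each coordinate in \<open>J M\<close> moves by at most \<open>d\<close>,
      together they contribute at most \<open>\<epsilon> / 2\<close>; the summand 1 covers an empty
      \<open>J M\<close>.\<close>
    define d where "d = sqrt (\<epsilon> / (2 * (real (card (J M)) + 1)))"
    have d: "d > 0" using \<epsilon> by (simp add: d_def add_nonneg_pos)
    have "\<forall>j. \<exists>N. \<forall>m\<ge>N. \<forall>n\<ge>N. cmod (ip (X (r m)) (e j) - ip (X (r n)) (e j)) < d"
      using r(2) d by (metis CauchyD Cauchy_convergent_iff)
    then obtain N where N: "\<And>j m n. \<lbrakk>m \<ge> N j; n \<ge> N j\<rbrakk> \<Longrightarrow> cmod (ip (X (r m)) (e j) - ip (X (r n)) (e j)) < d"
      by metis
    define N' where "N' = Max (insert 0 (N ` J M))"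
    have N': "N j \<le> N'" if "j \<in> J M" for j unfolding N'_def using that fin[of M] by (intro Max_ge) auto
    have "ip.q (\<lambda>x. X (r m) x - X (r n) x) < \<epsilon>" if mn: "m \<ge> N'" "n \<ge> N'" for m n
    proof -
      define u where "u = (\<lambda>x. X (r m) x - X (r n) x)"
      have u: "u \<in> W" unfolding u_def by (intro ip.diff_mem X)
      have "D.q u \<le> 4 * R" unfolding u_def
        using D.q_diff_le[OF X(1) X(1), of "r m" "r n"] X(3)[of "r m"] X(3)[of "r n"] by linarith
      moreover have "L * ip.q (Q M u) \<le> D.q (Q M u)" by (rule tail_bound[OF u M])
      moreover have "D.q (Q M u) \<le> D.q u" using Dq_split[OF u, of M] D.pos[OF P_mem, of M u] by simp
      ultimately have "L * ip.q (Q M u) \<le> 4 * R" by linarith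
      also have "4 * R < L * (\<epsilon> / 2)" using \<epsilon> by (simp add: L_def)
      finally have "ip.q (Q M u) < \<epsilon> / 2" using L by simp
      moreover have "ip.q (P M u) \<le> \<epsilon> / 2"
      proof -
        have "ip.q (P M u) \<le> (\<Sum>j\<in>J M. d\<^sup>2)" unfolding q_P[OF u]
        proof (intro sum_mono power_mono)
          fix j assume "j \<in> J M"
          then show "cmod (ip u (e j)) \<le> d"
            using N[of j m n] N'[of j] mn by (simp add: u_def ip.diff_left X e_mem)
        qed simp
        also have "\<dots> = real (card (J M)) * (\<epsilon> / (2 * (real (card (J M)) + 1)))"
          using \<epsilon> by (simp add: d_def)
        also have "\<dots> \<le> \<epsilon> / 2" using \<epsilon> by (simp add: field_simps)
        finally show ?thesis .
      qed
      ultimately show ?thesis using q_split[OF u, of M] by (simp add: u_def)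
    qed
    then show ?thesis by blast
  qed
  then show ?thesis using that r(1) by blast
qed

text \<open>A new eigenvector is a minimiser of the Rayleigh quotient on the orthogonal complement of the
  given ones; the parallelogram law turns a minimising sequence that is Cauchy for \<open>ip\<close> into
  one that is Cauchy for the form.\<close>

lemma extend_esys:
  assumes es: "esys k us \<mu>s" and x0: "x0 \<in> W" "\<And>i. i < k \<Longrightarrow> ip x0 (us i) = 0"
    and less: "D.q x0 + B.q x0 < t * ip.q x0"
  obtains w \<mu> where "\<mu> < t" "eig \<mu> w" "ip w w = 1" "\<And>i. i < k \<Longrightarrow> ip w (us i) = 0"
proof -
  obtain K where K: "K \<ge> 0" "\<And>u. u \<in> W \<Longrightarrow> \<bar>B.q u\<bar> \<le> (D.q u + K * ip.q u) / 2"
    "\<And>u. u \<in> W \<Longrightarrow> D.q u \<le> 2 * (D.q u + B.q u) + K * ip.q u"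
    "\<And>u. u \<in> W \<Longrightarrow> - K * ip.q u \<le> D.q u + B.q u"
    using form_lower_bound by blast
  \<comment> \<open>The factor \<open>of_real 1\<close> puts the sum into the shape of
    \<open>hermitian_comb\<close>.\<close>
  define h where "h u v = D u v + of_real 1 * B u v" for u v
  interpret h: hermitian W h unfolding h_def
    by (rule hermitian_comb) unfold_locales
  have hq: "h.q u = D.q u + B.q u" for u by (simp add: h_def)
  define V where "V = {x \<in> W. \<forall>i<k. ip x (us i) = 0}"
  have us: "\<And>i. i < k \<Longrightarrow> us i \<in> W" using es by (auto simp: esys_def eig_def)
  have VW: "V \<subseteq> W" by (auto simp: V_def)
  have Vlin: "lin_closed V" unfolding lin_closed_def
    by (auto simp: V_def ip.zero_mem ip.zero_left us ip.comb_mem ip.left)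
  have x0q: "ip.q x0 > 0"
  proof (rule ccontr)
    assume "\<not> ?thesis"
    then have "ip.q x0 = 0" using ip.pos[OF x0(1)] by simp
    then show False using less K(4)[OF x0(1)] by simp
  qed
  define S where "S = {h.q x | x. x \<in> V \<and> ip.q x = 1}"
  have scaled: "h.q x / ip.q x \<in> S" if x: "x \<in> V" "ip.q x > 0" for x
  proof -
    let ?y = "\<lambda>z. of_real (1 / sqrt (ip.q x)) * x z"
    have xW: "x \<in> W" using x VW by auto
    have "?y \<in> V" by (rule hermitian.scale_mem[OF hermitian_subspace[OF ip.hermitian_axioms VW Vlin] x(1)])
    moreover have "ip.q ?y = 1" using x by (subst ip.q_scale[OF xW]) (simp add: power_divide norm_divide)
    moreover have "h.q ?y = h.q x / ip.q x" using x
      by (subst h.q_scale[OF xW]) (simp add: power_divide norm_divide)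
    ultimately show ?thesis unfolding S_def by force
  qed
  have Sbdd: "bdd_below S" unfolding S_def bdd_below_def hq
    using K(4) VW by (intro exI[of _ "-K"]) force
  have x0V: "x0 \<in> V" using x0 by (auto simp: V_def)
  define I where "I = Inf S"
  have I_less: "I < t"
  proof -
    have "I \<le> h.q x0 / ip.q x0" unfolding I_def by (intro cInf_lower scaled x0V x0q Sbdd)
    also have "\<dots> < t" using less x0q by (simp add: hq field_simps)
    finally show ?thesis .
  qed
  have hI: "I * ip.q x \<le> h.q x" if x: "x \<in> V" for x
  proof (cases "ip.q x = 0")
    case True
    then show ?thesis using K(4)[of x] x VW by (auto simp: hq)
  next
    case False
    then have pos: "ip.q x > 0" using ip.pos[of x] x VW by force
    have "I \<le> h.q x / ip.q x" unfolding I_def by (intro cInf_lower scaled x pos Sbdd)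
    then show ?thesis using pos by (simp add: field_simps)
  qed
  have "\<exists>x. x \<in> V \<and> ip.q x = 1 \<and> h.q x < I + 1 / (real n + 1)" for n
  proof -
    have "\<exists>s\<in>S. s < I + 1 / (real n + 1)"
      unfolding I_def using scaled[OF x0V x0q] Sbdd
      by (subst cInf_less_iff[symmetric]) (auto simp: add_nonneg_pos)
    then show ?thesis by (auto simp: S_def)
  qed
  then obtain X where X: "\<And>n. X n \<in> V" "\<And>n. ip.q (X n) = 1" "\<And>n. h.q (X n) < I + 1 / (real n + 1)"
    by metis
  have XW: "\<And>n. X n \<in> W" using X VW by auto
  have DX: "D.q (X n) \<le> 2 * (I + 1) + K" for n
  proof -
    have "1 / (real n + 1) \<le> 1" by simp
    then have "D.q (X n) + B.q (X n) \<le> I + 1" using X(3)[of n] unfolding hq by linarith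
    then show ?thesis using K(3)[OF XW[of n]] X(2)[of n] by simp
  qed
  obtain r where r: "strict_mono r"
    "\<And>\<epsilon>::real. \<epsilon> > 0 \<Longrightarrow> \<exists>N::nat. \<forall>m\<ge>N. \<forall>n\<ge>N. ip.q (\<lambda>x. X (r m) x - X (r n) x) < \<epsilon>"
    by (rule bounded_form_Cauchy_subseq[OF XW eq_refl[OF X(2)] DX]) (rule that)
  define Y where "Y n = X (r n)" for n
  have Y: "Y n \<in> V" "Y n \<in> W" "ip.q (Y n) = 1" for n using X XW by (auto simp: Y_def)
  have Yh: "h.q (Y n) < I + 1 / (real n + 1)" for n
  proof -
    have "1 / (real (r n) + 1) \<le> 1 / (real n + 1)"
      using seq_suble[OF r(1), of n] by (intro divide_left_mono) auto
    then show ?thesis using X(3)[of "r n"] by (simp add: Y_def)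
  qed
  \<comment> \<open>The sum \<open>Y m + Y n\<close> lies in \<open>V\<close>, so its energy is at
    least \<open>I\<close> times its squared norm \<open>4 - ip.q (Y m - Y n)\<close>.
    Near-minimality of both vectors leaves little energy for the difference.\<close>
  have Ydiff: "h.q (\<lambda>x. Y m x - Y n x) \<le> 2 / (real m + 1) + 2 / (real n + 1) + I * ip.q (\<lambda>x. Y m x - Y n x)" for m n
  proof -
    have "(\<lambda>x. Y m x + Y n x) \<in> V"
      using hermitian.add_mem[OF hermitian_subspace[OF ip.hermitian_axioms VW Vlin]] Y by simp
    then have "I * ip.q (\<lambda>x. Y m x + Y n x) \<le> h.q (\<lambda>x. Y m x + Y n x)" by (rule hI)
    moreover have "ip.q (\<lambda>x. Y m x + Y n x) = 4 - ip.q (\<lambda>x. Y m x - Y n x)"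
      using ip.parallelogram[OF Y(2) Y(2), of m n] Y(3) by simp
    ultimately have "4 * I - I * ip.q (\<lambda>x. Y m x - Y n x) \<le> h.q (\<lambda>x. Y m x + Y n x)"
      by (simp add: algebra_simps)
    moreover have "h.q (\<lambda>x. Y m x + Y n x) + h.q (\<lambda>x. Y m x - Y n x) = 2 * h.q (Y m) + 2 * h.q (Y n)"
      by (rule h.parallelogram) (rule Y)+
    moreover have "2 / (real m + 1) = 2 * (1 / (real m + 1))" "2 / (real n + 1) = 2 * (1 / (real n + 1))"
      by simp_all
    ultimately show ?thesis using Yh[of m] Yh[of n] by linarith
  qed
  have Ycauchy: "\<exists>N::nat. \<forall>m\<ge>N. \<forall>n\<ge>N. ip.q (\<lambda>x. Y m x - Y n x) + D.q (\<lambda>x. Y m x - Y n x) < \<epsilon>"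
    if \<epsilon>: "\<epsilon> > 0" for \<epsilon> :: real
  proof -
    \<comment> \<open>This collects the coefficients of \<open>ip.q\<close>: 1 from the norm itself,
      \<open>2 * \<bar>I\<bar>\<close> from twice the bound \<open>Ydiff\<close>, and
      \<open>K\<close> from recovering \<open>D\<close> out of \<open>h\<close>.\<close>
    define c where "c = 1 + 2 * \<bar>I\<bar> + K"
    have c: "c > 0" using K(1) by (simp add: c_def)
    obtain N1 where N1: "\<And>m n. \<lbrakk>m \<ge> N1; n \<ge> N1\<rbrakk> \<Longrightarrow> ip.q (\<lambda>x. Y m x - Y n x) < \<epsilon> / (2 * c)"
      using r(2)[of "\<epsilon> / (2 * c)"] \<epsilon> c unfolding Y_def by (metis divide_pos_pos mult_pos_pos zero_less_numeral)
    obtain N2 where N2: "1 / (real N2 + 1) < \<epsilon> / 16"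
      using reals_Archimedean[of "\<epsilon> / 16"] \<epsilon> by (auto simp: inverse_eq_divide add.commute)
    show ?thesis
    proof (intro exI[of _ "max N1 N2"] allI impI)
      fix m n assume mn: "max N1 N2 \<le> m" "max N1 N2 \<le> n"
      let ?d = "\<lambda>x. Y m x - Y n x"
      have d: "?d \<in> W" by (intro ip.diff_mem Y)
      have inv: "2 / (real i + 1) < \<epsilon> / 8" if "max N1 N2 \<le> i" for i
      proof -
        have "1 / (real i + 1) \<le> 1 / (real N2 + 1)" using that by (intro divide_left_mono) auto
        then have "2 * (1 / (real i + 1)) < \<epsilon> / 8" using N2 by linarith
        then show ?thesis by simp
      qed
      define a b where "a = 2 / (real m + 1)" and "b = 2 / (real n + 1)"
      have "D.q ?d \<le> 2 * h.q ?d + K * ip.q ?d" using K(3)[OF d] by (simp add: hq)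
      moreover have "I * ip.q ?d \<le> \<bar>I\<bar> * ip.q ?d" using ip.pos[OF d] by (intro mult_right_mono) auto
      ultimately have "ip.q ?d + D.q ?d \<le> 2 * (a + b) + c * ip.q ?d"
        using Ydiff[of m n] unfolding a_def[symmetric] b_def[symmetric] by (simp add: c_def algebra_simps)
      moreover have "c * ip.q ?d < \<epsilon> / 2" using N1[of m n] mn c by (simp add: field_simps)
      moreover have "p < \<epsilon>" if "p \<le> 2 * (a + b) + z" "z < \<epsilon> / 2" for p z
        using that inv[OF mn(1)] inv[OF mn(2)] unfolding a_def[symmetric] b_def[symmetric] by argo
      ultimately show "ip.q ?d + D.q ?d < \<epsilon>" by blast
    qed
  qed
  have "\<exists>w\<in>W. (\<lambda>n. ip.q (\<lambda>x. Y n x - w x)) \<longlonglongrightarrow> 0 \<and> (\<lambda>n. D.q (\<lambda>x. Y n x - w x)) \<longlonglongrightarrow> 0"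
    by (rule complete) (rule Y(2), rule Ycauchy)
  then obtain w where w: "w \<in> W" "(\<lambda>n. ip.q (\<lambda>x. Y n x - w x)) \<longlonglongrightarrow> 0" "(\<lambda>n. D.q (\<lambda>x. Y n x - w x)) \<longlonglongrightarrow> 0"
    by blast
  have wV: "w \<in> V"
  proof -
    have "ip w (us i) = 0" if "i < k" for i
    proof -
      have "(\<lambda>n. ip (Y n) (us i)) \<longlonglongrightarrow> ip w (us i)" by (intro ip.tendsto_left Y w us that)
      moreover have "ip (Y n) (us i) = 0" for n using Y(1)[of n] that by (simp add: V_def)
      ultimately have "(\<lambda>n. 0) \<longlonglongrightarrow> ip w (us i)" by simp
      then show ?thesis by (simp add: LIMSEQ_const_iff)
    qed
    then show ?thesis using w by (simp add: V_def)
  qed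
  have wq: "ip.q w = 1"
    using ip.q_tendsto[OF Y(2) w(1,2)] by (simp add: Y(3) LIMSEQ_const_iff)
  \<comment> \<open>Adding \<open>K * ip\<close> makes the form nonnegative, so the continuity
    results for nonnegative forms apply and the minimum is attained at \<open>w\<close>.\<close>
  define g where "g u v = h u v + of_real K * ip u v" for u v
  interpret g: pos_hermitian W g
  proof -
    have "hermitian W g" unfolding g_def
      by (rule hermitian_comb[OF h.hermitian_axioms ip.hermitian_axioms])
    moreover have "0 \<le> Re (g u u)" if "u \<in> W" for u using K(4)[OF that] by (simp add: g_def hq)
    ultimately show "pos_hermitian W g" by (simp add: pos_hermitian_def pos_hermitian_axioms_def)
  qed
  have gq: "g.q u = h.q u + K * ip.q u" for u by (simp add: g_def)
  have "(\<lambda>n. g.q (\<lambda>x. Y n x - w x)) \<longlonglongrightarrow> 0"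
  proof (rule tendsto_sandwich[OF _ _ tendsto_const])
    let ?d = "\<lambda>n x. Y n x - w x"
    have d: "?d n \<in> W" for n by (intro ip.diff_mem Y w)
    show "\<forall>\<^sub>F n in sequentially. 0 \<le> g.q (?d n)" using g.pos[OF d] by simp
    have hd: "h.q (?d n) \<le> 2 * D.q (?d n) + K * ip.q (?d n)" for n
      using K(2)[OF d[of n]] K(1) D.pos[OF d[of n]] ip.pos[OF d[of n]] mult_nonneg_nonneg[OF K(1) ip.pos[OF d[of n]]]
      by (auto simp: hq abs_le_iff)
    show "\<forall>\<^sub>F n in sequentially. g.q (?d n) \<le> 2 * D.q (?d n) + K * ip.q (?d n) + K * ip.q (?d n)"
    proof (intro always_eventually allI)
      fix n show "g.q (?d n) \<le> 2 * D.q (?d n) + K * ip.q (?d n) + K * ip.q (?d n)"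
        unfolding gq using hd[of n] by (rule add_right_mono)
    qed
    have "(\<lambda>n. 2 * D.q (?d n) + K * ip.q (?d n) + K * ip.q (?d n)) \<longlonglongrightarrow> 2 * 0 + K * 0 + K * 0"
      by (intro tendsto_intros w)
    then show "(\<lambda>n. 2 * D.q (?d n) + K * ip.q (?d n) + K * ip.q (?d n)) \<longlonglongrightarrow> 0" by simp
  qed
  then have "(\<lambda>n. g.q (Y n)) \<longlonglongrightarrow> g.q w" by (intro g.q_tendsto Y w)
  moreover have "(\<lambda>n. I + 1 / (real n + 1) + K) \<longlonglongrightarrow> I + 0 + K"
    using LIMSEQ_inverse_real_of_nat by (intro tendsto_intros) (simp add: inverse_eq_divide add.commute)
  moreover have "\<exists>N. \<forall>n\<ge>N. g.q (Y n) \<le> I + 1 / (real n + 1) + K"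
    using Yh Y(3) by (intro exI[of _ 0]) (auto simp: gq intro: less_imp_le)
  ultimately have "g.q w \<le> I + 0 + K" by (rule LIMSEQ_le)
  then have "h.q w \<le> I * ip.q w" using wq by (simp add: gq)
  then have hw: "h.q w = I * ip.q w" using hI[OF wV] by simp
  \<comment> \<open>On \<open>V\<close> this form is nonnegative and vanishes at the minimiser, so
    by Cauchy--Schwarz \<open>w\<close> annihilates \<open>V\<close>: the Euler--Lagrange equation
    without differentiation.\<close>
  define f where "f u v = h u v + of_real (- I) * ip u v" for u v
  have fW: "hermitian W f" unfolding f_def
    by (rule hermitian_comb[OF h.hermitian_axioms ip.hermitian_axioms])
  interpret f: pos_hermitian V f
  proof -
    have "hermitian V f" by (rule hermitian_subspace[OF fW VW Vlin])
    moreover have "0 \<le> Re (f u u)" if "u \<in> V" for u using hI[OF that] by (simp add: f_def)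
    ultimately show "pos_hermitian V f" by (simp add: pos_hermitian_def pos_hermitian_axioms_def)
  qed
  have "f.q w = 0" using hw by (simp add: f_def)
  then have fV: "f w v = 0" if "v \<in> V" for v using f.null_left[OF wV that] by simp
  \<comment> \<open>In the directions orthogonal to \<open>V\<close> the equation comes from the old
    eigenvectors: \<open>h (us i) w\<close> is a multiple of \<open>ip (us i) w\<close>, which is
    0.\<close>
  have fus: "f w (us i) = 0" if i: "i < k" for i
  proof -
    have "h (us i) w = of_real (\<mu>s i) * ip (us i) w"
      using es i w(1) by (simp add: esys_def eig_def h_def)
    moreover have "ip (us i) w = 0" using wV i ip.sym[OF w(1) us[OF i]] by (simp add: V_def)
    ultimately have "f (us i) w = 0" by (simp add: f_def)
    then show ?thesis using hermitian.sym[OF fW us[OF i] w(1)] by simp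
  qed
  \<comment> \<open>An arbitrary \<open>v\<close> splits into its projection to the span of the
    \<open>us i\<close> and a remainder in \<open>V\<close>.\<close>
  have "f w v = 0" if v: "v \<in> W" for v
  proof -
    let ?p = "\<lambda>x. \<Sum>i<k. ip v (us i) * us i x"
    have p: "?p \<in> W" using us by (intro ip.sum_mem) auto
    have "(\<lambda>x. v x - ?p x) \<in> V"
    proof -
      have "ip ?p (us i) = ip v (us i)" if i: "i < k" for i
      proof -
        have "ip ?p (us i) = (\<Sum>l<k. ip v (us l) * ip (us l) (us i))"
          using us i by (intro ip.sum_left) auto
        also have "\<dots> = (\<Sum>l<k. if l = i then ip v (us i) else 0)"
          using es i by (intro sum.cong) (auto simp: esys_def)
        finally show ?thesis using i by simp
      qed
      then show ?thesis using us by (auto simp: V_def ip.diff_left ip.diff_mem v p)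
    qed
    then have "f w (\<lambda>x. v x - ?p x) = 0" by (rule fV)
    moreover have "f w ?p = 0"
      using us by (subst hermitian.sum_right[OF fW]) (auto simp: w fus)
    ultimately show ?thesis by (simp add: hermitian.diff_right[OF fW] v p w)
  qed
  then have "eig I w" using w(1) by (simp add: eig_def f_def h_def)
  moreover have "ip w w = 1" using ip.diag_real[OF w(1)] wq by simp
  moreover have "ip w (us i) = 0" if "i < k" for i using wV that by (simp add: V_def)
  ultimately show ?thesis using that I_less by blast
qed

text \<open>While \<open>k < card (J l)\<close>, the low modes have a nonzero combination orthogonal
  to the \<open>k\<close> eigenvectors already found. On low modes \<open>D - t\<close> is
  \<open>- A l t\<close>, and \<open>B\<close> restores at most half of it, so its Rayleigh quotient
  is below \<open>t\<close> and \<open>extend_esys\<close> yields the next eigenvector.\<close>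

theorem esys_exists:
  assumes g: "gap l t"
  shows "k \<le> card (J l) \<Longrightarrow> \<exists>us \<mu>s. esys k us \<mu>s \<and> (\<forall>i<k. \<mu>s i < t)"
proof (induction k)
  case 0
  then show ?case by (simp add: esys_def)
next
  case (Suc k)
  then obtain us \<mu>s where es: "esys k us \<mu>s" "\<forall>i<k. \<mu>s i < t" by auto
  have us: "\<And>i. i < k \<Longrightarrow> us i \<in> W" using es by (auto simp: esys_def eig_def)
  obtain c where c: "\<exists>j\<in>J l. c j \<noteq> 0" "\<And>i. i < k \<Longrightarrow> (\<Sum>j\<in>J l. c j * ip (e j) (us i)) = 0"
    using homogeneous_system_solvable[OF fin, of k l "\<lambda>i j. ip (e j) (us i)"] Suc.prems by auto
  define x where "x = (\<lambda>z. \<Sum>j\<in>J l. c j * e j z)"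
  have x: "x \<in> W" unfolding x_def by (intro ip.sum_mem e_mem)
  have xe: "ip x (e j) = (if j \<in> J l then c j else 0)" for j
    unfolding x_def by (simp add: ip.sum_left e_mem orth fin if_distrib[of "\<lambda>z. _ * z"] cong: if_cong)
  have Px: "P l x = x" unfolding P_def xe by (simp add: x_def)
  have "ip.q x = (\<Sum>j\<in>J l. (cmod (c j))\<^sup>2)" using q_P[OF x, of l] Px by (simp add: xe)
  moreover have "\<dots> > 0" using c(1) fin[of l] by (auto intro!: sum_pos2)
  ultimately have qx: "ip.q x > 0" by simp
  have "D.q x + B.q x < t * ip.q x"
  proof -
    have "A l t x = - (D.q x - t * ip.q x)"
      unfolding A_def Q_def Px by (simp add: ip.zero_left D.zero_left ip.zero_mem)
    moreover have "\<bar>B.q x\<bar> \<le> A l t x / 2" using g x by (auto simp: gap_def)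
    moreover obtain \<delta> where "\<delta> > 0" "\<delta> * ip.q x \<le> A l t x" using A_lower g x by (metis gap_def)
    moreover have "\<delta> * ip.q x > 0" using \<open>\<delta> > 0\<close> qx by simp
    ultimately show ?thesis by linarith
  qed
  moreover have "ip x (us i) = 0" if "i < k" for i
    using c(2)[OF that] us[OF that] by (simp add: x_def ip.sum_left e_mem)
  ultimately obtain w \<mu> where w: "\<mu> < t" "eig \<mu> w" "ip w w = 1" "\<And>i. i < k \<Longrightarrow> ip w (us i) = 0"
    using extend_esys[OF es(1) x] by blast
  have "ip (us i) w = 0" if "i < k" for i
    using w(2,4) that ip.sym[of w "us i"] us by (simp add: eig_def)
  then have "esys (Suc k) (us(k := w)) (\<mu>s(k := \<mu>))"
    using es(1) w unfolding esys_def by (auto simp: less_Suc_eq)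
  moreover have "\<forall>i<Suc k. (\<mu>s(k := \<mu>)) i < t" using es(2) w(1) by (auto simp: less_Suc_eq)
  ultimately show ?case by blast
qed

end

section \<open>Square integrable functions\<close>

lemma cnj_borel_measurable [measurable]: "cnj \<in> borel_measurable borel"
  by (intro borel_measurable_continuous_onI continuous_intros)

definition sqi :: "'a measure \<Rightarrow> ('a \<Rightarrow> complex) set" where
  "sqi M = {u \<in> borel_measurable M. integrable M (\<lambda>x. (cmod (u x))\<^sup>2)}"

definition ipm :: "'a measure \<Rightarrow> ('a \<Rightarrow> complex) \<Rightarrow> ('a \<Rightarrow> complex) \<Rightarrow> complex" where
  "ipm M u v = (LINT x|M. u x * cnj (v x))"

lemma sqi_measurable: "u \<in> sqi M \<Longrightarrow> u \<in> borel_measurable M"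
  and sqi_integrable: "u \<in> sqi M \<Longrightarrow> integrable M (\<lambda>x. (cmod (u x))\<^sup>2)"
  by (auto simp: sqi_def)

lemma sqi_comb:
  assumes "u \<in> sqi M" "v \<in> sqi M"
  shows "(\<lambda>x. a * u x + b * v x) \<in> sqi M"
proof -
  have [measurable]: "u \<in> borel_measurable M" "v \<in> borel_measurable M" using assms by (auto simp: sqi_def)
  have "integrable M (\<lambda>x. (cmod (a * u x + b * v x))\<^sup>2)"
  proof (rule Bochner_Integration.integrable_bound)
    show "integrable M (\<lambda>x. 2 * (cmod a)\<^sup>2 * (cmod (u x))\<^sup>2 + 2 * (cmod b)\<^sup>2 * (cmod (v x))\<^sup>2)"
      using assms by (auto simp: sqi_def)
    have "(cmod (a * u x + b * v x))\<^sup>2 \<le> 2 * (cmod a)\<^sup>2 * (cmod (u x))\<^sup>2 + 2 * (cmod b)\<^sup>2 * (cmod (v x))\<^sup>2" for x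
    proof -
      have "(cmod (a * u x + b * v x))\<^sup>2 \<le> (cmod (a * u x) + cmod (b * v x))\<^sup>2"
        by (intro power_mono norm_triangle_ineq) simp
      also have "\<dots> \<le> 2 * (cmod (a * u x))\<^sup>2 + 2 * (cmod (b * v x))\<^sup>2"
        using sum_squares_bound[of "cmod (a * u x)" "cmod (b * v x)"] by (simp add: power2_sum)
      finally show ?thesis by (simp add: norm_mult power_mult_distrib)
    qed
    then show "AE x in M. norm ((cmod (a * u x + b * v x))\<^sup>2)
        \<le> norm (2 * (cmod a)\<^sup>2 * (cmod (u x))\<^sup>2 + 2 * (cmod b)\<^sup>2 * (cmod (v x))\<^sup>2)"
      by (intro AE_I2) simp
  qed measurable
  then show ?thesis by (simp add: sqi_def)
qed

lemma sqi_zero: "(\<lambda>x. 0) \<in> sqi M"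
  by (simp add: sqi_def)

lemma sqi_mult_integrable:
  assumes "u \<in> sqi M" "v \<in> sqi M"
  shows "integrable M (\<lambda>x. u x * v x)"
proof (rule Bochner_Integration.integrable_bound)
  have [measurable]: "u \<in> borel_measurable M" "v \<in> borel_measurable M" using assms by (auto simp: sqi_def)
  show "integrable M (\<lambda>x. (cmod (u x))\<^sup>2 + (cmod (v x))\<^sup>2)"
    using assms by (auto simp: sqi_def)
  have "cmod (u x) * cmod (v x) \<le> (cmod (u x))\<^sup>2 + (cmod (v x))\<^sup>2" for x
  proof -
    have "0 \<le> cmod (u x) * cmod (v x)" by simp
    then show ?thesis using sum_squares_bound[of "cmod (u x)" "cmod (v x)"] by linarith
  qed
  then show "AE x in M. norm (u x * v x) \<le> norm ((cmod (u x))\<^sup>2 + (cmod (v x))\<^sup>2)"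
    by (intro AE_I2) (simp add: norm_mult)
  show "(\<lambda>x. u x * v x) \<in> borel_measurable M" by measurable
qed

lemma sqi_cnj: "u \<in> sqi M \<Longrightarrow> (\<lambda>x. cnj (u x)) \<in> sqi M"
  by (auto simp: sqi_def intro: measurable_compose[OF _ cnj_borel_measurable])

lemma ipm_integrable: "u \<in> sqi M \<Longrightarrow> v \<in> sqi M \<Longrightarrow> integrable M (\<lambda>x. u x * cnj (v x))"
  by (intro sqi_mult_integrable sqi_cnj)

lemma sqi_mult_bounded:
  assumes "u \<in> sqi M" "g \<in> borel_measurable M" "AE x in M. cmod (g x) \<le> K"
  shows "(\<lambda>x. g x * u x) \<in> sqi M"
proof -
  have [measurable]: "u \<in> borel_measurable M" "g \<in> borel_measurable M" using assms by (auto simp: sqi_def)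
  have "integrable M (\<lambda>x. (cmod (g x * u x))\<^sup>2)"
  proof (rule Bochner_Integration.integrable_bound)
    show "integrable M (\<lambda>x. K\<^sup>2 * (cmod (u x))\<^sup>2)" using assms by (simp add: sqi_def)
    show "AE x in M. norm ((cmod (g x * u x))\<^sup>2) \<le> norm (K\<^sup>2 * (cmod (u x))\<^sup>2)"
      using assms(3) by eventually_elim (auto simp: norm_mult power_mult_distrib intro!: mult_right_mono power_mono)
  qed measurable
  then show ?thesis by (simp add: sqi_def)
qed

lemma (in finite_measure) bounded_sqi:
  assumes "g \<in> borel_measurable M" "AE x in M. cmod (g x) \<le> K"
  shows "g \<in> sqi M"
proof -
  have "(\<lambda>x. g x * 1) \<in> sqi M" by (rule sqi_mult_bounded[OF _ assms]) (simp add: sqi_def)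
  then show ?thesis by simp
qed

lemma sqi_AE_cong:
  assumes "u \<in> sqi M" "v \<in> borel_measurable M" "AE x in M. u x = v x"
  shows "v \<in> sqi M"
proof -
  have "integrable M (\<lambda>x. (cmod (v x))\<^sup>2) = integrable M (\<lambda>x. (cmod (u x))\<^sup>2)"
    using assms by (intro integrable_cong_AE) (auto simp: sqi_def)
  then show ?thesis using assms by (simp add: sqi_def)
qed

lemma ipm_AE_cong:
  assumes "u \<in> borel_measurable M" "u' \<in> borel_measurable M" "v \<in> borel_measurable M" "v' \<in> borel_measurable M"
    "AE x in M. u x = u' x" "AE x in M. v x = v' x"
  shows "ipm M u v = ipm M u' v'"
proof -
  note [measurable] = assms(1-4)
  show ?thesis unfolding ipm_def
  proof (rule integral_cong_AE)
    show "AE x in M. u x * cnj (v x) = u' x * cnj (v' x)"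
      using assms(5,6) by eventually_elim simp
  qed measurable
qed

lemma ipm_norm: "Re (ipm M u u) = (LINT x|M. (cmod (u x))\<^sup>2)"
proof -
  have "ipm M u u = (LINT x|M. complex_of_real ((cmod (u x))\<^sup>2))"
    unfolding ipm_def by (simp only: complex_norm_square)
  also have "\<dots> = of_real (LINT x|M. (cmod (u x))\<^sup>2)" by (rule integral_complex_of_real)
  finally show ?thesis by simp
qed

lemma pos_hermitian_ipm: "pos_hermitian (sqi M) (ipm M)"
proof
  show "lin_closed (sqi M)" by (simp add: lin_closed_def sqi_zero sqi_comb)
  show "ipm M (\<lambda>x. a * u x + b * v x) w = a * ipm M u w + b * ipm M v w"
    if "u \<in> sqi M" "v \<in> sqi M" "w \<in> sqi M" for u v w a b
    unfolding ipm_def using ipm_integrable[OF that(1,3)] ipm_integrable[OF that(2,3)]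
    by (simp add: distrib_right mult.assoc)
  show "ipm M v u = cnj (ipm M u v)" for u v
  proof -
    have "cnj (LINT x|M. u x * cnj (v x)) = (LINT x|M. cnj (u x * cnj (v x)))" by (rule Bochner_Integration.integral_cnj[symmetric])
    then show ?thesis unfolding ipm_def by (simp add: mult.commute)
  qed
  show "0 \<le> Re (ipm M u u)" for u unfolding ipm_norm by simp
qed

lemma ipm_eq_0_iff:
  assumes "u \<in> sqi M" shows "Re (ipm M u u) = 0 \<longleftrightarrow> (AE x in M. u x = 0)"
  unfolding ipm_norm using assms by (subst integral_nonneg_eq_0_iff_AE) (auto simp: sqi_def)

text \<open>Riesz--Fischer: along a fast subsequence the increments are summable in mean, hence
  almost everywhere, and Fatou's lemma upgrades the pointwise limit to a mean-square limit.
  Finiteness of the measure passes from mean-square to mean bounds.\<close>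

lemma (in finite_measure) sqi_complete:
  fixes X :: "nat \<Rightarrow> 'a \<Rightarrow> complex"
  assumes X: "\<And>n. X n \<in> sqi M"
    and cauchy: "\<And>\<epsilon>::real. \<epsilon> > 0 \<Longrightarrow> \<exists>N::nat. \<forall>m\<ge>N. \<forall>n\<ge>N. Re (ipm M (\<lambda>x. X m x - X n x) (\<lambda>x. X m x - X n x)) < \<epsilon>"
  obtains w where "w \<in> sqi M" "(\<lambda>n. Re (ipm M (\<lambda>x. X n x - w x) (\<lambda>x. X n x - w x))) \<longlonglongrightarrow> 0"
proof -
  interpret pos_hermitian "sqi M" "ipm M" by (rule pos_hermitian_ipm)
  have [measurable]: "X n \<in> borel_measurable M" for n using X by (rule sqi_measurable)
  have diff: "(\<lambda>x. X m x - X n x) \<in> sqi M" for m n by (intro diff_mem X)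
  define d where "d m n = (LINT x|M. (cmod (X m x - X n x))\<^sup>2)" for m n
  have cauchy': "\<exists>N::nat. \<forall>m\<ge>N. \<forall>n\<ge>N. d m n < \<epsilon>" if "\<epsilon> > 0" for \<epsilon>
    using cauchy[OF that] by (simp add: ipm_norm d_def)
  have "\<exists>r. \<forall>k. \<forall>m\<ge>r k. \<forall>n\<ge>r k. d m n < (1/4)^k"
    using cauchy'[of "(1/4)^k" for k] by (intro choice) simp
  then obtain r0 where r0: "\<And>k m n. \<lbrakk>m \<ge> r0 k; n \<ge> r0 k\<rbrakk> \<Longrightarrow> d m n < (1/4)^k" by blast
  \<comment> \<open>The sum dominates every \<open>r0 i\<close> with \<open>i \<le> k\<close>, and
    the summand \<open>k\<close> lets \<open>r\<close> tend to infinity.\<close>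
  define r where "r k = (\<Sum>i\<le>k. r0 i) + k" for k :: nat
  have r: "r0 i \<le> r k" if "i \<le> k" for i k
    unfolding r_def using that by (intro trans_le_add1 member_le_sum) auto
  define f where "f k x = cmod (X (r (Suc k)) x - X (r k) x)" for k x
  have [measurable]: "f k \<in> borel_measurable M" for k unfolding f_def by measurable
  have fint: "integrable M (f k)" for k
  proof -
    have "integrable M (\<lambda>x. (X (r (Suc k)) x - X (r k) x) * 1)"
      by (rule sqi_mult_integrable[OF diff]) (simp add: sqi_def)
    then show ?thesis unfolding f_def by (intro integrable_norm) simp
  qed
  define c where "c = measure M (space M) + 1"
  have fbound: "(LINT x|M. f k x) \<le> c * (1/2)^k" for k
  proof -
    \<comment> \<open>The weight \<open>2 ^ k\<close> balances the two terms: the squared increment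
      has integral below \<open>(1/4) ^ k\<close>, so both contribute the order
      \<open>(1/2) ^ k\<close>.\<close>
    have "(LINT x|M. f k x) \<le> (LINT x|M. (1/2)^k + 2^k * (f k x)\<^sup>2)"
    proof (rule integral_mono[OF fint])
      show "integrable M (\<lambda>x. (1/2)^k + 2^k * (f k x)\<^sup>2)"
        using diff[of "r (Suc k)" "r k"] by (simp add: sqi_def f_def)
      fix x
      have "0 \<le> f k x" by (simp add: f_def)
      have "2 * (f k x * 2^k) * 1 \<le> (f k x * 2^k)\<^sup>2 + 1\<^sup>2" by (rule sum_squares_bound)
      moreover have "0 \<le> f k x * 2^k" using \<open>0 \<le> f k x\<close> by simp
      moreover have "z \<le> y + 1" if "2 * z * 1 \<le> y + 1\<^sup>2" "0 \<le> z" for y z :: real using that by simp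
      ultimately have "f k x * 2^k \<le> (f k x * 2^k)\<^sup>2 + 1" by blast
      then have "f k x * 2^k * (1/2)^k \<le> ((f k x * 2^k)\<^sup>2 + 1) * (1/2)^k" by (intro mult_right_mono) auto
      then show "f k x \<le> (1/2)^k + 2^k * (f k x)\<^sup>2"
        by (simp add: power_mult_distrib power_one_over field_simps power2_eq_square)
    qed
    also have "\<dots> = (1/2)^k * measure M (space M) + 2^k * d (r (Suc k)) (r k)"
      using diff[of "r (Suc k)" "r k"] by (subst Bochner_Integration.integral_add) (auto simp: sqi_def f_def d_def)
    also have "\<dots> \<le> (1/2)^k * measure M (space M) + 2^k * (1/4)^k"
      using r0[of k "r (Suc k)" "r k"] r by (intro add_left_mono mult_left_mono) (auto intro: less_imp_le)
    also have "(2::real)^k * (1/4)^k = (1/2)^k" by (simp flip: power_mult_distrib)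
    finally show ?thesis by (simp add: c_def algebra_simps)
  qed
  have "(\<integral>\<^sup>+x. (\<Sum>k. ennreal (f k x)) \<partial>M) = (\<Sum>k. \<integral>\<^sup>+x. ennreal (f k x) \<partial>M)"
    by (rule nn_integral_suminf) simp
  also have "\<dots> = (\<Sum>k. ennreal (LINT x|M. f k x))"
    by (intro suminf_cong nn_integral_eq_integral fint) (simp add: f_def)
  also have "\<dots> \<le> (\<Sum>k. ennreal (c * (1/2)^k))"
    by (intro suminf_le ennreal_leI fbound) auto
  also have "\<dots> < \<infinity>"
  proof -
    have "summable (\<lambda>k. c * (1/2::real)^k)" by (intro summable_mult summable_geometric) simp
    moreover have "0 \<le> c" by (simp add: c_def)
    ultimately show ?thesis by (subst suminf_ennreal2) auto
  qed
  finally have "AE x in M. (\<Sum>k. ennreal (f k x)) \<noteq> \<infinity>"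
    by (intro nn_integral_PInf_AE) auto
  then have conv: "AE x in M. convergent (\<lambda>k. X (r k) x)"
  proof eventually_elim
    case (elim x)
    then have "summable (\<lambda>k. f k x)"
      by (intro summable_suminf_not_top) (auto simp: f_def)
    then have "summable (\<lambda>k. X (r (Suc k)) x - X (r k) x)"
      unfolding f_def by (rule summable_norm_cancel)
    then have "convergent (\<lambda>n. \<Sum>k<n. X (r (Suc k)) x - X (r k) x)"
      by (simp add: summable_iff_convergent)
    then have "convergent (\<lambda>n. X (r n) x - X (r 0) x)" by (simp only: sum_lessThan_telescope[of "\<lambda>k. X (r k) x"])
    then have "convergent (\<lambda>n. X (r n) x - X (r 0) x + X (r 0) x)"
      by (intro convergent_add convergent_const)
    then show ?case by simp
  qed
  define w where "w x = lim (\<lambda>k. X (r k) x)" for x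
  have [measurable]: "w \<in> borel_measurable M" unfolding w_def by (intro borel_measurable_lim_metric) measurable
  have wlim: "AE x in M. (\<lambda>k. X (r k) x) \<longlonglongrightarrow> w x"
    using conv by eventually_elim (simp add: w_def convergent_LIMSEQ_iff)
  have fatou: "(\<integral>\<^sup>+x. ennreal ((cmod (X n x - w x))\<^sup>2) \<partial>M) \<le> ennreal \<epsilon>"
    if N: "\<And>m. m \<ge> N \<Longrightarrow> d n (r m) \<le> \<epsilon>" for n N \<epsilon>
  proof -
    have "(\<integral>\<^sup>+x. ennreal ((cmod (X n x - w x))\<^sup>2) \<partial>M)
      = (\<integral>\<^sup>+x. liminf (\<lambda>k. ennreal ((cmod (X n x - X (r k) x))\<^sup>2)) \<partial>M)"
    proof (rule nn_integral_cong_AE)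
      show "AE x in M. ennreal ((cmod (X n x - w x))\<^sup>2) = liminf (\<lambda>k. ennreal ((cmod (X n x - X (r k) x))\<^sup>2))"
        using wlim
      proof eventually_elim
        case (elim x)
        then have "(\<lambda>k. ennreal ((cmod (X n x - X (r k) x))\<^sup>2)) \<longlonglongrightarrow> ennreal ((cmod (X n x - w x))\<^sup>2)"
          by (intro tendsto_intros)
        from lim_imp_Liminf[OF _ this] show ?case by simp
      qed
    qed
    also have "\<dots> \<le> liminf (\<lambda>k. \<integral>\<^sup>+x. ennreal ((cmod (X n x - X (r k) x))\<^sup>2) \<partial>M)"
      by (rule nn_integral_liminf) measurable
    also have "\<dots> = liminf (\<lambda>k. ennreal (d n (r k)))"
      unfolding d_def by (intro arg_cong[where f=liminf] ext nn_integral_eq_integral sqi_integrable diff) simp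
    also have "\<dots> \<le> ennreal \<epsilon>"
    proof (rule order_trans[OF Liminf_le_Limsup])
      show "limsup (\<lambda>k. ennreal (d n (r k))) \<le> ennreal \<epsilon>"
        by (intro Limsup_bounded eventually_sequentiallyI[of N] ennreal_leI N)
    qed simp
    finally show ?thesis .
  qed
  have small: "\<exists>N. \<forall>n\<ge>N. (\<integral>\<^sup>+x. ennreal ((cmod (X n x - w x))\<^sup>2) \<partial>M) \<le> ennreal \<epsilon>" if \<epsilon>: "\<epsilon> > 0" for \<epsilon>
  proof -
    obtain N where N: "\<And>m n. \<lbrakk>m \<ge> N; n \<ge> N\<rbrakk> \<Longrightarrow> d m n < \<epsilon>" using cauchy'[OF \<epsilon>] by blast
    have "N \<le> r m" if "N \<le> m" for m using that by (simp add: r_def trans_le_add2)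
    then show ?thesis using N by (intro exI[of _ N] allI impI fatou[of N]) (auto intro: less_imp_le)
  qed
  have Xw: "\<exists>N. \<forall>n\<ge>N. (\<lambda>x. X n x - w x) \<in> sqi M \<and> (LINT x|M. (cmod (X n x - w x))\<^sup>2) \<le> \<epsilon>" if \<epsilon>: "\<epsilon> > 0" for \<epsilon>
  proof -
    obtain N where N: "\<And>n. n \<ge> N \<Longrightarrow> (\<integral>\<^sup>+x. ennreal ((cmod (X n x - w x))\<^sup>2) \<partial>M) \<le> ennreal \<epsilon>"
      using small[OF \<epsilon>] by blast
    have "(\<lambda>x. X n x - w x) \<in> sqi M \<and> (LINT x|M. (cmod (X n x - w x))\<^sup>2) \<le> \<epsilon>" if "n \<ge> N" for n
    proof
      have i: "integrable M (\<lambda>x. (cmod (X n x - w x))\<^sup>2)"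
        using le_less_trans[OF N[OF that], of \<infinity>] by (intro integrableI_nonneg) auto
      then show "(\<lambda>x. X n x - w x) \<in> sqi M" by (simp add: sqi_def)
      have "ennreal (LINT x|M. (cmod (X n x - w x))\<^sup>2) \<le> ennreal \<epsilon>"
        using N[OF that] nn_integral_eq_integral[OF i] by simp
      then show "(LINT x|M. (cmod (X n x - w x))\<^sup>2) \<le> \<epsilon>" using \<epsilon> by simp
    qed
    then show ?thesis by blast
  qed
  have "w \<in> sqi M"
  proof -
    obtain n where "(\<lambda>x. X n x - w x) \<in> sqi M" using Xw[of 1] by auto
    from diff_mem[OF X[of n] this] show ?thesis by simp
  qed
  moreover have "(\<lambda>n. Re (ipm M (\<lambda>x. X n x - w x) (\<lambda>x. X n x - w x))) \<longlonglongrightarrow> 0"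
    unfolding ipm_norm
  proof (rule LIMSEQ_I)
    fix \<epsilon> :: real assume "\<epsilon> > 0"
    then obtain N where "\<And>n. n \<ge> N \<Longrightarrow> (LINT x|M. (cmod (X n x - w x))\<^sup>2) \<le> \<epsilon> / 2"
      using Xw[of "\<epsilon> / 2"] by auto
    then show "\<exists>no. \<forall>n\<ge>no. norm ((LINT x|M. (cmod (X n x - w x))\<^sup>2) - 0) < \<epsilon>"
      using \<open>\<epsilon> > 0\<close> by (intro exI[of _ N]) (force simp: abs_of_nonneg)
  qed
  ultimately show ?thesis using that by blast
qed

section \<open>The hemisphere and weak derivatives\<close>

lemma sets_hemi [measurable_cong]: "sets hemi = sets borel"
  and space_hemi [simp]: "space hemi = UNIV"
  by (simp_all add: hemi_def)

lemma borel_measurable_hemi: "borel_measurable hemi = borel_measurable borel"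
  by (rule measurable_cong_sets) (simp_all add: sets_hemi)

lemma fst_snd_borel [measurable]: "fst \<in> borel_measurable (borel :: (real \<times> real) measure)"
  "snd \<in> borel_measurable (borel :: (real \<times> real) measure)"
  by (intro borel_measurable_continuous_onI continuous_intros)+

lemma hemi_dom_borel [measurable]: "hemi_dom \<in> sets borel"
  unfolding hemi_dom_def by (intro borel_Times) auto

lemma sin_nonneg_hemi: "x \<in> hemi_dom \<Longrightarrow> 0 \<le> sin (fst x)"
  unfolding hemi_dom_def by (auto intro!: sin_ge_zero)

lemma hemi_sin_pos:
  assumes "x \<in> hemi_dom" "fst x \<noteq> 0"
  shows "0 < sin (fst x)"
proof (rule sin_gt_zero)
  show "0 < fst x" using assms by (auto simp: hemi_dom_def)
  have "fst x \<le> pi/2" using assms by (auto simp: hemi_dom_def)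
  then show "fst x < pi" using pi_gt_zero by linarith
qed

lemma hemi_weight_nonneg: "0 \<le> indicator hemi_dom x * sin (fst x)"
  using sin_nonneg_hemi by (auto simp: indicator_def)

lemma L2_eq: "L2 = sqi hemi"
  by (simp add: L2_def sqi_def borel_measurable_hemi)

lemma L2_inner_eq: "L2_inner = ipm hemi"
  by (intro ext) (simp add: L2_inner_def ipm_def)

interpretation L2: pos_hermitian L2 L2_inner
  unfolding L2_eq L2_inner_eq by (rule pos_hermitian_ipm)

lemma integral_hemi:
  fixes f :: "real \<times> real \<Rightarrow> 'b::{banach, second_countable_topology}"
  assumes "f \<in> borel_measurable borel"
  shows "(LINT x|hemi. f x) = (LINT x|lborel. (indicator hemi_dom x * sin (fst x)) *\<^sub>R f x)"
  unfolding hemi_def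
  by (rule integral_density) (use assms hemi_weight_nonneg in auto)

lemma null_vertical_line: "{x::real\<times>real. fst x = c} \<in> null_sets lborel"
proof -
  have "{x::real\<times>real. fst x = c} = {c} \<times> UNIV" by auto
  moreover have "{c} \<times> (UNIV::real set) \<in> null_sets (lborel \<Otimes>\<^sub>M lborel)"
    by (rule lborel.times_in_null_sets1) auto
  ultimately show ?thesis by (simp add: lborel_prod)
qed

lemma AE_hemi: "AE x in hemi. 0 < fst x \<and> fst x < pi/2 \<and> -pi < snd x \<and> snd x \<le> pi"
proof -
  have "AE x in lborel. fst (x::real\<times>real) \<noteq> pi/2" "AE x in lborel. fst (x::real\<times>real) \<noteq> 0"
    using AE_not_in[OF null_vertical_line[of "pi/2"]] AE_not_in[OF null_vertical_line[of 0]] by simp_all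
  then have "AE x in lborel. 0 < ennreal (indicator hemi_dom x * sin (fst x)) \<longrightarrow>
      0 < fst x \<and> fst x < pi/2 \<and> -pi < snd x \<and> snd x \<le> pi"
    by eventually_elim (auto simp: hemi_dom_def indicator_def)
  then show ?thesis unfolding hemi_def by (subst AE_density) measurable
qed

lemma AE_hemiI: "(\<And>\<theta> \<phi>. \<lbrakk>0 < \<theta>; \<theta> < pi/2; -pi < \<phi>; \<phi> \<le> pi\<rbrakk> \<Longrightarrow> P (\<theta>, \<phi>)) \<Longrightarrow> AE x in hemi. P x"
  using AE_hemi by eventually_elim (metis prod.collapse)

lemma AE_hemi_sin: "AE x in hemi. 0 < sin (fst x)"
  using AE_hemi by eventually_elim (simp add: sin_gt_zero2)

lemma finite_measure_hemi: "finite_measure hemi"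
proof
  have "emeasure hemi (space hemi) = (\<integral>\<^sup>+x. ennreal (indicator hemi_dom x * sin (fst x)) \<partial>lborel)"
    unfolding hemi_def by (simp add: emeasure_density)
  also have "\<dots> \<le> (\<integral>\<^sup>+x. indicator (cbox (0, -pi) (pi/2, pi)) x \<partial>lborel)"
    by (intro nn_integral_mono) (auto simp: hemi_dom_def indicator_def cbox_Pair_eq)
  also have "\<dots> = emeasure lborel (cbox (0, -pi) (pi/2, pi))" by simp
  also have "\<dots> < \<infinity>" by (rule emeasure_lborel_cbox_finite)
  finally show "emeasure hemi (space hemi) \<noteq> \<infinity>" by simp
qed

interpretation hemi: finite_measure hemi by (rule finite_measure_hemi)

lemma L2_bounded:
  assumes "g \<in> borel_measurable borel"
    and "\<And>\<theta> \<phi>. \<lbrakk>0 < \<theta>; \<theta> < pi/2; -pi < \<phi>; \<phi> \<le> pi\<rbrakk> \<Longrightarrow> cmod (g (\<theta>, \<phi>)) \<le> K"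
  shows "g \<in> L2"
  unfolding L2_eq using assms
  by (intro hemi.bounded_sqi[of _ K] AE_hemiI) (auto simp: borel_measurable_hemi)

lemma L2_AE_cong: "\<lbrakk>u \<in> L2; v \<in> borel_measurable borel; AE x in hemi. u x = v x\<rbrakk> \<Longrightarrow> v \<in> L2"
  unfolding L2_eq by (rule sqi_AE_cong) (auto simp: borel_measurable_hemi)

lemma L2_measurable: "u \<in> L2 \<Longrightarrow> u \<in> borel_measurable borel"
  by (simp add: L2_def)

lemma L2_inner_AE_cong:
  "\<lbrakk>u \<in> L2; u' \<in> L2; v \<in> L2; v' \<in> L2; AE x in hemi. u x = u' x; AE x in hemi. v x = v' x\<rbrakk>
    \<Longrightarrow> L2_inner u v = L2_inner u' v'"
  unfolding L2_inner_eq L2_eq by (intro ipm_AE_cong) (auto simp: sqi_def)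

lemma L2_q_eq_0: "u \<in> L2 \<Longrightarrow> L2.q u = 0 \<longleftrightarrow> (AE x in hemi. u x = 0)"
  unfolding L2_inner_eq L2_eq by (rule ipm_eq_0_iff)

text \<open>The division by sin undoes the density of \<open>hemi\<close>. On the line \<theta> = 0,
  where the quotient is the default value 0, the hypothesis \<open>z\<close> makes both integrands
  vanish.\<close>

lemma set_integral_hemi_dom:
  fixes g :: "real \<times> real \<Rightarrow> complex"
  assumes g: "g \<in> borel_measurable borel" and z: "\<And>\<phi>. g (0, \<phi>) = 0"
  shows "(LINT x:hemi_dom|lborel. g x) = (LINT x|hemi. g x / of_real (sin (fst x)))"
proof -
  note [measurable] = g
  have "(LINT x|hemi. g x / of_real (sin (fst x)))
      = (LINT x|lborel. (indicator hemi_dom x * sin (fst x)) *\<^sub>R (g x / of_real (sin (fst x))))"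
    by (rule integral_hemi) measurable
  also have "\<dots> = (LINT x:hemi_dom|lborel. g x)"
    unfolding set_lebesgue_integral_def
  proof (intro Bochner_Integration.integral_cong refl)
    fix x :: "real \<times> real"
    show "(indicator hemi_dom x * sin (fst x)) *\<^sub>R (g x / of_real (sin (fst x))) = indicator hemi_dom x *\<^sub>R g x"
    proof (cases "x \<in> hemi_dom \<and> fst x \<noteq> 0")
      case True
      then have "sin (fst x) > 0" by (intro hemi_sin_pos) auto
      then show ?thesis by (simp add: scaleR_conv_of_real)
    next
      case False
      then show ?thesis using z by (cases x) auto
    qed
  qed
  finally show ?thesis ..
qed

section \<open>Test functions, and weak derivatives as pairings in \<open>L2\<close>\<close>

abbreviation d1 :: "(real \<times> real \<Rightarrow> real) \<Rightarrow> real \<times> real \<Rightarrow> real" where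
  "d1 \<psi> x \<equiv> frechet_derivative \<psi> (at x) (1, 0)"
abbreviation d2 :: "(real \<times> real \<Rightarrow> real) \<Rightarrow> real \<times> real \<Rightarrow> real" where
  "d2 \<psi> x \<equiv> frechet_derivative \<psi> (at x) (0, 1)"

lemma C1_continuous_partial:
  assumes "C1 f"
  shows "continuous_on UNIV (\<lambda>x. frechet_derivative f (at x) v)"
proof -
  obtain f' where f': "\<And>x. (f has_derivative blinfun_apply (f' x)) (at x)" "continuous_on UNIV f'"
    using assms by (auto simp: C1_def)
  have "frechet_derivative f (at x) v = blinfun_apply (f' x) v" for x
    using frechet_derivative_at[OF f'(1)[of x]] by simp
  then show ?thesis using f'(2) by (simp add: continuous_intros)
qed

lemma C1_continuous: "C1 f \<Longrightarrow> continuous_on UNIV f"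
  unfolding C1_def by (meson continuous_at_imp_continuous_on has_derivative_continuous)

lemma C1_has_derivative: "C1 f \<Longrightarrow> (f has_derivative frechet_derivative f (at x)) (at x)"
  unfolding C1_def by (metis frechet_derivative_at)

lemma C1_linear_fd: "C1 f \<Longrightarrow> linear (frechet_derivative f (at x))"
  using C1_has_derivative has_derivative_linear by blast

lemma continuous_borel [intro]: "continuous_on UNIV f \<Longrightarrow> f \<in> borel_measurable borel"
  by (rule borel_measurable_continuous_onI)

lemma test_function_C1: "test_function \<psi> \<Longrightarrow> C1 \<psi>"
  by (simp add: test_function_def)

lemma test_function_zero:
  assumes "test_function \<psi>"
  obtains \<epsilon> where "\<epsilon> > 0" "\<And>\<theta> \<phi>. \<theta> < \<epsilon> \<or> pi/2 - \<epsilon> < \<theta> \<Longrightarrow> \<psi> (\<theta>, \<phi>) = 0 \<and> frechet_derivative \<psi> (at (\<theta>, \<phi>)) v = 0"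
proof -
  obtain \<epsilon> where e: "\<epsilon> > 0" "\<And>\<theta> \<phi>. \<theta> < \<epsilon> \<or> pi/2 - \<epsilon> < \<theta> \<Longrightarrow> \<psi> (\<theta>, \<phi>) = 0"
    using assms unfolding test_function_def by blast
  have "frechet_derivative \<psi> (at (\<theta>, \<phi>)) v = 0" if "\<theta> < \<epsilon> \<or> pi/2 - \<epsilon> < \<theta>" for \<theta> \<phi>
  proof -
    let ?S = "({..<\<epsilon>} \<union> {pi/2 - \<epsilon><..}) \<times> (UNIV::real set)"
    have "open ?S" by (intro open_Times open_Un) auto
    moreover have "(\<theta>, \<phi>) \<in> ?S" using that by auto
    moreover have "((\<lambda>_. 0) has_derivative (\<lambda>_. 0)) (at (\<theta>, \<phi>))" by simp
    ultimately have "(\<psi> has_derivative (\<lambda>_. 0)) (at (\<theta>, \<phi>))"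
      using e(2) has_derivative_transform_within_open[of "\<lambda>_. 0" "\<lambda>_. 0" "(\<theta>, \<phi>)" UNIV ?S \<psi>] by auto
    then show ?thesis using frechet_derivative_at by metis
  qed
  then show ?thesis using that e by blast
qed

lemma test_function_at_pole:
  assumes "test_function \<psi>"
  shows "\<psi> (0, \<phi>) = 0" "frechet_derivative \<psi> (at (0, \<phi>)) v = 0"
proof -
  obtain \<epsilon> where "\<epsilon> > 0" "\<And>\<theta> \<phi>. \<theta> < \<epsilon> \<or> pi/2 - \<epsilon> < \<theta> \<Longrightarrow> \<psi> (\<theta>, \<phi>) = 0 \<and> frechet_derivative \<psi> (at (\<theta>, \<phi>)) v = 0"
    using test_function_zero[OF assms] by blast
  then show "\<psi> (0, \<phi>) = 0" "frechet_derivative \<psi> (at (0, \<phi>)) v = 0" by auto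
qed

lemma sin_quotient_L2:
  fixes g :: "real \<times> real \<Rightarrow> real"
  assumes g: "continuous_on UNIV g" and e: "\<epsilon> > 0" and z: "\<And>\<theta> \<phi>. \<theta> < \<epsilon> \<Longrightarrow> g (\<theta>, \<phi>) = 0"
  shows "(\<lambda>x. of_real (g x / sin (fst x))) \<in> L2"
proof -
  define S where "S = cbox (min \<epsilon> (pi/2), -pi) (pi/2, pi)"
  have S: "x \<in> S \<longleftrightarrow> min \<epsilon> (pi/2) \<le> fst x \<and> fst x \<le> pi/2 \<and> -pi \<le> snd x \<and> snd x \<le> pi" for x
    by (cases x) (auto simp: S_def cbox_Pair_eq)
  have "continuous_on S (\<lambda>x. g x / sin (fst x))"
  proof (intro continuous_intros continuous_on_subset[OF g])
    show "\<forall>x\<in>S. sin (fst x) \<noteq> 0"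
    proof
      fix x assume "x \<in> S"
      moreover have "0 < min \<epsilon> (pi/2)" using e by simp
      ultimately have "0 < fst x" "fst x \<le> pi/2" unfolding S by linarith+
      then have "0 < fst x" "fst x < pi" using pi_gt_zero by linarith+
      then show "sin (fst x) \<noteq> 0" using sin_gt_zero by force
    qed
  qed auto
  then have "bounded ((\<lambda>x. g x / sin (fst x)) ` S)"
    by (intro compact_imp_bounded compact_continuous_image) (auto simp: S_def)
  then obtain K where K: "K > 0" "\<And>x. x \<in> S \<Longrightarrow> \<bar>g x / sin (fst x)\<bar> \<le> K"
    unfolding bounded_pos by auto
  show ?thesis
  proof (rule L2_bounded)
    show "(\<lambda>x. complex_of_real (g x / sin (fst x))) \<in> borel_measurable borel"
      using continuous_borel[OF g] by measurable
    show "cmod (complex_of_real (g (\<theta>, \<phi>) / sin (fst (\<theta>, \<phi>)))) \<le> K"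
      if "0 < \<theta>" "\<theta> < pi/2" "-pi < \<phi>" "\<phi> \<le> pi" for \<theta> \<phi>
    proof (cases "\<theta> < \<epsilon>")
      case True
      then show ?thesis using z K(1) by simp
    next
      case False
      then have "(\<theta>, \<phi>) \<in> S" using that by (auto simp: S)
      then show ?thesis using K(2)[of "(\<theta>, \<phi>)"] by (simp flip: of_real_divide)
    qed
  qed
qed

lemma test_function_L2:
  assumes "test_function \<psi>"
  shows "(\<lambda>x. of_real (\<psi> x / sin (fst x))) \<in> L2" "(\<lambda>x. of_real (frechet_derivative \<psi> (at x) v / sin (fst x))) \<in> L2"
    "(\<lambda>x. of_real (\<psi> x)) \<in> L2"
proof -
  obtain \<epsilon> where e: "\<epsilon> > 0" "\<And>\<theta> \<phi>. \<theta> < \<epsilon> \<or> pi/2 - \<epsilon> < \<theta> \<Longrightarrow> \<psi> (\<theta>, \<phi>) = 0 \<and> frechet_derivative \<psi> (at (\<theta>, \<phi>)) v = 0"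
    using test_function_zero[OF assms] by blast
  note c = C1_continuous[OF test_function_C1[OF assms]]
  show 1: "(\<lambda>x. of_real (\<psi> x / sin (fst x))) \<in> L2" using e by (intro sin_quotient_L2[OF c e(1)]) auto
  show "(\<lambda>x. of_real (frechet_derivative \<psi> (at x) v / sin (fst x))) \<in> L2"
    using e by (intro sin_quotient_L2[OF C1_continuous_partial[OF test_function_C1[OF assms]] e(1)]) auto
  have 2: "(\<lambda>x. of_real (sin (fst x)) * of_real (\<psi> x / sin (fst x))) \<in> L2"
    unfolding L2_eq
  proof (rule sqi_mult_bounded[where K=1])
    show "(\<lambda>x. complex_of_real (sin (fst x))) \<in> borel_measurable hemi"
      unfolding borel_measurable_hemi by measurable
    show "AE x in hemi. cmod (complex_of_real (sin (fst x))) \<le> 1" by simp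
  qed (use 1 in \<open>simp add: L2_eq\<close>)
  have 3: "AE x in hemi. of_real (sin (fst x)) * of_real (\<psi> x / sin (fst x)) = complex_of_real (\<psi> x)"
    using AE_hemi_sin by eventually_elim simp
  have 4: "(\<lambda>x. complex_of_real (\<psi> x)) \<in> borel_measurable borel"
    using continuous_borel[OF c] by measurable
  show "(\<lambda>x. of_real (\<psi> x)) \<in> L2" by (rule L2_AE_cong[OF 2 4 3])
qed

text \<open>Pairings with test functions over the coordinate rectangle become inner products in
  \<open>L2\<close>, so linearity, Cauchy--Schwarz and limits are available for weak
  derivatives.\<close>

lemma weak_pairing:
  fixes u :: "real \<times> real \<Rightarrow> complex" and g :: "real \<times> real \<Rightarrow> real"
  assumes u: "u \<in> borel_measurable borel" and g: "g \<in> borel_measurable borel" and z: "\<And>\<phi>. g (0, \<phi>) = 0"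
  shows "(LINT x:hemi_dom|lborel. g x *\<^sub>R u x) = L2_inner u (\<lambda>x. of_real (g x / sin (fst x)))"
proof -
  have "(LINT x:hemi_dom|lborel. g x *\<^sub>R u x) = (LINT x|hemi. (g x *\<^sub>R u x) / of_real (sin (fst x)))"
    using u g z by (intro set_integral_hemi_dom) auto
  then show ?thesis unfolding L2_inner_def by (simp add: scaleR_conv_of_real field_simps)
qed

lemma has_weak_dtheta_iff:
  assumes "u \<in> L2" "p \<in> L2"
  shows "has_weak_dtheta u p \<longleftrightarrow> (\<forall>\<psi>. test_function \<psi> \<longrightarrow>
    L2_inner u (\<lambda>x. of_real (d1 \<psi> x / sin (fst x))) = - L2_inner p (\<lambda>x. of_real (\<psi> x / sin (fst x))))"
proof -
  have "(LINT x:hemi_dom|lborel. d1 \<psi> x *\<^sub>R u x) = L2_inner u (\<lambda>x. of_real (d1 \<psi> x / sin (fst x)))"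
    "(LINT x:hemi_dom|lborel. \<psi> x *\<^sub>R p x) = L2_inner p (\<lambda>x. of_real (\<psi> x / sin (fst x)))"
    if "test_function \<psi>" for \<psi>
    by (intro weak_pairing L2_measurable continuous_borel C1_continuous_partial C1_continuous
        test_function_C1 test_function_at_pole assms that)+
  then show ?thesis unfolding has_weak_dtheta_def by auto
qed

text \<open>Only the quotient of \<open>q\<close> by sin is square integrable, so here the sine is
  moved to \<open>q\<close>, and the test function on the right appears without a divisor.\<close>

lemma has_weak_dphi_iff:
  assumes u: "u \<in> L2" and s: "(\<lambda>x. q x / of_real (sin (fst x))) \<in> L2"
  shows "has_weak_dphi u q \<longleftrightarrow> (\<forall>\<psi>. test_function \<psi> \<longrightarrow>
    L2_inner u (\<lambda>x. of_real (d2 \<psi> x / sin (fst x))) = - L2_inner (\<lambda>x. q x / of_real (sin (fst x))) (\<lambda>x. of_real (\<psi> x)))"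
proof -
  have "(LINT x:hemi_dom|lborel. d2 \<psi> x *\<^sub>R u x) = L2_inner u (\<lambda>x. of_real (d2 \<psi> x / sin (fst x)))"
    "(LINT x:hemi_dom|lborel. \<psi> x *\<^sub>R q x) = L2_inner (\<lambda>x. q x / of_real (sin (fst x))) (\<lambda>x. of_real (\<psi> x))"
    if t: "test_function \<psi>" for \<psi>
  proof -
    show "(LINT x:hemi_dom|lborel. d2 \<psi> x *\<^sub>R u x) = L2_inner u (\<lambda>x. of_real (d2 \<psi> x / sin (fst x)))"
      by (intro weak_pairing L2_measurable continuous_borel C1_continuous_partial
        test_function_C1 test_function_at_pole u t)
    define s where "s = (\<lambda>x. q x / of_real (sin (fst x)))"
    have "(LINT x:hemi_dom|lborel. \<psi> x *\<^sub>R q x) = (LINT x:hemi_dom|lborel. (\<psi> x * sin (fst x)) *\<^sub>R s x)"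
    proof (rule set_lebesgue_integral_cong)
      show "\<forall>x. x \<in> hemi_dom \<longrightarrow> \<psi> x *\<^sub>R q x = (\<psi> x * sin (fst x)) *\<^sub>R s x"
      proof (intro allI impI)
        fix x assume x: "x \<in> hemi_dom"
        show "\<psi> x *\<^sub>R q x = (\<psi> x * sin (fst x)) *\<^sub>R s x"
        proof (cases "fst x = 0")
          case True
          then show ?thesis using test_function_at_pole(1)[OF t, of "snd x"] by (cases x) simp
        next
          case False
          then have "sin (fst x) > 0" using x by (intro hemi_sin_pos) auto
          then show ?thesis by (simp add: s_def scaleR_conv_of_real)
        qed
      qed
    qed simp
    also have "\<dots> = L2_inner s (\<lambda>x. of_real ((\<psi> x * sin (fst x)) / sin (fst x)))"
    proof (rule weak_pairing)
      show "s \<in> borel_measurable borel" using s by (simp add: s_def L2_measurable)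
      show "(\<lambda>x. \<psi> x * sin (fst x)) \<in> borel_measurable borel"
        by (intro continuous_borel continuous_intros C1_continuous test_function_C1 t)
    qed simp
    also have "\<dots> = L2_inner s (\<lambda>x. of_real (\<psi> x))"
      unfolding L2_inner_def
    proof (intro Bochner_Integration.integral_cong_AE)
      show "AE x in hemi. s x * cnj (of_real (\<psi> x * sin (fst x) / sin (fst x))) = s x * cnj (of_real (\<psi> x))"
        using AE_hemi_sin by eventually_elim simp
      have [measurable]: "s \<in> borel_measurable borel" "\<psi> \<in> borel_measurable borel"
        using s by (auto simp: s_def L2_measurable intro!: C1_continuous test_function_C1 t)
      show "(\<lambda>x. s x * cnj (of_real (\<psi> x * sin (fst x) / sin (fst x)))) \<in> borel_measurable hemi"
        "(\<lambda>x. s x * cnj (of_real (\<psi> x))) \<in> borel_measurable hemi"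
        unfolding borel_measurable_hemi by measurable
    qed
    finally show "(LINT x:hemi_dom|lborel. \<psi> x *\<^sub>R q x) = L2_inner (\<lambda>x. q x / of_real (sin (fst x))) (\<lambda>x. of_real (\<psi> x))"
      by (simp add: s_def)
  qed
  then show ?thesis unfolding has_weak_dphi_def by auto
qed

lemma C1_product:
  fixes a b a' b' :: "real \<Rightarrow> real"
  assumes a: "\<And>t. (a has_real_derivative a' t) (at t)" "continuous_on UNIV a'"
    and b: "\<And>t. (b has_real_derivative b' t) (at t)" "continuous_on UNIV b'"
  shows "C1 (\<lambda>x. a (fst x) * b (snd x))"
    and "frechet_derivative (\<lambda>x. a (fst x) * b (snd x)) (at x) v
      = a' (fst x) * b (snd x) * fst v + a (fst x) * b' (snd x) * snd v"
proof -
  have ca: "continuous_on UNIV a" and cb: "continuous_on UNIV b"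
    using a(1) b(1) by (auto intro!: continuous_at_imp_continuous_on DERIV_isCont)
  define F where "F x = (a' (fst x) * b (snd x)) *\<^sub>R (fst_blinfun :: (real \<times> real) \<Rightarrow>\<^sub>L real)
    + (a (fst x) * b' (snd x)) *\<^sub>R snd_blinfun" for x
  have F: "((\<lambda>x. a (fst x) * b (snd x)) has_derivative blinfun_apply (F x)) (at x)" for x
  proof -
    have 1: "((\<lambda>x. a (fst x)) has_derivative (\<lambda>h. a' (fst x) * fst h)) (at x)"
      using has_derivative_compose[OF has_derivative_fst[OF has_derivative_ident], of a "\<lambda>h. a' (fst x) * h" x UNIV] a(1)[of "fst x"]
      by (simp add: has_field_derivative_def)
    have 2: "((\<lambda>x. b (snd x)) has_derivative (\<lambda>h. b' (snd x) * snd h)) (at x)"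
      using has_derivative_compose[OF has_derivative_snd[OF has_derivative_ident], of b "\<lambda>h. b' (snd x) * h" x UNIV] b(1)[of "snd x"]
      by (simp add: has_field_derivative_def)
    show ?thesis
      by (rule has_derivative_eq_rhs[OF has_derivative_mult[OF 1 2]])
        (auto simp: F_def blinfun.add_left blinfun.scaleR_left)
  qed
  moreover have "continuous_on UNIV F" unfolding F_def
    by (intro continuous_intros continuous_on_compose2[OF a(2)] continuous_on_compose2[OF b(2)]
        continuous_on_compose2[OF ca] continuous_on_compose2[OF cb]) auto
  ultimately show "C1 (\<lambda>x. a (fst x) * b (snd x))" unfolding C1_def by blast
  show "frechet_derivative (\<lambda>x. a (fst x) * b (snd x)) (at x) v
      = a' (fst x) * b (snd x) * fst v + a (fst x) * b' (snd x) * snd v"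
    by (simp add: F_def blinfun.add_left blinfun.scaleR_left flip: frechet_derivative_at[OF F[of x]])
qed

section \<open>Separated test functions\<close>

definition fmode :: "(real \<Rightarrow> real) \<Rightarrow> int \<Rightarrow> real \<times> real \<Rightarrow> complex" where
  "fmode h k = (\<lambda>x. of_real (h (fst x)) * cis (of_int k * snd x))"

definition test_profile :: "(real \<Rightarrow> real) \<Rightarrow> (real \<Rightarrow> real) \<Rightarrow> bool" where
  "test_profile a a' \<longleftrightarrow> (\<forall>t. (a has_real_derivative a' t) (at t)) \<and> continuous_on UNIV a' \<and>
    (\<exists>\<epsilon>>0. \<forall>\<theta>. \<theta> < \<epsilon> \<or> pi/2 - \<epsilon> < \<theta> \<longrightarrow> a \<theta> = 0)"

lemma periodic_trig: "cos (of_int k * (t + 2 * pi)) = cos (of_int k * t)" "sin (of_int k * (t + 2 * pi)) = sin (of_int k * t)"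
proof -
  have *: "of_int k * (t + 2 * pi) = of_int k * t + 2 * pi * of_int k" by (simp add: algebra_simps)
  show "cos (of_int k * (t + 2 * pi)) = cos (of_int k * t)" "sin (of_int k * (t + 2 * pi)) = sin (of_int k * t)"
    unfolding * by (simp_all add: cos_add sin_add)
qed

lemma test_profile_function:
  assumes a: "test_profile a a'"
  shows "test_function (\<lambda>x. a (fst x) * cos (of_int k * snd x))" "test_function (\<lambda>x. a (fst x) * sin (of_int k * snd x))"
    "frechet_derivative (\<lambda>x. a (fst x) * cos (of_int k * snd x)) (at x) v
      = a' (fst x) * cos (of_int k * snd x) * fst v + a (fst x) * (- of_int k * sin (of_int k * snd x)) * snd v"
    "frechet_derivative (\<lambda>x. a (fst x) * sin (of_int k * snd x)) (at x) v
      = a' (fst x) * sin (of_int k * snd x) * fst v + a (fst x) * (of_int k * cos (of_int k * snd x)) * snd v"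
proof -
  have a': "\<And>t. (a has_real_derivative a' t) (at t)" "continuous_on UNIV a'" using a by (auto simp: test_profile_def)
  have c: "((\<lambda>t. cos (of_int k * t)) has_real_derivative (- of_int k * sin (of_int k * t))) (at t)"
    "((\<lambda>t. sin (of_int k * t)) has_real_derivative (of_int k * cos (of_int k * t))) (at t)" for t :: real
    by (auto intro!: derivative_eq_intros)
  have cc: "continuous_on UNIV (\<lambda>t::real. - of_int k * sin (of_int k * t))"
    "continuous_on UNIV (\<lambda>t::real. of_int k * cos (of_int k * t))" by (intro continuous_intros)+
  note C = C1_product[OF a' c(1) cc(1)] C1_product[OF a' c(2) cc(2)]
  show "test_function (\<lambda>x. a (fst x) * cos (of_int k * snd x))" "test_function (\<lambda>x. a (fst x) * sin (of_int k * snd x))"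
    using C(1) C(3) a unfolding test_function_def test_profile_def fst_conv snd_conv periodic_trig by auto
  show "frechet_derivative (\<lambda>x. a (fst x) * cos (of_int k * snd x)) (at x) v
      = a' (fst x) * cos (of_int k * snd x) * fst v + a (fst x) * (- of_int k * sin (of_int k * snd x)) * snd v"
    by (rule C(2))
  show "frechet_derivative (\<lambda>x. a (fst x) * sin (of_int k * snd x)) (at x) v
      = a' (fst x) * sin (of_int k * snd x) * fst v + a (fst x) * (of_int k * cos (of_int k * snd x)) * snd v"
    by (rule C(4))
qed

lemma fmode_split: "fmode h k = (\<lambda>x. 1 * of_real (h (fst x) * cos (of_int k * snd x)) + \<i> * of_real (h (fst x) * sin (of_int k * snd x)))"
  by (intro ext) (simp add: fmode_def complex_eq_iff)

text \<open>Test functions are real, so the complex mode is assembled from its cosine and sine parts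
  by linearity.\<close>

lemma weak_dtheta_fmode:
  assumes u: "u \<in> L2" "p \<in> L2" and w: "has_weak_dtheta u p" and a: "test_profile a a'"
  shows "L2_inner u (fmode (\<lambda>\<theta>. a' \<theta> / sin \<theta>) k) = - L2_inner p (fmode (\<lambda>\<theta>. a \<theta> / sin \<theta>) k)"
proof -
  let ?c = "\<lambda>x. a (fst x) * cos (of_int k * snd x)" and ?s = "\<lambda>x. a (fst x) * sin (of_int k * snd x)"
  note t = test_profile_function[OF a, of k]
  have eq: "L2_inner u (\<lambda>x. of_real (d1 ?c x / sin (fst x))) = - L2_inner p (\<lambda>x. of_real (?c x / sin (fst x)))"
    "L2_inner u (\<lambda>x. of_real (d1 ?s x / sin (fst x))) = - L2_inner p (\<lambda>x. of_real (?s x / sin (fst x)))"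
    using w t(1,2) unfolding has_weak_dtheta_iff[OF u] by auto
  note L = test_function_L2[OF t(1)] test_function_L2[OF t(2)]
  have "L2_inner u (fmode (\<lambda>\<theta>. a' \<theta> / sin \<theta>) k) = L2_inner u (\<lambda>x. 1 * of_real (d1 ?c x / sin (fst x)) + \<i> * of_real (d1 ?s x / sin (fst x)))"
    unfolding fmode_split t(3,4) by simp
  also have "\<dots> = - L2_inner p (\<lambda>x. 1 * of_real (?c x / sin (fst x)) + \<i> * of_real (?s x / sin (fst x)))"
    by (subst (1 2) L2.right) (use L u eq in auto)
  also have "\<dots> = - L2_inner p (fmode (\<lambda>\<theta>. a \<theta> / sin \<theta>) k)"
    unfolding fmode_split by simp
  finally show ?thesis .
qed

text \<open>The factor on the left is the conjugate of \<open>\<i> * k\<close>, since the inner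
  product is antilinear in its second argument. For \<open>k\<close> not 0 the identity trades a
  division by sin for the \<phi>-derivative, which is how the singularity at the pole is handled in
  \<open>green\<close>.\<close>

lemma weak_dphi_fmode:
  assumes u: "u \<in> L2" "s \<in> L2" and w: "has_weak_dphi u q" and s: "s = (\<lambda>x. q x / of_real (sin (fst x)))"
    and a: "test_profile a a'"
  shows "L2_inner u (fmode (\<lambda>\<theta>. a \<theta> / sin \<theta>) k) * (- \<i> * of_int k) = - L2_inner s (fmode a k)"
proof -
  let ?c = "\<lambda>x. a (fst x) * cos (of_int k * snd x)" and ?s = "\<lambda>x. a (fst x) * sin (of_int k * snd x)"
  note t = test_profile_function[OF a, of k]
  have eq: "L2_inner u (\<lambda>x. of_real (d2 ?c x / sin (fst x))) = - L2_inner s (\<lambda>x. of_real (?c x))"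
    "L2_inner u (\<lambda>x. of_real (d2 ?s x / sin (fst x))) = - L2_inner s (\<lambda>x. of_real (?s x))"
    using w t(1,2) u unfolding s by (auto simp: has_weak_dphi_iff)
  note L = test_function_L2[OF t(1)] test_function_L2[OF t(2)]
  have "fmode (\<lambda>\<theta>. a \<theta> / sin \<theta>) k \<in> L2"
    using L2.comb_mem[OF L(1) L(4), of 1 \<i>] unfolding fmode_split by simp
  then have "L2_inner u (fmode (\<lambda>\<theta>. a \<theta> / sin \<theta>) k) * (- \<i> * of_int k) = L2_inner u (\<lambda>x. \<i> * of_int k * fmode (\<lambda>\<theta>. a \<theta> / sin \<theta>) k x)"
    using u by (subst L2.scale_right) auto
  also have "\<dots> = L2_inner u (\<lambda>x. 1 * of_real (d2 ?c x / sin (fst x)) + \<i> * of_real (d2 ?s x / sin (fst x)))"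
    unfolding fmode_split t(3,4) by (rule arg_cong[where f="L2_inner u"]) (auto simp: field_simps)
  also have "\<dots> = - L2_inner s (\<lambda>x. 1 * of_real (?c x) + \<i> * of_real (?s x))"
    by (subst (1 2) L2.right) (use L u eq in auto)
  also have "\<dots> = - L2_inner s (fmode a k)"
    unfolding fmode_split by simp
  finally show ?thesis .
qed

section \<open>Cutoffs and Green's identity\<close>

text \<open>Only the kink at 1 needs an argument: there the difference quotient is at most
  \<open>\<bar>h\<bar> ^ (n + 1)\<close>. The cases \<open>n = 1\<close> and \<open>n = 0\<close>
  give \<open>ramp\<close> its two continuous derivatives.\<close>

lemma max_power_deriv:
  "((\<lambda>x::real. max 0 (x - 1) ^ (n + 2)) has_real_derivative (real (n + 2) * max 0 (x - 1) ^ (n + 1))) (at x)"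
proof -
  consider "x > 1" | "x < 1" | "x = 1" by linarith
  then show ?thesis
  proof cases
    case 1
    have "((\<lambda>x. (x - 1) ^ (n + 2)) has_real_derivative (real (n + 2) * max 0 (x - 1) ^ (n + 1))) (at x)"
      by (rule DERIV_cong[OF DERIV_power[of "\<lambda>x. x - 1" 1]]) (use 1 in \<open>auto intro!: derivative_eq_intros simp: max_def\<close>)
    then show ?thesis
      by (rule has_field_derivative_transform_within_open[of _ _ _ "{1<..}"]) (use 1 in auto)
  next
    case 2
    have "((\<lambda>x. 0) has_real_derivative (real (n + 2) * max 0 (x - 1) ^ (n + 1))) (at x)"
      using 2 by (auto simp: max_def)
    then show ?thesis
      by (rule has_field_derivative_transform_within_open[of _ _ _ "{..<1}"]) (use 2 in auto)
  next
    case 3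
    have "((\<lambda>h. max 0 h ^ (n + 2) / h) \<longlongrightarrow> 0) (at (0::real))"
    proof (rule Lim_null_comparison)
      have *: "max 0 h ^ (n + 2) \<le> \<bar>h\<bar> ^ (n + 1) * \<bar>h\<bar>" for h :: real
        using power_mono[of "max 0 h" "\<bar>h\<bar>" "n + 2"] by (simp add: algebra_simps)
      show "\<forall>\<^sub>F h in at (0::real). norm (max 0 h ^ (n + 2) / h) \<le> \<bar>h\<bar> ^ (n + 1)"
        unfolding eventually_at_filter
        by (rule always_eventually) (use * in \<open>auto simp: abs_divide divide_le_eq\<close>)
      have "((\<lambda>h::real. \<bar>h\<bar> ^ (n + 1)) \<longlongrightarrow> \<bar>0\<bar> ^ (n + 1)) (at 0)" by (intro tendsto_intros)
      then show "((\<lambda>h::real. \<bar>h\<bar> ^ (n + 1)) \<longlongrightarrow> 0) (at 0)" by simp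
    qed
    then show ?thesis unfolding DERIV_def using 3 by simp
  qed
qed

text \<open>A twice continuously differentiable step with \<open>x * ramp1 x\<close> bounded, so that the cutoffs \<open>cut n\<close> below
  converge to 1 while \<open>bump \<theta> * cut1 n \<theta>\<close> stays bounded.\<close>

definition ramp :: "real \<Rightarrow> real" where "ramp x = max 0 (x - 1) ^ 3 / (1 + max 0 (x - 1) ^ 3)"
definition ramp1 :: "real \<Rightarrow> real" where "ramp1 x = 3 * max 0 (x - 1) ^ 2 / (1 + max 0 (x - 1) ^ 3) ^ 2"
definition ramp2 :: "real \<Rightarrow> real" where
  "ramp2 x = (6 * max 0 (x - 1) * (1 + max 0 (x - 1) ^ 3) ^ 2
    - 3 * max 0 (x - 1) ^ 2 * (2 * (1 + max 0 (x - 1) ^ 3) * (3 * max 0 (x - 1) ^ 2))) / ((1 + max 0 (x - 1) ^ 3) ^ 2) ^ 2"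

lemma ramp_den_pos: "0 < 1 + max 0 (x - 1 :: real) ^ 3"
  by (intro add_pos_nonneg) auto

lemma ramp_deriv: "(ramp has_real_derivative ramp1 x) (at x)"
proof -
  have w: "((\<lambda>x::real. max 0 (x - 1) ^ 3) has_real_derivative (3 * max 0 (x - 1) ^ 2)) (at x)"
    using max_power_deriv[of 1 x] by (simp add: numeral_eq_Suc)
  note p = ramp_den_pos[of x]
  show ?thesis unfolding ramp_def[abs_def] ramp1_def
    by (rule DERIV_cong[OF DERIV_divide[OF w DERIV_add[OF DERIV_const w]]])
      (use p in \<open>simp_all add: power2_eq_square algebra_simps\<close>)
qed

lemma ramp1_deriv: "(ramp1 has_real_derivative ramp2 x) (at x)"
proof -
  have w: "((\<lambda>x::real. max 0 (x - 1) ^ 3) has_real_derivative (3 * max 0 (x - 1) ^ 2)) (at x)"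
    using max_power_deriv[of 1 x] by (simp add: numeral_eq_Suc)
  have w2: "((\<lambda>x::real. max 0 (x - 1) ^ 2) has_real_derivative (2 * max 0 (x - 1))) (at x)"
    using max_power_deriv[of 0 x] by (simp add: numeral_eq_Suc)
  have 1: "((\<lambda>x::real. 3 * max 0 (x - 1) ^ 2) has_real_derivative (6 * max 0 (x - 1))) (at x)"
    by (rule DERIV_cong[OF DERIV_cmult[OF w2]]) simp
  have 2: "((\<lambda>x::real. (1 + max 0 (x - 1) ^ 3) ^ 2) has_real_derivative (2 * (1 + max 0 (x - 1) ^ 3) * (3 * max 0 (x - 1) ^ 2))) (at x)"
    by (rule DERIV_cong[OF DERIV_power[OF DERIV_add[OF DERIV_const w]]]) simp
  note p = ramp_den_pos[of x]
  show ?thesis unfolding ramp1_def[abs_def] ramp2_def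
    by (rule DERIV_cong[OF DERIV_divide[OF 1 2]]) (use p in \<open>simp_all add: power2_eq_square\<close>)
qed

lemma ramp2_cont: "continuous_on UNIV ramp2"
  unfolding ramp2_def[abs_def] using ramp_den_pos
  by (intro continuous_intros) (metis less_irrefl power_not_zero)

lemma ramp_bounds: "0 \<le> ramp x" "ramp x \<le> 1" "0 \<le> ramp1 x" "x * ramp1 x \<le> 6" "x \<le> 1 \<Longrightarrow> ramp x = 0" "x \<le> 1 \<Longrightarrow> ramp1 x = 0"
proof -
  note p = ramp_den_pos[of x]
  show "0 \<le> ramp x" "ramp x \<le> 1" using p by (auto simp: ramp_def)
  show "0 \<le> ramp1 x" by (simp add: ramp1_def)
  show "x \<le> 1 \<Longrightarrow> ramp x = 0" "x \<le> 1 \<Longrightarrow> ramp1 x = 0" by (auto simp: ramp_def ramp1_def max_def)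
  show "x * ramp1 x \<le> 6"
  proof (cases "x \<le> 1")
    case True
    then show ?thesis by (simp add: ramp1_def max_def)
  next
    case False
    define y where "y = x - 1"
    have y: "y > 0" "max 0 (x - 1) = y" "x = y + 1" using False by (auto simp: y_def)
    have "y^2 \<le> 1 + y^3"
    proof (cases "y \<le> 1")
      case True
      then have "y^2 \<le> 1" using y by (simp add: power_le_one)
      then show ?thesis using y zero_less_power[of y 3] by linarith
    next
      case False
      then have "y^2 \<le> y^3" by (intro power_increasing) auto
      then show ?thesis by linarith
    qed
    then have "(y + 1) * (3 * y^2) \<le> 6 * (1 + y^3)" by (simp add: algebra_simps power2_eq_square power3_eq_cube)
    also have "\<dots> \<le> 6 * (1 + y^3)^2" using y self_le_power[of "1 + y^3" 2] by simp
    finally show ?thesis using y p by (simp add: ramp1_def divide_le_eq)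
  qed
qed

lemma ramp_decay:
  assumes x: "x \<ge> 2"
  shows "x * ramp1 x \<le> 12 / x" "1 - ramp x \<le> 2 / x"
proof -
  define y where "y = x - 1"
  have y: "y \<ge> 1" "max 0 (x - 1) = y" "x = y + 1" "x \<le> 2 * y" using x by (auto simp: y_def)
  have y3: "y \<le> y^3" "y^2 \<le> y^3" using y(1) power_increasing[of 1 3 y] power_increasing[of 2 3 y] by auto
  have p: "0 < 1 + y^3" "0 < y^3" using y by (auto intro: add_pos_pos)
  have "(y + 1) * (3 * y^2) \<le> 6 * (1 + y^3)" using y3 by (simp add: algebra_simps power2_eq_square power3_eq_cube)
  then have "x * ramp1 x \<le> 6 * (1 + y^3) / (1 + y^3)^2"
    unfolding ramp1_def y(2) using y p by (simp add: divide_right_mono)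
  also have "6 * D / D^2 = 6 / D" if "D > 0" for D :: real using that by (simp add: power2_eq_square)
  from this[OF p(1)] have "6 * (1 + y^3) / (1 + y^3)^2 = 6 / (1 + y^3)" .
  also have "\<dots> \<le> 6 / (x / 2)" using p y y3 by (intro divide_left_mono) auto
  finally show "x * ramp1 x \<le> 12 / x" by simp
  have "1 - ramp x = 1 / (1 + y^3)" unfolding ramp_def y(2)
  proof -
    have "1 - z / (1 + z) = 1 / (1 + z)" if "0 < 1 + z" for z :: real using that by (simp add: field_simps)
    then show "1 - y^3 / (1 + y^3) = 1 / (1 + y^3)" using p by blast
  qed
  also have "\<dots> \<le> 1 / (x / 2)" using p y y3 by (intro divide_left_mono) auto
  finally show "1 - ramp x \<le> 2 / x" by simp
qed

lemma ramp_lim: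
  assumes x: "x > 0"
  shows "(\<lambda>n. real n * x * ramp1 (real n * x)) \<longlonglongrightarrow> 0" "(\<lambda>n. ramp (real n * x)) \<longlonglongrightarrow> 1"
proof -
  have ev: "\<forall>\<^sub>F n in sequentially. real n * x \<ge> 2"
    using x by (intro eventually_sequentiallyI[of "nat \<lceil>2 / x\<rceil>"]) (simp add: field_simps nat_ceiling_le_eq)
  have l: "(\<lambda>n. c / (real n * x)) \<longlonglongrightarrow> 0" for c
    using tendsto_mult[OF tendsto_const[of "c / x"] lim_1_over_n] by (simp add: field_simps)
  show "(\<lambda>n. real n * x * ramp1 (real n * x)) \<longlonglongrightarrow> 0"
  proof (rule tendsto_sandwich[OF _ _ tendsto_const l[of 12]])
    show "\<forall>\<^sub>F n in sequentially. 0 \<le> real n * x * ramp1 (real n * x)" using x ramp_bounds(3) by simp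
    show "\<forall>\<^sub>F n in sequentially. real n * x * ramp1 (real n * x) \<le> 12 / (real n * x)"
      using ev by eventually_elim (rule ramp_decay)
  qed
  have "(\<lambda>n. 1 - ramp (real n * x)) \<longlonglongrightarrow> 0"
  proof (rule tendsto_sandwich[OF _ _ tendsto_const l[of 2]])
    show "\<forall>\<^sub>F n in sequentially. 0 \<le> 1 - ramp (real n * x)" using ramp_bounds(2) by simp
    show "\<forall>\<^sub>F n in sequentially. 1 - ramp (real n * x) \<le> 2 / (real n * x)"
      using ev by eventually_elim (rule ramp_decay)
  qed
  from tendsto_diff[OF tendsto_const[of 1] this] show "(\<lambda>n. ramp (real n * x)) \<longlonglongrightarrow> 1" by simp
qed

text \<open>The product of the distances to the pole and to the equator, since test profiles must
  vanish near both. It dominates \<open>sin \<theta> * cos \<theta>\<close> on the open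
  interval.\<close>

definition bump :: "real \<Rightarrow> real" where "bump \<theta> = \<theta> * (pi/2 - \<theta>)"
definition cut :: "nat \<Rightarrow> real \<Rightarrow> real" where "cut n \<theta> = ramp (real n * bump \<theta>)"
definition cut1 :: "nat \<Rightarrow> real \<Rightarrow> real" where
  "cut1 n \<theta> = ramp1 (real n * bump \<theta>) * (real n * (pi/2 - 2 * \<theta>))"
definition cut2 :: "nat \<Rightarrow> real \<Rightarrow> real" where
  "cut2 n \<theta> = ramp2 (real n * bump \<theta>) * (real n * (pi/2 - 2 * \<theta>))\<^sup>2 - 2 * real n * ramp1 (real n * bump \<theta>)"

lemma bump_deriv: "((\<lambda>\<theta>. real n * bump \<theta>) has_real_derivative real n * (pi/2 - 2 * \<theta>)) (at \<theta>)"
  unfolding bump_def by (auto intro!: derivative_eq_intros simp: algebra_simps)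

lemma bump_pos: "0 < \<theta> \<Longrightarrow> \<theta> < pi/2 \<Longrightarrow> 0 < bump \<theta>"
  by (simp add: bump_def)

lemma cut_deriv: "(cut n has_real_derivative cut1 n \<theta>) (at \<theta>)"
  unfolding cut_def[abs_def] cut1_def by (rule DERIV_chain2[OF ramp_deriv bump_deriv])

lemma cut1_deriv: "(cut1 n has_real_derivative cut2 n \<theta>) (at \<theta>)"
proof -
  have "((\<lambda>\<theta>. real n * (pi/2 - 2 * \<theta>)) has_real_derivative - 2 * real n) (at \<theta>)"
    by (auto intro!: derivative_eq_intros)
  from DERIV_mult[OF DERIV_chain2[OF ramp1_deriv bump_deriv] this]
  show ?thesis unfolding cut1_def[abs_def] cut2_def
    by (rule DERIV_cong) (simp add: power2_eq_square algebra_simps)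
qed

lemma bump_cont: "continuous_on UNIV bump"
  unfolding bump_def[abs_def] by (intro continuous_intros)

lemma DERIV_continuous: "(\<And>x. (f has_real_derivative f' x) (at x)) \<Longrightarrow> continuous_on UNIV f"
  by (auto intro!: continuous_at_imp_continuous_on DERIV_isCont)

lemma cut2_cont: "continuous_on UNIV (cut2 n)"
  unfolding cut2_def[abs_def]
  by (intro continuous_intros continuous_on_compose2[OF ramp2_cont] continuous_on_compose2[OF DERIV_continuous[OF ramp1_deriv]] bump_cont) auto

lemma cut_zero: "\<exists>\<epsilon>>0. \<forall>\<theta>. \<theta> < \<epsilon> \<or> pi/2 - \<epsilon> < \<theta> \<longrightarrow> cut n \<theta> = 0 \<and> cut1 n \<theta> = 0"
\<comment> \<open>If one of the two distances is below this number and the other at most 2, then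
  \<open>real n * bump \<theta>\<close> is at most \<open>n / (n + 1)\<close>, where
  \<open>ramp\<close> still vanishes.\<close>
proof (intro exI[of _ "1 / (2 * (real n + 1))"] conjI allI impI)
  let ?\<epsilon> = "1 / (2 * (real n + 1))"
  fix \<theta> assume \<theta>: "\<theta> < ?\<epsilon> \<or> pi/2 - ?\<epsilon> < \<theta>"
  have small: "real n * (a * b) \<le> 1" if "a < ?\<epsilon>" "a + b = pi/2" for a b
  proof (cases "a \<le> 0")
    case True
    then have "a * b \<le> 0" using that pi_gt_zero by (intro mult_nonpos_nonneg) linarith+
    then show ?thesis using mult_nonneg_nonpos[of "real n" "a * b"] by linarith
  next
    case False
    show ?thesis
    proof (cases "b \<le> 0")
      case True
      then have "a * b \<le> 0" using False by (intro mult_nonneg_nonpos) auto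
      then show ?thesis using mult_nonneg_nonpos[of "real n" "a * b"] by linarith
    next
      case b: False
      have "b \<le> 2" using that False pi_less_4 by linarith
      then have "a * b \<le> ?\<epsilon> * 2" using that False b by (intro mult_mono) auto
      then have "real n * (a * b) \<le> real n * (?\<epsilon> * 2)" by (intro mult_left_mono) auto
      also have "\<dots> \<le> 1" by (simp add: field_simps)
      finally show ?thesis .
    qed
  qed
  have "real n * bump \<theta> \<le> 1"
    using \<theta> small[of \<theta> "pi/2 - \<theta>"] small[of "pi/2 - \<theta>" \<theta>] by (auto simp: bump_def mult.commute)
  then show "cut n \<theta> = 0" "cut1 n \<theta> = 0" by (simp_all add: cut_def cut1_def ramp_bounds)
qed simp

lemma test_profile_cut:
  assumes "\<And>t. (a has_real_derivative a' t) (at t)" "continuous_on UNIV a'"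
  shows "test_profile (\<lambda>\<theta>. cut n \<theta> * a \<theta>) (\<lambda>\<theta>. cut1 n \<theta> * a \<theta> + cut n \<theta> * a' \<theta>)"
proof -
  obtain \<epsilon> where "\<epsilon> > 0" "\<And>\<theta>. \<theta> < \<epsilon> \<or> pi/2 - \<epsilon> < \<theta> \<Longrightarrow> cut n \<theta> = 0" using cut_zero[of n] by blast
  moreover have "continuous_on UNIV (\<lambda>\<theta>. cut1 n \<theta> * a \<theta> + cut n \<theta> * a' \<theta>)"
    by (intro continuous_intros DERIV_continuous[OF cut1_deriv] DERIV_continuous[OF cut_deriv] assms DERIV_continuous[OF assms(1)])
  moreover have "((\<lambda>\<theta>. cut n \<theta> * a \<theta>) has_real_derivative (cut1 n t * a t + cut n t * a' t)) (at t)" for t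
    by (rule DERIV_cong[OF DERIV_mult[OF cut_deriv assms(1)]]) simp
  ultimately show ?thesis unfolding test_profile_def by (metis mult_zero_left)
qed

lemma test_profile_cut_deriv:
  assumes a: "\<And>t. (a has_real_derivative a' t) (at t)" "\<And>t. (a' has_real_derivative a'' t) (at t)" "continuous_on UNIV a''"
  shows "test_profile (\<lambda>\<theta>. cut1 n \<theta> * a \<theta> + cut n \<theta> * a' \<theta>)
    (\<lambda>\<theta>. cut2 n \<theta> * a \<theta> + 2 * cut1 n \<theta> * a' \<theta> + cut n \<theta> * a'' \<theta>)"
proof -
  obtain \<epsilon> where "\<epsilon> > 0" "\<And>\<theta>. \<theta> < \<epsilon> \<or> pi/2 - \<epsilon> < \<theta> \<Longrightarrow> cut n \<theta> = 0 \<and> cut1 n \<theta> = 0" using cut_zero[of n] by blast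
  moreover have "continuous_on UNIV (\<lambda>\<theta>. cut2 n \<theta> * a \<theta> + 2 * cut1 n \<theta> * a' \<theta> + cut n \<theta> * a'' \<theta>)"
    by (intro continuous_intros cut2_cont DERIV_continuous[OF cut1_deriv] DERIV_continuous[OF cut_deriv] assms
        DERIV_continuous[OF a(1)] DERIV_continuous[OF a(2)])
  moreover have "((\<lambda>\<theta>. cut1 n \<theta> * a \<theta> + cut n \<theta> * a' \<theta>) has_real_derivative
      (cut2 n t * a t + 2 * cut1 n t * a' t + cut n t * a'' t)) (at t)" for t
    by (rule DERIV_cong[OF DERIV_add[OF DERIV_mult[OF cut1_deriv a(1)] DERIV_mult[OF cut_deriv a(2)]]]) simp
  ultimately show ?thesis unfolding test_profile_def by (metis add.right_neutral mult_zero_left)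
qed

lemma cut_bounds:
  assumes "0 < \<theta>" "\<theta> < pi/2"
  shows "\<bar>cut n \<theta>\<bar> \<le> 1" "\<bar>cut1 n \<theta>\<bar> * bump \<theta> \<le> 12" "(\<lambda>n. cut n \<theta>) \<longlonglongrightarrow> 1" "(\<lambda>n. cut1 n \<theta>) \<longlonglongrightarrow> 0"
proof -
  note b = bump_pos[OF assms]
  show "\<bar>cut n \<theta>\<bar> \<le> 1" using ramp_bounds(1,2) by (simp add: cut_def abs_le_iff order_trans[of "- ramp _" 0 1])
  have d: "\<bar>pi/2 - 2 * \<theta>\<bar> \<le> 2" using assms pi_less_4 by (auto simp: abs_le_iff)
  have "\<bar>cut1 n \<theta>\<bar> * bump \<theta> = (real n * bump \<theta> * ramp1 (real n * bump \<theta>)) * \<bar>pi/2 - 2 * \<theta>\<bar>"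
    using ramp_bounds(3) by (simp add: cut1_def abs_mult)
  \<comment> \<open>The 6 bounds \<open>x * ramp1 x\<close>, and the 2 bounds the derivative of
    \<open>bump\<close>.\<close>
  also have "\<dots> \<le> 6 * 2" using ramp_bounds(3,4) b d by (intro mult_mono) auto
  finally show "\<bar>cut1 n \<theta>\<bar> * bump \<theta> \<le> 12" by simp
  show "(\<lambda>n. cut n \<theta>) \<longlonglongrightarrow> 1" unfolding cut_def by (rule ramp_lim[OF b])
  have "(\<lambda>n. (real n * bump \<theta> * ramp1 (real n * bump \<theta>)) * ((pi/2 - 2 * \<theta>) / bump \<theta>)) \<longlonglongrightarrow> 0 * ((pi/2 - 2 * \<theta>) / bump \<theta>)"
    by (intro tendsto_intros ramp_lim b)
  then show "(\<lambda>n. cut1 n \<theta>) \<longlonglongrightarrow> 0" using b by (simp add: cut1_def mult_ac)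
qed

lemma fmode_borel: "h \<in> borel_measurable borel \<Longrightarrow> fmode h k \<in> borel_measurable borel"
proof -
  assume [measurable]: "h \<in> borel_measurable borel"
  have [measurable]: "cis \<in> borel_measurable borel"
    by (intro borel_measurable_continuous_onI continuous_intros)
  show ?thesis unfolding fmode_def by measurable
qed

lemma fmode_L2:
  assumes "h \<in> borel_measurable borel" "\<And>\<theta>. \<lbrakk>0 < \<theta>; \<theta> < pi/2\<rbrakk> \<Longrightarrow> \<bar>h \<theta>\<bar> \<le> K"
  shows "fmode h k \<in> L2"
  using assms by (intro L2_bounded[of _ K] fmode_borel) (auto simp: fmode_def norm_mult)

lemma continuous_bounded_interval:
  fixes h :: "real \<Rightarrow> real"
  assumes "continuous_on UNIV h"
  obtains K where "K > 0" "\<And>\<theta>. \<lbrakk>0 \<le> \<theta>; \<theta> \<le> pi/2\<rbrakk> \<Longrightarrow> \<bar>h \<theta>\<bar> \<le> K"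
proof -
  have "bounded (h ` {0..pi/2})"
    by (intro compact_imp_bounded compact_continuous_image continuous_on_subset[OF assms]) auto
  then show ?thesis using that unfolding bounded_pos by auto
qed

lemma fmode_L2_cont: "continuous_on UNIV h \<Longrightarrow> fmode h k \<in> L2"
  using continuous_bounded_interval[of h] by (metis fmode_L2 less_imp_le continuous_borel borel_measurable_continuous_onI)

lemma L2_inner_fmode_tendsto:
  assumes u: "u \<in> L2" and H: "\<And>n. H n \<in> borel_measurable borel" and h: "h \<in> borel_measurable borel"
    and K: "\<And>n \<theta>. \<lbrakk>0 < \<theta>; \<theta> < pi/2\<rbrakk> \<Longrightarrow> \<bar>H n \<theta>\<bar> \<le> K"
    and lim: "\<And>\<theta>. \<lbrakk>0 < \<theta>; \<theta> < pi/2\<rbrakk> \<Longrightarrow> (\<lambda>n. H n \<theta>) \<longlonglongrightarrow> h \<theta>"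
  shows "(\<lambda>n. L2_inner u (fmode (H n) k)) \<longlonglongrightarrow> L2_inner u (fmode h k)"
  unfolding L2_inner_def
proof (rule integral_dominated_convergence[where w="\<lambda>x. K * cmod (u x)"])
  note [measurable] = L2_measurable[OF u] fmode_borel[OF h] fmode_borel[OF H]
  show "(\<lambda>x. u x * cnj (fmode h k x)) \<in> borel_measurable hemi"
    "\<And>n. (\<lambda>x. u x * cnj (fmode (H n) k x)) \<in> borel_measurable hemi"
    unfolding borel_measurable_hemi by measurable
  have "integrable hemi (\<lambda>x. u x * 1)"
    by (rule sqi_mult_integrable) (use u in \<open>auto simp: L2_eq sqi_def\<close>)
  then show "integrable hemi (\<lambda>x. K * cmod (u x))" by simp
  show "AE x in hemi. (\<lambda>n. u x * cnj (fmode (H n) k x)) \<longlonglongrightarrow> u x * cnj (fmode h k x)"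
    unfolding fmode_def by (intro AE_hemiI tendsto_intros) (use lim in auto)
  show "AE x in hemi. norm (u x * cnj (fmode (H n) k x)) \<le> K * cmod (u x)" for n
    by (rule AE_hemiI) (use K in \<open>auto simp: fmode_def norm_mult mult.commute[of K] intro!: mult_left_mono\<close>)
qed

lemma LIMSEQ_eqI:
  fixes a b :: "'a::t2_space"
  shows "\<lbrakk>\<And>n. f n = g n; f \<longlonglongrightarrow> a; g \<longlonglongrightarrow> b\<rbrakk> \<Longrightarrow> a = b"
  using LIMSEQ_unique by (metis (no_types, lifting) ext)

text \<open>The latitudinal factor \<open>f\<close> of an eigenfunction of order \<open>m\<close>.
  The shape \<open>cos t * c t\<close> of its derivative is the Neumann condition at the equator,
  \<open>g\<close> is the derivative of \<open>sin t * f' t\<close>, and \<open>ode\<close> is the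
  associated Legendre equation. Regularity at the pole is encoded by continuous quotients:
  \<open>fs\<close> is \<open>f\<close> divided by sin when \<open>m\<close> is not 0, and
  \<open>c0\<close> is \<open>c\<close> divided by sin when \<open>m\<close> is 0.\<close>

locale profile =
  fixes m :: int and lam :: real and f c g g' fs c0 :: "real \<Rightarrow> real"
  assumes f_deriv: "\<And>t. (f has_real_derivative cos t * c t) (at t)"
    and a_deriv: "\<And>t. ((\<lambda>t. sin t * (cos t * c t)) has_real_derivative g t) (at t)"
    and g_deriv: "\<And>t. (g has_real_derivative g' t) (at t)"
    and g'_cont: "continuous_on UNIV g'"
    and c_cont: "continuous_on UNIV c" and fs_cont: "continuous_on UNIV fs" and c0_cont: "continuous_on UNIV c0"
    and ode: "\<And>t. sin t * g t = (of_int m ^ 2 - lam * (sin t)\<^sup>2) * f t"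
    and fs: "m \<noteq> 0 \<Longrightarrow> f t = sin t * fs t"
    and c0: "m = 0 \<Longrightarrow> c t = sin t * c0 t"
begin

abbreviation a where "a t \<equiv> sin t * (cos t * c t)"

lemma f_cont: "continuous_on UNIV f" and g_cont: "continuous_on UNIV g"
  using DERIV_continuous[OF f_deriv] DERIV_continuous[OF g_deriv] .

lemma sin_cos_le_bump: "\<lbrakk>0 < \<theta>; \<theta> < pi/2\<rbrakk> \<Longrightarrow> \<bar>sin \<theta> * cos \<theta>\<bar> \<le> bump \<theta>"
proof -
  assume t: "0 < \<theta>" "\<theta> < pi/2"
  have "0 \<le> sin \<theta>" "0 \<le> cos \<theta>" using t by (auto intro!: sin_ge_zero cos_ge_zero)
  moreover have "sin \<theta> \<le> \<theta>" "cos \<theta> \<le> pi/2 - \<theta>"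
    using sin_x_le_x[of \<theta>] sin_x_le_x[of "pi/2 - \<theta>"] t by (auto simp: sin_diff)
  ultimately show ?thesis using t by (simp add: abs_mult bump_def mult_mono)
qed

text \<open>The derivative of a cutoff is unbounded in \<open>n\<close> near the pole and near the
  equator. The factor sin compensates at the pole, and the factor cos, which is the Neumann
  condition, at the equator.\<close>

lemma cut1_bound:
  assumes h: "continuous_on UNIV h"
  obtains K where "\<And>n \<theta>. \<lbrakk>0 < \<theta>; \<theta> < pi/2\<rbrakk> \<Longrightarrow> \<bar>cut1 n \<theta> * (sin \<theta> * (cos \<theta> * h \<theta>))\<bar> \<le> K"
proof -
  obtain K where K: "K > 0" "\<And>\<theta>. \<lbrakk>0 \<le> \<theta>; \<theta> \<le> pi/2\<rbrakk> \<Longrightarrow> \<bar>h \<theta>\<bar> \<le> K"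
    using continuous_bounded_interval[OF h] by blast
  have "\<bar>cut1 n \<theta> * (sin \<theta> * (cos \<theta> * h \<theta>))\<bar> \<le> 12 * K" if t: "0 < \<theta>" "\<theta> < pi/2" for n \<theta>
  proof -
    have "\<bar>cut1 n \<theta> * (sin \<theta> * (cos \<theta> * h \<theta>))\<bar> = \<bar>cut1 n \<theta>\<bar> * \<bar>sin \<theta> * cos \<theta>\<bar> * \<bar>h \<theta>\<bar>"
      by (simp add: abs_mult)
    also have "\<dots> \<le> \<bar>cut1 n \<theta>\<bar> * bump \<theta> * K"
      using K t bump_pos[OF t] sin_cos_le_bump[OF t] by (intro mult_mono mult_left_mono) auto
    also have "\<dots> \<le> 12 * K" using K cut_bounds(2)[OF t] by (intro mult_right_mono) auto
    finally show ?thesis .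
  qed
  then show ?thesis using that by blast
qed

lemma cut_add_bound:
  assumes h: "continuous_on UNIV h" "continuous_on UNIV h2"
  obtains K where "\<And>n \<theta>. \<lbrakk>0 < \<theta>; \<theta> < pi/2\<rbrakk> \<Longrightarrow> \<bar>cut1 n \<theta> * (sin \<theta> * (cos \<theta> * h \<theta>)) + cut n \<theta> * h2 \<theta>\<bar> \<le> K"
proof -
  obtain K1 where K1: "\<And>n \<theta>. \<lbrakk>0 < \<theta>; \<theta> < pi/2\<rbrakk> \<Longrightarrow> \<bar>cut1 n \<theta> * (sin \<theta> * (cos \<theta> * h \<theta>))\<bar> \<le> K1"
    using cut1_bound[OF h(1)] by blast
  obtain K2 where K2: "K2 > 0" "\<And>\<theta>. \<lbrakk>0 \<le> \<theta>; \<theta> \<le> pi/2\<rbrakk> \<Longrightarrow> \<bar>h2 \<theta>\<bar> \<le> K2"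
    using continuous_bounded_interval[OF h(2)] by blast
  have "\<bar>cut1 n \<theta> * (sin \<theta> * (cos \<theta> * h \<theta>)) + cut n \<theta> * h2 \<theta>\<bar> \<le> K1 + 1 * K2" if t: "0 < \<theta>" "\<theta> < pi/2" for n \<theta>
  proof (rule order_trans[OF abs_triangle_ineq add_mono])
    show "\<bar>cut n \<theta> * h2 \<theta>\<bar> \<le> 1 * K2" unfolding abs_mult
      using cut_bounds(1)[OF t] K2 t by (intro mult_mono) auto
  qed (rule K1[OF t])
  then show ?thesis using that by blast
qed

lemma cut_borel: "continuous_on UNIV h \<Longrightarrow> (\<lambda>\<theta>. cut n \<theta> * h \<theta>) \<in> borel_measurable borel"
  "continuous_on UNIV h \<Longrightarrow> (\<lambda>\<theta>. cut1 n \<theta> * h \<theta>) \<in> borel_measurable borel"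
  by (auto intro!: borel_measurable_continuous_onI continuous_intros DERIV_continuous[OF cut1_deriv] DERIV_continuous[OF cut_deriv])

lemma L2_cut_tendsto:
  assumes u: "u \<in> L2" and h: "continuous_on UNIV h"
  shows "(\<lambda>n. L2_inner u (fmode (\<lambda>\<theta>. cut n \<theta> * h \<theta>) k)) \<longlonglongrightarrow> L2_inner u (fmode h k)"
proof -
  obtain K where K: "K > 0" "\<And>\<theta>. \<lbrakk>0 \<le> \<theta>; \<theta> \<le> pi/2\<rbrakk> \<Longrightarrow> \<bar>h \<theta>\<bar> \<le> K"
    using continuous_bounded_interval[OF h] by blast
  show ?thesis
  proof (rule L2_inner_fmode_tendsto[OF u])
    show "\<bar>cut n \<theta> * h \<theta>\<bar> \<le> 1 * K" if t: "0 < \<theta>" "\<theta> < pi/2" for n \<theta>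
      unfolding abs_mult using cut_bounds(1)[OF t] K t by (intro mult_mono) auto
    show "(\<lambda>n. cut n \<theta> * h \<theta>) \<longlonglongrightarrow> h \<theta>" if t: "0 < \<theta>" "\<theta> < pi/2" for \<theta>
      using tendsto_mult[OF cut_bounds(3)[OF t] tendsto_const[of "h \<theta>"]] by simp
  qed (intro cut_borel borel_measurable_continuous_onI h)+
qed

lemma L2_cut_add_tendsto:
  assumes u: "u \<in> L2" and h: "continuous_on UNIV h" "continuous_on UNIV h2"
  shows "(\<lambda>n. L2_inner u (fmode (\<lambda>\<theta>. cut1 n \<theta> * (sin \<theta> * (cos \<theta> * h \<theta>)) + cut n \<theta> * h2 \<theta>) k)) \<longlonglongrightarrow> L2_inner u (fmode h2 k)"
proof -
  obtain K where K: "\<And>n \<theta>. \<lbrakk>0 < \<theta>; \<theta> < pi/2\<rbrakk> \<Longrightarrow> \<bar>cut1 n \<theta> * (sin \<theta> * (cos \<theta> * h \<theta>)) + cut n \<theta> * h2 \<theta>\<bar> \<le> K"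
    using cut_add_bound[OF h] by blast
  show ?thesis
  proof (rule L2_inner_fmode_tendsto[OF u _ _ K])
    show "(\<lambda>n. cut1 n \<theta> * (sin \<theta> * (cos \<theta> * h \<theta>)) + cut n \<theta> * h2 \<theta>) \<longlonglongrightarrow> h2 \<theta>" if t: "0 < \<theta>" "\<theta> < pi/2" for \<theta>
      using tendsto_add[OF tendsto_mult[OF cut_bounds(4)[OF t] tendsto_const[of "sin \<theta> * (cos \<theta> * h \<theta>)"]]
        tendsto_mult[OF cut_bounds(3)[OF t] tendsto_const[of "h2 \<theta>"]]] by simp
    show "(\<lambda>\<theta>. cut1 n \<theta> * (sin \<theta> * (cos \<theta> * h \<theta>)) + cut n \<theta> * h2 \<theta>) \<in> borel_measurable borel" for n
      by (intro borel_measurable_add cut_borel continuous_intros h)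
  qed (intro borel_measurable_continuous_onI h)
qed

lemma fmode_cong_L2:
  assumes "u \<in> L2" "fmode h k \<in> L2" "h2 \<in> borel_measurable borel" "\<And>\<theta>. \<lbrakk>0 < \<theta>; \<theta> < pi/2\<rbrakk> \<Longrightarrow> h \<theta> = h2 \<theta>"
  shows "L2_inner u (fmode h k) = L2_inner u (fmode h2 k)"
proof -
  have ae: "AE x in hemi. fmode h k x = fmode h2 k x" by (rule AE_hemiI) (use assms in \<open>simp add: fmode_def\<close>)
  have "fmode h2 k \<in> L2" by (rule L2_AE_cong[OF assms(2) fmode_borel[OF assms(3)] ae])
  then show ?thesis using ae assms by (intro L2_inner_AE_cong) auto
qed

text \<open>Integration by parts for a weak derivative: test with \<open>cut n * a\<close> and let
  the cutoff tend to 1. No boundary term survives, because the derivative of the cutoff always meets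
  the factor \<open>sin * cos\<close>. The pole is the delicate place, and the cases
  \<open>m = 0\<close> and \<open>m \<noteq> 0\<close> resolve it differently.\<close>

theorem green:
  assumes u: "u \<in> L2" "p \<in> L2" "s \<in> L2" and wt: "has_weak_dtheta u p" and wp: "has_weak_dphi u q"
    and s: "s = (\<lambda>x. q x / of_real (sin (fst x)))"
  shows "L2_inner p (fmode (\<lambda>\<theta>. cos \<theta> * c \<theta>) m) + L2_inner s (\<lambda>x. \<i> * of_int m * fmode fs m x)
    = of_real lam * L2_inner u (fmode f m)"
proof -
  have th: "L2_inner u (fmode (\<lambda>\<theta>. (cut1 n \<theta> * a \<theta> + cut n \<theta> * g \<theta>) / sin \<theta>) m)
      = - L2_inner p (fmode (\<lambda>\<theta>. cut n \<theta> * (cos \<theta> * c \<theta>)) m)" for n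
  proof -
    have "L2_inner u (fmode (\<lambda>\<theta>. (cut1 n \<theta> * a \<theta> + cut n \<theta> * g \<theta>) / sin \<theta>) m)
      = - L2_inner p (fmode (\<lambda>\<theta>. cut n \<theta> * a \<theta> / sin \<theta>) m)"
      by (rule weak_dtheta_fmode[OF u(1,2) wt test_profile_cut[OF a_deriv g_cont]])
    also have "L2_inner p (fmode (\<lambda>\<theta>. cut n \<theta> * a \<theta> / sin \<theta>) m) = L2_inner p (fmode (\<lambda>\<theta>. cut n \<theta> * (cos \<theta> * c \<theta>)) m)"
    proof (rule fmode_cong_L2[OF u(2), symmetric])
      show "cut n \<theta> * (cos \<theta> * c \<theta>) = cut n \<theta> * a \<theta> / sin \<theta>" if "0 < \<theta>" "\<theta> < pi/2" for \<theta>
        using sin_gt_zero2[OF that] by simp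
      show "(\<lambda>\<theta>. cut n \<theta> * a \<theta> / sin \<theta>) \<in> borel_measurable borel"
        by (intro borel_measurable_divide cut_borel borel_measurable_continuous_onI continuous_intros c_cont)
      show "fmode (\<lambda>\<theta>. cut n \<theta> * (cos \<theta> * c \<theta>)) m \<in> L2"
        by (intro fmode_L2_cont continuous_intros c_cont DERIV_continuous[OF cut_deriv])
    qed
    finally show ?thesis .
  qed
  have lp: "(\<lambda>n. - L2_inner p (fmode (\<lambda>\<theta>. cut n \<theta> * (cos \<theta> * c \<theta>)) m)) \<longlonglongrightarrow> - L2_inner p (fmode (\<lambda>\<theta>. cos \<theta> * c \<theta>) m)"
    by (intro tendsto_intros L2_cut_tendsto u continuous_intros c_cont)
  show ?thesis
  proof (cases "m = 0")
    case True
    have g: "g \<theta> = - lam * sin \<theta> * f \<theta>" if "0 < \<theta>" "\<theta> < pi/2" for \<theta>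
    proof -
      have "sin \<theta> * g \<theta> = sin \<theta> * (- lam * sin \<theta> * f \<theta>)"
        unfolding ode using True by (simp add: power2_eq_square)
      then show ?thesis using sin_gt_zero2[OF that] by (simp only: mult_cancel_left) simp
    qed
    \<comment> \<open>Division by sin uses up the factor sin of \<open>a\<close>; for
      \<open>m = 0\<close> the function \<open>c\<close> supplies another one through
      \<open>c0\<close>.\<close>
    have eq: "(cut1 n \<theta> * a \<theta> + cut n \<theta> * g \<theta>) / sin \<theta> = cut1 n \<theta> * (sin \<theta> * (cos \<theta> * c0 \<theta>)) + cut n \<theta> * (- lam * f \<theta>)"
      if t: "0 < \<theta>" "\<theta> < pi/2" for n \<theta>
      using sin_gt_zero2[OF t] unfolding g[OF t] c0[OF True] by (simp add: field_simps)
    have e: "L2_inner u (fmode (\<lambda>\<theta>. (cut1 n \<theta> * a \<theta> + cut n \<theta> * g \<theta>) / sin \<theta>) m)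
      = L2_inner u (fmode (\<lambda>\<theta>. cut1 n \<theta> * (sin \<theta> * (cos \<theta> * c0 \<theta>)) + cut n \<theta> * (- lam * f \<theta>)) m)" for n
    proof (rule fmode_cong_L2[OF u(1), symmetric])
      show "fmode (\<lambda>\<theta>. cut1 n \<theta> * (sin \<theta> * (cos \<theta> * c0 \<theta>)) + cut n \<theta> * (- lam * f \<theta>)) m \<in> L2"
        by (intro fmode_L2_cont continuous_intros c0_cont f_cont DERIV_continuous[OF cut_deriv] DERIV_continuous[OF cut1_deriv])
      show "(\<lambda>\<theta>. (cut1 n \<theta> * a \<theta> + cut n \<theta> * g \<theta>) / sin \<theta>) \<in> borel_measurable borel"
        by (intro borel_measurable_divide borel_measurable_add cut_borel borel_measurable_continuous_onI continuous_intros c_cont g_cont)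
    qed (use eq in auto)
    have l: "(\<lambda>n. L2_inner u (fmode (\<lambda>\<theta>. cut1 n \<theta> * (sin \<theta> * (cos \<theta> * c0 \<theta>)) + cut n \<theta> * (- lam * f \<theta>)) m))
      \<longlonglongrightarrow> L2_inner u (fmode (\<lambda>\<theta>. - lam * f \<theta>) m)"
      by (intro L2_cut_add_tendsto u continuous_intros c0_cont f_cont)
    have "L2_inner u (fmode (\<lambda>\<theta>. - lam * f \<theta>) m) = - L2_inner p (fmode (\<lambda>\<theta>. cos \<theta> * c \<theta>) m)"
      by (rule LIMSEQ_eqI[OF _ l lp]) (simp only: e[symmetric] th)
    moreover have "fmode (\<lambda>\<theta>. - lam * f \<theta>) m = (\<lambda>x. of_real (- lam) * fmode f m x)"
      by (auto simp: fmode_def)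
    ultimately have "of_real lam * L2_inner u (fmode f m) = L2_inner p (fmode (\<lambda>\<theta>. cos \<theta> * c \<theta>) m)"
      using L2.scale_right[OF fmode_L2_cont[OF f_cont, of m] u(1), of "of_real (- lam)"] by simp
    then show ?thesis using True u(3) by (simp add: L2.zero_right)
  next
    case False
    \<comment> \<open>For \<open>m \<noteq> 0\<close> the quotient by sin need not stay bounded as
      \<open>n\<close> grows. Multiplication by \<open>I\<close> turns its pairing with
      \<open>u\<close> into a pairing with \<open>s\<close> in which the division has disappeared;
      this applies the \<phi>-identity to the derivative of \<open>cut n * a\<close>, hence the
      second derivative of the cutoff.\<close>
    define I where "I = - \<i> * of_int m"
    have I: "I \<noteq> 0" using False by (simp add: I_def)
    have e1: "L2_inner u (fmode (\<lambda>\<theta>. (cut1 n \<theta> * a \<theta> + cut n \<theta> * g \<theta>) / sin \<theta>) m) * I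
      = - L2_inner s (fmode (\<lambda>\<theta>. cut1 n \<theta> * a \<theta> + cut n \<theta> * g \<theta>) m)" for n
      unfolding I_def by (rule weak_dphi_fmode[OF u(1,3) wp s test_profile_cut_deriv[OF a_deriv g_deriv g'_cont]])
    have l1: "(\<lambda>n. - L2_inner s (fmode (\<lambda>\<theta>. cut1 n \<theta> * a \<theta> + cut n \<theta> * g \<theta>) m)) \<longlonglongrightarrow> - L2_inner s (fmode g m)"
      by (intro tendsto_intros L2_cut_add_tendsto u c_cont g_cont)
    have l2: "(\<lambda>n. - L2_inner p (fmode (\<lambda>\<theta>. cut n \<theta> * (cos \<theta> * c \<theta>)) m) * I) \<longlonglongrightarrow> - L2_inner p (fmode (\<lambda>\<theta>. cos \<theta> * c \<theta>) m) * I"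
      by (intro tendsto_mult lp tendsto_const)
    have "- L2_inner p (fmode (\<lambda>\<theta>. cos \<theta> * c \<theta>) m) * I = - L2_inner s (fmode g m)"
      by (rule LIMSEQ_eqI[OF _ l2 l1]) (simp only: e1[symmetric] th)
    then have 1: "L2_inner s (fmode g m) = L2_inner p (fmode (\<lambda>\<theta>. cos \<theta> * c \<theta>) m) * I"
      by simp
    \<comment> \<open>The same exchange for the profile \<open>sin * f\<close>, to turn the term
      with the eigenvalue back from \<open>s\<close> into \<open>u\<close>.\<close>
    have e2: "L2_inner u (fmode (\<lambda>\<theta>. cut n \<theta> * (sin \<theta> * f \<theta>) / sin \<theta>) m) * I = - L2_inner s (fmode (\<lambda>\<theta>. cut n \<theta> * (sin \<theta> * f \<theta>)) m)" for n
      unfolding I_def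
      by (rule weak_dphi_fmode[OF u(1,3) wp s test_profile_cut[of _ "\<lambda>t. cos t * f t + sin t * (cos t * c t)"]])
        (auto intro!: derivative_eq_intros f_deriv continuous_intros f_cont c_cont)
    have e3: "L2_inner u (fmode (\<lambda>\<theta>. cut n \<theta> * (sin \<theta> * f \<theta>) / sin \<theta>) m) = L2_inner u (fmode (\<lambda>\<theta>. cut n \<theta> * f \<theta>) m)" for n
    proof (rule fmode_cong_L2[OF u(1), symmetric])
      show "cut n \<theta> * f \<theta> = cut n \<theta> * (sin \<theta> * f \<theta>) / sin \<theta>" if "0 < \<theta>" "\<theta> < pi/2" for \<theta>
        using sin_gt_zero2[OF that] by simp
      show "(\<lambda>\<theta>. cut n \<theta> * (sin \<theta> * f \<theta>) / sin \<theta>) \<in> borel_measurable borel"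
        by (intro borel_measurable_divide cut_borel borel_measurable_continuous_onI continuous_intros f_cont)
      show "fmode (\<lambda>\<theta>. cut n \<theta> * f \<theta>) m \<in> L2"
        by (intro fmode_L2_cont continuous_intros f_cont DERIV_continuous[OF cut_deriv])
    qed
    have l3: "(\<lambda>n. L2_inner u (fmode (\<lambda>\<theta>. cut n \<theta> * f \<theta>) m) * I) \<longlonglongrightarrow> L2_inner u (fmode f m) * I"
      by (intro tendsto_intros L2_cut_tendsto u f_cont)
    have l4: "(\<lambda>n. - L2_inner s (fmode (\<lambda>\<theta>. cut n \<theta> * (sin \<theta> * f \<theta>)) m)) \<longlonglongrightarrow> - L2_inner s (fmode (\<lambda>\<theta>. sin \<theta> * f \<theta>) m)"
      by (intro tendsto_intros L2_cut_tendsto u continuous_intros f_cont)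
    have 2: "L2_inner u (fmode f m) * I = - L2_inner s (fmode (\<lambda>\<theta>. sin \<theta> * f \<theta>) m)"
      by (rule LIMSEQ_eqI[OF _ l3 l4]) (simp only: e3[symmetric] e2)
    \<comment> \<open>The Legendre equation divided by sin. The two exchanged identities are
      combined through it, and the common factor \<open>I\<close>, whose square is
      \<open>- m ^ 2\<close>, is cancelled at the end.\<close>
    have g: "g \<theta> = of_int m ^ 2 * fs \<theta> - lam * (sin \<theta> * f \<theta>)" if "0 < \<theta>" "\<theta> < pi/2" for \<theta>
    proof -
      have "sin \<theta> * g \<theta> = sin \<theta> * (of_int m ^ 2 * fs \<theta> - lam * (sin \<theta> * f \<theta>))"
        unfolding ode fs[OF False] by (simp add: algebra_simps power2_eq_square)
      then show ?thesis using sin_gt_zero2[OF that] by simp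
    qed
    have L: "fmode fs m \<in> L2" "fmode (\<lambda>\<theta>. sin \<theta> * f \<theta>) m \<in> L2"
      by (intro fmode_L2_cont fs_cont continuous_intros f_cont)+
    have "L2_inner s (fmode g m) = L2_inner s (fmode (\<lambda>\<theta>. of_int m ^ 2 * fs \<theta> - lam * (sin \<theta> * f \<theta>)) m)"
      by (intro fmode_cong_L2 u fmode_L2_cont g_cont borel_measurable_continuous_onI continuous_intros fs_cont f_cont g)
    also have "fmode (\<lambda>\<theta>. of_int m ^ 2 * fs \<theta> - lam * (sin \<theta> * f \<theta>)) m
      = (\<lambda>x. of_int m ^ 2 * fmode fs m x + of_real (- lam) * fmode (\<lambda>\<theta>. sin \<theta> * f \<theta>) m x)"
      by (auto simp: fmode_def algebra_simps)
    also have "L2_inner s \<dots> = of_int m ^ 2 * L2_inner s (fmode fs m) - of_real lam * L2_inner s (fmode (\<lambda>\<theta>. sin \<theta> * f \<theta>) m)"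
      by (subst L2.right[OF L u(3)]) simp
    also have "\<dots> = of_int m ^ 2 * L2_inner s (fmode fs m) + of_real lam * (L2_inner u (fmode f m) * I)"
      unfolding 2 by simp
    finally have "L2_inner p (fmode (\<lambda>\<theta>. cos \<theta> * c \<theta>) m) * I = of_int m ^ 2 * L2_inner s (fmode fs m) + of_real lam * (L2_inner u (fmode f m) * I)"
      using 1 by simp
    moreover have "of_int m ^ 2 = - I * I" by (simp add: I_def power2_eq_square complex_eq_iff)
    ultimately have "(L2_inner p (fmode (\<lambda>\<theta>. cos \<theta> * c \<theta>) m) + I * L2_inner s (fmode fs m)) * I = (of_real lam * L2_inner u (fmode f m)) * I"
      by (simp add: algebra_simps)
    then have "L2_inner p (fmode (\<lambda>\<theta>. cos \<theta> * c \<theta>) m) + I * L2_inner s (fmode fs m) = of_real lam * L2_inner u (fmode f m)"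
      using I by simp
    moreover have "L2_inner s (\<lambda>x. \<i> * of_int m * fmode fs m x) = I * L2_inner s (fmode fs m)"
      by (subst L2.scale_right[OF L(1) u(3)]) (simp add: I_def)
    ultimately show ?thesis by simp
  qed
qed

end

section \<open>The equator and product integrals\<close>

definition circ :: "real measure" where "circ = density lborel (\<lambda>x. ennreal (indicator {-pi<..pi} x))"

lemma sets_circ [measurable_cong]: "sets circ = sets borel" and space_circ [simp]: "space circ = UNIV"
  by (simp_all add: circ_def)

lemma borel_measurable_circ: "borel_measurable circ = borel_measurable borel"
  by (rule measurable_cong_sets) (simp_all add: sets_circ)

lemma integral_circ:
  fixes f :: "real \<Rightarrow> 'b::{banach, second_countable_topology}"
  assumes "f \<in> borel_measurable borel"
  shows "(LINT x|circ. f x) = (LINT x:{-pi<..pi}|lborel. f x)"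
  unfolding circ_def set_lebesgue_integral_def by (rule integral_density) (use assms in auto)

lemma integrable_circ:
  fixes f :: "real \<Rightarrow> 'b::{banach, second_countable_topology}"
  assumes "f \<in> borel_measurable borel"
  shows "integrable circ f \<longleftrightarrow> set_integrable lborel {-pi<..pi} f"
  unfolding circ_def set_integrable_def by (rule integrable_density) (use assms in auto)

lemma finite_measure_circ: "finite_measure circ"
proof
  have "emeasure circ (space circ) = (\<integral>\<^sup>+x. indicator {-pi<..pi} x \<partial>lborel)"
    unfolding circ_def by (simp add: emeasure_density ennreal_indicator)
  also have "\<dots> = emeasure lborel {-pi<..pi}" by simp
  also have "\<dots> \<noteq> \<infinity>" by simp
  finally show "emeasure circ (space circ) \<noteq> \<infinity>" .
qed

interpretation circ: finite_measure circ by (rule finite_measure_circ)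

interpretation C: pos_hermitian "sqi circ" "ipm circ" by (rule pos_hermitian_ipm)

lemma sqi_circ_continuous:
  assumes "continuous_on UNIV g"
  shows "g \<in> sqi circ"
proof -
  have "bounded (g ` {-pi..pi})"
    by (intro compact_imp_bounded compact_continuous_image continuous_on_subset[OF assms]) auto
  then obtain K where "\<forall>y\<in>g ` {-pi..pi}. cmod y \<le> K" unfolding bounded_iff by blast
  then have K: "\<And>x. x \<in> {-pi..pi} \<Longrightarrow> cmod (g x) \<le> K" by auto
  show ?thesis
  proof (rule circ.bounded_sqi)
    show "g \<in> borel_measurable circ" using assms by (simp add: borel_measurable_circ continuous_borel)
    have "AE x in lborel. 0 < ennreal (indicator {-pi<..pi} x) \<longrightarrow> cmod (g x) \<le> K"
      by (rule AE_I2) (use K in \<open>auto simp: indicator_def\<close>)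
    then show "AE x in circ. cmod (g x) \<le> K" unfolding circ_def by (subst AE_density) auto
  qed
qed

lemma integral_circ_cis: "(LINT x|circ. cis (of_int k * x)) = (if k = 0 then 2 * pi else 0)"
proof (cases "k = 0")
  case True
  have "measure circ (space circ) = 2 * pi"
  proof -
    have "emeasure circ (space circ) = (\<integral>\<^sup>+x. indicator {-pi<..pi} x \<partial>lborel)"
      unfolding circ_def by (simp add: emeasure_density ennreal_indicator)
    also have "\<dots> = emeasure lborel {-pi<..pi}" by simp
    finally show ?thesis by (simp add: measure_def)
  qed
  then show ?thesis using True by (simp add: scaleR_conv_of_real)
next
  case False
  have "(LINT x|circ. cis (of_int k * x)) = (LINT x:{-pi<..pi}|lborel. cis (of_int k * x))"
    by (rule integral_circ) (auto intro!: borel_measurable_continuous_onI continuous_intros)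
  also have "\<dots> = (LINT x:{-pi..pi}|lborel. cis (of_int k * x))"
    by (rule set_integral_discrete_difference[where X="{-pi}"]) auto
  also have "\<dots> = cis (of_int k * pi) / (\<i> * of_int k) - cis (of_int k * (-pi)) / (\<i> * of_int k)"
    unfolding set_lebesgue_integral_def
  proof (rule integral_FTC_Icc)
    fix x :: real
    have "((\<lambda>x. cis (of_int k * x) / (\<i> * of_int k)) has_vector_derivative
        (of_int k *\<^sub>R (\<i> * cis (of_int k * x))) / (\<i> * of_int k)) (at x within {-pi..pi})"
      unfolding divide_inverse
      by (intro has_vector_derivative_mult_left) (auto simp: has_vector_derivative_def intro!: derivative_eq_intros)
    then show "((\<lambda>x. cis (of_int k * x) / (\<i> * of_int k)) has_vector_derivative cis (of_int k * x)) (at x within {-pi..pi})"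
      using False by (simp add: scaleR_conv_of_real)
  qed (auto intro!: continuous_intros)
  also have "\<dots> = 0"
  proof -
    have "cis (of_int k * pi) = cis (of_int k * (-pi))"
      by (simp add: complex_eq_iff sin_times_pi_eq_0)
    then show ?thesis by simp
  qed
  finally show ?thesis using False by simp
qed

section \<open>Weighted integrals over the polar angle and separated functions\<close>

definition polint :: "(real \<Rightarrow> real) \<Rightarrow> real" where
  "polint h = (LINT t:{0..pi/2}|lborel. h t * sin t)"

lemma polint_integrable: "continuous_on UNIV h \<Longrightarrow> set_integrable lborel {0..pi/2} (\<lambda>t. h t * sin t :: real)"
  by (intro borel_integrable_atLeastAtMost' continuous_intros) (auto intro: continuous_on_subset)

lemma polint_mono:
  assumes "continuous_on UNIV h" "continuous_on UNIV g" "\<And>t. \<lbrakk>0 \<le> t; t \<le> pi/2\<rbrakk> \<Longrightarrow> h t \<le> g t"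
  shows "polint h \<le> polint g"
  unfolding polint_def
  using assms by (intro set_integral_mono polint_integrable mult_right_mono) (auto intro: sin_ge_zero)

lemma polint_add: "continuous_on UNIV h \<Longrightarrow> continuous_on UNIV g \<Longrightarrow> polint (\<lambda>t. h t + g t) = polint h + polint g"
  unfolding polint_def using set_integral_add(2)[OF polint_integrable polint_integrable, of h g]
  by (simp add: distrib_right)

lemma polint_cmult: "polint (\<lambda>t. c * h t) = c * polint h"
  unfolding polint_def by (simp add: mult.assoc)

lemma polint_pos:
  assumes h: "continuous_on UNIV h" and nn: "\<And>t. 0 \<le> h t" and t0: "0 < t0" "t0 < pi/2" "h t0 > 0"
  shows "polint h > 0"
proof -
  have "isCont h t0" using h by (simp add: continuous_on_eq_continuous_at)
  then have "\<forall>\<^sub>F t in nhds t0. h t > h t0 / 2"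
    using t0(3) by (intro order_tendstoD) (auto simp: isCont_def tendsto_at_iff_tendsto_nhds)
  then obtain d where d: "d > 0" "\<And>t. dist t t0 < d \<Longrightarrow> h t > h t0 / 2"
    by (auto simp: eventually_nhds_metric)
  \<comment> \<open>The lower bound is taken to the right of \<open>t0\<close> only: there sin is at
    least \<open>sin t0\<close> as long as \<open>pi/2\<close> is not passed.\<close>
  define b where "b = min (t0 + d / 2) (pi/2)"
  have "b \<le> t0 + d / 2" unfolding b_def by (rule min.cobounded1)
  then have b: "t0 < b" "b \<le> pi/2" "\<And>t. \<lbrakk>t0 \<le> t; t \<le> b\<rbrakk> \<Longrightarrow> h t > h t0 / 2"
    using d t0 min.cobounded2[of "t0 + d / 2" "pi/2"] by (auto simp: b_def dist_real_def)
  have "0 < (h t0 / 2) * sin t0 * (b - t0)" using t0 b sin_gt_zero2 by simp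
  also have "\<dots> = (LINT t:{t0..b}|lborel. (h t0 / 2) * sin t0)"
    using b by (simp add: set_lebesgue_integral_def)
  also have "\<dots> \<le> (LINT t:{t0..b}|lborel. h t * sin t)"
  proof (rule set_integral_mono)
    show "set_integrable lborel {t0..b} (\<lambda>t. h t0 / 2 * sin t0)"
      by (intro borel_integrable_atLeastAtMost' continuous_intros)
    show "set_integrable lborel {t0..b} (\<lambda>t. h t * sin t)"
      by (intro borel_integrable_atLeastAtMost' continuous_intros) (auto intro: continuous_on_subset[OF h])
    show "h t0 / 2 * sin t0 \<le> h t * sin t" if "t \<in> {t0..b}" for t
      using that b t0 less_imp_le[OF b(3)[of t]] by (intro mult_mono sin_monotone_2pi_le sin_ge_zero) auto
  qed
  also have "\<dots> \<le> polint h" unfolding polint_def set_lebesgue_integral_def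
  proof (rule integral_mono)
    show "integrable lborel (\<lambda>t. indicat_real {t0..b} t *\<^sub>R (h t * sin t))"
      using set_integrable_subset[OF polint_integrable[OF h], of "{t0..b}"] t0 b by (simp add: set_integrable_def)
    show "integrable lborel (\<lambda>t. indicat_real {0..pi/2} t *\<^sub>R (h t * sin t))"
      using polint_integrable[OF h] by (simp add: set_integrable_def)
    show "indicat_real {t0..b} t *\<^sub>R (h t * sin t) \<le> indicat_real {0..pi/2} t *\<^sub>R (h t * sin t)" for t
      using t0 b nn[of t] by (auto simp: indicator_def intro!: mult_nonneg_nonneg sin_ge_zero)
  qed
  finally show ?thesis .
qed

lemma polint_FTC:
  assumes "\<And>t. (F has_real_derivative (h t * sin t)) (at t)" "continuous_on UNIV h"
  shows "polint h = F (pi/2) - F 0"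
proof -
  have "(LINT x|lborel. (h x * sin x) * indicator {0..pi/2} x) = F (pi/2) - F 0"
    using assms by (intro integral_FTC_Icc_real)
      (auto intro!: continuous_intros simp: continuous_on_eq_continuous_at)
  then show ?thesis by (simp add: polint_def set_lebesgue_integral_def mult.commute)
qed

lemma integral_hemi_product:
  fixes h :: "real \<Rightarrow> real" and w :: "real \<Rightarrow> complex"
  assumes h: "continuous_on UNIV h" and w: "continuous_on UNIV w"
  shows "(LINT x|hemi. of_real (h (fst x)) * w (snd x)) = of_real (polint h) * (LINT y|circ. w y)"
proof -
  define F where "F = (\<lambda>x::real\<times>real. (indicator {0..pi/2} (fst x) * (h (fst x) * sin (fst x))) *\<^sub>R (indicator {-pi<..pi} (snd x) *\<^sub>R w (snd x)))"
  note [measurable] = continuous_borel[OF h] continuous_borel[OF w]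
  have Feq: "(indicator hemi_dom x * sin (fst x)) *\<^sub>R (of_real (h (fst x)) * w (snd x)) = F x" for x
    by (cases x) (auto simp: F_def hemi_dom_def indicator_def scaleR_conv_of_real)
  have F2: "integrable lborel (\<lambda>x. indicator {-pi<..pi} x *\<^sub>R w x)"
    unfolding set_integrable_def[symmetric]
  proof (rule set_integrable_subset)
    show "set_integrable lborel {-pi..pi} w"
      by (rule borel_integrable_atLeastAtMost') (rule continuous_on_subset[OF w], simp)
  qed auto
  have F1: "integrable lborel (\<lambda>x. indicator {0..pi/2} x * (h x * sin x))"
    using polint_integrable[OF h] by (simp add: set_integrable_def)
  have "integrable (lborel \<Otimes>\<^sub>M lborel) F"
  proof (rule lborel_pair.Fubini_integrable)
    show "F \<in> borel_measurable (lborel \<Otimes>\<^sub>M lborel)" unfolding F_def by measurable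
    have "(\<lambda>x. LINT y|lborel. norm (F (x, y))) = (\<lambda>x. \<bar>indicator {0..pi/2} x * (h x * sin x)\<bar>
        * (LINT y|lborel. norm (indicator {-pi<..pi} y *\<^sub>R w y)))"
      unfolding F_def fst_conv snd_conv norm_scaleR[of "indicator {0..pi/2} _ * _"] by simp
    then show "integrable lborel (\<lambda>x. LINT y|lborel. norm (F (x, y)))"
      using F1 by (simp only:) (intro integrable_mult_left integrable_abs)
    show "AE x in lborel. integrable lborel (\<lambda>y. F (x, y))" unfolding F_def fst_conv snd_conv
      by (intro AE_I2 integrable_scaleR_right F2)
  qed
  then have "(LINT x|(lborel \<Otimes>\<^sub>M lborel). F x) = (LINT x|lborel. LINT y|lborel. F (x, y))"
    by (rule lborel_pair.integral_fst'[symmetric])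
  also have "\<dots> = (LINT x|lborel. (indicator {0..pi/2} x * (h x * sin x)) *\<^sub>R (LINT y|circ. w y))"
    unfolding F_def fst_conv snd_conv by (subst integral_circ) (auto simp: set_lebesgue_integral_def simp del: scaleR_scaleR)
  also have "\<dots> = of_real (polint h) * (LINT y|circ. w y)"
    by (subst integral_scaleR_left[OF F1]) (simp add: polint_def set_lebesgue_integral_def scaleR_conv_of_real)
  finally have "(LINT x|(lborel \<Otimes>\<^sub>M lborel). F x) = of_real (polint h) * (LINT y|circ. w y)" .
  moreover have "(LINT x|hemi. of_real (h (fst x)) * w (snd x)) = (LINT x|lborel. F x)"
    unfolding Feq[symmetric] by (rule integral_hemi) measurable
  ultimately show ?thesis by (simp add: lborel_prod)
qed

lemma fmode_inner:
  assumes "continuous_on UNIV h" "continuous_on UNIV h'"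
  shows "L2_inner (fmode h k) (fmode h' k') = (if k = k' then of_real (2 * pi * polint (\<lambda>t. h t * h' t)) else 0)"
proof -
  have "L2_inner (fmode h k) (fmode h' k') = (LINT x|hemi. of_real (h (fst x) * h' (fst x)) * cis (of_int (k - k') * snd x))"
    unfolding L2_inner_def fmode_def
    by (intro Bochner_Integration.integral_cong refl) (simp add: cis_cnj cis_mult algebra_simps)
  also have "\<dots> = of_real (polint (\<lambda>t. h t * h' t)) * (LINT y|circ. cis (of_int (k - k') * y))"
    by (rule integral_hemi_product) (intro continuous_intros assms)+
  finally show ?thesis unfolding integral_circ_cis by simp
qed

section \<open>The Rellich identity and boundary values of profiles\<close>

context profile
begin

text \<open>Multiplying the Legendre equation by \<open>a\<close> gives, up to sin, the derivative
  of the quantity \<open>F\<close>, except for the term from differentiating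
  \<open>(sin t)\<^sup>2\<close>. At the pole \<open>F\<close> vanishes since \<open>m\<close> or
  \<open>f 0\<close> is 0; at the equator \<open>a\<close> vanishes by the Neumann condition, so
  only \<open>f (pi/2)\<close> remains.\<close>

lemma rellich: "(lam - of_int m ^ 2) * (f (pi/2))\<^sup>2 = 2 * lam * polint (\<lambda>t. cos t * (f t)\<^sup>2)"
proof -
  define F where "F t = (a t)\<^sup>2 / 2 - (of_int m ^ 2 - lam * (sin t)\<^sup>2) * (f t)\<^sup>2 / 2" for t
  have "(F has_real_derivative (lam * (cos t * (f t)\<^sup>2)) * sin t) (at t)" for t
  proof -
    have eq: "a t * g t = cos t * c t * ((of_int m ^ 2 - lam * (sin t)\<^sup>2) * f t)"
      unfolding ode[symmetric] by (simp add: mult_ac)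
    have d1: "((\<lambda>t. (a t)\<^sup>2) has_real_derivative 2 * a t * g t) (at t)"
      by (rule DERIV_cong[OF DERIV_power[OF a_deriv, of 2]]) simp
    have d2: "((\<lambda>t. of_int m ^ 2 - lam * (sin t)\<^sup>2) has_real_derivative - lam * (2 * sin t * cos t)) (at t)"
      by (auto intro!: derivative_eq_intros)
    have d3: "((\<lambda>t. (f t)\<^sup>2) has_real_derivative 2 * f t * (cos t * c t)) (at t)"
      by (rule DERIV_cong[OF DERIV_power[OF f_deriv, of 2]]) simp
    have "(F has_real_derivative (2 * a t * g t / 2 -
      ((- lam * (2 * sin t * cos t)) * (f t)\<^sup>2 + (of_int m ^ 2 - lam * (sin t)\<^sup>2) * (2 * f t * (cos t * c t))) / 2)) (at t)"
      unfolding F_def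
      by (rule DERIV_cong[OF DERIV_diff[OF DERIV_cdivide[OF d1] DERIV_cdivide[OF DERIV_mult[OF d2 d3]]]]) (simp add: mult_ac)
    moreover have "2 * a t * g t / 2 -
      ((- lam * (2 * sin t * cos t)) * (f t)\<^sup>2 + (of_int m ^ 2 - lam * (sin t)\<^sup>2) * (2 * f t * (cos t * c t))) / 2
      = (lam * (cos t * (f t)\<^sup>2)) * sin t + (a t * g t - cos t * c t * ((of_int m ^ 2 - lam * (sin t)\<^sup>2) * f t))"
      by (simp add: field_simps)
    ultimately show ?thesis using eq by simp
  qed
  then have "polint (\<lambda>t. lam * (cos t * (f t)\<^sup>2)) = F (pi/2) - F 0"
    by (rule polint_FTC) (intro continuous_intros f_cont)
  moreover have "F 0 = 0" using fs[of 0] by (cases "m = 0") (auto simp: F_def)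
  moreover have "F (pi/2) = (lam - of_int m ^ 2) * (f (pi/2))\<^sup>2 / 2" by (simp add: F_def field_simps)
  ultimately show ?thesis unfolding polint_cmult by (simp add: field_simps)
qed

text \<open>Estimating the cosine in the Rellich identity by 1 suffices as long as
  \<open>lam - m ^ 2\<close> is comparable with \<open>lam\<close>.\<close>

lemma trace_bound1:
  assumes "0 \<le> lam"
  shows "(lam - of_int m ^ 2) * (f (pi/2))\<^sup>2 \<le> 2 * lam * polint (\<lambda>t. (f t)\<^sup>2)"
  unfolding rellich using assms
  by (intro mult_left_mono polint_mono continuous_intros f_cont) (auto simp: mult_left_le_one_le cos_ge_zero)

text \<open>When \<open>lam - m ^ 2\<close> is small, \<open>f\<close> concentrates where the cosine
  is small, and that has to be used. The energy identity bounds the integral of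
  \<open>(cos t)\<^sup>2 * (fs t)\<^sup>2\<close> by \<open>(lam - M\<^sup>2) / M\<^sup>2\<close>
  times that of \<open>(f t)\<^sup>2\<close>; splitting the cosine by the inequality of arithmetic
  and geometric means with \<open>s = sqrt (lam - M\<^sup>2)\<close> gains a factor
  \<open>s / M\<close> over the trivial bound.\<close>

lemma trace_bound2:
  assumes m: "m \<noteq> 0" and lam: "of_int m ^ 2 < lam"
  shows "of_int \<bar>m\<bar> * sqrt (lam - of_int m ^ 2) * (f (pi/2))\<^sup>2 \<le> 2 * lam * polint (\<lambda>t. (f t)\<^sup>2)"
proof -
  define N where "N = polint (\<lambda>t. (f t)\<^sup>2)"
  define N1 where "N1 = polint (\<lambda>t. (cos t)\<^sup>2 * (fs t)\<^sup>2)"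
  define M where "M = real_of_int \<bar>m\<bar>"
  have M: "M > 0" "M\<^sup>2 = of_int m ^ 2" using m by (auto simp: M_def)
  \<comment> \<open>The energy identity: the Legendre equation tested with \<open>f\<close> itself.
    The boundary terms vanish since sin is 0 at the pole and cos is 0 at the equator.\<close>
  have "polint (\<lambda>t. M\<^sup>2 * (fs t)\<^sup>2 + ((- lam) * (f t)\<^sup>2 + (cos t)\<^sup>2 * (c t)\<^sup>2)) = a (pi/2) * f (pi/2) - a 0 * f 0"
  proof (rule polint_FTC)
    show "((\<lambda>t. a t * f t) has_real_derivative (M\<^sup>2 * (fs t)\<^sup>2 + ((- lam) * (f t)\<^sup>2 + (cos t)\<^sup>2 * (c t)\<^sup>2)) * sin t) (at t)" for t
    proof -
      have "g t * f t = (sin t * g t) * fs t" using fs[OF m, of t] by simp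
      also have "\<dots> = (M\<^sup>2 * (fs t)\<^sup>2 - lam * (f t)\<^sup>2) * sin t"
        unfolding ode M(2) fs[OF m] by (simp add: power2_eq_square algebra_simps)
      finally have "g t * f t + cos t * c t * a t = (M\<^sup>2 * (fs t)\<^sup>2 + ((- lam) * (f t)\<^sup>2 + (cos t)\<^sup>2 * (c t)\<^sup>2)) * sin t"
        by (simp add: power2_eq_square algebra_simps)
      with DERIV_mult[OF a_deriv f_deriv, of t] show ?thesis by simp
    qed
  qed (intro continuous_intros f_cont c_cont fs_cont)
  also have "\<dots> = 0" by simp
  finally have z: "polint (\<lambda>t. M\<^sup>2 * (fs t)\<^sup>2 + ((- lam) * (f t)\<^sup>2 + (cos t)\<^sup>2 * (c t)\<^sup>2)) = 0" .
  have "polint (\<lambda>t. M\<^sup>2 * (fs t)\<^sup>2 + ((- lam) * (f t)\<^sup>2 + (cos t)\<^sup>2 * (c t)\<^sup>2))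
    = polint (\<lambda>t. M\<^sup>2 * (fs t)\<^sup>2) + polint (\<lambda>t. (- lam) * (f t)\<^sup>2 + (cos t)\<^sup>2 * (c t)\<^sup>2)"
    by (rule polint_add) (intro continuous_intros f_cont c_cont fs_cont)+
  also have "polint (\<lambda>t. (- lam) * (f t)\<^sup>2 + (cos t)\<^sup>2 * (c t)\<^sup>2)
    = polint (\<lambda>t. (- lam) * (f t)\<^sup>2) + polint (\<lambda>t. (cos t)\<^sup>2 * (c t)\<^sup>2)"
    by (rule polint_add) (intro continuous_intros f_cont c_cont)+
  finally have "M\<^sup>2 * polint (\<lambda>t. (fs t)\<^sup>2) - lam * N + polint (\<lambda>t. (cos t)\<^sup>2 * (c t)\<^sup>2) = 0"
    unfolding z polint_cmult N_def by simp
  moreover have "0 \<le> polint (\<lambda>t. (cos t)\<^sup>2 * (c t)\<^sup>2)"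
    using polint_mono[of "\<lambda>t. 0" "\<lambda>t. (cos t)\<^sup>2 * (c t)\<^sup>2"] by (simp add: polint_def continuous_intros c_cont)
  \<comment> \<open>Since \<open>f = sin * fs\<close>, the Pythagorean identity splits the
    centrifugal term; its part \<open>N\<close> then combines with the eigenvalue to
    \<open>lam - M\<^sup>2\<close>.\<close>
  moreover have "polint (\<lambda>t. (fs t)\<^sup>2) = N + N1"
  proof -
    have "(fs t)\<^sup>2 = (f t)\<^sup>2 + (cos t)\<^sup>2 * (fs t)\<^sup>2" for t
      unfolding fs[OF m] power_mult_distrib distrib_right[symmetric] by simp
    then have "polint (\<lambda>t. (fs t)\<^sup>2) = polint (\<lambda>t. (f t)\<^sup>2 + (cos t)\<^sup>2 * (fs t)\<^sup>2)" by simp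
    then show ?thesis unfolding N_def N1_def by (simp add: polint_add continuous_intros f_cont fs_cont)
  qed
  ultimately have N1: "M\<^sup>2 * N1 \<le> (lam - M\<^sup>2) * N" by (simp add: algebra_simps)
  define s where "s = sqrt (lam - M\<^sup>2)"
  have s: "s > 0" "s\<^sup>2 = lam - M\<^sup>2" using lam M by (auto simp: s_def)
  have "polint (\<lambda>t. (2 * M * s) * (cos t * (f t)\<^sup>2)) \<le> polint (\<lambda>t. s\<^sup>2 * (f t)\<^sup>2 + M\<^sup>2 * ((cos t)\<^sup>2 * (fs t)\<^sup>2))"
  proof (rule polint_mono)
    fix t :: real assume t: "0 \<le> t" "t \<le> pi/2"
    have "2 * s * (M * cos t) \<le> s\<^sup>2 + (M * cos t)\<^sup>2" by (rule sum_squares_bound)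
    then have "(2 * s * (M * cos t)) * (f t)\<^sup>2 \<le> (s\<^sup>2 + (M * cos t)\<^sup>2) * (f t)\<^sup>2" by (rule mult_right_mono) simp
    also have "\<dots> = s\<^sup>2 * (f t)\<^sup>2 + M\<^sup>2 * ((cos t)\<^sup>2 * (f t)\<^sup>2)" by (simp add: power_mult_distrib algebra_simps)
    finally have 1: "(2 * M * s) * (cos t * (f t)\<^sup>2) \<le> s\<^sup>2 * (f t)\<^sup>2 + M\<^sup>2 * ((cos t)\<^sup>2 * (f t)\<^sup>2)"
      by (simp add: mult_ac)
    have "(f t)\<^sup>2 \<le> 1 * (fs t)\<^sup>2" unfolding fs[OF m] power_mult_distrib
      by (intro mult_right_mono) (auto simp: abs_square_le_1)
    then have "M\<^sup>2 * ((cos t)\<^sup>2 * (f t)\<^sup>2) \<le> M\<^sup>2 * ((cos t)\<^sup>2 * (fs t)\<^sup>2)" by (intro mult_left_mono) auto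
    with 1 show "(2 * M * s) * (cos t * (f t)\<^sup>2) \<le> s\<^sup>2 * (f t)\<^sup>2 + M\<^sup>2 * ((cos t)\<^sup>2 * (fs t)\<^sup>2)"
      by linarith
  qed (intro continuous_intros f_cont fs_cont)+
  also have "\<dots> = s\<^sup>2 * N + M\<^sup>2 * N1"
    unfolding N_def N1_def by (simp add: polint_add polint_cmult continuous_intros f_cont fs_cont)
  also have "\<dots> \<le> 2 * s\<^sup>2 * N" using N1 unfolding s(2) by (simp add: algebra_simps)
  finally have "s * (M * polint (\<lambda>t. cos t * (f t)\<^sup>2)) \<le> s * (s * N)" unfolding polint_cmult by (simp add: power2_eq_square mult_ac)
  then have b: "M * polint (\<lambda>t. cos t * (f t)\<^sup>2) \<le> s * N" using s by simp
  have "s * (M * s * (f (pi/2))\<^sup>2) = M * ((lam - of_int m ^ 2) * (f (pi/2))\<^sup>2)"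
    using s M by (simp add: power2_eq_square mult_ac)
  also have "\<dots> = 2 * lam * (M * polint (\<lambda>t. cos t * (f t)\<^sup>2))" unfolding rellich by simp
  also have "\<dots> \<le> 2 * lam * (s * N)" using b lam by (intro mult_left_mono) (auto intro: order_trans[OF zero_le_power2 less_imp_le])
  finally have "s * (M * s * (f (pi/2))\<^sup>2) \<le> s * (2 * lam * N)" by (simp add: mult_ac)
  then show ?thesis using s M by (simp add: N_def M_def s_def)
qed

end

section \<open>Explicit Neumann eigenfunctions\<close>

definition ev :: "nat \<Rightarrow> real" where "ev n = real (n * (n + 1))"

lemma ev_mono: "n \<le> k \<Longrightarrow> ev n \<le> ev k"
  unfolding ev_def of_nat_le_iff by (intro mult_le_mono) auto

lemma ev_strict_mono: "n < k \<Longrightarrow> ev n < ev k"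
proof -
  assume "n < k"
  then have "n * (n + 1) < k * (k + 1)" by (intro mult_strict_mono) auto
  then show ?thesis unfolding ev_def by (simp only: of_nat_less_iff)
qed

text \<open>With \<open>z = sin \<theta> * cis \<phi>\<close> the Laplacian maps \<open>z^a * (cnj z)^b\<close> to
  \<open>4 a b z^(a-1) (cnj z)^(b-1) - (a+b)(a+b+1) z^a (cnj z)^b\<close>; the recursion below is the resulting
  equation for the coefficients of an eigenfunction with leading term \<open>z^a * (cnj z)^b\<close>.\<close>

primrec coef :: "nat \<Rightarrow> nat \<Rightarrow> nat \<Rightarrow> real" where
  "coef a b 0 = 1"
| "coef a b (Suc i) = - coef a b i * (4 * (real a - real i) * (real b - real i)) / (ev (a + b) - ev (a + b - 2 * Suc i))"

text \<open>The argument \<open>h\<close> gives the contribution of each degree, so derivatives,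
  products and the differential equation are treated degree by degree with the same
  coefficients.\<close>

definition psum :: "nat \<Rightarrow> nat \<Rightarrow> (nat \<Rightarrow> real) \<Rightarrow> real" where
  "psum a b h = (\<Sum>i\<le>min a b. coef a b i * h (a + b - 2 * i))"

lemma psum_cont: "(\<And>n. continuous_on UNIV (\<lambda>t. h t n)) \<Longrightarrow> continuous_on UNIV (\<lambda>t::real. psum a b (h t))"
  unfolding psum_def by (intro continuous_intros)

lemma psum_deriv:
  "(\<And>n. ((\<lambda>t. h t n) has_real_derivative h' n) (at t)) \<Longrightarrow> ((\<lambda>t. psum a b (h t)) has_real_derivative psum a b h') (at t)"
  unfolding psum_def by (intro DERIV_sum DERIV_cmult)

lemma psum_mult: "c * psum a b h = psum a b (\<lambda>n. c * h n)"
  unfolding psum_def sum_distrib_left by (intro sum.cong) auto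

lemma psum_diff: "psum a b h - psum a b g = psum a b (\<lambda>n. h n - g n)"
  unfolding psum_def sum_subtractf[symmetric] by (intro sum.cong) (auto simp: right_diff_distrib)

lemma psum_cong: "(\<And>i. i \<le> min a b \<Longrightarrow> h (a + b - 2 * i) = g (a + b - 2 * i)) \<Longrightarrow> psum a b h = psum a b g"
  unfolding psum_def by (intro sum.cong) auto

definition pf :: "nat \<Rightarrow> nat \<Rightarrow> real \<Rightarrow> real" where
  "pf a b t = psum a b (\<lambda>n. sin t ^ n)"

text \<open>The difference of the sides is a telescoping sum. The term \<open>A i\<close> produced
  in degree \<open>n i\<close> cancels the term with coefficient \<open>i + 1\<close>, whose degree
  \<open>n (Suc i) + 2\<close> is again \<open>n i\<close>; that is the recursion for
  \<open>coef\<close>.\<close>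

lemma psum_ode:
  "psum a b (\<lambda>n. (real n)\<^sup>2 * x ^ n - real (n * (n + 1)) * x ^ (n + 2))
    = psum a b (\<lambda>n. (of_int (int a - int b))\<^sup>2 * x ^ n - ev (a + b) * x ^ (n + 2))"
proof -
  define d where "d = min a b"
  define n where "n i = a + b - 2 * i" for i
  define A where "A i = coef a b i * (4 * (real a - real i) * (real b - real i)) * x ^ n i" for i
  have d: "i \<le> d \<Longrightarrow> 2 * i \<le> a + b" for i by (simp add: d_def)
  have "psum a b (\<lambda>n. (real n)\<^sup>2 * x ^ n - real (n * (n + 1)) * x ^ (n + 2))
    - psum a b (\<lambda>n. (of_int (int a - int b))\<^sup>2 * x ^ n - ev (a + b) * x ^ (n + 2))
    = (\<Sum>i\<le>d. A i) + (\<Sum>i\<le>d. coef a b i * (ev (a + b) - ev (n i)) * x ^ (n i + 2))"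
  proof -
    have "coef a b i * (((real (n i))\<^sup>2 * x ^ n i - real (n i * (n i + 1)) * x ^ (n i + 2)) -
       ((of_int (int a - int b))\<^sup>2 * x ^ n i - ev (a + b) * x ^ (n i + 2)))
      = A i + coef a b i * (ev (a + b) - ev (n i)) * x ^ (n i + 2)" if "i \<le> d" for i
    proof -
      have r: "real (n i) = real a + real b - 2 * real i" using d[OF that] by (simp add: n_def of_nat_diff)
      have "(real (n i))\<^sup>2 - (of_int (int a - int b))\<^sup>2 = 4 * (real a - real i) * (real b - real i)"
        unfolding r by (simp add: power2_eq_square algebra_simps)
      then have "A i = coef a b i * ((real (n i))\<^sup>2 - (of_int (int a - int b))\<^sup>2) * x ^ n i" unfolding A_def by simp
      then show ?thesis unfolding ev_def[of "n i"] by (simp add: algebra_simps)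
    qed
    then show ?thesis unfolding psum_diff
      unfolding psum_def d_def[symmetric] n_def[symmetric] sum.distrib[symmetric]
      by (intro sum.cong) auto
  qed
  also have "(\<Sum>i\<le>d. coef a b i * (ev (a + b) - ev (n i)) * x ^ (n i + 2)) = (\<Sum>i<d. - A i)"
  proof -
    have "coef a b (Suc i) * (ev (a + b) - ev (n (Suc i))) * x ^ (n (Suc i) + 2) = - A i" if "i < d" for i
    proof -
      have "2 * Suc i \<le> a + b" using d[of "Suc i"] that by simp
      then have n: "n (Suc i) + 2 = n i" "n (Suc i) < a + b" by (auto simp: n_def)
      have "ev (a + b) - ev (n (Suc i)) \<noteq> 0" using ev_strict_mono[OF n(2)] by simp
      then show ?thesis unfolding n(1) by (simp add: A_def flip: n_def[of "Suc i", simplified])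
    qed
    then show ?thesis unfolding sum.atMost_shift by (simp add: n_def)
  qed
  also have "(\<Sum>i\<le>d. A i) = A d + (\<Sum>i<d. A i)" by (simp add: lessThan_Suc_atMost[symmetric])
  \<comment> \<open>The recursion stops by itself: at \<open>min a b\<close> one of the factors
    \<open>a - i\<close>, \<open>b - i\<close> vanishes.\<close>
  also have "A d = 0" by (auto simp: A_def d_def min_def)
  finally show ?thesis by (simp add: sum_negf)
qed

lemma profile_pf:
  "profile (int a - int b) (ev (a + b)) (pf a b)
    (\<lambda>t. psum a b (\<lambda>n. real n * sin t ^ (n - 1)))
    (\<lambda>t. psum a b (\<lambda>n. (real n)\<^sup>2 * (sin t ^ (n - 1) * (1 - (sin t)\<^sup>2)) - real n * sin t ^ (n + 1)))
    (\<lambda>t. psum a b (\<lambda>n. (real n)\<^sup>2 * ((real (n - 1) * (sin t ^ (n - 1 - 1) * cos t)) * (1 - (sin t)\<^sup>2) + sin t ^ (n - 1) * (- (2 * sin t * cos t))) - real n * (real (n + 1) * (sin t ^ n * cos t))))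
    (\<lambda>t. psum a b (\<lambda>n. sin t ^ (n - 1)))
    (\<lambda>t. psum a b (\<lambda>n. real n * sin t ^ (n - 2)))"
proof
  have pw: "((\<lambda>t. sin t ^ n) has_real_derivative real n * (sin t ^ (n - 1) * cos t)) (at t)" for n t
    by (auto intro!: derivative_eq_intros)
  fix t :: real
  show "(pf a b has_real_derivative cos t * psum a b (\<lambda>n. real n * sin t ^ (n - 1))) (at t)"
    unfolding pf_def psum_mult by (rule psum_deriv) (rule DERIV_cong[OF pw], simp)
  \<comment> \<open>The truncated exponent at \<open>n = 0\<close> is harmless because of the factor
    \<open>real n\<close>.\<close>
  have sp: "real n * (sin t * sin t ^ (n - 1)) = real n * sin t ^ n" for n t
    by (cases n) auto
  have "sin t * (cos t * psum a b (\<lambda>n. real n * sin t ^ (n - 1))) = psum a b (\<lambda>n. cos t * (real n * sin t ^ n))" for t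
    unfolding psum_mult by (intro psum_cong) (subst sp[symmetric], simp only: mult_ac)
  moreover have "((\<lambda>t. psum a b (\<lambda>n. cos t * (real n * sin t ^ n))) has_real_derivative
      psum a b (\<lambda>n. (real n)\<^sup>2 * (sin t ^ (n - 1) * (1 - (sin t)\<^sup>2)) - real n * sin t ^ (n + 1))) (at t)"
  proof (rule psum_deriv)
    fix n
    have "((\<lambda>t. cos t * (real n * sin t ^ n)) has_real_derivative
      - sin t * (real n * sin t ^ n) + (real n * (real n * (sin t ^ (n - 1) * cos t))) * cos t) (at t)"
      by (rule DERIV_mult[OF DERIV_cos DERIV_cmult[OF pw]])
    moreover have "- sin t * (real n * sin t ^ n) + (real n * (real n * (sin t ^ (n - 1) * cos t))) * cos t
       = (real n)\<^sup>2 * (sin t ^ (n - 1) * (1 - (sin t)\<^sup>2)) - real n * sin t ^ (n + 1)"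
      unfolding cos_squared_eq[symmetric] by (simp add: power2_eq_square algebra_simps)
    ultimately show "((\<lambda>t. cos t * (real n * sin t ^ n)) has_real_derivative
      (real n)\<^sup>2 * (sin t ^ (n - 1) * (1 - (sin t)\<^sup>2)) - real n * sin t ^ (n + 1)) (at t)" by (rule DERIV_cong)
  qed
  ultimately show "((\<lambda>t. sin t * (cos t * psum a b (\<lambda>n. real n * sin t ^ (n - 1)))) has_real_derivative
      psum a b (\<lambda>n. (real n)\<^sup>2 * (sin t ^ (n - 1) * (1 - (sin t)\<^sup>2)) - real n * sin t ^ (n + 1))) (at t)"
    by simp
  have s2: "((\<lambda>t. 1 - (sin t)\<^sup>2) has_real_derivative - (2 * sin t * cos t)) (at t)"
    by (auto intro!: derivative_eq_intros)
  show "((\<lambda>t. psum a b (\<lambda>n. (real n)\<^sup>2 * (sin t ^ (n - 1) * (1 - (sin t)\<^sup>2)) - real n * sin t ^ (n + 1)))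
     has_real_derivative psum a b (\<lambda>n. (real n)\<^sup>2 * ((real (n - 1) * (sin t ^ (n - 1 - 1) * cos t)) * (1 - (sin t)\<^sup>2) + sin t ^ (n - 1) * (- (2 * sin t * cos t))) - real n * (real (n + 1) * (sin t ^ n * cos t)))) (at t)"
  proof (rule psum_deriv)
    fix n
    show "((\<lambda>t. (real n)\<^sup>2 * (sin t ^ (n - 1) * (1 - (sin t)\<^sup>2)) - real n * sin t ^ (n + 1)) has_real_derivative
      (real n)\<^sup>2 * ((real (n - 1) * (sin t ^ (n - 1 - 1) * cos t)) * (1 - (sin t)\<^sup>2) + sin t ^ (n - 1) * (- (2 * sin t * cos t))) - real n * (real (n + 1) * (sin t ^ n * cos t))) (at t)"
      by (rule DERIV_cong[OF DERIV_diff[OF DERIV_cmult[OF DERIV_mult[OF pw s2]] DERIV_cmult[OF pw]]]) simp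
  qed
  show "sin t * psum a b (\<lambda>n. (real n)\<^sup>2 * (sin t ^ (n - 1) * (1 - (sin t)\<^sup>2)) - real n * sin t ^ (n + 1))
     = (of_int (int a - int b) ^ 2 - ev (a + b) * (sin t)\<^sup>2) * pf a b t"
  proof -
    have "sin t * psum a b (\<lambda>n. (real n)\<^sup>2 * (sin t ^ (n - 1) * (1 - (sin t)\<^sup>2)) - real n * sin t ^ (n + 1))
      = psum a b (\<lambda>n. (real n)\<^sup>2 * sin t ^ n - real (n * (n + 1)) * sin t ^ (n + 2))"
      unfolding psum_mult
    proof (rule psum_cong, goal_cases)
      case (1 i)
      have "sin t * ((real n)\<^sup>2 * (sin t ^ (n - 1) * (1 - (sin t)\<^sup>2)) - real n * sin t ^ (n + 1))
        = real n * (real n * (sin t * sin t ^ (n - 1))) * (1 - (sin t)\<^sup>2) - real n * sin t ^ (n + 2)" for n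
        by (simp add: power2_eq_square algebra_simps)
      also have "\<dots> n = (real n)\<^sup>2 * sin t ^ n - real (n * (n + 1)) * sin t ^ (n + 2)" for n
        unfolding sp by (simp add: power2_eq_square algebra_simps)
      finally show ?case .
    qed
    also have "\<dots> = (of_int (int a - int b) ^ 2 - ev (a + b) * (sin t)\<^sup>2) * pf a b t"
      unfolding psum_ode pf_def psum_mult by (intro psum_cong) (simp add: algebra_simps power2_eq_square)
    finally show ?thesis .
  qed
  \<comment> \<open>For different \<open>a\<close> and \<open>b\<close> every degree
    \<open>a + b - 2 * i\<close> is positive, so one factor sin can be split off each term.\<close>
  show "pf a b t = sin t * psum a b (\<lambda>n. sin t ^ (n - 1))" if "int a - int b \<noteq> 0"
    unfolding pf_def psum_mult
  proof (rule psum_cong)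
    fix i assume "i \<le> min a b"
    then have "a + b - 2 * i \<noteq> 0" using that by auto
    then show "sin t ^ (a + b - 2 * i) = sin t * sin t ^ (a + b - 2 * i - 1)"
      by (metis Suc_pred' not_gr_zero power_Suc)
  qed
  \<comment> \<open>For \<open>a = b\<close> all degrees are even: degree 0 is killed by its factor,
    and every other degree is at least 2.\<close>
  show "psum a b (\<lambda>n. real n * sin t ^ (n - 1)) = sin t * psum a b (\<lambda>n. real n * sin t ^ (n - 2))" if ab: "int a - int b = 0"
    unfolding psum_mult
  proof (rule psum_cong)
    fix i assume i: "i \<le> min a b"
    have "a = b" using ab by simp
    show "real (a + b - 2 * i) * sin t ^ (a + b - 2 * i - 1) = sin t * (real (a + b - 2 * i) * sin t ^ (a + b - 2 * i - 2))"
    proof (cases "a + b - 2 * i = 0")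
      case False
      have e: "a + b - 2 * i = 2 * (a - i)" using \<open>a = b\<close> by simp
      with False obtain l where "a - i = Suc l" by (cases "a - i") auto
      with e obtain k where "a + b - 2 * i = k + 2" by simp
      then show ?thesis by simp
    qed simp
  qed
qed (intro psum_cont continuous_intros)+

section \<open>The eigenfunctions on the hemisphere\<close>

definition E :: "nat \<times> nat \<Rightarrow> real \<times> real \<Rightarrow> complex" where
  "E j = fmode (pf (fst j) (snd j)) (int (fst j) - int (snd j))"

text \<open>The monomial \<open>z ^ a * (cnj z) ^ b\<close> in the horizontal coordinate
  \<open>z\<close>. Lowering both exponents by \<open>i\<close> preserves the order, so
  \<open>E (a, b)\<close> is a combination of such monomials.\<close>

definition zmono :: "nat \<Rightarrow> nat \<Rightarrow> real \<times> real \<Rightarrow> complex" where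
  "zmono a b = fmode (\<lambda>t. sin t ^ (a + b)) (int a - int b)"

lemma zmono_eq: "zmono a b x = (of_real (sin (fst x)) * cis (snd x)) ^ a * (of_real (sin (fst x)) * cis (- snd x)) ^ b"
  unfolding zmono_def fmode_def
  by (simp add: power_mult_distrib power_add Complex.DeMoivre cis_mult algebra_simps)

lemma E_expand: "E (a, b) x = (\<Sum>i\<le>min a b. of_real (coef a b i) * zmono (a - i) (b - i) x)"
proof -
  have "zmono (a - i) (b - i) x = of_real (sin (fst x) ^ (a + b - 2 * i)) * cis (of_int (int a - int b) * snd x)" if "i \<le> min a b" for i
  proof -
    have "a - i + (b - i) = a + b - 2 * i" "int (a - i) - int (b - i) = int a - int b" using that by auto
    then show ?thesis unfolding zmono_def fmode_def by simp
  qed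
  then have "(\<Sum>i\<le>min a b. of_real (coef a b i) * zmono (a - i) (b - i) x)
    = (\<Sum>i\<le>min a b. of_real (coef a b i * sin (fst x) ^ (a + b - 2 * i)) * cis (of_int (int a - int b) * snd x))"
    by (intro sum.cong) auto
  then show ?thesis unfolding E_def fmode_def pf_def psum_def fst_conv snd_conv of_real_sum sum_distrib_right by simp
qed

lemma pf_cont: "continuous_on UNIV (pf a b)"
  by (rule profile.f_cont[OF profile_pf])

definition nrm :: "nat \<times> nat \<Rightarrow> real" where
  "nrm j = polint (\<lambda>t. (pf (fst j) (snd j) t)\<^sup>2)"

text \<open>The factor is a polynomial in the sine, and its coefficient of degree
  \<open>a + b\<close> is 1 because only the term \<open>i = 0\<close> reaches that degree. A
  nonzero polynomial has only finitely many roots in the unit interval.\<close>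

lemma pf_nonzero: "\<exists>t0>0. t0 < pi/2 \<and> pf a b t0 \<noteq> 0"
proof -
  define p where "p = (\<Sum>i\<le>min a b. monom (coef a b i) (a + b - 2 * i))"
  have poly: "poly p (sin t) = pf a b t" for t
    by (simp add: p_def pf_def psum_def poly_sum poly_monom)
  have "coeff p (a + b) = (\<Sum>i\<le>min a b. if i = 0 then 1 else 0)"
    unfolding p_def coeff_sum coeff_monom by (intro sum.cong) auto
  then have "p \<noteq> 0" by (auto simp: if_distrib cong: if_cong)
  then have "finite {x. poly p x = 0}" by (rule poly_roots_finite)
  moreover have "infinite {0<..<1::real}" by (simp add: infinite_Ioo)
  ultimately obtain x where x: "x \<in> {0<..<1}" "poly p x \<noteq> 0"
    by (metis (mono_tags, lifting) finite_subset mem_Collect_eq subsetI)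
  define t where "t = arcsin x"
  have "0 < t" "t < pi/2" "sin t = x" using x arcsin_lt_bounded[of x] by (auto simp: t_def arcsin_less_arcsin[of 0 x, simplified])
  then show ?thesis using x poly by metis
qed

lemma nrm_pos: "nrm j > 0"
proof -
  obtain t0 where t0: "t0 > 0" "t0 < pi/2" "pf (fst j) (snd j) t0 \<noteq> 0" using pf_nonzero by blast
  show ?thesis unfolding nrm_def
    by (rule polint_pos[OF _ _ t0(1,2)]) (use t0 in \<open>auto intro!: continuous_intros pf_cont\<close>)
qed

lemma E_norm: "L2_inner (E j) (E j) = of_real (2 * pi * nrm j)"
  unfolding E_def by (simp add: fmode_inner pf_cont nrm_def power2_eq_square)

lemma E_inner_diff: "int (fst i) - int (snd i) \<noteq> int (fst j) - int (snd j) \<Longrightarrow> L2_inner (E i) (E j) = 0"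
  unfolding E_def by (simp add: fmode_inner pf_cont)

section \<open>Completeness of the eigenfunctions\<close>

lemma L2_integrable: "u \<in> L2 \<Longrightarrow> integrable hemi u"
proof -
  assume u: "u \<in> L2"
  have "(\<lambda>_. 1) \<in> sqi hemi" by (simp add: sqi_def)
  from sqi_mult_integrable[OF u[unfolded L2_eq] this] show ?thesis by simp
qed

lemma L2_complete:
  fixes X :: "nat \<Rightarrow> real \<times> real \<Rightarrow> complex"
  assumes X: "\<And>n. X n \<in> L2"
    and c: "\<And>\<epsilon>::real. \<epsilon> > 0 \<Longrightarrow> \<exists>N::nat. \<forall>m\<ge>N. \<forall>n\<ge>N. L2.q (\<lambda>x. X m x - X n x) < \<epsilon>"
  obtains w where "w \<in> L2" "(\<lambda>n. L2.q (\<lambda>x. X n x - w x)) \<longlonglongrightarrow> 0"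
proof (rule hemi.sqi_complete[of X])
  show "X n \<in> sqi hemi" for n using X by (simp add: L2_eq)
  show "\<exists>N. \<forall>m\<ge>N. \<forall>n\<ge>N. Re (ipm hemi (\<lambda>x. X m x - X n x) (\<lambda>x. X m x - X n x)) < \<epsilon>" if "\<epsilon> > 0" for \<epsilon> :: real
    using c[OF that] by (simp add: L2_inner_eq)
  show thesis if "w \<in> sqi hemi" "(\<lambda>n. Re (ipm hemi (\<lambda>x. X n x - w x) (\<lambda>x. X n x - w x))) \<longlonglongrightarrow> 0" for w
    by (rule \<open>\<And>w. w \<in> L2 \<Longrightarrow> (\<lambda>n. L2.q (\<lambda>x. X n x - w x)) \<longlonglongrightarrow> 0 \<Longrightarrow> thesis\<close>) (use that in \<open>simp_all add: L2_eq L2_inner_eq\<close>)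
qed

lemma L2_continuous:
  assumes "continuous_on UNIV g"
  shows "g \<in> L2"
proof -
  let ?S = "cbox (0, -pi) (pi/2, pi)"
  have "bounded (g ` ?S)"
    by (intro compact_imp_bounded compact_continuous_image continuous_on_subset[OF assms]) auto
  then obtain K where "\<forall>y\<in>g ` ?S. cmod y \<le> K" unfolding bounded_iff by blast
  then show ?thesis using continuous_borel[OF assms]
    by (intro L2_bounded[of g K]) (auto simp: cbox_Pair_eq)
qed

lemma zmono_L2: "zmono a b \<in> L2"
  unfolding zmono_def by (intro fmode_L2_cont continuous_intros)

text \<open>The passage from monomials to eigenfunctions is unitriangular, since
  \<open>E (a, b)\<close> is \<open>zmono a b\<close> plus monomials with smaller first
  exponent.\<close>

lemma zmono_orthogonal:
  assumes u: "u \<in> L2" and o: "\<And>j. L2_inner u (E j) = 0"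
  shows "L2_inner u (zmono a b) = 0"
proof (induction a arbitrary: b rule: less_induct)
  case (less a)
  have "E (a, b) = (\<lambda>x. \<Sum>i\<in>{..min a b}. of_real (coef a b i) * zmono (a - i) (b - i) x)"
    by (intro ext E_expand)
  then have "0 = L2_inner u (\<lambda>x. \<Sum>i\<in>{..min a b}. of_real (coef a b i) * zmono (a - i) (b - i) x)"
    using o[of "(a, b)"] by simp
  also have "\<dots> = (\<Sum>i\<in>{..min a b}. cnj (of_real (coef a b i)) * L2_inner u (zmono (a - i) (b - i)))"
    by (rule L2.sum_right[OF zmono_L2 u])
  also have "\<dots> = (\<Sum>i\<in>{..min a b}. if i = 0 then L2_inner u (zmono a b) else 0)"
    by (intro sum.cong) (auto intro!: less.IH)
  also have "\<dots> = L2_inner u (zmono a b)" by simp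
  finally show ?case ..
qed

section \<open>Orthogonality to polynomials, continuous functions and Borel sets\<close>

text \<open>The vertical projection to the equatorial plane, which is injective on the closed
  hemisphere.\<close>

definition chart :: "real \<times> real \<Rightarrow> real \<times> real" where
  "chart x = (sin (fst x) * cos (snd x), sin (fst x) * sin (snd x))"

lemma chart_cont: "continuous_on UNIV chart"
  unfolding chart_def[abs_def] by (intro continuous_intros)

lemma zmono_cont: "continuous_on UNIV (zmono a b)"
  unfolding zmono_eq[abs_def] by (intro continuous_intros)

text \<open>The induction needs a multiplier \<open>g\<close>: for a product of polynomials, the
  first factor is absorbed into \<open>g\<close> before the second is treated. The hypothesis covers
  all monomials because multiplying by a coordinate raises one of the two exponents.\<close>

lemma polynomial_orthogonal:
  assumes u: "u \<in> L2"
    and P: "real_polynomial_function (P :: real \<times> real \<Rightarrow> real)"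
  shows "continuous_on UNIV g \<Longrightarrow> (\<And>a b. L2_inner u (\<lambda>x. g x * zmono a b x) = 0)
    \<Longrightarrow> L2_inner u (\<lambda>x. (g x * of_real (P (chart x))) * zmono a b x) = 0"
  using P
proof (induction arbitrary: g a b rule: real_polynomial_function.induct)
  case (linear P)
  interpret P: bounded_linear P by fact
  \<comment> \<open>The coordinates of the chart are the real and imaginary parts of
    \<open>z\<close>, so a linear form is \<open>c1 * z + c2 * cnj z\<close>.\<close>
  define c1 c2 where "c1 = (of_real (P (1, 0)) - \<i> * of_real (P (0, 1))) / 2"
    and "c2 = (of_real (P (1, 0)) + \<i> * of_real (P (0, 1))) / 2"
  have "(g x * of_real (P (chart x))) * zmono a b x
    = c1 * (g x * zmono (a + 1) b x) + c2 * (g x * zmono a (b + 1) x)" for x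
  proof -
    have "P (chart x) = P (fst (chart x) *\<^sub>R (1, 0) + snd (chart x) *\<^sub>R (0, 1))" by simp
    also have "\<dots> = sin (fst x) * cos (snd x) * P (1, 0) + sin (fst x) * sin (snd x) * P (0, 1)"
      unfolding P.add P.scaleR by (simp add: chart_def)
    finally have "of_real (P (chart x)) = c1 * (of_real (sin (fst x)) * cis (snd x)) + c2 * (of_real (sin (fst x)) * cis (- snd x))"
      by (simp add: c1_def c2_def complex_eq_iff field_simps)
    then show ?thesis unfolding zmono_eq by (simp add: algebra_simps)
  qed
  moreover have "(\<lambda>x. g x * zmono a b x) \<in> L2" for a b
    by (intro L2_continuous continuous_intros linear zmono_cont)
  ultimately show ?case using linear u by (simp add: L2.right)
next
  case (const c)
  have "(\<lambda>x. (g x * of_real c) * zmono a b x) = (\<lambda>x. of_real c * (g x * zmono a b x))" by (simp add: mult_ac)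
  moreover have "(\<lambda>x. g x * zmono a b x) \<in> L2" by (intro L2_continuous continuous_intros const zmono_cont)
  ultimately show ?case using const u by (simp add: L2.scale_right)
next
  case (add P Q)
  have c: "continuous_on UNIV (\<lambda>x. of_real (R (chart x)) :: complex)" if "real_polynomial_function R" for R :: "real \<times> real \<Rightarrow> real"
    using continuous_real_polymonial_function[OF that]
    by (intro continuous_intros continuous_on_compose2[OF _ chart_cont, of UNIV R]) (auto simp: continuous_on_eq_continuous_at)
  have "(\<lambda>x. (g x * of_real (P (chart x) + Q (chart x))) * zmono a b x)
    = (\<lambda>x. (g x * of_real (P (chart x))) * zmono a b x + (g x * of_real (Q (chart x))) * zmono a b x)"
    by (simp add: algebra_simps)
  moreover have "(\<lambda>x. (g x * of_real (P (chart x))) * zmono a b x) \<in> L2" "(\<lambda>x. (g x * of_real (Q (chart x))) * zmono a b x) \<in> L2"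
    by (intro L2_continuous continuous_on_mult c add zmono_cont)+
  ultimately show ?case using add u by (simp add: L2.add_right)
next
  case (mult P Q)
  have c: "continuous_on UNIV (\<lambda>x. of_real (P (chart x)) :: complex)"
    using continuous_real_polymonial_function[OF mult(1)]
    by (intro continuous_intros continuous_on_compose2[OF _ chart_cont, of UNIV P]) (auto simp: continuous_on_eq_continuous_at)
  have "L2_inner u (\<lambda>x. ((g x * of_real (P (chart x))) * of_real (Q (chart x))) * zmono a b x) = 0"
    by (rule mult.IH(2)) (auto intro!: mult.IH(1) mult.prems continuous_on_mult c)
  then show ?case by (simp add: mult_ac)
qed

lemma L2_inner_abs_bound:
  assumes u: "u \<in> L2" and g: "g \<in> borel_measurable borel"
    and K: "\<And>\<theta> \<phi>. \<lbrakk>0 < \<theta>; \<theta> < pi/2; -pi < \<phi>; \<phi> \<le> pi\<rbrakk> \<Longrightarrow> cmod (g (\<theta>, \<phi>)) \<le> K"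
  shows "cmod (L2_inner u g) \<le> K * (LINT x|hemi. cmod (u x))"
proof -
  have iu: "integrable hemi u"
    by (rule L2_integrable[OF u])
  have gL: "g \<in> L2" by (rule L2_bounded[OF g K])
  have "cmod (L2_inner u g) \<le> (LINT x|hemi. cmod (u x * cnj (g x)))"
    unfolding L2_inner_def by (rule integral_norm_bound)
  also have "\<dots> \<le> (LINT x|hemi. K * cmod (u x))"
  proof (rule integral_mono_AE)
    show "integrable hemi (\<lambda>x. cmod (u x * cnj (g x)))"
      using ipm_integrable[of u hemi g] u gL by (auto simp: L2_eq)
    show "AE x in hemi. cmod (u x * cnj (g x)) \<le> K * cmod (u x)"
      by (rule AE_hemiI) (use K in \<open>auto simp: norm_mult mult.commute[of K] intro!: mult_left_mono\<close>)
  qed (use iu in simp)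
  finally show ?thesis by simp
qed

text \<open>Weierstrass approximation on the square that contains the image of the chart; a uniform
  error \<open>d\<close> costs at most \<open>d\<close> times the integral of
  \<open>cmod (u x)\<close>.\<close>

lemma continuous_orthogonal:
  assumes u: "u \<in> L2" and o: "\<And>j. L2_inner u (E j) = 0" and f: "continuous_on UNIV (f :: real \<times> real \<Rightarrow> real)"
  shows "L2_inner u (\<lambda>x. of_real (f (chart x))) = 0"
proof -
  define I where "I = (LINT x|hemi. cmod (u x))"
  have I: "I \<ge> 0" by (simp add: I_def)
  have cc: "continuous_on UNIV (\<lambda>x. complex_of_real (R (chart x)))" if "continuous_on UNIV R" for R :: "real \<times> real \<Rightarrow> real"
    by (intro continuous_intros continuous_on_compose2[OF that chart_cont]) auto
  have "cmod (L2_inner u (\<lambda>x. of_real (f (chart x)))) \<le> e" if e: "e > 0" for e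
  proof -
    define d where "d = e / (I + 1)"
    have d: "d > 0" using e I by (simp add: d_def)
    obtain P where P: "real_polynomial_function P" "\<And>x. x \<in> cbox (-1, -1) (1, 1) \<Longrightarrow> \<bar>f x - P x\<bar> < d"
      using Stone_Weierstrass_real_polynomial_function[OF compact_cbox continuous_on_subset[OF f] d] by (metis subset_UNIV)
    have cP: "continuous_on UNIV P" using continuous_real_polymonial_function[OF P(1)] by (simp add: continuous_on_eq_continuous_at)
    have z0: "zmono 0 0 = (\<lambda>x. 1)" by (rule ext) (simp add: zmono_eq)
    have P0: "L2_inner u (\<lambda>x. of_real (P (chart x))) = 0"
      using polynomial_orthogonal[OF u P(1), of "\<lambda>_. 1" 0 0] zmono_orthogonal[OF u o] by (simp add: z0)
    have L: "(\<lambda>x. complex_of_real (f (chart x))) \<in> L2" "(\<lambda>x. complex_of_real (P (chart x))) \<in> L2"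
      by (intro L2_continuous cc f cP)+
    have "cmod (L2_inner u (\<lambda>x. of_real (f (chart x)) - of_real (P (chart x)))) \<le> d * I"
      unfolding I_def
    proof (rule L2_inner_abs_bound[OF u])
      show "(\<lambda>x. complex_of_real (f (chart x)) - complex_of_real (P (chart x))) \<in> borel_measurable borel"
        by (intro continuous_borel continuous_intros cc f cP)
      fix \<theta> \<phi>
      have "chart (\<theta>, \<phi>) \<in> cbox (-1, -1) (1, 1)"
        using abs_sin_le_one[of \<theta>] abs_sin_le_one[of \<phi>] abs_cos_le_one[of \<phi>]
          mult_mono[of "\<bar>sin \<theta>\<bar>" 1 "\<bar>cos \<phi>\<bar>" 1] mult_mono[of "\<bar>sin \<theta>\<bar>" 1 "\<bar>sin \<phi>\<bar>" 1]
        by (simp add: chart_def cbox_Pair_eq abs_mult[symmetric] abs_le_iff minus_le_iff)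
      then show "cmod (complex_of_real (f (chart (\<theta>, \<phi>))) - complex_of_real (P (chart (\<theta>, \<phi>)))) \<le> d"
        using P(2) by (simp flip: of_real_diff) (meson less_imp_le)
    qed
    also have "d * I \<le> e" using e I by (simp add: d_def field_simps)
    finally show ?thesis using P0 u L by (simp add: L2.diff_right)
  qed
  then show ?thesis using field_le_epsilon[of "cmod (L2_inner u (\<lambda>x. of_real (f (chart x))))" 0] by simp
qed

text \<open>Indicators of closed sets are bounded pointwise limits of continuous functions. Closed
  sets are stable under intersection and generate the Borel sets, so Dynkin's theorem does the
  rest.\<close>

lemma borel_orthogonal:
  assumes u: "u \<in> L2" and o: "\<And>j. L2_inner u (E j) = 0" and B: "B \<in> sets (borel :: (real \<times> real) measure)"
  shows "(LINT x|hemi. indicator B (chart x) *\<^sub>R u x) = 0"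
proof -
  note [measurable] = L2_measurable[OF u] continuous_borel[OF chart_cont]
  have iu: "integrable hemi u"
    by (rule L2_integrable[OF u])
  then have iu': "integrable hemi (\<lambda>x. cmod (u x))" by simp
  have iB: "integrable hemi (\<lambda>x. indicator B (chart x) *\<^sub>R u x)" if [measurable]: "B \<in> sets borel" for B
  proof (rule Bochner_Integration.integrable_bound[OF iu])
    show "(\<lambda>x. indicat_real B (chart x) *\<^sub>R u x) \<in> borel_measurable hemi" unfolding borel_measurable_hemi by measurable
  qed (auto simp: indicator_def)
  have B': "B \<in> sigma_sets UNIV (Collect closed)"
    using B unfolding borel_eq_closed by simp
  have closed: "(LINT x|hemi. indicator K (chart x) *\<^sub>R u x) = 0" if K: "closed K" for K :: "(real \<times> real) set"
  proof (cases "K = {}")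
    case False
    \<comment> \<open>These functions are 1 on \<open>K\<close> and, at a point outside, 0 as soon
      as \<open>n\<close> exceeds the reciprocal of its positive distance to
      \<open>K\<close>.\<close>
    define f where "f n x = max 0 (1 - real n * infdist x K)" for n x
    have fc: "continuous_on UNIV (f n)" for n unfolding f_def by (intro continuous_intros)
    have "(LINT x|hemi. f n (chart x) *\<^sub>R u x) = 0" for n
      using continuous_orthogonal[OF u o fc[of n]] by (simp add: L2_inner_def scaleR_conv_of_real mult.commute)
    moreover have "(\<lambda>n. LINT x|hemi. f n (chart x) *\<^sub>R u x) \<longlonglongrightarrow> (LINT x|hemi. indicator K (chart x) *\<^sub>R u x)"
    proof (rule integral_dominated_convergence[OF _ _ iu'])
      note [measurable] = continuous_borel[OF fc]
      have [measurable]: "K \<in> sets borel" using K by simp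
      show "(\<lambda>x. indicat_real K (chart x) *\<^sub>R u x) \<in> borel_measurable hemi"
        "\<And>n. (\<lambda>x. f n (chart x) *\<^sub>R u x) \<in> borel_measurable hemi"
        unfolding borel_measurable_hemi by measurable
      show "AE x in hemi. norm (f n (chart x) *\<^sub>R u x) \<le> cmod (u x)" for n
        by (intro AE_I2) (auto simp: f_def infdist_nonneg intro!: mult_left_le_one_le)
      have "(\<lambda>n. f n y) \<longlonglongrightarrow> indicator K y" for y
      proof (cases "y \<in> K")
        case True
        then show ?thesis by (simp add: f_def)
      next
        case y: False
        then have pos: "infdist y K > 0"
          using in_closed_iff_infdist_zero[OF K False, of y] infdist_nonneg[of y K] by simp
        have "\<forall>\<^sub>F n in sequentially. f n y = 0"
          using pos by (intro eventually_sequentiallyI[of "nat \<lceil>1 / infdist y K\<rceil>"])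
            (simp add: f_def field_simps nat_ceiling_le_eq)
        then show ?thesis using y by (simp add: tendsto_eventually)
      qed
      then show "AE x in hemi. (\<lambda>n. f n (chart x) *\<^sub>R u x) \<longlonglongrightarrow> indicat_real K (chart x) *\<^sub>R u x"
        by (intro AE_I2 tendsto_intros)
    qed
    ultimately show ?thesis by (simp add: LIMSEQ_const_iff)
  qed simp
  have "Int_stable (Collect closed :: (real \<times> real) set set)" by (auto simp: Int_stable_def)
  moreover have "Collect closed \<subseteq> Pow (UNIV :: (real \<times> real) set)" by simp
  ultimately show ?thesis using B'
  proof (induction rule: sigma_sets_induct_disjoint)
    case (basic A)
    then show ?case using closed by simp
  next
    case empty
    then show ?case by simp
  next
    case (compl A)
    have A: "A \<in> sets borel" using compl(1) unfolding borel_eq_closed by simp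
    have "(\<lambda>x. indicator (UNIV - A) (chart x) *\<^sub>R u x) = (\<lambda>x. indicator UNIV (chart x) *\<^sub>R u x - indicator A (chart x) *\<^sub>R u x)"
      by (auto simp: indicator_def)
    then show ?case using closed[of UNIV] compl(2) iB[OF A] iu by simp
  next
    case (union A)
    have A[measurable]: "A i \<in> sets borel" for i using union(2)[THEN subsetD, of "A i"] unfolding borel_eq_closed by auto
    have "(\<lambda>n. LINT x|hemi. (\<Sum>i<n. indicator (A i) (chart x)) *\<^sub>R u x) \<longlonglongrightarrow> (LINT x|hemi. indicator (\<Union>i. A i) (chart x) *\<^sub>R u x)"
    proof (rule integral_dominated_convergence[OF _ _ iu'])
      have [measurable]: "(\<Union>i. A i) \<in> sets borel" using A by (intro sets.countable_UN) auto
      show "(\<lambda>x. indicat_real (\<Union>i. A i) (chart x) *\<^sub>R u x) \<in> borel_measurable hemi"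
        unfolding borel_measurable_hemi by measurable
      show "(\<lambda>x. (\<Sum>i<n. indicat_real (A i) (chart x)) *\<^sub>R u x) \<in> borel_measurable hemi" for n
        unfolding borel_measurable_hemi by measurable
      have s: "(\<Sum>i<n. indicat_real (A i) y) = indicator (\<Union>i<n. A i) y" for n y
        using union(1) by (intro indicator_UN_disjoint[symmetric]) (auto simp: disjoint_family_on_def)
      show "AE x in hemi. norm ((\<Sum>i<n. indicat_real (A i) (chart x)) *\<^sub>R u x) \<le> cmod (u x)" for n
        unfolding s by (intro AE_I2) (auto simp: indicator_def)
      have "(\<lambda>n. \<Sum>i<n. indicat_real (A i) y) \<longlonglongrightarrow> indicator (\<Union>i. A i) y" for y
        unfolding s by (rule LIMSEQ_indicator_UN)
      then show "AE x in hemi. (\<lambda>n. (\<Sum>i<n. indicat_real (A i) (chart x)) *\<^sub>R u x) \<longlonglongrightarrow> indicat_real (\<Union>i. A i) (chart x) *\<^sub>R u x"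
        by (intro AE_I2 tendsto_intros)
    qed
    moreover have "(LINT x|hemi. (\<Sum>i<n. indicator (A i) (chart x)) *\<^sub>R u x) = 0" for n
      unfolding scaleR_sum_left
      by (subst Bochner_Integration.integral_sum) (simp_all only: union(3) iB[OF A] sum.neutral_const)
    ultimately show ?case by (simp add: LIMSEQ_const_iff)
  qed
qed

text \<open>Polar coordinates of the projected point. The clipping to [-1, 1] makes the function
  Borel on the whole plane, and the sign of the second coordinate selects the half circle.\<close>

definition chart_inv :: "real \<times> real \<Rightarrow> real \<times> real" where
  "chart_inv y = (let r = sqrt ((fst y)\<^sup>2 + (snd y)\<^sup>2); c = arccos (max (-1) (min 1 (fst y / r)))
     in (arcsin (max (-1) (min 1 r)), if 0 \<le> snd y then c else - c))"

lemma chart_inv_chart: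
  assumes "0 < \<theta>" "\<theta> < pi/2" "-pi < \<phi>" "\<phi> \<le> pi"
  shows "chart_inv (chart (\<theta>, \<phi>)) = (\<theta>, \<phi>)"
proof -
  have s: "sin \<theta> > 0" using assms by (intro sin_gt_zero2)
  have "(sin \<theta> * cos \<phi>)\<^sup>2 + (sin \<theta> * sin \<phi>)\<^sup>2 = (sin \<theta>)\<^sup>2"
    unfolding power_mult_distrib distrib_left[symmetric] by simp
  then have r: "sqrt ((sin \<theta> * cos \<phi>)\<^sup>2 + (sin \<theta> * sin \<phi>)\<^sup>2) = sin \<theta>" using s by simp
  have sg: "0 \<le> sin \<theta> * sin \<phi> \<longleftrightarrow> 0 \<le> \<phi>"
  proof (cases "0 \<le> \<phi>")
    case True
    then show ?thesis using s assms sin_ge_zero[of \<phi>] by simp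
  next
    case False
    then have "sin (- \<phi>) > 0" using assms by (intro sin_gt_zero) auto
    then show ?thesis using s False by (simp add: zero_le_mult_iff)
  qed
  have ac: "arccos (cos \<phi>) = \<bar>\<phi>\<bar>"
    using arccos_cos[of \<phi>] arccos_cos[of "- \<phi>"] assms by (cases "\<phi> < 0") auto
  have "max (- 1) (min 1 (cos \<phi>)) = cos \<phi>" "max (- 1) (min 1 (sin \<theta>)) = sin \<theta>"
    by (simp_all add: min_absorb2 max_absorb2)
  moreover have "arcsin (sin \<theta>) = \<theta>" using assms by (intro arcsin_sin) auto
  ultimately show ?thesis using s sg ac by (auto simp: chart_inv_def chart_def Let_def r)
qed

lemma chart_inv_borel: "chart_inv \<in> borel_measurable borel"
proof -
  have [measurable]: "(\<lambda>x::real. arccos (max (-1) (min 1 x))) \<in> borel_measurable borel"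
    "(\<lambda>x::real. arcsin (max (-1) (min 1 x))) \<in> borel_measurable borel"
    by (intro borel_measurable_continuous_onI continuous_on_arccos continuous_on_arcsin continuous_intros; auto)+
  have "(\<lambda>y. fst (chart_inv y)) \<in> borel_measurable borel" "(\<lambda>y. snd (chart_inv y)) \<in> borel_measurable borel"
    unfolding chart_inv_def Let_def fst_conv snd_conv by measurable
  then have "(\<lambda>y. (fst (chart_inv y), snd (chart_inv y))) \<in> borel_measurable borel"
    by (rule borel_measurable_Pair)
  then show ?thesis by simp
qed

text \<open>Away from a null set the chart is injective, so every Borel set of parameters is a
  preimage of a Borel set of the plane. Hence \<open>u\<close> integrates to 0 over all Borel
  sets.\<close>

theorem E_complete:
  assumes u: "u \<in> L2" and o: "\<And>j. L2_inner u (E j) = 0"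
  shows "AE x in hemi. u x = 0"
proof (rule hemi.density_zero)
  show "integrable hemi u"
    by (rule L2_integrable[OF u])
  fix A assume "A \<in> sets hemi"
  then have A[measurable]: "A \<in> sets borel" by (simp add: sets_hemi)
  note [measurable] = L2_measurable[OF u] continuous_borel[OF chart_cont] chart_inv_borel
  define B where "B = chart_inv -` A"
  have B[measurable]: "B \<in> sets borel" using measurable_sets[OF chart_inv_borel A] by (simp add: B_def)
  have "set_lebesgue_integral hemi A u = (LINT x|hemi. indicator B (chart x) *\<^sub>R u x)"
    unfolding set_lebesgue_integral_def
  proof (rule integral_cong_AE)
    show "AE x in hemi. indicat_real A x *\<^sub>R u x = indicat_real B (chart x) *\<^sub>R u x"
      by (rule AE_hemiI) (simp add: B_def indicator_def chart_inv_chart)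
  qed (unfold borel_measurable_hemi, measurable)
  then show "set_lebesgue_integral hemi A u = 0" using borel_orthogonal[OF u o B] by simp
qed

section \<open>Weak derivatives as elements of \<open>L2\<close>\<close>

text \<open>Here \<open>s\<close> stands for the weak \<open>\<phi>\<close>-derivative divided by \<open>sin \<theta>\<close>, which makes both components of the
  gradient elements of \<open>L2\<close>.\<close>

definition weak_phi :: "(real \<times> real \<Rightarrow> complex) \<Rightarrow> (real \<times> real \<Rightarrow> complex) \<Rightarrow> bool" where
  "weak_phi u s \<longleftrightarrow> (\<forall>\<psi>. test_function \<psi> \<longrightarrow>
    L2_inner u (\<lambda>x. of_real (d2 \<psi> x / sin (fst x))) = - L2_inner s (\<lambda>x. of_real (\<psi> x)))"

definition weak_grad :: "(real \<times> real \<Rightarrow> complex) \<Rightarrow> (real \<times> real \<Rightarrow> complex) \<Rightarrow> (real \<times> real \<Rightarrow> complex) \<Rightarrow> bool" where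
  "weak_grad u p s \<longleftrightarrow> u \<in> L2 \<and> p \<in> L2 \<and> s \<in> L2 \<and> has_weak_dtheta u p \<and> weak_phi u s"

lemma weak_grad_comb:
  assumes "weak_grad u p s" "weak_grad u' p' s'"
  shows "weak_grad (\<lambda>x. a * u x + b * u' x) (\<lambda>x. a * p x + b * p' x) (\<lambda>x. a * s x + b * s' x)"
proof -
  have L: "u \<in> L2" "p \<in> L2" "s \<in> L2" "u' \<in> L2" "p' \<in> L2" "s' \<in> L2"
    using assms by (auto simp: weak_grad_def)
  have L': "(\<lambda>x. a * u x + b * u' x) \<in> L2" "(\<lambda>x. a * p x + b * p' x) \<in> L2" "(\<lambda>x. a * s x + b * s' x) \<in> L2"
    using L by (auto intro: L2.comb_mem)
  have 1: "has_weak_dtheta u p" "has_weak_dtheta u' p'" "weak_phi u s" "weak_phi u' s'"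
    using assms by (auto simp: weak_grad_def)
  show ?thesis unfolding weak_grad_def has_weak_dtheta_iff[OF L'(1,2)] weak_phi_def
  proof (intro conjI L' allI impI)
    fix \<psi> assume t: "test_function \<psi>"
    note T = test_function_L2[OF t]
    show "L2_inner (\<lambda>x. a * u x + b * u' x) (\<lambda>x. of_real (d1 \<psi> x / sin (fst x)))
       = - L2_inner (\<lambda>x. a * p x + b * p' x) (\<lambda>x. of_real (\<psi> x / sin (fst x)))"
      using 1(1)[unfolded has_weak_dtheta_iff[OF L(1,2)]] 1(2)[unfolded has_weak_dtheta_iff[OF L(4,5)]] t
      by (simp add: L2.left[OF L(1,4) T(2)] L2.left[OF L(2,5) T(1)] del: of_real_divide)
    show "L2_inner (\<lambda>x. a * u x + b * u' x) (\<lambda>x. of_real (d2 \<psi> x / sin (fst x)))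
       = - L2_inner (\<lambda>x. a * s x + b * s' x) (\<lambda>x. of_real (\<psi> x))"
      using 1(3,4) t unfolding weak_phi_def
      by (simp add: L2.left[OF L(1,4) T(2)] L2.left[OF L(3,6) T(3)] del: of_real_divide)
  qed
qed

text \<open>Take \<open>q = s * sin\<close>. Dividing by sin again returns \<open>s\<close> except
  where the sine vanishes, so a representative that agrees with \<open>s\<close> almost everywhere
  must replace it.\<close>

lemma weak_phi_rep:
  assumes u: "u \<in> L2" "s \<in> L2" and w: "weak_phi u s"
  obtains q s' where "s' = (\<lambda>x. q x / of_real (sin (fst x)))" "s' \<in> L2" "has_weak_dphi u q" "AE x in hemi. s' x = s x"
proof -
  define q where "q x = s x * of_real (sin (fst x))" for x
  define s' where "s' x = q x / of_real (sin (fst x))" for x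
  have [measurable]: "s \<in> borel_measurable borel" using u by (simp add: L2_measurable)
  have ae: "AE x in hemi. s x = s' x" using AE_hemi_sin by eventually_elim (simp add: s'_def q_def)
  have s'm: "s' \<in> borel_measurable borel" unfolding s'_def[abs_def] q_def by measurable
  have s': "s' \<in> L2" by (rule L2_AE_cong[OF u(2) s'm ae])
  have ae': "AE x in hemi. s' x = s x" using ae by eventually_elim simp
  have eq: "L2_inner s' v = L2_inner s v" if "v \<in> L2" for v
    using ae' by (intro L2_inner_AE_cong s' u that) auto
  have s'_eq: "s' = (\<lambda>x. q x / of_real (sin (fst x)))" by (rule ext) (simp add: s'_def)
  have "has_weak_dphi u q"
    using w eq[OF test_function_L2(3)] has_weak_dphi_iff[OF u(1) s'[unfolded s'_eq]]
    unfolding weak_phi_def s'_eq[symmetric] by simp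
  then show ?thesis using that s'_eq s' ae' by blast
qed

lemma weak_phi_fmode:
  assumes u: "u \<in> L2" "s \<in> L2" and w: "weak_phi u s" and a: "test_profile a a'"
  shows "L2_inner u (fmode (\<lambda>\<theta>. a \<theta> / sin \<theta>) k) * (- \<i> * of_int k) = - L2_inner s (fmode a k)"
proof -
  obtain q s' where q: "s' = (\<lambda>x. q x / of_real (sin (fst x)))" "s' \<in> L2" "has_weak_dphi u q" "AE x in hemi. s' x = s x"
    by (rule weak_phi_rep[OF u w])
  have "fmode a k \<in> L2" using a DERIV_continuous by (intro fmode_L2_cont) (auto simp: test_profile_def)
  then have "L2_inner s' (fmode a k) = L2_inner s (fmode a k)"
    using q(4) by (intro L2_inner_AE_cong q u) auto
  then show ?thesis using weak_dphi_fmode[OF u(1) q(2,3,1) a, of k] by simp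
qed

text \<open>If \<open>u\<close> is null, its weak derivatives are orthogonal to all cut-off
  eigenfunctions, hence in the limit to the eigenfunctions, and \<open>E_complete\<close>
  applies.\<close>

lemma weak_grad_unique0:
  assumes "weak_grad u p s" "AE x in hemi. u x = 0"
  shows "AE x in hemi. p x = 0" "AE x in hemi. s x = 0"
proof -
  have L: "u \<in> L2" "p \<in> L2" "s \<in> L2" and w: "has_weak_dtheta u p" "weak_phi u s"
    using assms by (auto simp: weak_grad_def)
  have u0: "L2_inner u v = 0" if "v \<in> L2" for v
    using L2.null_left[OF L(1) that] L2_q_eq_0[OF L(1)] assms(2) by simp
  have c: "continuous_on UNIV (\<lambda>t. cos t * pf a b t + sin t * (cos t * psum a b (\<lambda>n. real n * sin t ^ (n - 1))))" for a b
    by (intro continuous_intros pf_cont psum_cont)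
  \<comment> \<open>The additional factor sin cancels the division by sin in the pairing of the
    \<theta>-derivative.\<close>
  have tp: "test_profile (\<lambda>\<theta>. cut n \<theta> * (sin \<theta> * pf a b \<theta>))
     (\<lambda>\<theta>. cut1 n \<theta> * (sin \<theta> * pf a b \<theta>) + cut n \<theta> * (cos \<theta> * pf a b \<theta> + sin \<theta> * (cos \<theta> * psum a b (\<lambda>n. real n * sin \<theta> ^ (n - 1)))))" for a b n
    by (rule test_profile_cut[OF _ c]) (rule DERIV_cong[OF DERIV_mult[OF DERIV_sin profile.f_deriv[OF profile_pf]]], simp)
  have tp2: "test_profile (\<lambda>\<theta>. cut n \<theta> * pf a b \<theta>)
     (\<lambda>\<theta>. cut1 n \<theta> * pf a b \<theta> + cut n \<theta> * (cos \<theta> * psum a b (\<lambda>n. real n * sin \<theta> ^ (n - 1))))" for a b n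
    by (rule test_profile_cut[OF profile.f_deriv[OF profile_pf]]) (intro continuous_intros psum_cont)
  have quot: "fmode (\<lambda>\<theta>. g \<theta> / sin \<theta>) k \<in> L2" if t: "test_profile h g'" and "g = h \<or> g = g'" for h g g' k
  proof -
    note T = test_profile_function[OF t, of k]
    note L = test_function_L2[OF T(1)] test_function_L2[OF T(2)]
    have "fmode (\<lambda>\<theta>. h \<theta> / sin \<theta>) k \<in> L2" "fmode (\<lambda>\<theta>. g' \<theta> / sin \<theta>) k \<in> L2"
      using L2.comb_mem[OF L(1) L(4), of 1 \<i>] L2.comb_mem[OF L(2)[of "(1,0)"] L(5)[of "(1,0)"], of 1 \<i>]
      unfolding fmode_split T(3,4) by simp_all
    then show ?thesis using that by auto
  qed
  show "AE x in hemi. p x = 0"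
  proof (rule E_complete[OF L(2)])
    fix j :: "nat \<times> nat" obtain a b where j: "j = (a, b)" by (cases j)
    have "L2_inner p (fmode (\<lambda>\<theta>. cut n \<theta> * pf a b \<theta>) k) = 0" for n k
    proof -
      have "L2_inner p (fmode (\<lambda>\<theta>. cut n \<theta> * (sin \<theta> * pf a b \<theta>) / sin \<theta>) k) = 0"
        using weak_dtheta_fmode[OF L(1,2) w(1) tp[of n a b], of k] u0[OF quot[OF tp, OF disjI2[OF refl]], of n a b k] by simp
      moreover have "L2_inner p (fmode (\<lambda>\<theta>. cut n \<theta> * pf a b \<theta>) k) = L2_inner p (fmode (\<lambda>\<theta>. cut n \<theta> * (sin \<theta> * pf a b \<theta>) / sin \<theta>) k)"
      proof (rule profile.fmode_cong_L2[OF profile_pf L(2)])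
        show "fmode (\<lambda>\<theta>. cut n \<theta> * pf a b \<theta>) k \<in> L2"
          by (intro fmode_L2_cont continuous_intros pf_cont DERIV_continuous[OF cut_deriv])
        show "(\<lambda>\<theta>. cut n \<theta> * (sin \<theta> * pf a b \<theta>) / sin \<theta>) \<in> borel_measurable borel"
          by (intro borel_measurable_divide profile.cut_borel[OF profile_pf] borel_measurable_continuous_onI continuous_intros pf_cont)
        show "cut n \<theta> * pf a b \<theta> = cut n \<theta> * (sin \<theta> * pf a b \<theta>) / sin \<theta>" if "0 < \<theta>" "\<theta> < pi/2" for \<theta>
          using sin_gt_zero2[OF that] by simp
      qed
      ultimately show ?thesis by simp
    qed
    then show "L2_inner p (E j) = 0"
      using profile.L2_cut_tendsto[OF profile_pf L(2) pf_cont, of a b "int a - int b"]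
      by (simp add: j E_def LIMSEQ_const_iff)
  qed
  show "AE x in hemi. s x = 0"
  proof (rule E_complete[OF L(3)])
    fix j :: "nat \<times> nat" obtain a b where j: "j = (a, b)" by (cases j)
    have "L2_inner s (fmode (\<lambda>\<theta>. cut n \<theta> * pf a b \<theta>) k) = 0" for n k
      using weak_phi_fmode[OF L(1,3) w(2) tp2[of n a b], of k] u0[OF quot[OF tp2, OF disjI1[OF refl]], of n a b k] by simp
    then show "L2_inner s (E j) = 0"
      using profile.L2_cut_tendsto[OF profile_pf L(3) pf_cont, of a b "int a - int b"]
      by (simp add: j E_def LIMSEQ_const_iff)
  qed
qed

lemma weak_grad_unique:
  assumes "weak_grad u p s" "weak_grad u' p' s'" "AE x in hemi. u x = u' x"
  shows "AE x in hemi. p x = p' x" "AE x in hemi. s x = s' x"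
  using weak_grad_unique0[OF weak_grad_comb[OF assms(1,2), of 1 "-1"]] assms(3) by auto

definition gphi :: "(real \<times> real \<Rightarrow> complex) \<Rightarrow> real \<times> real \<Rightarrow> complex" where
  "gphi u = (\<lambda>x. weak_dphi u x / of_real (sin (fst x)))"

lemma W21_iff: "u \<in> W21 \<longleftrightarrow> (\<exists>p s. weak_grad u p s)"
proof
  assume "u \<in> W21"
  then obtain p q where u: "u \<in> L2" and p: "p \<in> L2" "has_weak_dtheta u p"
    and q: "(\<lambda>x. q x / of_real (sin (fst x))) \<in> L2" "has_weak_dphi u q"
    unfolding W21_def by blast
  then have "weak_grad u p (\<lambda>x. q x / of_real (sin (fst x)))"
    unfolding weak_grad_def weak_phi_def using has_weak_dphi_iff[OF u q(1)] by blast
  then show "\<exists>p s. weak_grad u p s" by blast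
next
  assume "\<exists>p s. weak_grad u p s"
  then obtain p s where w: "weak_grad u p s" by blast
  then have u: "u \<in> L2" "s \<in> L2" "weak_phi u s" by (auto simp: weak_grad_def)
  obtain q s' where "s' = (\<lambda>x. q x / of_real (sin (fst x)))" "s' \<in> L2" "has_weak_dphi u q"
    using weak_phi_rep[OF u] by blast
  then show "u \<in> W21" using w unfolding W21_def weak_grad_def by blast
qed

lemma weak_grad_choice:
  assumes "u \<in> W21"
  shows "weak_grad u (weak_dtheta u) (gphi u)"
proof -
  have u: "u \<in> L2" and ex1: "\<exists>p. p \<in> L2 \<and> has_weak_dtheta u p"
    and ex2: "\<exists>q. (\<lambda>x. q x / of_real (sin (fst x))) \<in> L2 \<and> has_weak_dphi u q"
    using assms by (auto simp: W21_def)
  have p: "weak_dtheta u \<in> L2 \<and> has_weak_dtheta u (weak_dtheta u)"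
    unfolding weak_dtheta_def by (rule someI_ex[OF ex1])
  have q: "(\<lambda>x. weak_dphi u x / of_real (sin (fst x))) \<in> L2 \<and> has_weak_dphi u (weak_dphi u)"
    unfolding weak_dphi_def by (rule someI_ex[OF ex2])
  then show ?thesis unfolding weak_grad_def weak_phi_def gphi_def using u has_weak_dphi_iff[OF u conjunct1[OF q]] p q by simp
qed

lemma dirichlet_choice:
  assumes "u \<in> W21" "v \<in> W21"
  shows "dirichlet u v = L2_inner (weak_dtheta u) (weak_dtheta v) + L2_inner (gphi u) (gphi v)"
proof -
  have L: "weak_dtheta u \<in> L2" "weak_dtheta v \<in> L2" "gphi u \<in> L2" "gphi v \<in> L2"
    using weak_grad_choice[OF assms(1)] weak_grad_choice[OF assms(2)] by (auto simp: weak_grad_def)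
  have "dirichlet u v = (LINT x|hemi. weak_dtheta u x * cnj (weak_dtheta v x) + gphi u x * cnj (gphi v x))"
    unfolding dirichlet_def gphi_def by (simp add: power2_eq_square)
  also have "\<dots> = L2_inner (weak_dtheta u) (weak_dtheta v) + L2_inner (gphi u) (gphi v)"
    unfolding L2_inner_def
    using L unfolding L2_eq by (intro Bochner_Integration.integral_add ipm_integrable)
  finally show ?thesis .
qed

text \<open>This frees the form from the choices made in \<open>weak_dtheta\<close> and
  \<open>weak_dphi\<close>: any weak gradient computes it.\<close>

lemma dirichlet_eq:
  assumes u: "weak_grad u p s" and v: "weak_grad v p' s'"
  shows "dirichlet u v = L2_inner p p' + L2_inner s s'"
proof -
  have W: "u \<in> W21" "v \<in> W21" using u v by (auto simp: W21_iff)
  note c = weak_grad_choice[OF W(1)] weak_grad_choice[OF W(2)]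
  have "L2_inner (weak_dtheta u) (weak_dtheta v) = L2_inner p p'"
    using c u v weak_grad_unique(1)[OF c(1) u] weak_grad_unique(1)[OF c(2) v]
    by (intro L2_inner_AE_cong) (auto simp: weak_grad_def)
  moreover have "L2_inner (gphi u) (gphi v) = L2_inner s s'"
    using c u v weak_grad_unique(2)[OF c(1) u] weak_grad_unique(2)[OF c(2) v]
    by (intro L2_inner_AE_cong) (auto simp: weak_grad_def)
  ultimately show ?thesis using dirichlet_choice[OF W] by simp
qed

lemma W21_L2: "u \<in> W21 \<Longrightarrow> u \<in> L2"
  by (simp add: W21_def)

lemma W21_lin: "lin_closed W21"
proof -
  have "weak_grad (\<lambda>x. 0) (\<lambda>x. 0) (\<lambda>x. 0)"
    by (auto simp: weak_grad_def has_weak_dtheta_iff weak_phi_def L2.zero_mem L2_inner_def)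
  then have "(\<lambda>x. 0) \<in> W21" by (auto simp: W21_iff)
  moreover have "(\<lambda>x. a * u x + b * v x) \<in> W21" if "u \<in> W21" "v \<in> W21" for u v a b
    using that weak_grad_comb unfolding W21_iff by blast
  ultimately show ?thesis by (simp add: lin_closed_def)
qed

interpretation Wip: pos_hermitian W21 L2_inner
  using hermitian_subspace[OF L2.hermitian_axioms _ W21_lin] W21_L2 L2.pos
  by (auto simp: pos_hermitian_def pos_hermitian_axioms_def)

lemma pos_hermitian_dirichlet: "pos_hermitian W21 dirichlet"
proof
  show "lin_closed W21" by (rule W21_lin)
  show "dirichlet (\<lambda>x. a * u x + b * v x) w = a * dirichlet u w + b * dirichlet v w"
    if "u \<in> W21" "v \<in> W21" "w \<in> W21" for u v w a b
  proof -
    note c = weak_grad_choice[OF that(1)] weak_grad_choice[OF that(2)] weak_grad_choice[OF that(3)]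
    then have "weak_dtheta u \<in> L2" "weak_dtheta v \<in> L2" "weak_dtheta w \<in> L2" "gphi u \<in> L2" "gphi v \<in> L2" "gphi w \<in> L2"
      by (auto simp: weak_grad_def)
    then show ?thesis
      unfolding dirichlet_eq[OF weak_grad_comb[OF c(1,2)] c(3)] dirichlet_eq[OF c(1,3)] dirichlet_eq[OF c(2,3)]
      by (simp add: L2.left algebra_simps)
  qed
  show "dirichlet v u = cnj (dirichlet u v)" if "u \<in> W21" "v \<in> W21" for u v
    using that weak_grad_choice[OF that(1)] weak_grad_choice[OF that(2)]
      L2.sym[of "weak_dtheta u" "weak_dtheta v"] L2.sym[of "gphi u" "gphi v"]
    by (simp add: dirichlet_choice weak_grad_def)
  show "0 \<le> Re (dirichlet u u)" if "u \<in> W21" for u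
    using that weak_grad_choice[OF that] L2.pos by (simp add: dirichlet_choice weak_grad_def)
qed

interpretation WD: pos_hermitian W21 dirichlet by (rule pos_hermitian_dirichlet)

lemma weak_grad_q:
  assumes "weak_grad u p s"
  shows "WD.q u = L2.q p + L2.q s"
  using dirichlet_eq[OF assms assms] by simp

text \<open>The function and both gradient components converge in \<open>L2\<close>, and the
  defining identities pass to the limit because each test function is a fixed vector of
  \<open>L2\<close>.\<close>

theorem W21_complete:
  fixes X :: "nat \<Rightarrow> real \<times> real \<Rightarrow> complex"
  assumes X: "\<And>n. X n \<in> W21"
    and c: "\<And>\<epsilon>::real. \<epsilon> > 0 \<Longrightarrow> \<exists>N::nat. \<forall>m\<ge>N. \<forall>n\<ge>N. Wip.q (\<lambda>x. X m x - X n x) + WD.q (\<lambda>x. X m x - X n x) < \<epsilon>"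
  shows "\<exists>w\<in>W21. (\<lambda>n. Wip.q (\<lambda>x. X n x - w x)) \<longlonglongrightarrow> 0 \<and> (\<lambda>n. WD.q (\<lambda>x. X n x - w x)) \<longlonglongrightarrow> 0"
proof -
  define p where "p n = weak_dtheta (X n)" for n
  define s where "s n = gphi (X n)" for n
  have g: "weak_grad (X n) (p n) (s n)" for n unfolding p_def s_def by (rule weak_grad_choice[OF X])
  have L: "X n \<in> L2" "p n \<in> L2" "s n \<in> L2" for n using g[of n] by (auto simp: weak_grad_def)
  have gd: "weak_grad (\<lambda>x. u x - v x) (\<lambda>x. p x - p' x) (\<lambda>x. s x - s' x)"
    if "weak_grad u p s" "weak_grad v p' s'" for u v p p' s s'
    using weak_grad_comb[OF that, of 1 "-1"] by simp
  have dq: "WD.q (\<lambda>x. X m x - X n x) = L2.q (\<lambda>x. p m x - p n x) + L2.q (\<lambda>x. s m x - s n x)" for m n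
    by (rule weak_grad_q[OF gd[OF g g]])
  have nn: "0 \<le> L2.q (\<lambda>x. X m x - X n x)" "0 \<le> L2.q (\<lambda>x. p m x - p n x)" "0 \<le> L2.q (\<lambda>x. s m x - s n x)" for m n
    using L by (auto intro!: L2.pos L2.diff_mem)
  have small: "a < e \<and> b < e \<and> d < e" if "a + (b + d) < e" "0 \<le> a" "0 \<le> b" "0 \<le> d" for a b d e :: real
    using that by linarith
  have cc: "\<exists>N. \<forall>m\<ge>N. \<forall>n\<ge>N. L2.q (\<lambda>x. X m x - X n x) < e \<and> L2.q (\<lambda>x. p m x - p n x) < e \<and> L2.q (\<lambda>x. s m x - s n x) < e"
    if "e > 0" for e
    using c[OF that] small[OF _ nn] unfolding dq by meson
  obtain u where u: "u \<in> L2" "(\<lambda>n. L2.q (\<lambda>x. X n x - u x)) \<longlonglongrightarrow> 0"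
    by (rule L2_complete[of X]) (use L(1) cc in \<open>meson | assumption\<close>)+
  obtain p' where p': "p' \<in> L2" "(\<lambda>n. L2.q (\<lambda>x. p n x - p' x)) \<longlonglongrightarrow> 0"
    by (rule L2_complete[of p]) (use L(2) cc in \<open>meson | assumption\<close>)+
  obtain s' where s': "s' \<in> L2" "(\<lambda>n. L2.q (\<lambda>x. s n x - s' x)) \<longlonglongrightarrow> 0"
    by (rule L2_complete[of s]) (use L(3) cc in \<open>meson | assumption\<close>)+
  have w: "weak_grad u p' s'"
    unfolding weak_grad_def weak_phi_def has_weak_dtheta_iff[OF u(1) p'(1)]
  proof (intro conjI u p' s' allI impI)
    fix \<psi> assume t: "test_function \<psi>"
    note T = test_function_L2[OF t]
    have 1: "L2_inner (X n) (\<lambda>x. of_real (d1 \<psi> x / sin (fst x))) = - L2_inner (p n) (\<lambda>x. of_real (\<psi> x / sin (fst x)))" for n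
      using g[of n] t has_weak_dtheta_iff[OF L(1)[of n] L(2)[of n]] by (auto simp: weak_grad_def)
    show "L2_inner u (\<lambda>x. of_real (d1 \<psi> x / sin (fst x))) = - L2_inner p' (\<lambda>x. of_real (\<psi> x / sin (fst x)))"
      by (rule LIMSEQ_eqI[OF 1 L2.tendsto_left[OF L(1) u(1) T(2) u(2)] tendsto_minus[OF L2.tendsto_left[OF L(2) p'(1) T(1) p'(2)]]])
    have 2: "L2_inner (X n) (\<lambda>x. of_real (d2 \<psi> x / sin (fst x))) = - L2_inner (s n) (\<lambda>x. of_real (\<psi> x))" for n
      using g[of n] t by (auto simp: weak_grad_def weak_phi_def)
    show "L2_inner u (\<lambda>x. of_real (d2 \<psi> x / sin (fst x))) = - L2_inner s' (\<lambda>x. of_real (\<psi> x))"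
      by (rule LIMSEQ_eqI[OF 2 L2.tendsto_left[OF L(1) u(1) T(2) u(2)] tendsto_minus[OF L2.tendsto_left[OF L(3) s'(1) T(3) s'(2)]]])
  qed
  have "WD.q (\<lambda>x. X n x - u x) = L2.q (\<lambda>x. p n x - p' x) + L2.q (\<lambda>x. s n x - s' x)" for n
    by (rule weak_grad_q[OF gd[OF g w]])
  then have "(\<lambda>n. WD.q (\<lambda>x. X n x - u x)) \<longlonglongrightarrow> 0"
    using tendsto_add[OF p'(2) s'(2)] by simp
  moreover have "u \<in> W21" using w by (auto simp: W21_iff)
  ultimately show ?thesis using u(2) by blast
qed

section \<open>Classical gradients\<close>

lemma hemi_dom_integrable:
  fixes g :: "real \<times> real \<Rightarrow> 'b::{banach, second_countable_topology}"
  assumes g: "continuous_on UNIV g"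
  shows "set_integrable lborel hemi_dom g"
proof (rule set_integrable_subset)
  show "set_integrable lborel (cbox (0, -pi) (pi/2, pi)) g"
    unfolding set_integrable_def
    by (rule borel_integrable_compact) (auto intro: continuous_on_subset[OF g])
  show "hemi_dom \<in> sets lborel" by simp
  show "hemi_dom \<subseteq> cbox (0, -pi) (pi/2, pi)" by (auto simp: hemi_dom_def cbox_Pair_eq)
qed

lemma hemi_dom_Fubini:
  fixes g :: "real \<times> real \<Rightarrow> 'b::{banach, second_countable_topology}"
  assumes g: "continuous_on UNIV g"
  shows "(LINT x:hemi_dom|lborel. g x) = (LINT t:{0..pi/2}|lborel. LINT y:{-pi<..pi}|lborel. g (t, y))"
    and "(LINT x:hemi_dom|lborel. g x) = (LINT y:{-pi<..pi}|lborel. LINT t:{0..pi/2}|lborel. g (t, y))"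
    and "set_integrable lborel {-pi<..pi} (\<lambda>y. LINT t:{0..pi/2}|lborel. g (t, y))"
proof -
  define G where "G x = indicat_real hemi_dom x *\<^sub>R g x" for x
  have G: "integrable (lborel \<Otimes>\<^sub>M lborel) G"
    using hemi_dom_integrable[OF g] by (simp add: set_integrable_def G_def[abs_def] lborel_prod)
  have Geq: "G (t, y) = indicator {0..pi/2} t *\<^sub>R (indicator {-pi<..pi} y *\<^sub>R g (t, y))" for t y
    by (auto simp: G_def hemi_dom_def indicator_def)
  have Geq2: "G (t, y) = indicator {-pi<..pi} y *\<^sub>R (indicator {0..pi/2} t *\<^sub>R g (t, y))" for t y
    by (auto simp: G_def hemi_dom_def indicator_def)
  have int: "(LINT x:hemi_dom|lborel. g x) = (LINT x|(lborel \<Otimes>\<^sub>M lborel). G x)"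
    by (simp add: set_lebesgue_integral_def G_def lborel_prod)
  also have "\<dots> = (LINT t|lborel. LINT y|lborel. G (t, y))"
    by (rule lborel_pair.integral_fst'[OF G, symmetric])
  also have "\<dots> = (LINT t:{0..pi/2}|lborel. LINT y:{-pi<..pi}|lborel. g (t, y))"
    unfolding Geq set_lebesgue_integral_def by (simp del: scaleR_scaleR)
  finally show "(LINT x:hemi_dom|lborel. g x) = (LINT t:{0..pi/2}|lborel. LINT y:{-pi<..pi}|lborel. g (t, y))" .
  have G': "integrable (lborel \<Otimes>\<^sub>M lborel) (\<lambda>(t, y). G (t, y))" using G by simp
  have "(LINT x|(lborel \<Otimes>\<^sub>M lborel). G x) = (LINT y|lborel. LINT t|lborel. G (t, y))"
    using lborel_pair.integral_snd[OF G'] by simp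
  also have "\<dots> = (LINT y:{-pi<..pi}|lborel. LINT t:{0..pi/2}|lborel. g (t, y))"
    unfolding Geq2 set_lebesgue_integral_def by (simp del: scaleR_scaleR)
  finally show "(LINT x:hemi_dom|lborel. g x) = (LINT y:{-pi<..pi}|lborel. LINT t:{0..pi/2}|lborel. g (t, y))"
    unfolding int .
  have "integrable lborel (\<lambda>y. LINT t|lborel. G (t, y))"
    by (rule lborel_pair.integrable_snd[OF G'])
  then show "set_integrable lborel {-pi<..pi} (\<lambda>y. LINT t:{0..pi/2}|lborel. g (t, y))"
    unfolding Geq2 set_lebesgue_integral_def set_integrable_def by (simp del: scaleR_scaleR)
qed

lemma partial_vector_derivative:
  assumes "C1 (\<psi> :: real \<times> real \<Rightarrow> real)"
  shows "((\<lambda>t. \<psi> (t, y)) has_vector_derivative d1 \<psi> (t, y)) (at t within S)"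
    and "((\<lambda>y. \<psi> (t, y)) has_vector_derivative d2 \<psi> (t, y)) (at y within S)"
proof -
  have D: "(\<psi> has_derivative frechet_derivative \<psi> (at x)) (at x)" for x using C1_has_derivative[OF assms] .
  have lin: "linear (frechet_derivative \<psi> (at x))" for x by (rule C1_linear_fd[OF assms])
  have lf: "((\<lambda>t. (t, y)) has_derivative (\<lambda>h. (h, 0))) (at t)" by (auto intro!: derivative_eq_intros)
  have D1: "((\<lambda>t. \<psi> (t, y)) has_derivative (\<lambda>h. frechet_derivative \<psi> (at (t, y)) (h, 0))) (at t)"
    by (rule has_derivative_compose[OF lf D])
  have D2: "frechet_derivative \<psi> (at (t, y)) (h, 0) = h *\<^sub>R d1 \<psi> (t, y)" for h
  proof -
    have "frechet_derivative \<psi> (at (t, y)) (h, 0) = frechet_derivative \<psi> (at (t, y)) (h *\<^sub>R (1, 0))" by simp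
    also have "\<dots> = h *\<^sub>R d1 \<psi> (t, y)" by (rule linear_scale[OF lin])
    finally show ?thesis .
  qed
  have "((\<lambda>t. \<psi> (t, y)) has_derivative (\<lambda>h. h *\<^sub>R d1 \<psi> (t, y))) (at t)"
    by (rule has_derivative_eq_rhs[OF D1]) (rule ext, rule D2)
  then show "((\<lambda>t. \<psi> (t, y)) has_vector_derivative d1 \<psi> (t, y)) (at t within S)"
    unfolding has_vector_derivative_def by (rule has_derivative_at_withinI)
  have lf: "((\<lambda>y. (t, y)) has_derivative (\<lambda>h. (0, h))) (at y)" by (auto intro!: derivative_eq_intros)
  have D1: "((\<lambda>y. \<psi> (t, y)) has_derivative (\<lambda>h. frechet_derivative \<psi> (at (t, y)) (0, h))) (at y)"
    by (rule has_derivative_compose[OF lf D])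
  have D2: "frechet_derivative \<psi> (at (t, y)) (0, h) = h *\<^sub>R d2 \<psi> (t, y)" for h
  proof -
    have "frechet_derivative \<psi> (at (t, y)) (0, h) = frechet_derivative \<psi> (at (t, y)) (h *\<^sub>R (0, 1))" by simp
    also have "\<dots> = h *\<^sub>R d2 \<psi> (t, y)" by (rule linear_scale[OF lin])
    finally show ?thesis .
  qed
  have "((\<lambda>y. \<psi> (t, y)) has_derivative (\<lambda>h. h *\<^sub>R d2 \<psi> (t, y))) (at y)"
    by (rule has_derivative_eq_rhs[OF D1]) (rule ext, rule D2)
  then show "((\<lambda>y. \<psi> (t, y)) has_vector_derivative d2 \<psi> (t, y)) (at y within S)"
    unfolding has_vector_derivative_def by (rule has_derivative_at_withinI)
qed

text \<open>Integrate by parts along meridians, where the test function vanishes at both ends, and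
  along parallels, where everything is periodic. Giving the \<phi>-derivative as
  \<open>sin * s\<close> with continuous \<open>s\<close> makes the gradient bounded at the
  pole.\<close>

theorem classical_weak_grad:
  assumes c: "continuous_on UNIV w" "continuous_on UNIV w1" "continuous_on UNIV s"
    and t: "\<And>t y. ((\<lambda>t. w (t, y)) has_vector_derivative w1 (t, y)) (at t)"
    and p: "\<And>t y. ((\<lambda>y. w (t, y)) has_vector_derivative (of_real (sin t) * s (t, y))) (at y)"
    and per: "\<And>t y. w (t, y + 2 * pi) = w (t, y)"
  shows "weak_grad w w1 s"
proof -
  have L: "w \<in> L2" "w1 \<in> L2" "s \<in> L2" using c by (auto intro: L2_continuous)
  define w2 where "w2 x = of_real (sin (fst x)) * s x" for x
  have c2: "continuous_on UNIV w2" unfolding w2_def[abs_def] by (intro continuous_intros c)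
  have pair: "continuous_on UNIV f \<Longrightarrow> continuous_on S (\<lambda>t. f (t, y))" "continuous_on UNIV f \<Longrightarrow> continuous_on S (\<lambda>y. f (t, y))"
    for f :: "real \<times> real \<Rightarrow> complex" and S t y
    by (erule continuous_on_compose2, auto intro!: continuous_intros)+
  have "has_weak_dtheta w w1" unfolding has_weak_dtheta_def
  proof (intro allI impI)
    fix \<psi> assume ps: "test_function \<psi>"
    note C = test_function_C1[OF ps]
    define g where "g x = d1 \<psi> x *\<^sub>R w x + \<psi> x *\<^sub>R w1 x" for x
    have gc: "continuous_on UNIV g" unfolding g_def[abs_def]
      by (intro continuous_intros c C1_continuous[OF C] C1_continuous_partial[OF C])
    obtain \<epsilon> where e: "\<epsilon> > 0" "\<And>\<theta> \<phi>. \<theta> < \<epsilon> \<or> pi/2 - \<epsilon> < \<theta> \<Longrightarrow> \<psi> (\<theta>, \<phi>) = 0"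
      using ps unfolding test_function_def by blast
    have inner: "(LINT t:{0..pi/2}|lborel. g (t, y)) = 0" for y
    proof -
      have "(LINT t:{0..pi/2}|lborel. g (t, y)) = \<psi> (pi/2, y) *\<^sub>R w (pi/2, y) - \<psi> (0, y) *\<^sub>R w (0, y)"
        unfolding set_lebesgue_integral_def
      proof (rule integral_FTC_Icc)
        show "((\<lambda>t. \<psi> (t, y) *\<^sub>R w (t, y)) has_vector_derivative g (t, y)) (at t within {0..pi/2})" for t
          using has_vector_derivative_scaleR[OF partial_vector_derivative(1)[OF C, unfolded has_real_derivative_iff_has_vector_derivative[symmetric]] has_vector_derivative_at_within[OF t]]
          by (simp add: g_def add.commute)
        show "continuous_on {0..pi/2} (\<lambda>t. g (t, y))" by (rule pair[OF gc])
      qed simp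
      then show ?thesis using e by simp
    qed
    have "(LINT x:hemi_dom|lborel. g x) = 0"
      unfolding hemi_dom_Fubini(2)[OF gc] inner by simp
    moreover have "(LINT x:hemi_dom|lborel. g x) = (LINT x:hemi_dom|lborel. d1 \<psi> x *\<^sub>R w x) + (LINT x:hemi_dom|lborel. \<psi> x *\<^sub>R w1 x)"
      unfolding g_def
      by (intro set_integral_add hemi_dom_integrable continuous_intros c C1_continuous[OF C] C1_continuous_partial[OF C])
    ultimately show "(LINT x:hemi_dom|lborel. d1 \<psi> x *\<^sub>R w x) = - (LINT x:hemi_dom|lborel. \<psi> x *\<^sub>R w1 x)"
      by (simp add: eq_neg_iff_add_eq_0)
  qed
  moreover have "weak_phi w s"
    unfolding weak_phi_def
  proof (intro allI impI)
    fix \<psi> assume ps: "test_function \<psi>"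
    note C = test_function_C1[OF ps]
    define g where "g x = d2 \<psi> x *\<^sub>R w x + \<psi> x *\<^sub>R w2 x" for x
    have gc: "continuous_on UNIV g" unfolding g_def[abs_def]
      by (intro continuous_intros c c2 C1_continuous[OF C] C1_continuous_partial[OF C])
    have inner: "(LINT y:{-pi<..pi}|lborel. g (t, y)) = 0" for t
    proof -
      have "(LINT y:{-pi<..pi}|lborel. g (t, y)) = (LINT y:{-pi..pi}|lborel. g (t, y))"
        by (rule set_integral_discrete_difference[where X="{-pi}"]) auto
      also have "\<dots> = \<psi> (t, pi) *\<^sub>R w (t, pi) - \<psi> (t, -pi) *\<^sub>R w (t, -pi)"
        unfolding set_lebesgue_integral_def
      proof (rule integral_FTC_Icc)
        show "((\<lambda>y. \<psi> (t, y) *\<^sub>R w (t, y)) has_vector_derivative g (t, y)) (at y within {-pi..pi})" for y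
          using has_vector_derivative_scaleR[OF partial_vector_derivative(2)[OF C, unfolded has_real_derivative_iff_has_vector_derivative[symmetric]] has_vector_derivative_at_within[OF p]]
          by (simp add: g_def w2_def add.commute)
        show "continuous_on {-pi..pi} (\<lambda>y. g (t, y))" by (rule pair[OF gc])
      qed simp
      also have "\<dots> = 0"
      proof -
        have "-pi + 2 * pi = pi" by simp
        moreover have "\<psi> (t, -pi + 2 * pi) = \<psi> (t, -pi)" using ps unfolding test_function_def by blast
        ultimately show ?thesis using per[of t "-pi"] by simp
      qed
      finally show ?thesis .
    qed
    have "(LINT x:hemi_dom|lborel. g x) = 0"
      unfolding hemi_dom_Fubini(1)[OF gc] inner by simp
    moreover have "(LINT x:hemi_dom|lborel. g x) = (LINT x:hemi_dom|lborel. d2 \<psi> x *\<^sub>R w x) + (LINT x:hemi_dom|lborel. \<psi> x *\<^sub>R w2 x)"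
      unfolding g_def
      by (intro set_integral_add hemi_dom_integrable continuous_intros c c2 C1_continuous[OF C] C1_continuous_partial[OF C])
    moreover have "(LINT x:hemi_dom|lborel. d2 \<psi> x *\<^sub>R w x) = L2_inner w (\<lambda>x. of_real (d2 \<psi> x / sin (fst x)))"
      by (intro weak_pairing continuous_borel c C1_continuous_partial C test_function_at_pole ps)
    moreover have "(LINT x:hemi_dom|lborel. \<psi> x *\<^sub>R w2 x) = L2_inner w2 (\<lambda>x. of_real (\<psi> x / sin (fst x)))"
      by (intro weak_pairing continuous_borel c2 C1_continuous C test_function_at_pole ps)
    moreover have "L2_inner w2 (\<lambda>x. of_real (\<psi> x / sin (fst x))) = L2_inner s (\<lambda>x. of_real (\<psi> x))"
      unfolding L2_inner_def
    proof (rule integral_cong_AE)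
      note [measurable] = continuous_borel[OF c2] continuous_borel[OF c(3)] continuous_borel[OF C1_continuous[OF C]]
      show "(\<lambda>x. w2 x * cnj (of_real (\<psi> x / sin (fst x)))) \<in> borel_measurable hemi"
        unfolding borel_measurable_hemi by measurable
      show "(\<lambda>x. s x * cnj (of_real (\<psi> x))) \<in> borel_measurable hemi"
        unfolding borel_measurable_hemi by measurable
      show "AE x in hemi. w2 x * cnj (of_real (\<psi> x / sin (fst x))) = s x * cnj (of_real (\<psi> x))"
        using AE_hemi_sin by eventually_elim (simp add: w2_def)
    qed
    ultimately show "L2_inner w (\<lambda>x. of_real (d2 \<psi> x / sin (fst x))) = - L2_inner s (\<lambda>x. of_real (\<psi> x))"
      by (simp add: eq_neg_iff_add_eq_0)
  qed
  ultimately show ?thesis using L by (simp add: weak_grad_def)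
qed

section \<open>Boundary traces\<close>

text \<open>By the chain rule the \<phi>-derivative of \<open>sphere_point\<close> has the factor
  sin, so the quotient \<open>s\<close> is an ambient directional derivative and is continuous at
  the pole.\<close>

lemma C1_hemi_classical:
  assumes "w \<in> C1_hemi"
  obtains w1 s where "continuous_on UNIV w" "continuous_on UNIV w1" "continuous_on UNIV s"
    "\<And>t y. ((\<lambda>t. w (t, y)) has_vector_derivative w1 (t, y)) (at t)" "weak_grad w w1 s"
proof -
  obtain F where w: "w = F \<circ> sphere_point" and "C1 F" using assms by (auto simp: C1_hemi_def)
  then obtain F' where F': "\<And>x. (F has_derivative blinfun_apply (F' x)) (at x)" "continuous_on UNIV F'"
    unfolding C1_def by blast
  have spc: "continuous_on UNIV sphere_point"
    unfolding sphere_point_def case_prod_beta by (intro continuous_intros)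
  have cF': "continuous_on UNIV (\<lambda>x. F' (sphere_point x))"
    by (rule continuous_on_compose2[OF F'(2) spc]) simp
  define w1 where "w1 x = blinfun_apply (F' (sphere_point x)) (cos (fst x) * cos (snd x), cos (fst x) * sin (snd x), - sin (fst x))" for x
  define s where "s x = blinfun_apply (F' (sphere_point x)) (- sin (snd x), cos (snd x), 0)" for x
  have cw: "continuous_on UNIV w" unfolding w
    using C1_continuous[OF \<open>C1 F\<close>] by (intro continuous_on_compose spc) (auto intro: continuous_on_subset)
  have c1: "continuous_on UNIV w1" "continuous_on UNIV s"
    unfolding w1_def[abs_def] s_def[abs_def] by (intro continuous_intros cF')+
  have sp: "sphere_point (t, y) = (sin t * cos y, sin t * sin y, cos t)" for t y by (simp add: sphere_point_def)
  have t: "((\<lambda>t. w (t, y)) has_vector_derivative w1 (t, y)) (at t)" for t y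
  proof -
    have "((\<lambda>t. (sin t * cos y, sin t * sin y, cos t)) has_derivative (\<lambda>h. h *\<^sub>R (cos t * cos y, cos t * sin y, - sin t))) (at t)"
      by (auto intro!: derivative_eq_intros)
    from has_derivative_compose[OF this F'(1)]
    show ?thesis unfolding has_vector_derivative_def w o_def sp w1_def fst_conv snd_conv by (simp add: blinfun.scaleR_right del: scaleR_Pair)
  qed
  have p: "((\<lambda>y. w (t, y)) has_vector_derivative (of_real (sin t) * s (t, y))) (at y)" for t y
  proof -
    have "((\<lambda>y. (sin t * cos y, sin t * sin y, cos t)) has_derivative (\<lambda>h. h *\<^sub>R sin t *\<^sub>R (- sin y, cos y, 0))) (at y)"
      by (auto intro!: derivative_eq_intros)
    from has_derivative_compose[OF this F'(1)]
    show ?thesis unfolding has_vector_derivative_def w o_def sp s_def fst_conv snd_conv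
      by (simp add: blinfun.scaleR_right scaleR_conv_of_real[symmetric] del: scaleR_Pair)
  qed
  have "weak_grad w w1 s"
    by (rule classical_weak_grad[OF cw c1 t p]) (simp add: w sp)
  then show ?thesis using that cw c1 t by blast
qed

lemma C1_hemi_W21: "w \<in> C1_hemi \<Longrightarrow> w \<in> W21"
  using C1_hemi_classical W21_iff by metis

lemma C1_comb:
  fixes f g :: "'a::real_normed_vector \<Rightarrow> complex"
  assumes "C1 f" "C1 g"
  shows "C1 (\<lambda>x. a * f x + b * g x)"
proof -
  obtain f' g' where *: "\<And>x. (f has_derivative blinfun_apply (f' x)) (at x)" "continuous_on UNIV f'"
    "\<And>x. (g has_derivative blinfun_apply (g' x)) (at x)" "continuous_on UNIV g'"
    using assms unfolding C1_def by blast
  define F where "F x = (blinfun_mult_right a o\<^sub>L f' x) + (blinfun_mult_right b o\<^sub>L g' x)" for x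
  have "((\<lambda>x. a * f x + b * g x) has_derivative blinfun_apply (F x)) (at x)" for x
    by (rule has_derivative_eq_rhs[OF has_derivative_add[OF has_derivative_mult_right[OF *(1)] has_derivative_mult_right[OF *(3)]]])
      (auto simp: F_def blinfun.add_left)
  moreover have "continuous_on UNIV F" unfolding F_def[abs_def] by (intro continuous_intros *)
  ultimately show ?thesis unfolding C1_def by blast
qed

lemma C1_mult:
  fixes f g :: "'a::real_normed_vector \<Rightarrow> complex"
  assumes "C1 f" "C1 g"
  shows "C1 (\<lambda>x. f x * g x)"
proof -
  obtain f' g' where *: "\<And>x. (f has_derivative blinfun_apply (f' x)) (at x)" "continuous_on UNIV f'"
    "\<And>x. (g has_derivative blinfun_apply (g' x)) (at x)" "continuous_on UNIV g'"
    using assms unfolding C1_def by blast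
  define F where "F x = (blinfun_mult_right (f x) o\<^sub>L g' x) + (blinfun_mult_left (g x) o\<^sub>L f' x)" for x
  have "((\<lambda>x. f x * g x) has_derivative blinfun_apply (F x)) (at x)" for x
    by (rule has_derivative_eq_rhs[OF has_derivative_mult[OF *(1,3)]])
      (auto simp: F_def blinfun.add_left)
  moreover have "continuous_on UNIV F" unfolding F_def[abs_def]
    by (intro continuous_intros * bounded_linear.continuous_on[OF bounded_linear_blinfun_mult_right]
        bounded_linear.continuous_on[OF bounded_linear_blinfun_mult_left] C1_continuous assms)
  ultimately show ?thesis unfolding C1_def by blast
qed

lemma C1_const: "C1 (\<lambda>x. c)"
  unfolding C1_def by (intro exI[of _ "\<lambda>_. 0"]) (auto simp: zero_blinfun.rep_eq)

lemma C1_bounded_linear: "bounded_linear f \<Longrightarrow> C1 f"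
  unfolding C1_def
  by (intro exI[of _ "\<lambda>_. Blinfun f"]) (auto simp: bounded_linear_Blinfun_apply bounded_linear_imp_has_derivative)

lemma C1_power: "C1 f \<Longrightarrow> C1 (\<lambda>x. f x ^ n :: complex)"
  by (induction n) (auto intro: C1_const C1_mult)

lemma C1_hemi_lin: "lin_closed C1_hemi"
  unfolding lin_closed_def
proof (intro conjI ballI allI)
  show "(\<lambda>x. 0) \<in> C1_hemi" unfolding C1_hemi_def by (auto intro!: exI[of _ "\<lambda>_. 0"] C1_const)
  fix u v a b assume "u \<in> C1_hemi" "v \<in> C1_hemi"
  then obtain F G where "u = F \<circ> sphere_point" "v = G \<circ> sphere_point" "C1 F" "C1 G" by (auto simp: C1_hemi_def)
  then show "(\<lambda>x. a * u x + b * v x) \<in> C1_hemi" unfolding C1_hemi_def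
    by (auto intro!: exI[of _ "\<lambda>x. a * F x + b * G x"] C1_comb)
qed

lemma C1_hemi_comb: "\<lbrakk>u \<in> C1_hemi; v \<in> C1_hemi\<rbrakk> \<Longrightarrow> (\<lambda>x. a * u x + b * v x) \<in> C1_hemi"
  using C1_hemi_lin by (simp add: lin_closed_def)

lemma C1_hemi_diff: "\<lbrakk>u \<in> C1_hemi; v \<in> C1_hemi\<rbrakk> \<Longrightarrow> (\<lambda>x. u x - v x) \<in> C1_hemi"
  using C1_hemi_comb[of u v 1 "-1"] by simp

lemma zmono_C1_hemi: "zmono a b \<in> C1_hemi"
proof -
  define F :: "real \<times> real \<times> real \<Rightarrow> complex"
    where "F x = (of_real (fst x) + \<i> * of_real (fst (snd x))) ^ a * (of_real (fst x) - \<i> * of_real (fst (snd x))) ^ b" for x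
  have "C1 F" unfolding F_def[abs_def]
    by (intro C1_mult C1_power C1_bounded_linear bounded_linear_add bounded_linear_sub bounded_linear_const_mult
        bounded_linear_compose[OF bounded_linear_of_real] bounded_linear_fst bounded_linear_compose[OF bounded_linear_fst] bounded_linear_snd)
  moreover have "zmono a b = F \<circ> sphere_point"
  proof
    fix x :: "real \<times> real"
    have "of_real (sin (fst x)) * cis (snd x) = of_real (fst (sphere_point x)) + \<i> * of_real (fst (snd (sphere_point x)))"
      "of_real (sin (fst x)) * cis (- snd x) = of_real (fst (sphere_point x)) - \<i> * of_real (fst (snd (sphere_point x)))"
      by (auto simp: sphere_point_def complex_eq_iff split: prod.splits)
    then show "zmono a b x = (F \<circ> sphere_point) x" by (simp only: zmono_eq F_def o_apply)
  qed
  ultimately show ?thesis by (auto simp: C1_hemi_def)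
qed

lemma C1_hemi_sum: "(\<And>i. i \<in> A \<Longrightarrow> u i \<in> C1_hemi) \<Longrightarrow> (\<lambda>x. \<Sum>i\<in>A. c i * u i x) \<in> C1_hemi"
proof (induction A rule: infinite_finite_induct)
  case (insert i A)
  then have "(\<lambda>x. c i * u i x + 1 * (\<Sum>i\<in>A. c i * u i x)) \<in> C1_hemi"
    by (intro C1_hemi_comb) auto
  with insert show ?case by simp
qed (use C1_hemi_lin in \<open>auto simp: lin_closed_def\<close>)

lemma E_C1_hemi: "E j \<in> C1_hemi"
proof -
  obtain a b where j: "j = (a, b)" by (cases j)
  have "E j = (\<lambda>x. \<Sum>i\<in>{..min a b}. of_real (coef a b i) * zmono (a - i) (b - i) x)"
    unfolding j by (intro ext E_expand)
  then show ?thesis by (simp add: C1_hemi_sum zmono_C1_hemi)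
qed

section \<open>The trace inequality for C1 functions\<close>

definition tr :: "(real \<times> real \<Rightarrow> complex) \<Rightarrow> real \<Rightarrow> complex" where
  "tr w = (\<lambda>y. w (pi/2, y))"

lemma tr_sqi: "continuous_on UNIV w \<Longrightarrow> tr w \<in> sqi circ"
  unfolding tr_def
  by (rule sqi_circ_continuous, erule continuous_on_compose2) (auto intro!: continuous_intros)

text \<open>Integrate the \<open>\<theta>\<close>-derivative of \<open>sin\<^sup>2 \<theta> |w|\<^sup>2\<close> over a meridian.\<close>

lemma trace_inequality:
  assumes c: "continuous_on UNIV w" "continuous_on UNIV w1"
    and t: "\<And>t y. ((\<lambda>t. w (t, y)) has_vector_derivative w1 (t, y)) (at t)"
  shows "C.q (tr w) \<le> 3 * L2.q w + L2.q w1"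
proof -
  define G where "G x = sin (fst x) * (3 * (cmod (w x))\<^sup>2 + (cmod (w1 x))\<^sup>2)" for x
  have Gc: "continuous_on UNIV G" unfolding G_def[abs_def] by (intro continuous_intros c)
  have pair: "continuous_on UNIV f \<Longrightarrow> continuous_on S (\<lambda>t. f (t, y))"
    for f :: "real \<times> real \<Rightarrow> 'z::topological_space" and S y
    by (erule continuous_on_compose2, auto intro!: continuous_intros)
  have pt: "(cmod (w (pi/2, y)))\<^sup>2 \<le> (LINT t:{0..pi/2}|lborel. G (t, y))" for y
  proof -
    define g where "g t = 2 * sin t * cos t * (cmod (w (t, y)))\<^sup>2 + (sin t)\<^sup>2 * (2 * (w (t, y) \<bullet> w1 (t, y)))" for t
    have gc: "continuous_on S g" for S unfolding g_def by (intro continuous_intros pair c)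
    have d: "((\<lambda>t. (sin t)\<^sup>2 * (w (t, y) \<bullet> w (t, y))) has_real_derivative g t) (at t)" for t
    proof -
      have e1: "((\<lambda>t. w (t, y) \<bullet> w (t, y)) has_real_derivative 2 * (w (t, y) \<bullet> w1 (t, y))) (at t)"
        using has_derivative_inner[OF t[of y t, unfolded has_vector_derivative_def] t[of y t, unfolded has_vector_derivative_def]]
        unfolding has_field_derivative_def
        by (rule has_derivative_eq_rhs) (auto simp: inner_commute algebra_simps)
      have e2: "((\<lambda>t. (sin t)\<^sup>2) has_real_derivative 2 * sin t * cos t) (at t)"
        by (auto intro!: derivative_eq_intros)
      show ?thesis
        by (rule DERIV_cong[OF DERIV_mult[OF e2 e1]]) (simp add: g_def dot_square_norm mult_ac)
    qed
    have "(LINT t|lborel. g t * indicator {0..pi/2} t) = (sin (pi/2))\<^sup>2 * (w (pi/2, y) \<bullet> w (pi/2, y)) - (sin 0)\<^sup>2 * (w (0, y) \<bullet> w (0, y))"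
      by (intro integral_FTC_Icc_real d) (use gc[of UNIV] in \<open>auto simp: continuous_on_eq_continuous_at\<close>)
    then have "(cmod (w (pi/2, y)))\<^sup>2 = (LINT t:{0..pi/2}|lborel. g t)"
      by (simp add: dot_square_norm set_lebesgue_integral_def mult.commute)
    also have "\<dots> \<le> (LINT t:{0..pi/2}|lborel. G (t, y))"
    proof (rule set_integral_mono)
      show "set_integrable lborel {0..pi/2} g" by (rule borel_integrable_atLeastAtMost'[OF gc])
      show "set_integrable lborel {0..pi/2} (\<lambda>t. G (t, y))" by (rule borel_integrable_atLeastAtMost'[OF pair[OF Gc]])
      fix t assume "t \<in> {0..pi/2}"
      then have s: "0 \<le> sin t" "sin t \<le> 1" by (auto intro: sin_ge_zero)
      define A B where "A = cmod (w (t, y))" and "B = cmod (w1 (t, y))"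
      \<comment> \<open>The weight 3 is 2 from differentiating the squared sine plus 1 from
        splitting the mixed term. One factor sin is kept as the density of the measure.\<close>
      have "cos t * A\<^sup>2 \<le> 1 * A\<^sup>2" by (intro mult_right_mono) auto
      moreover have "sin t * (2 * (w (t, y) \<bullet> w1 (t, y))) \<le> 1 * (A\<^sup>2 + B\<^sup>2)"
      proof (rule order_trans[OF mult_left_mono[OF _ s(1)] mult_right_mono[OF s(2)]])
        have "w (t, y) \<bullet> w1 (t, y) \<le> A * B" unfolding A_def B_def by (rule norm_cauchy_schwarz)
        then show "2 * (w (t, y) \<bullet> w1 (t, y)) \<le> A\<^sup>2 + B\<^sup>2" using sum_squares_bound[of A B] by simp
      qed simp
      ultimately have "2 * (cos t * A\<^sup>2) + sin t * (2 * (w (t, y) \<bullet> w1 (t, y))) \<le> 3 * A\<^sup>2 + B\<^sup>2" by simp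
      from mult_left_mono[OF this s(1)] show "g t \<le> G (t, y)"
        by (simp add: g_def G_def A_def B_def power2_eq_square algebra_simps)
    qed
    finally show ?thesis .
  qed
  have "C.q (tr w) = (LINT y:{-pi<..pi}|lborel. (cmod (w (pi/2, y)))\<^sup>2)"
  proof -
    have "(\<lambda>y. (cmod (tr w y))\<^sup>2) \<in> borel_measurable borel"
      using sqi_measurable[OF tr_sqi[OF c(1)]] unfolding borel_measurable_circ by measurable
    then show ?thesis unfolding ipm_norm by (subst integral_circ) (auto simp: tr_def)
  qed
  also have "\<dots> \<le> (LINT y:{-pi<..pi}|lborel. LINT t:{0..pi/2}|lborel. G (t, y))"
  proof (rule set_integral_mono[OF _ hemi_dom_Fubini(3)[OF Gc] pt])
    show "set_integrable lborel {-pi<..pi} (\<lambda>y. (cmod (w (pi/2, y)))\<^sup>2)"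
    proof -
      have "(\<lambda>y. (cmod (tr w y))\<^sup>2) \<in> borel_measurable borel"
        using sqi_measurable[OF tr_sqi[OF c(1)]] unfolding borel_measurable_circ by measurable
      from integrable_circ[OF this] sqi_integrable[OF tr_sqi[OF c(1)]] show ?thesis by (simp add: tr_def)
    qed
  qed
  also have "\<dots> = (LINT x:hemi_dom|lborel. G x)" by (rule hemi_dom_Fubini(2)[OF Gc, symmetric])
  also have "\<dots> = (LINT x|hemi. 3 * (cmod (w x))\<^sup>2 + (cmod (w1 x))\<^sup>2)"
  proof -
    note [measurable] = continuous_borel[OF c(1)] continuous_borel[OF c(2)]
    show ?thesis by (subst integral_hemi) (auto simp: set_lebesgue_integral_def G_def mult.assoc)
  qed
  also have "\<dots> = 3 * L2.q w + L2.q w1"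
    unfolding L2_inner_eq ipm_norm
    using L2_continuous[OF c(1)] L2_continuous[OF c(2)] unfolding L2_eq
    by (subst Bochner_Integration.integral_add) (auto simp: sqi_def)
  finally show ?thesis .
qed

lemma C1_hemi_trace:
  assumes "w \<in> C1_hemi"
  shows "tr w \<in> sqi circ" "C.q (tr w) \<le> 3 * (Wip.q w + WD.q w)"
proof -
  obtain w1 s where w: "continuous_on UNIV w" "continuous_on UNIV w1" "continuous_on UNIV s"
    "\<And>t y. ((\<lambda>t. w (t, y)) has_vector_derivative w1 (t, y)) (at t)" "weak_grad w w1 s"
    by (rule C1_hemi_classical[OF assms]) (rule that)
  show "tr w \<in> sqi circ" by (rule tr_sqi[OF w(1)])
  have "L2.q w1 \<le> WD.q w" "0 \<le> WD.q w"
    using weak_grad_q[OF w(5)] w(5) L2.pos by (auto simp: weak_grad_def)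
  then show "C.q (tr w) \<le> 3 * (Wip.q w + WD.q w)"
    using trace_inequality[OF w(1,2,4)] by simp
qed

section \<open>Estimates\<close>

text \<open>The junk value \<open>zt 0 = 0\<close> lets sums of \<open>zt\<close> run through truncated differences.\<close>

definition zt :: "nat \<Rightarrow> real" where "zt j = 1 / (real j * sqrt (real j))"

lemma zt_0 [simp]: "zt 0 = 0" and zt_nonneg: "0 \<le> zt j"
  by (simp_all add: zt_def)

text \<open>Each term after the first is at most a telescoping difference
  \<open>2 / sqrt n - 2 / sqrt (n + 1)\<close>, as in the comparison with an integral; the first
  term is 1.\<close>

lemma zt_sum_upto: "(\<Sum>j=1..Suc N. zt j) \<le> 3 - 2 / sqrt (real (Suc N))"
proof (induction N)
  case 0
  then show ?case by (simp add: zt_def)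
next
  case (Suc N)
  define a b where "a = sqrt (real (Suc N))" and "b = sqrt (real (Suc (Suc N)))"
  have ab: "0 < a" "0 < b" "a \<le> b" "a\<^sup>2 = real (Suc N)" "b\<^sup>2 = real (Suc N) + 1" by (auto simp: a_def b_def)
  have "(b - a) * (b + a) = 1" using ab by (simp add: power2_eq_square algebra_simps)
  moreover have "(b - a) * (b + a) \<le> (b - a) * (2 * b)" using ab by (intro mult_left_mono) auto
  ultimately have "1 \<le> 2 * (b - a) * b" by (simp add: algebra_simps)
  then have "1 / (b * b * b) \<le> (2 * (b - a) * b) / (b * b * b)" using ab by (intro divide_right_mono) auto
  also have "\<dots> = 2 * (b - a) / (b * b)" using ab by simp
  also have "\<dots> \<le> 2 * (b - a) / (a * b)" using ab by (intro divide_left_mono mult_right_mono) auto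
  also have "\<dots> = 2 / a - 2 / b" using ab by (simp add: field_simps)
  finally have "zt (Suc (Suc N)) \<le> 2 / a - 2 / b"
    using ab(5) by (simp add: zt_def power2_eq_square b_def del: real_sqrt_mult_self)
  then show ?case using Suc by (simp add: a_def b_def)
qed

lemma zt_sum:
  assumes "finite A" "inj_on f {l\<in>A. f l \<noteq> 0}"
  shows "(\<Sum>l\<in>A. zt (f l)) \<le> 3"
proof -
  define B where "B = {l\<in>A. f l \<noteq> 0}"
  have B: "finite B" "inj_on f B" using assms by (auto simp: B_def)
  have "(\<Sum>l\<in>A. zt (f l)) = (\<Sum>l\<in>B. zt (f l))"
    by (rule sum.mono_neutral_right) (auto simp: B_def assms)
  also have "\<dots> = (\<Sum>j\<in>f ` B. zt j)" using B by (simp add: sum.reindex)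
  also have "\<dots> \<le> (\<Sum>j=1..Suc (Max (insert 0 (f ` B))). zt j)"
  proof (rule sum_mono2)
    show "f ` B \<subseteq> {1..Suc (Max (insert 0 (f ` B)))}"
    proof
      fix y assume y: "y \<in> f ` B"
      then have "y \<le> Max (insert 0 (f ` B))" using B by (intro Max_ge) auto
      moreover have "y \<noteq> 0" using y by (auto simp: B_def)
      ultimately show "y \<in> {1..Suc (Max (insert 0 (f ` B)))}" by simp
    qed
  qed (auto simp: zt_nonneg)
  also have "\<dots> \<le> 3 - 2 / sqrt (real (Suc (Max (insert 0 (f ` B)))))" by (rule zt_sum_upto)
  also have "\<dots> \<le> 3" by simp
  finally show ?thesis .
qed

text \<open>The product is at least the power 3/2 of the smaller number. Bounding by both values
  separates the two index shifts in \<open>resolvent_sum\<close>, each of which then runs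
  injectively.\<close>

lemma inv_le_zt:
  assumes "x \<ge> 1" "y \<ge> 1"
  shows "1 / (real x * sqrt (real y)) \<le> zt x + zt y"
proof (cases "x \<le> y")
  case True
  have "1 / (real x * sqrt (real y)) \<le> zt x"
    unfolding zt_def using assms True by (intro divide_left_mono mult_left_mono) auto
  then show ?thesis using zt_nonneg[of y] by simp
next
  case False
  have "1 / (real x * sqrt (real y)) \<le> zt y"
    unfolding zt_def using assms False by (intro divide_left_mono mult_right_mono) auto
  then show ?thesis using zt_nonneg[of x] by simp
qed

text \<open>At most the two indices next to \<open>t\<close> contribute \<open>1 / C\<close> each.  All other terms are at most
  \<open>1 / (\<surd>n \<bar>l - n\<bar> \<surd>(l + 1 - k))\<close> up to a shift, where \<open>n\<close> is the first index with \<open>t < ev n\<close> and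
  \<open>C \<le> \<surd>n\<close>.  The fourth root of \<open>C\<close> is needed for negative \<open>t\<close> only.\<close>

lemma resolvent_sum:
  assumes C: "C \<ge> 1" and t: "\<And>l. C * sqrt (real (l + 1)) \<le> \<bar>ev l - t\<bar>"
  shows "(\<Sum>l=k..<N. sqrt (real (l + 1)) / (sqrt (real (l + 1 - k)) * \<bar>ev l - t\<bar>)) \<le> 11 / sqrt (sqrt C)"
proof (cases "t < 0")
  case True
  have tC: "t \<le> - C" using t[of 0] True by (simp add: ev_def)
  have "sqrt (real (l + 1)) / (sqrt (real (l + 1 - k)) * \<bar>ev l - t\<bar>) \<le> 2 / sqrt (sqrt C) * zt (l + 1 - k)"
    if l: "l \<in> {k..<N}" for l
  proof -
    define X where "X = \<bar>ev l - t\<bar>"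
    define L where "L = real (l + 1)"
    have L: "L \<ge> 1" by (simp add: L_def)
    have evl: "0 \<le> ev l" by (simp add: ev_def)
    then have X: "X = ev l - t" using True by (simp add: X_def)
    have XC: "C \<le> X" using tC evl by (simp add: X)
    \<comment> \<open>The summand 1 is paid for by \<open>- t\<close>, which is at least
      \<open>C\<close> and hence at least 1.\<close>
    have "L\<^sup>2 / 2 \<le> ev l + 1" by (simp add: ev_def L_def power2_eq_square algebra_simps)
    then have XL: "L\<^sup>2 / 2 \<le> X" using tC C by (simp add: X)
    define R where "R = sqrt X" define r where "r = sqrt R" define s where "s = sqrt L" define c where "c = sqrt (sqrt C)"
    have pos: "0 < X" "0 < R" "0 < r" "0 < s" "0 < c" using XC C L by (auto simp: R_def r_def s_def c_def)
    have "c \<le> r" unfolding c_def r_def R_def using XC by simp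
    have Rr: "R * R = X" "r * r = R" "s * s = L" using pos by (simp_all add: R_def r_def s_def)
    have R3: "L \<le> sqrt 2 * R"
    proof -
      have "L\<^sup>2 \<le> 2 * X" using XL by simp
      then have "sqrt (L\<^sup>2) \<le> sqrt (2 * X)" by (rule real_sqrt_le_mono)
      then show ?thesis using L by (simp add: R_def real_sqrt_mult)
    qed
    have r3: "s \<le> sqrt (sqrt 2) * r"
    proof -
      have "sqrt L \<le> sqrt (sqrt 2 * R)" using R3 by (rule real_sqrt_le_mono)
      then show ?thesis by (simp add: s_def r_def real_sqrt_mult)
    qed
    have s2: "sqrt (sqrt 2) * sqrt 2 \<le> (2::real)"
    proof -
      have "sqrt (sqrt 2) \<le> sqrt (2::real)" by (intro real_sqrt_le_mono) (simp add: real_le_lsqrt)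
      then have "sqrt (sqrt 2) * sqrt 2 \<le> sqrt 2 * sqrt (2::real)" by (intro mult_right_mono) auto
      then show ?thesis by simp
    qed
    \<comment> \<open>\<open>X\<close> is split into the powers 1/4 and 3/4: the first is compared
      with \<open>C\<close>, the second with \<open>L\<close>, which leaves the summable power
      3/2.\<close>
    have "c * (s * L) \<le> r * ((sqrt (sqrt 2) * r) * (sqrt 2 * R))"
      using pos L \<open>c \<le> r\<close> r3 R3 by (intro mult_mono) auto
    also have "\<dots> = (sqrt (sqrt 2) * sqrt 2) * X" unfolding Rr(1)[symmetric] Rr(2)[symmetric] by (simp add: mult_ac)
    also have "\<dots> \<le> 2 * X" using pos s2 by (intro mult_right_mono) auto
    finally have key: "c * (s * L) \<le> 2 * X" .
    define j where "j = l + 1 - k"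
    have j: "j \<ge> 1" "real j \<le> L" using l by (auto simp: j_def L_def)
    have "s / (sqrt (real j) * X) \<le> s / (sqrt (real j) * (c * (s * L) / 2))"
      using pos j key L by (intro divide_left_mono mult_left_mono) auto
    also have "\<dots> = 2 / c * (1 / (L * sqrt (real j)))" using pos by (simp add: field_simps)
    also have "\<dots> \<le> 2 / c * zt j"
      unfolding zt_def using pos j L by (intro mult_left_mono divide_left_mono mult_right_mono) auto
    finally show ?thesis by (simp add: s_def L_def X_def j_def c_def)
  qed
  then have "(\<Sum>l=k..<N. sqrt (real (l + 1)) / (sqrt (real (l + 1 - k)) * \<bar>ev l - t\<bar>))
     \<le> (\<Sum>l=k..<N. 2 / sqrt (sqrt C) * zt (l + 1 - k))" by (rule sum_mono)
  also have "\<dots> = 2 / sqrt (sqrt C) * (\<Sum>l=k..<N. zt (l + 1 - k))" by (simp add: sum_distrib_left)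
  also have "\<dots> \<le> 2 / sqrt (sqrt C) * 3"
    using C by (intro mult_left_mono zt_sum) (auto simp: inj_on_def)
  also have "\<dots> \<le> 11 / sqrt (sqrt C)" using C by (simp add: field_simps)
  finally show ?thesis .
next
  case False
  define n where "n = (LEAST n. t < ev n)"
  have ex: "t < ev (nat \<lceil>t\<rceil> + 1)"
  proof -
    have "t \<le> real (nat \<lceil>t\<rceil>)" by (rule real_nat_ceiling_ge)
    also have "\<dots> < real (nat \<lceil>t\<rceil> + 1) * real (nat \<lceil>t\<rceil> + 1 + 1)" by (simp add: algebra_simps add_pos_nonneg)
    also have "\<dots> = ev (nat \<lceil>t\<rceil> + 1)" by (simp only: ev_def of_nat_mult)
    finally show ?thesis .
  qed
  have tn: "t < ev n" unfolding n_def by (rule LeastI[of "\<lambda>n. t < ev n", OF ex])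
  have n1: "n \<ge> 1" using tn False by (cases n) (auto simp: ev_def)
  have tn1: "ev (n - 1) \<le> t"
  proof (rule ccontr)
    assume "\<not> ?thesis"
    then have "n \<le> n - 1" unfolding n_def by (intro Least_le) simp
    then show False using n1 by simp
  qed
  define q where "q = sqrt (real n)"
  have q: "q > 0" "q * q = real n" using n1 by (auto simp: q_def)
  \<comment> \<open>The neighbours \<open>ev (n - 1)\<close> and \<open>ev n\<close> differ by
    \<open>2 * n\<close>, and \<open>t\<close> keeps at least the distance \<open>C * sqrt n\<close>
    from both.\<close>
  have qC: "C \<le> q"
  proof -
    have "ev n - ev (n - 1) = 2 * (q * q)" unfolding q ev_def using n1 by (cases n) (auto simp: algebra_simps)
    moreover have "C * sqrt (real (n + 1)) \<le> ev n - t" using t[of n] tn by simp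
    moreover have "C * q \<le> t - ev (n - 1)" using t[of "n - 1"] tn1 n1 by (simp add: q_def)
    moreover have "C * q \<le> C * sqrt (real (n + 1))" unfolding q_def using C by (intro mult_left_mono) auto
    ultimately have "C * q \<le> q * q" by linarith
    then show ?thesis by (rule mult_right_le_imp_le) (rule q(1))
  qed
  have evdiff: "ev a - ev b = (real a - real b) * (real a + real b + 1)" for a b
    by (simp add: ev_def algebra_simps)
  have bound: "sqrt (real (l + 1)) / (sqrt (real (l + 1 - k)) * \<bar>ev l - t\<bar>)
     \<le> (if l = n - 1 \<or> l = n then 1 / C else 0) + 1 / q * (zt (l - n) + zt (n - 1 - l) + zt (l + 1 - k))"
    if l: "l \<in> {k..<N}" for l
  proof -
    define s where "s = sqrt (real (l + 1))"
    define j where "j = l + 1 - k"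
    have s: "s > 0" "s * s = real l + 1" by (auto simp: s_def)
    have j: "j \<ge> 1" using l by (auto simp: j_def)
    have "s / (sqrt (real j) * \<bar>ev l - t\<bar>) \<le> (if l = n - 1 \<or> l = n then 1 / C else 0) + 1 / q * (zt (l - n) + zt (n - 1 - l) + zt j)"
    proof -
      consider "l = n - 1 \<or> l = n" | "l > n" | "l + 1 < n" using n1 by linarith
      then show ?thesis
      proof cases
        case 1
        have "s / (sqrt (real j) * \<bar>ev l - t\<bar>) \<le> s / (1 * (C * s))"
        proof (rule divide_left_mono)
          have p: "0 < C * s" "C * s \<le> \<bar>ev l - t\<bar>" using t[of l] s C by (auto simp: s_def)
          show "1 * (C * s) \<le> sqrt (real j) * \<bar>ev l - t\<bar>" using p j by (intro mult_mono) auto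
          show "0 < sqrt (real j) * \<bar>ev l - t\<bar> * (1 * (C * s))" using j C s less_le_trans[OF p] by (intro mult_pos_pos) auto
        qed (use s in simp)
        also have "\<dots> = 1 / C" using s by simp
        finally have "s / (sqrt (real j) * \<bar>ev l - t\<bar>) \<le> 1 / C" .
        moreover have "0 \<le> 1 / q * (zt (l - n) + zt (n - 1 - l) + zt j)"
          using q zt_nonneg by (intro mult_nonneg_nonneg add_nonneg_nonneg) auto
        moreover have "(if l = n - 1 \<or> l = n then 1 / C else 0) = 1 / C" using 1 by auto
        ultimately show ?thesis by linarith
      next
        case 2
        define x where "x = l - n"
        have x: "x \<ge> 1" "real x = real l - real n" using 2 by (auto simp: x_def)
        \<comment> \<open>The distance to \<open>ev n\<close> factors as
          \<open>(l - n) * (l + n + 1)\<close>. The second factor exceeds \<open>s * s\<close>, so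
          one \<open>s\<close> cancels the numerator and the other leaves a factor
          \<open>q\<close>.\<close>
        have "real x * (s * q) \<le> real x * (s * s)"
          using 2 s q by (intro mult_left_mono) (auto simp: s_def q_def)
        also have "\<dots> \<le> real x * (real l + real n + 1)" unfolding s by (intro mult_left_mono) auto
        also have "\<dots> = ev l - ev n" by (simp add: evdiff x)
        also have "\<dots> \<le> \<bar>ev l - t\<bar>" using tn by simp
        finally have key: "real x * (s * q) \<le> \<bar>ev l - t\<bar>" .
        have p: "0 < real x * (s * q)" using x s q by simp
        have "s / (sqrt (real j) * \<bar>ev l - t\<bar>) \<le> s / (sqrt (real j) * (real x * (s * q)))"
          using key j s q(1) x(1) less_le_trans[OF p key] by (intro divide_left_mono mult_left_mono mult_pos_pos) auto
        also have "\<dots> = 1 / q * (1 / (real x * sqrt (real j)))" using s by simp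
        also have "\<dots> \<le> 1 / q * (zt x + zt j)" using q by (intro mult_left_mono inv_le_zt x j) auto
        also have "\<dots> \<le> 1 / q * (zt (l - n) + zt (n - 1 - l) + zt j)"
          using q zt_nonneg by (intro mult_left_mono) (auto simp: x_def)
        finally have "s / (sqrt (real j) * \<bar>ev l - t\<bar>) \<le> 1 / q * (zt (l - n) + zt (n - 1 - l) + zt j)" .
        moreover have "(if l = n - 1 \<or> l = n then 1 / C else 0) = 0" using 2 by auto
        ultimately show ?thesis by linarith
      next
        case 3
        define x where "x = n - 1 - l"
        have x: "x \<ge> 1" "real x = real (n - 1) - real l" using 3 by (auto simp: x_def)
        have sq: "s \<le> q" using 3 by (auto simp: s_def q_def)
        have "real x * (s * q) \<le> real x * (q * q)"
          using s q sq by (intro mult_left_mono mult_right_mono) auto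
        also have "\<dots> \<le> real x * (real (n - 1) + real l + 1)" unfolding q using n1 by (intro mult_left_mono) auto
        also have "\<dots> = ev (n - 1) - ev l" by (simp add: evdiff x)
        also have "\<dots> \<le> \<bar>ev l - t\<bar>" using tn1 by simp
        finally have key: "real x * (s * q) \<le> \<bar>ev l - t\<bar>" .
        have p: "0 < real x * (s * q)" using x s q by simp
        have "s / (sqrt (real j) * \<bar>ev l - t\<bar>) \<le> s / (sqrt (real j) * (real x * (s * q)))"
          using key j s q(1) x(1) less_le_trans[OF p key] by (intro divide_left_mono mult_left_mono mult_pos_pos) auto
        also have "\<dots> = 1 / q * (1 / (real x * sqrt (real j)))" using s by simp
        also have "\<dots> \<le> 1 / q * (zt x + zt j)" using q by (intro mult_left_mono inv_le_zt x j) auto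
        also have "\<dots> \<le> 1 / q * (zt (l - n) + zt (n - 1 - l) + zt j)"
          using q zt_nonneg by (intro mult_left_mono) (auto simp: x_def)
        finally have "s / (sqrt (real j) * \<bar>ev l - t\<bar>) \<le> 1 / q * (zt (l - n) + zt (n - 1 - l) + zt j)" .
        moreover have "(if l = n - 1 \<or> l = n then 1 / C else 0) = 0" using 3 by auto
        ultimately show ?thesis by linarith
      qed
    qed
    then show ?thesis by (simp add: s_def j_def)
  qed
  have "(\<Sum>l=k..<N. sqrt (real (l + 1)) / (sqrt (real (l + 1 - k)) * \<bar>ev l - t\<bar>))
    \<le> (\<Sum>l=k..<N. (if l = n - 1 \<or> l = n then 1 / C else 0) + 1 / q * (zt (l - n) + zt (n - 1 - l) + zt (l + 1 - k)))"
    by (rule sum_mono[OF bound])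
  also have "\<dots> = (\<Sum>l=k..<N. (if l = n - 1 \<or> l = n then 1 / C else 0))
     + 1 / q * ((\<Sum>l=k..<N. zt (l - n)) + (\<Sum>l=k..<N. zt (n - 1 - l)) + (\<Sum>l=k..<N. zt (l + 1 - k)))"
    by (simp only: sum.distrib sum_distrib_left[symmetric])
  also have "\<dots> \<le> 2 / C + 1 / q * (3 + 3 + 3)"
  proof (rule add_mono)
    have "(\<Sum>l=k..<N. (if l = n - 1 \<or> l = n then 1 / C else 0)) \<le> (\<Sum>l\<in>{n - 1, n}. 1 / C)"
    proof -
      have "(\<Sum>l=k..<N. (if l = n - 1 \<or> l = n then 1 / C else 0)) = (\<Sum>l\<in>{k..<N} \<inter> {l. l = n - 1 \<or> l = n}. 1 / C)"
        by (simp add: sum.If_cases)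
      also have "\<dots> \<le> (\<Sum>l\<in>{n - 1, n}. 1 / C)" using C by (intro sum_mono2) auto
      finally show ?thesis .
    qed
    also have "\<dots> \<le> 2 / C" using C n1 by simp
    finally show "(\<Sum>l=k..<N. (if l = n - 1 \<or> l = n then 1 / C else 0)) \<le> 2 / C" .
    show "1 / q * ((\<Sum>l=k..<N. zt (l - n)) + (\<Sum>l=k..<N. zt (n - 1 - l)) + (\<Sum>l=k..<N. zt (l + 1 - k))) \<le> 1 / q * (3 + 3 + 3)"
      using q by (intro mult_left_mono add_mono zt_sum) (auto simp: inj_on_def)
  qed
  \<comment> \<open>Two neighbouring indices and three sums of \<open>zt\<close>, each at most 3,
    give 11.\<close>
  also have "\<dots> \<le> 2 / C + 1 / C * 9" using qC C by (intro add_left_mono) (simp add: frac_le)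
  also have "\<dots> = 11 / C" by simp
  also have "\<dots> \<le> 11 / sqrt (sqrt C)"
  proof (rule divide_left_mono)
    have "sqrt C \<le> C" using C by (intro real_le_lsqrt) (auto simp: power2_eq_square)
    moreover have "sqrt (sqrt C) \<le> sqrt C" using C \<open>sqrt C \<le> C\<close> by (intro real_sqrt_le_mono)
    ultimately show "sqrt (sqrt C) \<le> C" by linarith
  qed (use C in auto)
  finally show ?thesis .
qed

section \<open>Boundary values of normalised eigenfunctions\<close>

text \<open>For \<open>2 * M < l\<close> the first trace bound is enough, because
  \<open>lam - M\<^sup>2\<close> is at least three quarters of \<open>lam\<close>. For larger
  \<open>M\<close> the second is used with \<open>lam - M\<^sup>2 \<ge> l * (l + 1 - M)\<close> and
  \<open>M \<ge> l / 2\<close>; it gives the constant 4, doubled by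
  \<open>sqrt (l + 1) \<le> 2 * sqrt l\<close>. Degree 0, where both bounds degenerate, is computed
  directly.\<close>

lemma trace_bound:
  fixes a b :: nat
  defines "l \<equiv> a + b" and "M \<equiv> nat \<bar>int a - int b\<bar>"
  shows "(pf a b (pi/2))\<^sup>2 \<le> 8 * sqrt (real (l + 1)) / sqrt (real (l + 1 - M)) * nrm (a, b)"
proof -
  interpret profile "int a - int b" "ev (a + b)" "pf a b"
    "\<lambda>t. psum a b (\<lambda>n. real n * sin t ^ (n - 1))"
    "\<lambda>t. psum a b (\<lambda>n. (real n)\<^sup>2 * (sin t ^ (n - 1) * (1 - (sin t)\<^sup>2)) - real n * sin t ^ (n + 1))"
    "\<lambda>t. psum a b (\<lambda>n. (real n)\<^sup>2 * ((real (n - 1) * (sin t ^ (n - 1 - 1) * cos t)) * (1 - (sin t)\<^sup>2) + sin t ^ (n - 1) * (- (2 * sin t * cos t))) - real n * (real (n + 1) * (sin t ^ n * cos t)))"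
    "\<lambda>t. psum a b (\<lambda>n. sin t ^ (n - 1))"
    "\<lambda>t. psum a b (\<lambda>n. real n * sin t ^ (n - 2))"
    by (rule profile_pf)
  define N where "N = nrm (a, b)"
  define f2 where "f2 = (pf a b (pi/2))\<^sup>2"
  define lam where "lam = ev l"
  have N: "N > 0" "N = polint (\<lambda>t. (pf a b t)\<^sup>2)" using nrm_pos[of "(a, b)"] by (auto simp: N_def nrm_def)
  have f2: "f2 \<ge> 0" by (simp add: f2_def)
  have Ml: "M \<le> l" by (auto simp: M_def l_def)
  have mM: "real_of_int (int a - int b) ^ 2 = (real M)\<^sup>2" "real_of_int \<bar>int a - int b\<bar> = real M" by (auto simp: M_def)
  have lamnn: "lam \<ge> 0" by (simp add: lam_def ev_def)
  have b1: "(lam - (real M)\<^sup>2) * f2 \<le> 2 * lam * N"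
    using trace_bound1 lamnn unfolding mM lam_def l_def f2_def N(2) by simp
  have ratio: "1 \<le> sqrt (real (l + 1)) / sqrt (real (l + 1 - M))" using Ml by simp
  have d: "real (l + 1 - M) = real l + 1 - real M" using Ml by (simp add: of_nat_diff)
  have "f2 \<le> 8 * (sqrt (real (l + 1)) / sqrt (real (l + 1 - M))) * N"
  proof (cases "l = 0")
    case True
    then have ab: "a = 0" "b = 0" by (auto simp: l_def)
    have pf1: "pf a b t = 1" for t by (simp add: ab pf_def psum_def)
    have "N = 1"
    proof -
      have "polint (\<lambda>t. 1) = - cos (pi/2) - (- cos 0)"
        by (rule polint_FTC) (auto intro!: derivative_eq_intros)
      then show ?thesis unfolding N(2) pf1 by simp
    qed
    then show ?thesis using ratio by (simp add: f2_def pf1)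
  next
    case False
    then have l1: "real l \<ge> 1" by simp
    have lam: "lam = real l * (real l + 1)" by (simp add: lam_def ev_def algebra_simps)
    have lamM: "real l * (real l + 1 - real M) \<le> lam - (real M)\<^sup>2"
    proof -
      have "lam - (real M)\<^sup>2 - real l * (real l + 1 - real M) = real M * (real l - real M)"
        unfolding lam by (simp add: power2_eq_square algebra_simps)
      also have "\<dots> \<ge> 0" using Ml by simp
      finally show ?thesis by simp
    qed
    show ?thesis
    proof (cases "2 * M < l")
      case True
      then have M2: "2 * real M \<le> real l" by simp
      have "(2 * real M)\<^sup>2 \<le> (real l)\<^sup>2" using M2 by (intro power_mono) auto
      then have "4 * (real M)\<^sup>2 \<le> lam" unfolding lam by (simp add: power2_eq_square algebra_simps)
      then have "(3 / 4 * lam) * f2 \<le> (lam - (real M)\<^sup>2) * f2" using f2 by (intro mult_right_mono) auto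
      with b1 have "(3 / 4 * lam) * f2 \<le> 2 * lam * N" by linarith
      then have "lam * (3 / 4 * f2) \<le> lam * (2 * N)" by (simp add: mult_ac)
      moreover have "lam > 0" using l1 unfolding lam by (intro mult_pos_pos) auto
      ultimately have "3 / 4 * f2 \<le> 2 * N" by simp
      then have "f2 \<le> 8 * 1 * N" using N by simp
      also have "\<dots> \<le> 8 * (sqrt (real (l + 1)) / sqrt (real (l + 1 - M))) * N"
        using ratio N by (intro mult_right_mono mult_left_mono) auto
      finally show ?thesis .
    next
      case False
      then have M2: "real l \<le> 2 * real M" by simp
      have M0: "real M > 0" using M2 l1 by linarith
      define D where "D = real l + 1 - real M"
      have D: "D \<ge> 1" using Ml by (simp add: D_def)
      have pos: "lam - (real M)\<^sup>2 > 0" using lamM l1 D unfolding D_def[symmetric]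
        by (intro less_le_trans[OF _ lamM[folded D_def]] mult_pos_pos) auto
      have b2: "real M * sqrt (lam - (real M)\<^sup>2) * f2 \<le> 2 * lam * N"
        using trace_bound2 M0 pos unfolding mM lam_def l_def f2_def N(2) M_def by auto
      have "sqrt (real l * D) \<le> sqrt (lam - (real M)\<^sup>2)" using lamM unfolding D_def by (rule real_sqrt_le_mono)
      then have "real l / 2 * (sqrt (real l) * sqrt D) * f2 \<le> real M * sqrt (lam - (real M)\<^sup>2) * f2"
        using M2 D f2 l1 by (intro mult_right_mono mult_mono) (auto simp: real_sqrt_mult)
      with b2 have "real l / 2 * (sqrt (real l) * sqrt D) * f2 \<le> 2 * lam * N" by linarith
      then have "real l * (sqrt (real l) * sqrt D * f2) \<le> real l * (4 * (real l + 1) * N)"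
        unfolding lam by (simp add: algebra_simps)
      then have "sqrt (real l) * sqrt D * f2 \<le> 4 * (real l + 1) * N" using l1 by simp
      also have "real l + 1 = sqrt (real l + 1) * sqrt (real l + 1)" by simp
      also have "4 * (sqrt (real l + 1) * sqrt (real l + 1)) * N \<le> 4 * (sqrt (real l + 1) * (2 * sqrt (real l))) * N"
      proof -
        have "sqrt (real l + 1) \<le> sqrt (4 * real l)" using l1 by (intro real_sqrt_le_mono) simp
        also have "\<dots> = 2 * sqrt (real l)" by (simp add: real_sqrt_mult)
        finally show ?thesis using N by (intro mult_right_mono mult_left_mono) auto
      qed
      finally have "sqrt (real l) * (sqrt D * f2) \<le> sqrt (real l) * (8 * sqrt (real l + 1) * N)" by (simp add: mult_ac)
      then have "sqrt D * f2 \<le> 8 * sqrt (real l + 1) * N" using l1 by simp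
      then show ?thesis using D unfolding d D_def[symmetric] by (simp add: field_simps)
    qed
  qed
  then show ?thesis by (simp add: f2_def N_def)
qed

section \<open>The eigenbasis\<close>

definition kap :: "nat \<times> nat \<Rightarrow> complex" where "kap j = of_real (1 / sqrt (2 * pi * nrm j))"

lemma kap: "cnj (kap j) = kap j" "kap j \<noteq> 0" "kap j * (kap j * (2 * of_real pi * of_real (nrm j))) = 1"
proof -
  show "cnj (kap j) = kap j" "kap j \<noteq> 0" using nrm_pos[of j] by (simp_all add: kap_def)
  have "kap j * (kap j * (2 * of_real pi * of_real (nrm j))) = of_real ((1 / sqrt (2 * pi * nrm j)) * ((1 / sqrt (2 * pi * nrm j)) * (2 * pi * nrm j)))"
    by (simp only: kap_def of_real_mult of_real_numeral)
  also have "(1 / sqrt (2 * pi * nrm j)) * ((1 / sqrt (2 * pi * nrm j)) * (2 * pi * nrm j)) = 1"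
    using nrm_pos[of j] by (simp add: field_simps)
  finally show "kap j * (kap j * (2 * of_real pi * of_real (nrm j))) = 1" by simp
qed

definition eb :: "nat \<times> nat \<Rightarrow> real \<times> real \<Rightarrow> complex" where
  "eb j = (\<lambda>x. kap j * E j x)"

definition lamb :: "nat \<times> nat \<Rightarrow> real" where "lamb j = ev (fst j + snd j)"

definition Jset :: "nat \<Rightarrow> (nat \<times> nat) set" where "Jset n = {j. fst j + snd j < n}"

lemma E_W21: "E j \<in> W21" by (rule C1_hemi_W21[OF E_C1_hemi])

lemma eb_W21: "eb j \<in> W21" unfolding eb_def by (rule Wip.scale_mem[OF E_W21])

text \<open>The classical gradient of \<open>E j\<close> is the one that appears in
  \<open>green\<close>, so the Dirichlet form against \<open>E j\<close> is exactly the left side of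
  Green's identity.\<close>

lemma dirichlet_E:
  assumes u: "u \<in> W21"
  shows "dirichlet u (E j) = of_real (lamb j) * L2_inner u (E j)"
proof -
  obtain a b where j: "j = (a, b)" by (cases j)
  define m where "m = int a - int b"
  interpret profile m "ev (a + b)" "pf a b"
    "\<lambda>t. psum a b (\<lambda>n. real n * sin t ^ (n - 1))"
    "\<lambda>t. psum a b (\<lambda>n. (real n)\<^sup>2 * (sin t ^ (n - 1) * (1 - (sin t)\<^sup>2)) - real n * sin t ^ (n + 1))"
    "\<lambda>t. psum a b (\<lambda>n. (real n)\<^sup>2 * ((real (n - 1) * (sin t ^ (n - 1 - 1) * cos t)) * (1 - (sin t)\<^sup>2) + sin t ^ (n - 1) * (- (2 * sin t * cos t))) - real n * (real (n + 1) * (sin t ^ n * cos t)))"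
    "\<lambda>t. psum a b (\<lambda>n. sin t ^ (n - 1))"
    "\<lambda>t. psum a b (\<lambda>n. real n * sin t ^ (n - 2))"
    unfolding m_def by (rule profile_pf)
  define c where "c = (\<lambda>t. psum a b (\<lambda>n. real n * sin t ^ (n - 1)))"
  define fs where "fs = (\<lambda>t. psum a b (\<lambda>n. sin t ^ (n - 1)))"
  define E1 where "E1 = fmode (\<lambda>t. cos t * c t) m"
  define Es where "Es = (\<lambda>x. \<i> * of_int m * fmode fs m x)"
  have E: "E j = fmode (pf a b) m" by (simp add: j E_def m_def)
  have lj: "lamb j = ev (a + b)" by (simp add: lamb_def j)
  have fc: "continuous_on UNIV (fmode h k)" if "continuous_on UNIV h" for h k
    unfolding fmode_def
    by (intro continuous_intros continuous_on_compose2[OF that]) auto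
  have gradE: "weak_grad (E j) E1 Es"
  proof (rule classical_weak_grad)
    show "continuous_on UNIV (E j)" unfolding E by (rule fc[OF f_cont])
    show "continuous_on UNIV E1" unfolding E1_def c_def by (intro fc continuous_intros c_cont)
    show "continuous_on UNIV Es" unfolding Es_def fs_def by (intro continuous_intros fc fs_cont)
    fix t y :: real
    have "(pf a b has_real_derivative cos t * c t) (at t)" using f_deriv[of t] by (simp add: c_def)
    from has_vector_derivative_scaleR[OF this has_vector_derivative_const[of "cis (of_int m * y)"]]
    show "((\<lambda>t. E j (t, y)) has_vector_derivative E1 (t, y)) (at t)"
      by (simp add: E E1_def fmode_def scaleR_conv_of_real)
    have "((\<lambda>y. cis (of_int m * y)) has_vector_derivative (of_int m *\<^sub>R (\<i> * cis (of_int m * y)))) (at y)"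
      by (auto simp: has_vector_derivative_def intro!: derivative_eq_intros)
    from has_vector_derivative_mult_right[OF this, of "of_real (pf a b t)"]
    have 1: "((\<lambda>y. E j (t, y)) has_vector_derivative (of_real (pf a b t) * (of_int m *\<^sub>R (\<i> * cis (of_int m * y))))) (at y)"
      by (simp add: E fmode_def)
    have "of_real (pf a b t) * (of_int m *\<^sub>R (\<i> * cis (of_int m * y))) = of_real (sin t) * Es (t, y)"
      using fs[of t] by (cases "m = 0") (auto simp: Es_def fmode_def fs_def scaleR_conv_of_real)
    with 1 show "((\<lambda>y. E j (t, y)) has_vector_derivative of_real (sin t) * Es (t, y)) (at y)" by simp
    have "of_int m * (y + 2 * pi) = of_int m * y + 2 * pi * of_int m" by (simp add: algebra_simps)
    then show "E j (t, y + 2 * pi) = E j (t, y)"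
      by (simp add: E fmode_def complex_eq_iff cos_add sin_add)
  qed
  obtain p s where g: "weak_grad u p s" using u W21_iff by blast
  then have L: "u \<in> L2" "p \<in> L2" "s \<in> L2" and w: "has_weak_dtheta u p" "weak_phi u s" by (auto simp: weak_grad_def)
  obtain q s' where q: "s' = (\<lambda>x. q x / of_real (sin (fst x)))" "s' \<in> L2" "has_weak_dphi u q" "AE x in hemi. s' x = s x"
    by (rule weak_phi_rep[OF L(1,3) w(2)])
  have "L2_inner s' Es = L2_inner s Es"
    using gradE q(4) by (intro L2_inner_AE_cong q L) (auto simp: weak_grad_def)
  moreover have "L2_inner p E1 + L2_inner s' Es = of_real (ev (a + b)) * L2_inner u (fmode (pf a b) m)"
    unfolding E1_def Es_def c_def fs_def by (rule green[OF L(1,2) q(2) w(1) q(3,1)])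
  ultimately show ?thesis
    unfolding dirichlet_eq[OF g gradE] by (simp add: E lj)
qed

lemma dirichlet_eb: "u \<in> W21 \<Longrightarrow> dirichlet u (eb j) = of_real (lamb j) * L2_inner u (eb j)"
  unfolding eb_def by (simp add: WD.scale_right E_W21 Wip.scale_right dirichlet_E)

text \<open>Eigenfunctions of equal degree differ in order and are orthogonal in \<phi>; those of
  different degree belong to different eigenvalues of the symmetric form.\<close>

lemma eb_orth: "L2_inner (eb i) (eb j) = (if i = j then 1 else 0)"
proof (cases "i = j")
  case True
  have "L2_inner (eb j) (eb j) = kap j * (kap j * L2_inner (E j) (E j))"
    unfolding eb_def by (simp add: Wip.scale_left Wip.scale_right Wip.scale_mem E_W21 kap)
  also have "\<dots> = 1" unfolding E_norm using kap(3)[of j] by (simp add: mult.assoc)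
  finally show ?thesis using True by simp
next
  case False
  have "L2_inner (E i) (E j) = 0"
  proof (cases "fst i + snd i = fst j + snd j")
    case True
    have "int (fst i) - int (snd i) \<noteq> int (fst j) - int (snd j)"
    proof
      assume "int (fst i) - int (snd i) = int (fst j) - int (snd j)"
      then have "fst i = fst j" "snd i = snd j" using True by linarith+
      then show False using False by (simp add: prod_eq_iff)
    qed
    then show ?thesis by (rule E_inner_diff)
  next
    case l: False
    have "of_real (lamb j) * L2_inner (E i) (E j) = dirichlet (E i) (E j)" by (simp add: dirichlet_E E_W21)
    also have "\<dots> = cnj (dirichlet (E j) (E i))" by (rule WD.sym) (rule E_W21)+
    also have "\<dots> = of_real (lamb i) * cnj (L2_inner (E j) (E i))" by (simp add: dirichlet_E E_W21)
    also have "cnj (L2_inner (E j) (E i)) = L2_inner (E i) (E j)" using Wip.sym[OF E_W21 E_W21, of j i] by simp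
    finally have "(of_real (lamb j) - of_real (lamb i)) * L2_inner (E i) (E j) = 0" by (simp add: algebra_simps)
    moreover have "lamb j \<noteq> lamb i"
      using l ev_strict_mono[of "fst i + snd i" "fst j + snd j"] ev_strict_mono[of "fst j + snd j" "fst i + snd i"]
      unfolding lamb_def by linarith
    ultimately show ?thesis by simp
  qed
  then show ?thesis using False
    unfolding eb_def by (simp add: Wip.scale_left Wip.scale_right Wip.scale_mem E_W21)
qed

lemma Jset_Suc: "Jset (Suc n) = Jset n \<union> (\<lambda>a. (a, n - a)) ` {..n}"
  by (auto simp: Jset_def image_iff less_Suc_eq)

lemma finite_Jset: "finite (Jset n)"
  by (induction n) (auto simp: Jset_Suc, simp add: Jset_def)

lemma card_Jset: "card (Jset n) = n * (n + 1) div 2"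
proof (induction n)
  case 0
  then show ?case by (simp add: Jset_def)
next
  case (Suc n)
  have "card (Jset (Suc n)) = card (Jset n) + card ((\<lambda>a. (a, n - a)) ` {..n})"
    unfolding Jset_Suc by (rule card_Un_disjoint) (auto simp: finite_Jset, auto simp: Jset_def)
  also have "card ((\<lambda>a. (a, n - a)) ` {..n}) = n + 1" by (subst card_image) (auto simp: inj_on_def)
  finally show ?case using Suc by simp
qed

lemma L2_inner_E_of_eb:
  assumes "u \<in> W21" "L2_inner u (eb j) = 0"
  shows "L2_inner u (E j) = 0"
  using assms kap unfolding eb_def by (simp add: Wip.scale_right E_W21)

lemma spectral_basis_eb: "spectral_basis W21 L2_inner dirichlet eb lamb Jset"
proof
  show "eb j \<in> W21" for j by (rule eb_W21)
  show "L2_inner (eb i) (eb j) = (if i = j then 1 else 0)" for i j by (rule eb_orth)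
  show "dirichlet u (eb j) = of_real (lamb j) * L2_inner u (eb j)" if "u \<in> W21" for u j by (rule dirichlet_eb[OF that])
  show "finite (Jset n)" for n by (rule finite_Jset)
  show "Jset m \<subseteq> Jset n" if "m \<le> n" for m n using that by (auto simp: Jset_def)
  show "\<exists>n. j \<in> Jset n" for j by (rule exI[of _ "fst j + snd j + 1"]) (simp add: Jset_def)
  show "\<exists>n. \<forall>j. j \<notin> Jset n \<longrightarrow> R \<le> lamb j" for R
  proof (intro exI allI impI)
    fix j assume "j \<notin> Jset (nat \<lceil>R\<rceil>)"
    then have le: "nat \<lceil>R\<rceil> \<le> fst j + snd j" unfolding Jset_def mem_Collect_eq not_less .
    have "R \<le> real (nat \<lceil>R\<rceil>)" by (rule real_nat_ceiling_ge)
    also have "\<dots> \<le> ev (nat \<lceil>R\<rceil>)" unfolding ev_def of_nat_le_iff by simp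
    also have "\<dots> \<le> lamb j" unfolding lamb_def by (rule ev_mono[OF le])
    finally show "R \<le> lamb j" .
  qed
  show "Re (L2_inner u u) = 0 \<and> Re (dirichlet u u) = 0" if u: "u \<in> W21" and o: "\<And>j. L2_inner u (eb j) = 0" for u
  proof -
    have "AE x in hemi. u x = 0"
      by (rule E_complete[OF W21_L2[OF u] L2_inner_E_of_eb[OF u o]])
    obtain p s where g: "weak_grad u p s" using u unfolding W21_iff by blast
    have L: "p \<in> L2" "s \<in> L2" using g by (auto simp: weak_grad_def)
    have "L2.q p = 0" "L2.q s = 0" "L2.q u = 0"
      using weak_grad_unique0[OF g \<open>AE x in hemi. u x = 0\<close>] \<open>AE x in hemi. u x = 0\<close> L W21_L2[OF u]
      by (simp_all add: L2_q_eq_0)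
    then show ?thesis using weak_grad_q[OF g] by simp
  qed
  show "\<exists>w\<in>W21. (\<lambda>n. Wip.q (\<lambda>x. X n x - w x)) \<longlonglongrightarrow> 0 \<and> (\<lambda>n. WD.q (\<lambda>x. X n x - w x)) \<longlonglongrightarrow> 0"
    if "\<And>n. X n \<in> W21" "\<And>\<epsilon>::real. \<epsilon> > 0 \<Longrightarrow> \<exists>N::nat. \<forall>m\<ge>N. \<forall>n\<ge>N. Wip.q (\<lambda>x. X m x - X n x) + WD.q (\<lambda>x. X m x - X n x) < \<epsilon>" for X
    by (rule W21_complete) (rule that(1), rule that(2))
qed

interpretation basis: spectral_basis W21 L2_inner dirichlet eb lamb Jset by (rule spectral_basis_eb)

section \<open>Traces of \<open>W21\<close> functions\<close>

lemma eb_C1_hemi: "eb j \<in> C1_hemi"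
  using C1_hemi_comb[OF E_C1_hemi E_C1_hemi, of "kap j" j 0 j] by (simp add: eb_def)

lemma P_C1_hemi: "basis.P n u \<in> C1_hemi"
  unfolding basis.P_def by (intro C1_hemi_sum eb_C1_hemi)

lemma W21_norm_tendsto_iff:
  assumes "\<And>n. w n \<in> W21"
  shows "(\<lambda>n. W21_norm (w n)) \<longlonglongrightarrow> 0 \<longleftrightarrow> (\<lambda>n. Wip.q (w n) + WD.q (w n)) \<longlonglongrightarrow> 0"
proof -
  have nn: "0 \<le> Wip.q (w n) + WD.q (w n)" for n using Wip.pos[OF assms] WD.pos[OF assms] by simp
  have eq: "W21_norm (w n) = sqrt (Wip.q (w n) + WD.q (w n))" for n by (simp add: W21_norm_def)
  show ?thesis
  proof
    assume "(\<lambda>n. W21_norm (w n)) \<longlonglongrightarrow> 0"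
    then have "(\<lambda>n. (W21_norm (w n))\<^sup>2) \<longlonglongrightarrow> 0\<^sup>2" by (rule tendsto_power)
    then show "(\<lambda>n. Wip.q (w n) + WD.q (w n)) \<longlonglongrightarrow> 0" unfolding eq using nn by simp
  next
    assume "(\<lambda>n. Wip.q (w n) + WD.q (w n)) \<longlonglongrightarrow> 0"
    then have "(\<lambda>n. sqrt (Wip.q (w n) + WD.q (w n))) \<longlonglongrightarrow> sqrt 0" by (rule tendsto_real_sqrt)
    then show "(\<lambda>n. W21_norm (w n)) \<longlonglongrightarrow> 0" unfolding eq by simp
  qed
qed

lemma has_trace_iff:
  assumes u: "u \<in> W21"
  shows "has_trace u g \<longleftrightarrow> g \<in> sqi circ \<and> (\<exists>w. (\<forall>n. w n \<in> C1_hemi) \<and>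
     (\<lambda>n. Wip.q (\<lambda>x. w n x - u x) + WD.q (\<lambda>x. w n x - u x)) \<longlonglongrightarrow> 0 \<and>
     (\<lambda>n. C.q (\<lambda>y. tr (w n) y - g y)) \<longlonglongrightarrow> 0)"
proof -
  have s: "g \<in> borel_measurable borel \<and> set_integrable lborel {-pi<..pi} (\<lambda>\<phi>. (cmod (g \<phi>))\<^sup>2) \<longleftrightarrow> g \<in> sqi circ"
    using integrable_circ[of "\<lambda>\<phi>. (cmod (g \<phi>))\<^sup>2"] by (auto simp: sqi_def borel_measurable_circ)
  have w: "(\<lambda>n. W21_norm (\<lambda>x. w n x - u x)) \<longlonglongrightarrow> 0 \<longleftrightarrow> (\<lambda>n. Wip.q (\<lambda>x. w n x - u x) + WD.q (\<lambda>x. w n x - u x)) \<longlonglongrightarrow> 0"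
    if "\<forall>n. w n \<in> C1_hemi" for w
    by (rule W21_norm_tendsto_iff) (use that u C1_hemi_W21 in \<open>auto intro: Wip.diff_mem\<close>)
  have t: "(LINT \<phi>:{-pi<..pi}|lborel. (cmod (w n (pi/2, \<phi>) - g \<phi>))\<^sup>2) = C.q (\<lambda>y. tr (w n) y - g y)"
    if "\<forall>n. w n \<in> C1_hemi" "g \<in> sqi circ" for w :: "nat \<Rightarrow> real \<times> real \<Rightarrow> complex" and n
  proof -
    have "tr (w n) \<in> borel_measurable borel" "g \<in> borel_measurable borel"
      using C1_hemi_trace(1) that sqi_measurable unfolding borel_measurable_circ[symmetric] by blast+
    note [measurable] = this
    show ?thesis unfolding ipm_norm by (subst integral_circ) (auto simp: tr_def[symmetric], simp add: tr_def)
  qed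
  show ?thesis unfolding has_trace_def conj_assoc[symmetric] s
    using w t by (intro conj_cong refl iff_exI) auto
qed

lemma tr_diff: "tr (\<lambda>x. u x - v x) = (\<lambda>y. tr u y - tr v y)" by (simp add: tr_def)

lemma C_cauchy_limit:
  fixes X :: "nat \<Rightarrow> real \<Rightarrow> complex"
  assumes X: "\<And>n. X n \<in> sqi circ"
    and c: "\<And>\<epsilon>::real. \<epsilon> > 0 \<Longrightarrow> \<exists>N::nat. \<forall>m\<ge>N. \<forall>n\<ge>N. C.q (\<lambda>x. X m x - X n x) < \<epsilon>"
  obtains w where "w \<in> sqi circ" "(\<lambda>n. C.q (\<lambda>x. X n x - w x)) \<longlonglongrightarrow> 0"
  by (rule circ.sqi_complete[of X]) (rule X, rule c, assumption, rule that)

lemma P_q_tendsto: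
  assumes u: "u \<in> W21"
  shows "(\<lambda>n. Wip.q (\<lambda>x. basis.P n u x - u x) + WD.q (\<lambda>x. basis.P n u x - u x)) \<longlonglongrightarrow> 0"
proof -
  have "Wip.q (\<lambda>x. basis.P n u x - u x) = Wip.q (basis.Q n u)" "WD.q (\<lambda>x. basis.P n u x - u x) = WD.q (basis.Q n u)" for n
    unfolding basis.Q_def
    by (simp_all add: Wip.q_diff WD.q_diff basis.P_mem u Wip.Re_sym[of u "basis.P n u"] WD.Re_sym[of u "basis.P n u"])
  then show ?thesis using tendsto_add[OF basis.approx[OF u]] by simp
qed

text \<open>The partial sums of the eigenfunction expansion are themselves C1 on the closed
  hemisphere and converge to \<open>u\<close> in \<open>W21\<close>; the trace inequality makes
  their boundary values Cauchy.\<close>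

lemma trace_exists:
  assumes u: "u \<in> W21"
  shows "\<exists>g. has_trace u g"
proof -
  let ?P = "\<lambda>n. basis.P n u"
  have PC: "tr (?P n) \<in> sqi circ" for n by (rule C1_hemi_trace(1)[OF P_C1_hemi])
  define d where "d n = Wip.q (\<lambda>x. ?P n x - u x) + WD.q (\<lambda>x. ?P n x - u x)" for n
  have d0: "d \<longlonglongrightarrow> 0" unfolding d_def by (rule P_q_tendsto[OF u])
  have le: "C.q (\<lambda>y. tr (?P m) y - tr (?P n) y) \<le> 6 * (d m + d n)" for m n
  proof -
    have W: "(\<lambda>x. ?P k x - u x) \<in> W21" for k by (intro Wip.diff_mem basis.P_mem u)
    have eq: "(\<lambda>x. ?P m x - ?P n x) = (\<lambda>x. (?P m x - u x) - (?P n x - u x))" by simp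
    have "C.q (\<lambda>y. tr (?P m) y - tr (?P n) y) \<le> 3 * (Wip.q (\<lambda>x. ?P m x - ?P n x) + WD.q (\<lambda>x. ?P m x - ?P n x))"
      using C1_hemi_trace(2)[OF C1_hemi_diff[OF P_C1_hemi P_C1_hemi]] by (simp add: tr_diff)
    also have "\<dots> \<le> 6 * (d m + d n)"
      unfolding eq d_def using Wip.q_diff_le[OF W W, of m n] WD.q_diff_le[OF W W, of m n] by simp
    finally show ?thesis .
  qed
  have small: "p < e" if "p \<le> 6 * (a + b)" "a < e / 12" "b < e / 12" for p a b e :: real
    using that by argo
  obtain g where g: "g \<in> sqi circ" "(\<lambda>n. C.q (\<lambda>y. tr (?P n) y - g y)) \<longlonglongrightarrow> 0"
  proof (rule C_cauchy_limit[of "\<lambda>n. tr (?P n)"])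
    fix \<epsilon> :: real assume "\<epsilon> > 0"
    then have "\<forall>\<^sub>F n in sequentially. d n < \<epsilon> / 12" using order_tendstoD(2)[OF d0, of "\<epsilon> / 12"] by simp
    then obtain N where N: "\<And>n. n \<ge> N \<Longrightarrow> d n < \<epsilon> / 12" by (auto simp: eventually_sequentially)
    have "C.q (\<lambda>x. tr (?P m) x - tr (?P n) x) < \<epsilon>" if "m \<ge> N" "n \<ge> N" for m n
      by (rule small[OF le N[OF that(1)] N[OF that(2)]])
    then show "\<exists>N. \<forall>m\<ge>N. \<forall>n\<ge>N. C.q (\<lambda>x. tr (?P m) x - tr (?P n) x) < \<epsilon>" by blast
  qed (rule PC)
  then have "has_trace u g" unfolding has_trace_iff[OF u]
    using P_C1_hemi P_q_tendsto[OF u] by (intro conjI exI[of _ ?P]) auto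
  then show ?thesis by blast
qed

text \<open>Whatever approximating sequence belongs to the chosen trace, the trace inequality ties
  it to the partial sums. The trace is therefore computable from the expansion of
  \<open>u\<close>.\<close>

lemma trace_eq_limit:
  assumes u: "u \<in> W21"
  shows "trace_eq u \<in> sqi circ" "(\<lambda>n. C.q (\<lambda>y. tr (basis.P n u) y - trace_eq u y)) \<longlonglongrightarrow> 0"
proof -
  let ?P = "\<lambda>n. basis.P n u"
  have "has_trace u (trace_eq u)" unfolding trace_eq_def by (rule someI_ex[OF trace_exists[OF u]])
  then obtain w where g: "trace_eq u \<in> sqi circ" and w: "\<And>n. w n \<in> C1_hemi"
    "(\<lambda>n. Wip.q (\<lambda>x. w n x - u x) + WD.q (\<lambda>x. w n x - u x)) \<longlonglongrightarrow> 0"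
    "(\<lambda>n. C.q (\<lambda>y. tr (w n) y - trace_eq u y)) \<longlonglongrightarrow> 0"
    unfolding has_trace_iff[OF u] by blast
  show "trace_eq u \<in> sqi circ" by (rule g)
  have WW: "w n \<in> W21" for n by (rule C1_hemi_W21[OF w(1)])
  define d where "d n = Wip.q (\<lambda>x. ?P n x - u x) + WD.q (\<lambda>x. ?P n x - u x)" for n
  define d' where "d' n = Wip.q (\<lambda>x. w n x - u x) + WD.q (\<lambda>x. w n x - u x)" for n
  define r where "r n = C.q (\<lambda>y. tr (w n) y - trace_eq u y)" for n
  have T: "tr (?P n) \<in> sqi circ" "tr (w n) \<in> sqi circ" for n by (intro C1_hemi_trace(1) P_C1_hemi w)+
  have le: "C.q (\<lambda>y. tr (?P n) y - trace_eq u y) \<le> 2 * r n + 12 * (d n + d' n)" for n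
  proof -
    have W: "(\<lambda>x. ?P n x - u x) \<in> W21" "(\<lambda>x. w n x - u x) \<in> W21" by (intro Wip.diff_mem basis.P_mem u WW)+
    have eq: "(\<lambda>x. w n x - ?P n x) = (\<lambda>x. (w n x - u x) - (?P n x - u x))" by simp
    have "C.q (\<lambda>y. tr (w n) y - tr (?P n) y) \<le> 3 * (Wip.q (\<lambda>x. w n x - ?P n x) + WD.q (\<lambda>x. w n x - ?P n x))"
      using C1_hemi_trace(2)[OF C1_hemi_diff[OF w(1) P_C1_hemi]] by (simp add: tr_diff)
    also have "\<dots> \<le> 6 * (d n + d' n)"
      unfolding eq d_def d'_def using Wip.q_diff_le[OF W(2,1)] WD.q_diff_le[OF W(2,1)] by simp
    finally have 1: "C.q (\<lambda>y. tr (w n) y - tr (?P n) y) \<le> 6 * (d n + d' n)" .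
    have eq2: "(\<lambda>y. tr (?P n) y - trace_eq u y) = (\<lambda>y. (tr (w n) y - trace_eq u y) - (tr (w n) y - tr (?P n) y))" by simp
    show ?thesis
      unfolding eq2 using C.q_diff_le[OF C.diff_mem[OF T(2) g] C.diff_mem[OF T(2,1)], of n n n] 1 by (simp add: r_def)
  qed
  have "(\<lambda>n. 2 * r n + 12 * (d n + d' n)) \<longlonglongrightarrow> 2 * 0 + 12 * (0 + 0)"
    unfolding d_def d'_def r_def by (intro tendsto_intros w P_q_tendsto[OF u])
  then have l: "(\<lambda>n. 2 * r n + 12 * (d n + d' n)) \<longlonglongrightarrow> 0" by simp
  show "(\<lambda>n. C.q (\<lambda>y. tr (?P n) y - trace_eq u y)) \<longlonglongrightarrow> 0"
    by (rule tendsto_sandwich[OF _ _ tendsto_const l]) (simp_all only: le C.pos[OF C.diff_mem[OF T(1) g]] eventually_True)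
qed

section \<open>The Robin form\<close>

text \<open>Parseval's identity after grouping the indices by frequency; different frequencies do
  not interact on the equator.\<close>

lemma circ_modes:
  fixes m :: "'i \<Rightarrow> int"
  assumes "finite J"
  shows "C.q (\<lambda>y. \<Sum>j\<in>J. b j * cis (of_int (m j) * y)) = 2 * pi * (\<Sum>k\<in>m ` J. (cmod (\<Sum>j\<in>{j\<in>J. m j = k}. b j))\<^sup>2)"
proof -
  define \<beta> where "\<beta> k = (\<Sum>j\<in>{j\<in>J. m j = k}. b j)" for k
  define md where "md k = (\<lambda>y::real. cis (of_int k * y))" for k :: int
  have md: "md k \<in> sqi circ" for k unfolding md_def by (intro sqi_circ_continuous continuous_intros)
  have mi: "ipm circ (md k) (md k') = (if k = k' then of_real (2 * pi) else 0)" for k k'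
  proof -
    have "ipm circ (md k) (md k') = (LINT y|circ. cis (of_int (k - k') * y))"
      unfolding ipm_def md_def by (simp add: cis_cnj cis_mult algebra_simps)
    then show ?thesis unfolding integral_circ_cis by simp
  qed
  have fin: "finite (m ` J)" using assms by simp
  have eq: "(\<Sum>j\<in>J. b j * cis (of_int (m j) * y)) = (\<Sum>k\<in>m ` J. \<beta> k * md k y)" for y
  proof -
    have "(\<Sum>j\<in>J. b j * cis (of_int (m j) * y)) = (\<Sum>k\<in>m ` J. \<Sum>j\<in>{j\<in>J. m j = k}. b j * cis (of_int (m j) * y))"
      by (rule sum.image_gen[OF assms])
    also have "\<dots> = (\<Sum>k\<in>m ` J. \<beta> k * md k y)"
      unfolding \<beta>_def sum_distrib_right md_def by (intro sum.cong) auto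
    finally show ?thesis .
  qed
  have s: "(\<lambda>y. \<Sum>k\<in>m ` J. \<beta> k * md k y) \<in> sqi circ" by (intro C.sum_mem md)
  have "ipm circ (\<lambda>y. \<Sum>k\<in>m ` J. \<beta> k * md k y) (\<lambda>y. \<Sum>k\<in>m ` J. \<beta> k * md k y)
     = (\<Sum>k\<in>m ` J. \<beta> k * ipm circ (md k) (\<lambda>y. \<Sum>k\<in>m ` J. \<beta> k * md k y))"
    by (rule C.sum_left[OF md s])
  also have "\<dots> = (\<Sum>k\<in>m ` J. of_real (2 * pi * (cmod (\<beta> k))\<^sup>2))"
  proof (rule sum.cong[OF refl])
    fix k assume k: "k \<in> m ` J"
    have "ipm circ (md k) (\<lambda>y. \<Sum>k\<in>m ` J. \<beta> k * md k y) = (\<Sum>k'\<in>m ` J. cnj (\<beta> k') * ipm circ (md k) (md k'))"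
      by (rule C.sum_right[OF md md])
    also have "\<dots> = (\<Sum>k'\<in>m ` J. if k = k' then cnj (\<beta> k) * of_real (2 * pi) else 0)"
      unfolding mi by (intro sum.cong) auto
    also have "\<dots> = cnj (\<beta> k) * of_real (2 * pi)" using k fin by simp
    finally have "\<beta> k * ipm circ (md k) (\<lambda>y. \<Sum>k\<in>m ` J. \<beta> k * md k y) = (\<beta> k * cnj (\<beta> k)) * of_real (2 * pi)"
      by simp
    also have "\<beta> k * cnj (\<beta> k) = of_real ((cmod (\<beta> k))\<^sup>2)" by (simp only: complex_norm_square)
    finally show "\<beta> k * ipm circ (md k) (\<lambda>y. \<Sum>k\<in>m ` J. \<beta> k * md k y) = of_real (2 * pi * (cmod (\<beta> k))\<^sup>2)"
      by (simp only: of_real_mult mult.commute)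
  qed
  also have "\<dots> = of_real (2 * pi * (\<Sum>k\<in>m ` J. (cmod (\<beta> k))\<^sup>2))"
    by (simp only: of_real_sum sum_distrib_left)
  finally show ?thesis unfolding eq \<beta>_def[symmetric] by simp
qed

definition ang :: "nat \<times> nat \<Rightarrow> int" where "ang j = int (fst j) - int (snd j)"
text \<open>The boundary amplitude: on the equator \<open>eb j\<close> is \<open>tv j\<close> times
  the Fourier mode of frequency \<open>ang j\<close>.\<close>

definition tv :: "nat \<times> nat \<Rightarrow> complex" where "tv j = kap j * of_real (pf (fst j) (snd j) (pi/2))"

lemma tr_P: "tr (basis.P n u) = (\<lambda>y. \<Sum>j\<in>Jset n. (L2_inner u (eb j) * tv j) * cis (of_int (ang j) * y))"
  unfolding tr_def basis.P_def eb_def E_def fmode_def tv_def ang_def by (simp add: mult_ac)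

lemma tv_norm: "2 * pi * (cmod (tv j))\<^sup>2 = (pf (fst j) (snd j) (pi/2))\<^sup>2 / nrm j"
proof -
  have "cmod (kap j) = 1 / sqrt (2 * pi * nrm j)"
    using nrm_pos[of j] unfolding kap_def by (simp only: norm_of_real) simp
  then have "(cmod (tv j))\<^sup>2 = (pf (fst j) (snd j) (pi/2))\<^sup>2 / (2 * pi * nrm j)"
    using nrm_pos[of j] by (simp add: tv_def norm_mult power_mult_distrib power_divide)
  then show ?thesis using nrm_pos[of j] by (simp add: field_simps)
qed

text \<open>For a fixed frequency an index is determined by its degree, which is at least
  \<open>\<bar>k\<bar>\<close>, so this becomes a sum over degrees. The constant is 8 from
  \<open>trace_bound\<close> times 11 from \<open>resolvent_sum\<close>.\<close>

lemma trace_weight_sum: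
  assumes C: "C \<ge> 1" and t: "\<And>l. C * sqrt (real (l + 1)) \<le> \<bar>ev l - t\<bar>"
  shows "(\<Sum>j\<in>{j\<in>Jset n. ang j = k}. 2 * pi * (cmod (tv j))\<^sup>2 / \<bar>lamb j - t\<bar>) \<le> 88 / sqrt (sqrt C)"
proof -
  define Jk where "Jk = {j\<in>Jset n. ang j = k}"
  define L :: "nat \<times> nat \<Rightarrow> nat" where "L j = fst j + snd j" for j
  define h where "h l = sqrt (real (l + 1)) / (sqrt (real (l + 1 - nat \<bar>k\<bar>)) * \<bar>ev l - t\<bar>)" for l
  have inj: "inj_on L Jk"
  proof (rule inj_onI)
    fix i j assume "i \<in> Jk" "j \<in> Jk" "L i = L j"
    then have "fst i = fst j" "snd i = snd j" by (auto simp: Jk_def ang_def L_def)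
    then show "i = j" by (simp add: prod_eq_iff)
  qed
  have "(\<Sum>j\<in>Jk. 2 * pi * (cmod (tv j))\<^sup>2 / \<bar>lamb j - t\<bar>) \<le> (\<Sum>j\<in>Jk. 8 * h (L j))"
  proof (rule sum_mono)
    fix j assume "j \<in> Jk"
    then have k: "k = int (fst j) - int (snd j)" by (simp add: Jk_def ang_def)
    have "2 * pi * (cmod (tv j))\<^sup>2 = (pf (fst j) (snd j) (pi/2))\<^sup>2 / nrm j" by (rule tv_norm)
    also have "\<dots> \<le> 8 * sqrt (real (L j + 1)) / sqrt (real (L j + 1 - nat \<bar>k\<bar>))"
      using trace_bound[of "fst j" "snd j"] nrm_pos[of j] unfolding k L_def by (simp add: divide_le_eq)
    finally have "2 * pi * (cmod (tv j))\<^sup>2 / \<bar>lamb j - t\<bar> \<le> 8 * sqrt (real (L j + 1)) / sqrt (real (L j + 1 - nat \<bar>k\<bar>)) / \<bar>lamb j - t\<bar>"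
      by (rule divide_right_mono) simp
    then show "2 * pi * (cmod (tv j))\<^sup>2 / \<bar>lamb j - t\<bar> \<le> 8 * h (L j)" by (simp add: h_def lamb_def L_def)
  qed
  also have "\<dots> = 8 * (\<Sum>l\<in>L ` Jk. h l)" using inj by (simp add: sum.reindex sum_distrib_left)
  also have "\<dots> \<le> 8 * (\<Sum>l=nat \<bar>k\<bar>..<n. h l)"
    by (intro mult_left_mono sum_mono2) (auto simp: Jk_def L_def Jset_def ang_def h_def)
  also have "\<dots> \<le> 8 * (11 / sqrt (sqrt C))"
    unfolding h_def by (intro mult_left_mono resolvent_sum C t) simp
  finally show ?thesis by (simp add: Jk_def)
qed

lemma trace_P_bound:
  assumes C: "C \<ge> 1" and t: "\<And>l. C * sqrt (real (l + 1)) \<le> \<bar>ev l - t\<bar>"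
  shows "C.q (tr (basis.P n u)) \<le> 88 / sqrt (sqrt C) * (\<Sum>j\<in>Jset n. \<bar>lamb j - t\<bar> * (cmod (L2_inner u (eb j)))\<^sup>2)"
proof -
  define c where "c j = L2_inner u (eb j)" for j
  define w where "w j = \<bar>lamb j - t\<bar>" for j
  have w: "w j > 0" for j
  proof -
    have "0 < C * sqrt (real (fst j + snd j + 1))" using C by simp
    then show ?thesis using t[of "fst j + snd j"] unfolding w_def lamb_def by linarith
  qed
  define Jk where "Jk k = {j\<in>Jset n. ang j = k}" for k
  define G where "G k = (\<Sum>j\<in>Jk k. w j * (cmod (c j))\<^sup>2)" for k
  have fin: "finite (Jk k)" for k using finite_Jset by (simp add: Jk_def)
  have bnd: "2 * pi * (cmod (\<Sum>j\<in>Jk k. c j * tv j))\<^sup>2 \<le> 88 / sqrt (sqrt C) * G k" for k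
  proof -
    \<comment> \<open>The weights are placed so that after Cauchy--Schwarz the first factor is the
      energy of this frequency and the second is the sum in \<open>trace_weight_sum\<close>.\<close>
    have "cmod (\<Sum>j\<in>Jk k. c j * tv j) \<le> (\<Sum>j\<in>Jk k. (sqrt (w j) * cmod (c j)) * (cmod (tv j) / sqrt (w j)))"
      using w by (intro order_trans[OF norm_sum] sum_mono) (simp add: norm_mult less_imp_neq[symmetric])
    then have "(cmod (\<Sum>j\<in>Jk k. c j * tv j))\<^sup>2 \<le> (\<Sum>j\<in>Jk k. (sqrt (w j) * cmod (c j)) * (cmod (tv j) / sqrt (w j)))\<^sup>2"
      by (intro power_mono) auto
    also have "\<dots> \<le> (\<Sum>j\<in>Jk k. (sqrt (w j) * cmod (c j))\<^sup>2) * (\<Sum>j\<in>Jk k. (cmod (tv j) / sqrt (w j))\<^sup>2)"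
      by (rule Cauchy_Schwarz_ineq_sum)
    also have "(\<Sum>j\<in>Jk k. (sqrt (w j) * cmod (c j))\<^sup>2) = G k"
      unfolding G_def using w by (intro sum.cong) (auto simp: power_mult_distrib less_imp_le)
    finally have "2 * pi * (cmod (\<Sum>j\<in>Jk k. c j * tv j))\<^sup>2 \<le> 2 * pi * (G k * (\<Sum>j\<in>Jk k. (cmod (tv j) / sqrt (w j))\<^sup>2))"
      by (intro mult_left_mono) auto
    also have "\<dots> = G k * (\<Sum>j\<in>Jk k. 2 * pi * (cmod (tv j))\<^sup>2 / w j)"
      unfolding sum_distrib_left using w by (intro sum.cong refl) (simp add: power_divide less_imp_le)
    also have "\<dots> \<le> G k * (88 / sqrt (sqrt C))"
    proof (rule mult_left_mono)
      show "(\<Sum>j\<in>Jk k. 2 * pi * (cmod (tv j))\<^sup>2 / w j) \<le> 88 / sqrt (sqrt C)"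
        unfolding Jk_def w_def by (rule trace_weight_sum[OF C t])
      show "0 \<le> G k" unfolding G_def using w by (intro sum_nonneg mult_nonneg_nonneg) (auto intro: less_imp_le)
    qed
    finally show ?thesis by (simp only: mult.commute)
  qed
  have "C.q (tr (basis.P n u)) = (\<Sum>k\<in>ang ` Jset n. 2 * pi * (cmod (\<Sum>j\<in>Jk k. c j * tv j))\<^sup>2)"
    unfolding tr_P circ_modes[OF finite_Jset] c_def Jk_def by (simp only: sum_distrib_left)
  also have "\<dots> \<le> (\<Sum>k\<in>ang ` Jset n. 88 / sqrt (sqrt C) * G k)" by (rule sum_mono[OF bnd])
  also have "\<dots> = 88 / sqrt (sqrt C) * (\<Sum>k\<in>ang ` Jset n. G k)" by (simp only: sum_distrib_left)
  also have "(\<Sum>k\<in>ang ` Jset n. G k) = (\<Sum>j\<in>Jset n. w j * (cmod (c j))\<^sup>2)"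
    unfolding G_def Jk_def by (rule sum.image_gen[OF finite_Jset, symmetric])
  finally show ?thesis by (simp add: w_def c_def)
qed

lemma trace_eq_bound:
  assumes C: "C \<ge> 1" and t: "\<And>l. C * sqrt (real (l + 1)) \<le> \<bar>ev l - t\<bar>"
    and sep: "basis.separates l t" and u: "u \<in> W21"
  shows "C.q (trace_eq u) \<le> 88 / sqrt (sqrt C) * basis.A l t u"
proof (rule LIMSEQ_le)
  define c where "c j = (cmod (L2_inner u (eb j)))\<^sup>2" for j
  have T: "tr (basis.P n u) \<in> sqi circ" for n by (rule C1_hemi_trace(1)[OF P_C1_hemi])
  show "(\<lambda>n. C.q (tr (basis.P n u))) \<longlonglongrightarrow> C.q (trace_eq u)"
    by (rule C.q_tendsto[OF T trace_eq_limit[OF u]])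
  define a where "a n = (WD.q (basis.P n u) - t * Wip.q (basis.P n u))" for n
  have a: "a n = (\<Sum>j\<in>Jset n. (lamb j - t) * c j)" for n
    unfolding a_def basis.q_P[OF u] basis.Dq_P[OF u] c_def
    by (simp add: sum_distrib_left sum_subtractf left_diff_distrib)
  have sg: "j \<in> Jset l \<Longrightarrow> lamb j - t \<le> 0" "j \<notin> Jset l \<Longrightarrow> 0 \<le> lamb j - t" for j
  proof -
    obtain \<delta> where d: "\<delta> > 0" "\<And>j. j \<in> Jset l \<Longrightarrow> lamb j \<le> t - \<delta>" "\<And>j. j \<notin> Jset l \<Longrightarrow> t + \<delta> \<le> lamb j"
      using sep unfolding basis.separates_def by blast
    show "j \<in> Jset l \<Longrightarrow> lamb j - t \<le> 0" using d(1) d(2)[of j] by simp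
    show "j \<notin> Jset l \<Longrightarrow> 0 \<le> lamb j - t" using d(1) d(3)[of j] by simp
  qed
  \<comment> \<open>The absolute value reverses the sign exactly on \<open>Jset l\<close>. In the
    limit the right side becomes \<open>basis.A l t u\<close>.\<close>
  have eq: "(\<Sum>j\<in>Jset n. \<bar>lamb j - t\<bar> * c j) = a n - 2 * a l" if "n \<ge> l" for n
  proof -
    have sub: "Jset l \<subseteq> Jset n" using that by (rule basis.J_mono)
    have "(\<Sum>j\<in>Jset n. \<bar>lamb j - t\<bar> * c j) = (\<Sum>j\<in>Jset n - Jset l. \<bar>lamb j - t\<bar> * c j) + (\<Sum>j\<in>Jset l. \<bar>lamb j - t\<bar> * c j)"
      by (rule sum.subset_diff[OF sub finite_Jset])
    also have "(\<Sum>j\<in>Jset n - Jset l. \<bar>lamb j - t\<bar> * c j) = (\<Sum>j\<in>Jset n - Jset l. (lamb j - t) * c j)"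
      using sg by (intro sum.cong) auto
    also have "(\<Sum>j\<in>Jset l. \<bar>lamb j - t\<bar> * c j) = (\<Sum>j\<in>Jset l. - ((lamb j - t) * c j))"
      by (intro sum.cong refl) (simp only: abs_of_nonpos[OF sg(1)] mult_minus_left)
    also have "\<dots> = - a l" unfolding a sum_negf ..
    also have "(\<Sum>j\<in>Jset n - Jset l. (lamb j - t) * c j) = a n - a l"
      unfolding a using sum.subset_diff[OF sub finite_Jset, of "\<lambda>j. (lamb j - t) * c j"] by simp
    finally show ?thesis by simp
  qed
  have "a \<longlonglongrightarrow> WD.q u - t * Wip.q u"
    unfolding a_def by (intro tendsto_intros basis.P_tendsto[OF u])
  then have "(\<lambda>n. 88 / sqrt (sqrt C) * (a n - 2 * a l)) \<longlonglongrightarrow> 88 / sqrt (sqrt C) * ((WD.q u - t * Wip.q u) - 2 * a l)"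
    by (intro tendsto_intros)
  moreover have "(WD.q u - t * Wip.q u) - 2 * a l = basis.A l t u"
    unfolding a_def basis.A_def using basis.q_split[OF u, of l] basis.Dq_split[OF u, of l] by (simp add: algebra_simps)
  ultimately show "(\<lambda>n. 88 / sqrt (sqrt C) * (a n - 2 * a l)) \<longlonglongrightarrow> 88 / sqrt (sqrt C) * basis.A l t u" by simp
  show "\<exists>N. \<forall>n\<ge>N. C.q (tr (basis.P n u)) \<le> 88 / sqrt (sqrt C) * (a n - 2 * a l)"
  proof (intro exI[of _ l] allI impI)
    fix n assume n: "l \<le> n"
    show "C.q (tr (basis.P n u)) \<le> 88 / sqrt (sqrt C) * (a n - 2 * a l)"
      using trace_P_bound[OF C t, of n u] unfolding eq[OF n, unfolded c_def] .
  qed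
qed

section \<open>The boundary form of the Robin parameter\<close>

locale robin =
  fixes \<sigma> :: "real \<Rightarrow> real" and S :: real
  assumes \<sigma>_cont: "continuous_on UNIV \<sigma>" and S: "S > 0" and \<sigma>_le: "\<And>y. \<lbrakk>-pi < y; y \<le> pi\<rbrakk> \<Longrightarrow> \<bar>\<sigma> y\<bar> \<le> S"
begin

definition bd :: "(real \<Rightarrow> complex) \<Rightarrow> (real \<Rightarrow> complex) \<Rightarrow> complex" where
  "bd g h = ipm circ (\<lambda>y. of_real (\<sigma> y) * g y) h"

definition rb :: "(real \<times> real \<Rightarrow> complex) \<Rightarrow> (real \<times> real \<Rightarrow> complex) \<Rightarrow> complex" where
  "rb u v = bd (trace_eq u) (trace_eq v)"

lemma sigma_AE: "AE y in circ. cmod (complex_of_real (\<sigma> y)) \<le> S"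
proof -
  have "AE x in lborel. 0 < ennreal (indicator {-pi<..pi} x) \<longrightarrow> cmod (complex_of_real (\<sigma> x)) \<le> S"
    by (rule AE_I2) (use \<sigma>_le in \<open>auto simp: indicator_def\<close>)
  then show ?thesis unfolding circ_def by (subst AE_density) auto
qed

lemma sigma_borel: "(\<lambda>y. complex_of_real (\<sigma> y)) \<in> borel_measurable borel"
  by (intro continuous_borel continuous_intros \<sigma>_cont)

lemma sigma_mult_sqi: "g \<in> sqi circ \<Longrightarrow> (\<lambda>y. of_real (\<sigma> y) * g y) \<in> sqi circ"
  using sigma_borel by (intro sqi_mult_bounded[OF _ _ sigma_AE]) (auto simp: borel_measurable_circ)

lemma sigma_mult_q: "g \<in> sqi circ \<Longrightarrow> C.q (\<lambda>y. of_real (\<sigma> y) * g y) \<le> S\<^sup>2 * C.q g"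
proof -
  assume g: "g \<in> sqi circ"
  have "(LINT x|circ. (cmod (of_real (\<sigma> x) * g x))\<^sup>2) \<le> (LINT x|circ. S\<^sup>2 * (cmod (g x))\<^sup>2)"
  proof (rule integral_mono_AE)
    show "integrable circ (\<lambda>x. (cmod (of_real (\<sigma> x) * g x))\<^sup>2)" by (rule sqi_integrable[OF sigma_mult_sqi[OF g]])
    show "integrable circ (\<lambda>x. S\<^sup>2 * (cmod (g x))\<^sup>2)" using sqi_integrable[OF g] by simp
    show "AE x in circ. (cmod (of_real (\<sigma> x) * g x))\<^sup>2 \<le> S\<^sup>2 * (cmod (g x))\<^sup>2"
      using sigma_AE
    proof eventually_elim
      case (elim x)
      then show ?case unfolding norm_mult power_mult_distrib by (intro mult_right_mono power_mono) auto
    qed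
  qed
  then show ?thesis unfolding ipm_norm by simp
qed

lemma bd_sym: "bd h g = cnj (bd g h)"
proof -
  have "cnj (bd g h) = (LINT y|circ. cnj (of_real (\<sigma> y) * g y * cnj (h y)))"
    unfolding bd_def ipm_def by (rule Bochner_Integration.integral_cnj[symmetric])
  then show ?thesis unfolding bd_def ipm_def by (simp add: mult_ac)
qed

lemma bd_left:
  assumes "f \<in> sqi circ" "g \<in> sqi circ" "h \<in> sqi circ"
  shows "bd (\<lambda>y. a * f y + b * g y) h = a * bd f h + b * bd g h"
proof -
  have "(\<lambda>y. of_real (\<sigma> y) * (a * f y + b * g y)) = (\<lambda>y. a * (of_real (\<sigma> y) * f y) + b * (of_real (\<sigma> y) * g y))"
    by (simp add: algebra_simps)
  then show ?thesis unfolding bd_def using C.left[OF sigma_mult_sqi[OF assms(1)] sigma_mult_sqi[OF assms(2)] assms(3)] by simp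
qed

lemma bd_bound:
  assumes "g \<in> sqi circ"
  shows "\<bar>Re (bd g g)\<bar> \<le> S * C.q g"
proof -
  have "(cmod (bd g g))\<^sup>2 \<le> C.q (\<lambda>y. of_real (\<sigma> y) * g y) * C.q g"
    unfolding bd_def by (rule C.cauchy_schwarz[OF sigma_mult_sqi[OF assms] assms])
  also have "\<dots> \<le> (S\<^sup>2 * C.q g) * C.q g"
    by (intro mult_right_mono sigma_mult_q C.pos assms)
  also have "\<dots> = (S * C.q g)\<^sup>2" by (simp add: power2_eq_square)
  finally have "cmod (bd g g) \<le> S * C.q g"
    by (rule power2_le_imp_le) (use S C.pos[OF assms] in simp)
  then show ?thesis using abs_Re_le_cmod[of "bd g g"] by linarith
qed

lemma bd_trace_limit:
  assumes u: "u \<in> W21" and v: "v \<in> W21"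
  shows "(\<lambda>n. bd (tr (basis.P n u)) (tr (basis.P n v))) \<longlonglongrightarrow> rb u v"
  unfolding rb_def bd_def
proof (rule C.tendsto_both)
  have T: "tr (basis.P n u) \<in> sqi circ" for n u by (rule C1_hemi_trace(1)[OF P_C1_hemi])
  note tu = trace_eq_limit[OF u] and tv = trace_eq_limit[OF v]
  show "(\<lambda>y. of_real (\<sigma> y) * tr (basis.P n u) y) \<in> sqi circ" "tr (basis.P n v) \<in> sqi circ" for n by (intro sigma_mult_sqi T)+
  show "(\<lambda>y. of_real (\<sigma> y) * trace_eq u y) \<in> sqi circ" by (intro sigma_mult_sqi tu)
  show "trace_eq v \<in> sqi circ" by (rule tv)
  show "(\<lambda>n. C.q (\<lambda>x. tr (basis.P n v) x - trace_eq v x)) \<longlonglongrightarrow> 0" by (rule tv)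
  have l: "(\<lambda>n. S\<^sup>2 * C.q (\<lambda>x. tr (basis.P n u) x - trace_eq u x)) \<longlonglongrightarrow> 0"
    using tendsto_mult[OF tendsto_const[of "S\<^sup>2"] tu(2)] by simp
  have d: "(\<lambda>x. tr (basis.P n u) x - trace_eq u x) \<in> sqi circ" for n by (intro C.diff_mem T tu)
  show "(\<lambda>n. C.q (\<lambda>x. of_real (\<sigma> x) * tr (basis.P n u) x - of_real (\<sigma> x) * trace_eq u x)) \<longlonglongrightarrow> 0"
    unfolding right_diff_distrib[symmetric]
    by (rule tendsto_sandwich[OF _ _ tendsto_const l]) (simp_all only: sigma_mult_q[OF d] C.pos[OF sigma_mult_sqi[OF d]] eventually_True)
qed

text \<open>\<open>trace_eq\<close> is chosen separately for each function and need not be pointwise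
  linear. Linearity of the form is obtained from the partial sums, which are linear in
  \<open>u\<close>, by passing to the limit.\<close>

lemma hermitian_rb: "hermitian W21 rb"
proof
  show "lin_closed W21" by (rule W21_lin)
  show "rb v u = cnj (rb u v)" for u v unfolding rb_def by (rule bd_sym)
  fix u v w a b assume W: "u \<in> W21" "v \<in> W21" "w \<in> W21"
  have T: "tr (basis.P n u) \<in> sqi circ" for n u by (rule C1_hemi_trace(1)[OF P_C1_hemi])
  have P: "basis.P n (\<lambda>x. a * u x + b * v x) = (\<lambda>x. a * basis.P n u x + b * basis.P n v x)" for n
    unfolding basis.P_def using W eb_W21 by (simp add: Wip.left distrib_right sum.distrib sum_distrib_left mult.assoc)
  have "bd (tr (basis.P n (\<lambda>x. a * u x + b * v x))) (tr (basis.P n w))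
    = a * bd (tr (basis.P n u)) (tr (basis.P n w)) + b * bd (tr (basis.P n v)) (tr (basis.P n w))" for n
    unfolding P using bd_left[OF T T T, of a n u b n v n w] by (simp add: tr_def)
  then show "rb (\<lambda>x. a * u x + b * v x) w = a * rb u w + b * rb v w"
    by (rule LIMSEQ_eqI[OF _ bd_trace_limit[OF Wip.comb_mem[OF W(1,2)] W(3)]])
      (intro tendsto_intros bd_trace_limit W)
qed

lemma robin_form_eq:
  assumes "u \<in> W21" "v \<in> W21"
  shows "robin_form \<sigma> u v = dirichlet u v + rb u v"
proof -
  have "trace_eq u \<in> borel_measurable borel" "trace_eq v \<in> borel_measurable borel"
    using trace_eq_limit(1)[OF assms(1)] trace_eq_limit(1)[OF assms(2)] sqi_measurable borel_measurable_circ by auto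
  note [measurable] = this sigma_borel
  show ?thesis unfolding robin_form_def rb_def bd_def ipm_def
    by (subst integral_circ) (auto simp: mult.assoc)
qed

text \<open>The trace estimate multiplied by \<open>S\<close> has the factor
  \<open>88 * S / sqrt (sqrt C)\<close>. The number 176 is twice 88, which makes this factor at most
  1/2.\<close>

lemma rb_gap:
  assumes C: "C \<ge> 1" "176 * S \<le> sqrt (sqrt C)" and t: "\<And>l. C * sqrt (real (l + 1)) \<le> \<bar>ev l - t\<bar>"
    and sep: "basis.separates l t" and u: "u \<in> W21"
  shows "\<bar>Re (rb u u)\<bar> \<le> basis.A l t u / 2"
proof -
  obtain \<delta> where \<delta>: "\<delta> > 0" "\<And>u. u \<in> W21 \<Longrightarrow> \<delta> * Wip.q u \<le> basis.A l t u"
    using basis.A_lower[OF sep] by blast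
  have A: "0 \<le> basis.A l t u" using \<delta>(2)[OF u] \<delta>(1) Wip.pos[OF u] by (meson mult_nonneg_nonneg less_imp_le order_trans)
  have "\<bar>Re (rb u u)\<bar> \<le> S * C.q (trace_eq u)"
    unfolding rb_def by (rule bd_bound[OF trace_eq_limit(1)[OF u]])
  also have "\<dots> \<le> S * (88 / sqrt (sqrt C) * basis.A l t u)"
    using S by (intro mult_left_mono trace_eq_bound[OF C(1) t sep u]) auto
  also have "\<dots> = (88 * S / sqrt (sqrt C)) * basis.A l t u" by simp
  also have "\<dots> \<le> (1 / 2) * basis.A l t u"
    using C A by (intro mult_right_mono) (auto simp: divide_le_eq)
  finally show ?thesis by simp
qed

text \<open>It shows that \<open>- (C\<^sup>2 + C)\<close> keeps the distance from every
  \<open>ev l\<close> which the trace estimate requires.\<close>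

lemma ev_plus_ge: "C > 0 \<Longrightarrow> C * sqrt (real (l + 1)) \<le> ev l + (C\<^sup>2 + C)"
proof -
  assume C: "C > 0"
  have "sqrt (real (l + 1)) \<le> real (l + 1)" by (intro real_le_lsqrt) (auto simp: power2_eq_square)
  then have "C * sqrt (real (l + 1)) \<le> C * real (l + 1)" using C by (intro mult_left_mono) auto
  also have "\<dots> = C * real l + C" by (simp add: algebra_simps)
  also have "C * real l \<le> (real l)\<^sup>2 + C\<^sup>2"
  proof -
    have "0 \<le> C * real l" using C by simp
    then show ?thesis using sum_squares_bound[of C "real l"] by simp
  qed
  also have "(real l)\<^sup>2 + C\<^sup>2 + C \<le> ev l + (C\<^sup>2 + C)" by (simp add: ev_def power2_eq_square algebra_simps)
  finally show ?thesis by simp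
qed

text \<open>The relative bound is the gap estimate itself, used at the point \<open>- K\<close>
  below the whole spectrum: with \<open>Jset 0\<close> empty, the form \<open>A 0 (- K)\<close> is
  \<open>D + K * ip\<close>.\<close>

lemma form_setting_robin: "form_setting W21 L2_inner dirichlet rb eb lamb Jset"
proof -
  interpret B: hermitian W21 rb by (rule hermitian_rb)
  define C where "C = max 1 ((176 * S) ^ 4)"
  have C: "C \<ge> 1" by (simp add: C_def)
  have C2: "176 * S \<le> sqrt (sqrt C)"
  proof (intro real_le_rsqrt)
    show "((176 * S)\<^sup>2)\<^sup>2 \<le> C" unfolding C_def by (simp flip: power_mult)
  qed
  define K where "K = C\<^sup>2 + C"
  have K: "K > 0" unfolding K_def using C by (intro add_pos_pos) auto
  have evnn: "0 \<le> ev l" for l by (simp add: ev_def)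
  have t: "C * sqrt (real (l + 1)) \<le> \<bar>ev l - (- K)\<bar>" for l
    using ev_plus_ge[of C l] C evnn[of l] K unfolding K_def by simp
  have J0: "Jset 0 = {}" by (simp add: Jset_def)
  have sep: "basis.separates 0 (- K)"
    unfolding basis.separates_def J0 using K evnn by (intro exI[of _ K]) (auto simp: lamb_def)
  have A0: "basis.A 0 (- K) u = WD.q u + K * Wip.q u" if "u \<in> W21" for u
    unfolding basis.A_def basis.Q_def basis.P_def J0 using that by (simp add: Wip.zero_left WD.zero_left Wip.zero_mem)
  have "\<bar>B.q u\<bar> \<le> (WD.q u + K * Wip.q u) / 2" if "u \<in> W21" for u
    using rb_gap[OF C C2 t sep that] A0[OF that] by simp
  then show ?thesis using K
    unfolding form_setting_def form_setting_axioms_def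
    by (intro conjI basis.spectral_basis_axioms hermitian_rb exI[of _ K]) auto
qed

end

section \<open>Counting eigenvalues\<close>

text \<open>Otherwise all terms, and so the supremum, are at most \<open>n - 1\<close>. The case
  \<open>n = 0\<close> is excluded because the supremum of the empty set is 0.\<close>

lemma enat_le_SUP:
  assumes "0 < n" "enat n \<le> (SUP x\<in>X. f x)"
  shows "\<exists>x\<in>X. enat n \<le> f x"
proof (rule ccontr)
  assume "\<not> ?thesis"
  then have "f x \<le> enat (n - 1)" if "x \<in> X" for x
    using that assms(1) by (cases "f x") (auto simp: not_le)
  then have "(SUP x\<in>X. f x) \<le> enat (n - 1)" by (rule SUP_least)
  with assms(2) have "enat n \<le> enat (n - 1)" by (rule order_trans)
  then show False using assms(1) by simp
qed

text \<open>An extended natural number is determined by its finite lower bounds. Counts are compared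
  in this way, since a lower bound means the existence of a finite system of eigenvectors.\<close>

lemma enat_eqI:
  assumes "\<And>k. enat k \<le> a \<longleftrightarrow> enat k \<le> b"
  shows "a = (b::enat)"
proof (rule antisym)
  have "x \<le> y" if "\<And>k. enat k \<le> x \<Longrightarrow> enat k \<le> y" for x y :: enat
  proof (cases x)
    case infinity
    then have "enat k \<le> y" for k using that by simp
    then have "y = \<infinity>" by (cases y) (auto dest: spec[of _ "Suc _"], metis Suc_n_not_le_n)
    then show ?thesis by simp
  qed (use that in auto)
  then show "a \<le> b" "b \<le> a" using assms by blast+
qed

context robin
begin

sublocale F: form_setting W21 L2_inner dirichlet rb eb lamb Jset by (rule form_setting_robin)

lemma eigenspace_iff: "u \<in> robin_eigenspace \<sigma> \<mu> \<longleftrightarrow> F.eig \<mu> u"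
proof -
  have "(\<lambda>x. of_real \<mu> * u x) \<in> L2" if "u \<in> W21" by (rule L2.scale_mem[OF W21_L2[OF that]])
  moreover have "robin_form \<sigma> u v = L2_inner (\<lambda>x. of_real \<mu> * u x) v \<longleftrightarrow> dirichlet u v + rb u v = of_real \<mu> * L2_inner u v"
    if "u \<in> W21" "v \<in> W21" for v
    using that by (simp add: robin_form_eq Wip.scale_left)
  ultimately show ?thesis unfolding robin_eigenspace_def robin_op_rel_def F.eig_def by auto
qed

section \<open>Multiplicities as sizes of orthonormal systems\<close>

definition onb :: "real \<Rightarrow> nat \<Rightarrow> (nat \<Rightarrow> real \<times> real \<Rightarrow> complex) \<Rightarrow> bool" where
  "onb \<mu> n us \<longleftrightarrow> (\<forall>i<n. F.eig \<mu> (us i)) \<and> (\<forall>i<n. \<forall>k<n. L2_inner (us i) (us k) = (if i = k then 1 else 0))"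

lemma eig_W21: "F.eig \<mu> u \<Longrightarrow> u \<in> W21" by (simp add: F.eig_def)

lemma eig_sum:
  assumes "\<And>i. i \<in> A \<Longrightarrow> F.eig \<mu> (us i)"
  shows "F.eig \<mu> (\<lambda>x. \<Sum>i\<in>A. c i * us i x)"
  unfolding F.eig_def
proof (intro conjI ballI)
  have W: "\<And>i. i \<in> A \<Longrightarrow> us i \<in> W21" using assms eig_W21 by blast
  show "(\<lambda>x. \<Sum>i\<in>A. c i * us i x) \<in> W21" by (rule Wip.sum_mem[OF W])
  fix v assume v: "v \<in> W21"
  have "dirichlet (\<lambda>x. \<Sum>i\<in>A. c i * us i x) v = (\<Sum>i\<in>A. c i * dirichlet (us i) v)"
    "rb (\<lambda>x. \<Sum>i\<in>A. c i * us i x) v = (\<Sum>i\<in>A. c i * rb (us i) v)"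
    "L2_inner (\<lambda>x. \<Sum>i\<in>A. c i * us i x) v = (\<Sum>i\<in>A. c i * L2_inner (us i) v)"
    by (rule WD.sum_left F.B.sum_left Wip.sum_left, erule W, rule v)+
  then have eqs: "dirichlet (\<lambda>x. \<Sum>i\<in>A. c i * us i x) v + rb (\<lambda>x. \<Sum>i\<in>A. c i * us i x) v
      = (\<Sum>i\<in>A. c i * dirichlet (us i) v + c i * rb (us i) v)"
    "of_real \<mu> * L2_inner (\<lambda>x. \<Sum>i\<in>A. c i * us i x) v = (\<Sum>i\<in>A. of_real \<mu> * (c i * L2_inner (us i) v))"
    by (simp_all only: sum.distrib sum_distrib_left)
  show "dirichlet (\<lambda>x. \<Sum>i\<in>A. c i * us i x) v + rb (\<lambda>x. \<Sum>i\<in>A. c i * us i x) v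
    = of_real \<mu> * L2_inner (\<lambda>x. \<Sum>i\<in>A. c i * us i x) v"
    unfolding eqs
  proof (rule sum.cong[OF refl])
    fix i assume "i \<in> A"
    then have "dirichlet (us i) v + rb (us i) v = of_real \<mu> * L2_inner (us i) v"
      using assms v by (simp add: F.eig_def)
    then show "c i * dirichlet (us i) v + c i * rb (us i) v = of_real \<mu> * (c i * L2_inner (us i) v)"
      by (simp only: distrib_left[symmetric] mult.left_commute)
  qed
qed

lemma eig_scale: "F.eig \<mu> u \<Longrightarrow> F.eig \<mu> (\<lambda>x. c * u x)"
  using eig_sum[of "{()}" \<mu> "\<lambda>_. u" "\<lambda>_. c"] by simp

lemma eig_orth:
  assumes u: "F.eig \<mu> u" and v: "F.eig \<nu> v" and ne: "\<mu> \<noteq> \<nu>"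
  shows "L2_inner u v = 0"
proof -
  have W: "u \<in> W21" "v \<in> W21" using u v by (auto simp: eig_W21)
  have "of_real \<mu> * L2_inner u v = dirichlet u v + rb u v" using u W by (simp add: F.eig_def)
  also have "\<dots> = cnj (dirichlet v u + rb v u)"
    using WD.sym[OF W(2,1)] F.B.sym[OF W(2,1)] by simp
  also have "\<dots> = of_real \<nu> * L2_inner u v"
    using v W Wip.sym[OF W(2,1)] by (simp add: F.eig_def)
  finally show ?thesis using ne by simp
qed

text \<open>In place of Gram--Schmidt: as long as \<open>k < n\<close>, the \<open>n\<close>
  independent eigenvectors have a nontrivial combination orthogonal to the \<open>k\<close> vectors
  already chosen. Independence makes it nonzero, so it can be normalised.\<close>

lemma independent_imp_onb:
  assumes us: "\<And>i. i < n \<Longrightarrow> F.eig \<mu> (us i)" and ind: "L2_independent n us"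
  shows "k \<le> n \<Longrightarrow> \<exists>ws. onb \<mu> k ws"
proof (induction k)
  case 0
  then show ?case by (simp add: onb_def)
next
  case (Suc k)
  then obtain ws where ws: "onb \<mu> k ws" by auto
  have wW: "\<And>i. i < k \<Longrightarrow> ws i \<in> W21" using ws by (auto simp: onb_def eig_W21)
  have uW: "\<And>i. i < n \<Longrightarrow> us i \<in> W21" using us eig_W21 by blast
  obtain c where c: "\<exists>j\<in>{..<n}. c j \<noteq> 0" "\<And>i. i < k \<Longrightarrow> (\<Sum>j<n. c j * L2_inner (us j) (ws i)) = 0"
    using homogeneous_system_solvable[of "{..<n}" k "\<lambda>i j. L2_inner (us j) (ws i)"] Suc.prems by auto
  define x where "x = (\<lambda>z. \<Sum>j\<in>{..<n}. c j * us j z)"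
  have xe: "F.eig \<mu> x" unfolding x_def by (rule eig_sum) (use us in auto)
  have xW: "x \<in> W21" by (rule eig_W21[OF xe])
  have "Wip.q x \<noteq> 0"
  proof
    assume "Wip.q x = 0"
    then have "AE z in hemi. x z = 0" using L2_q_eq_0[OF W21_L2[OF xW]] by simp
    then show False using ind c(1) unfolding L2_independent_def x_def by auto
  qed
  then have q: "Wip.q x > 0" using Wip.pos[OF xW] by simp
  define w where "w = (\<lambda>z. of_real (1 / sqrt (Wip.q x)) * x z)"
  have we: "F.eig \<mu> w" unfolding w_def by (rule eig_scale[OF xe])
  have wW': "w \<in> W21" by (rule eig_W21[OF we])
  have "Wip.q w = 1" unfolding w_def using q by (subst Wip.q_scale[OF xW]) (simp add: norm_divide power_divide)
  then have ww: "L2_inner w w = 1" using Wip.diag_real[OF wW'] by simp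
  have xw: "L2_inner x (ws i) = 0" if "i < k" for i
    unfolding x_def using c(2)[OF that] uW wW[OF that] by (subst Wip.sum_left) auto
  have w1: "L2_inner w (ws i) = 0" if "i < k" for i
    unfolding w_def using xw[OF that] wW[OF that] xW by (simp only: Wip.scale_left mult_zero_right)
  have w2: "L2_inner (ws i) w = 0" if "i < k" for i
    using w1[OF that] Wip.sym[OF wW' wW[OF that]] by simp
  have "onb \<mu> (Suc k) (ws(k := w))"
    using ws we ww w1 w2 unfolding onb_def by (auto simp: less_Suc_eq)
  then show ?case by blast
qed

lemma onb_independent:
  assumes "onb \<mu> n us"
  shows "L2_independent n us"
  unfolding L2_independent_def
proof (intro allI impI)
  fix c i assume ae: "AE x in hemi. (\<Sum>i<n. c i * us i x) = 0" and i: "i < n"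
  have W: "\<And>i. i < n \<Longrightarrow> us i \<in> W21" using assms by (auto simp: onb_def eig_W21)
  have o: "\<And>i k. i < n \<Longrightarrow> k < n \<Longrightarrow> L2_inner (us i) (us k) = (if i = k then 1 else 0)" using assms by (auto simp: onb_def)
  have "(\<lambda>x. \<Sum>i<n. c i * us i x) \<in> L2" by (rule W21_L2[OF Wip.sum_mem]) (use W in auto)
  then have "Wip.q (\<lambda>x. \<Sum>i<n. c i * us i x) = 0" using L2_q_eq_0 ae by simp
  then have "(\<Sum>i<n. (cmod (c i))\<^sup>2) = 0" using F.q_orthonormal_sum(2)[OF W o, of n c] by simp
  then show "c i = 0" using i by (simp add: sum_nonneg_eq_0_iff)
qed

lemma mult_ge_iff: "enat n \<le> robin_mult \<sigma> \<mu> \<longleftrightarrow> (\<exists>us. onb \<mu> n us)"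
proof
  assume le: "enat n \<le> robin_mult \<sigma> \<mu>"
  show "\<exists>us. onb \<mu> n us"
  proof (cases "n = 0")
    case True
    then show ?thesis by (simp add: onb_def)
  next
    case False
    then obtain m us where m: "enat n \<le> enat m" "\<forall>i<m. us i \<in> robin_eigenspace \<sigma> \<mu>" "L2_independent m us"
      using enat_le_SUP[OF _ le[unfolded robin_mult_def]] by auto
    show ?thesis by (rule independent_imp_onb[of m \<mu> us n]) (use m in \<open>auto simp: eigenspace_iff\<close>)
  qed
next
  assume "\<exists>us. onb \<mu> n us"
  then obtain us where us: "onb \<mu> n us" by blast
  then have "n \<in> {n. \<exists>us. (\<forall>i<n. us i \<in> robin_eigenspace \<sigma> \<mu>) \<and> L2_independent n us}"
    using onb_independent[OF us] by (auto simp: eigenspace_iff onb_def)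
  then show "enat n \<le> robin_mult \<sigma> \<mu>" unfolding robin_mult_def by (rule SUP_upper)
qed

definition esys_in :: "nat \<Rightarrow> (nat \<Rightarrow> real \<times> real \<Rightarrow> complex) \<Rightarrow> (nat \<Rightarrow> real) \<Rightarrow> real set \<Rightarrow> bool" where
  "esys_in n us \<mu>s I \<longleftrightarrow> F.esys n us \<mu>s \<and> (\<forall>i<n. \<mu>s i \<in> I)"

text \<open>Disjointness of the two sets makes mixed pairs belong to different eigenvalues, and such
  eigenvectors are orthogonal.\<close>

lemma esys_append:
  assumes a: "esys_in n us \<mu>s I" and b: "esys_in m vs \<nu>s K" and d: "I \<inter> K = {}"
  shows "\<exists>ws \<rho>s. esys_in (n + m) ws \<rho>s (I \<union> K)"
proof -
  define ws where "ws i = (if i < n then us i else vs (i - n))" for i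
  define \<rho>s where "\<rho>s i = (if i < n then \<mu>s i else \<nu>s (i - n))" for i
  have e: "F.eig (\<rho>s i) (ws i)" "\<rho>s i \<in> I \<union> K" if "i < n + m" for i
    using that a b unfolding esys_in_def F.esys_def ws_def \<rho>s_def by auto
  have "L2_inner (ws i) (ws k) = (if i = k then 1 else 0)" if i: "i < n + m" and k: "k < n + m" for i k
  proof (cases "\<rho>s i = \<rho>s k")
    case False
    then show ?thesis using eig_orth[OF e(1)[OF i] e(1)[OF k]] by auto
  next
    case True
    have "(i < n \<longleftrightarrow> \<rho>s i \<in> I)" "(k < n \<longleftrightarrow> \<rho>s k \<in> I)"
      using a b d i k unfolding esys_in_def \<rho>s_def by (auto simp: disjoint_iff)
    then have "i < n \<longleftrightarrow> k < n" using True by simp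
    then show ?thesis using a b i k unfolding esys_in_def F.esys_def ws_def by auto
  qed
  then have "esys_in (n + m) ws \<rho>s (I \<union> K)" using e unfolding esys_in_def F.esys_def by blast
  then show ?thesis by blast
qed

lemma esys_restrict:
  assumes a: "esys_in n us \<mu>s I" and A: "A \<subseteq> {..<n}" and K: "\<And>i. i \<in> A \<Longrightarrow> \<mu>s i \<in> K"
  shows "\<exists>ws \<rho>s. esys_in (card A) ws \<rho>s K"
proof -
  have "finite A" using A finite_subset by blast
  then obtain f where f: "bij_betw f {..<card A} A" using ex_bij_betw_nat_finite atLeast0LessThan by metis
  have fA: "f i \<in> A" "f i < n" if "i < card A" for i using f that A by (auto simp: bij_betw_def)
  have inj: "f i = f k \<longleftrightarrow> i = k" if "i < card A" "k < card A" for i k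
    using f that by (auto simp: bij_betw_def inj_on_def)
  have "esys_in (card A) (us \<circ> f) (\<mu>s \<circ> f) K"
    using a fA inj K unfolding esys_in_def F.esys_def by auto
  then show ?thesis by blast
qed

lemma onb_iff_esys: "(\<exists>us. onb \<mu> n us) \<longleftrightarrow> (\<exists>us \<mu>s. esys_in n us \<mu>s {\<mu>})"
proof
  assume "\<exists>us. onb \<mu> n us"
  then obtain us where "onb \<mu> n us" by blast
  then have "esys_in n us (\<lambda>_. \<mu>) {\<mu>}" by (auto simp: onb_def esys_in_def F.esys_def)
  then show "\<exists>us \<mu>s. esys_in n us \<mu>s {\<mu>}" by blast
next
  assume "\<exists>us \<mu>s. esys_in n us \<mu>s {\<mu>}"
  then obtain us \<mu>s where "esys_in n us \<mu>s {\<mu>}" by blast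
  then have "onb \<mu> n us" by (auto simp: onb_def esys_in_def F.esys_def)
  then show "\<exists>us. onb \<mu> n us" by blast
qed

lemma enat_split_le:
  assumes "enat n \<le> a + b"
  obtains k where "k \<le> n" "enat k \<le> a" "enat (n - k) \<le> b"
proof (cases "enat n \<le> a")
  case True
  then show ?thesis using that[of n] by (simp add: zero_enat_def[symmetric])
next
  case False
  then obtain k where k: "a = enat k" "k < n" by (cases a) auto
  then have "enat (n - k) \<le> b" using assms by (cases b) auto
  then show ?thesis using that[of k] k by simp
qed

lemma sum_mult_ge:
  assumes "finite A"
  shows "enat n \<le> (\<Sum>\<mu>\<in>A. robin_mult \<sigma> \<mu>) \<Longrightarrow> \<exists>us \<mu>s. esys_in n us \<mu>s A"
  using assms
proof (induction A arbitrary: n rule: finite_induct)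
  case empty
  then show ?case by (auto simp: esys_in_def F.esys_def zero_enat_def)
next
  case (insert \<mu> A)
  obtain k where k: "k \<le> n" "enat k \<le> robin_mult \<sigma> \<mu>" "enat (n - k) \<le> (\<Sum>\<mu>\<in>A. robin_mult \<sigma> \<mu>)"
    using enat_split_le[of n "robin_mult \<sigma> \<mu>" "\<Sum>\<mu>\<in>A. robin_mult \<sigma> \<mu>"] insert by auto
  obtain us \<mu>s where 1: "esys_in k us \<mu>s {\<mu>}" using k(2) unfolding mult_ge_iff onb_iff_esys by blast
  obtain vs \<nu>s where 2: "esys_in (n - k) vs \<nu>s A" using insert.IH[OF k(3)] by blast
  have "\<exists>ws \<rho>s. esys_in (k + (n - k)) ws \<rho>s ({\<mu>} \<union> A)"
    by (rule esys_append[OF 1 2]) (use insert in auto)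
  then show ?case using k(1) by simp
qed

text \<open>The link between the defined counts and the variational part: eigenvectors chosen for
  each eigenvalue can be merged into one orthonormal system, and a system can be sorted by its
  eigenvalues.\<close>

theorem count_ge_iff: "enat n \<le> robin_count \<sigma> I \<longleftrightarrow> (\<exists>us \<mu>s. esys_in n us \<mu>s I)"
proof
  assume le: "enat n \<le> robin_count \<sigma> I"
  show "\<exists>us \<mu>s. esys_in n us \<mu>s I"
  proof (cases "n = 0")
    case True
    then show ?thesis by (simp add: esys_in_def F.esys_def)
  next
    case False
    then obtain A where A: "finite A" "A \<subseteq> I" "enat n \<le> (\<Sum>\<mu>\<in>A. robin_mult \<sigma> \<mu>)"
      using enat_le_SUP[OF _ le[unfolded robin_count_def]] by auto
    then show ?thesis using sum_mult_ge[OF A(1,3)] unfolding esys_in_def by blast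
  qed
next
  assume "\<exists>us \<mu>s. esys_in n us \<mu>s I"
  then obtain us \<mu>s where e: "esys_in n us \<mu>s I" by blast
  define A where "A = \<mu>s ` {..<n}"
  have A: "finite A" "A \<subseteq> I" using e by (auto simp: A_def esys_in_def)
  have "enat n = enat (\<Sum>\<mu>\<in>A. card {i\<in>{..<n}. \<mu>s i = \<mu>})"
    using sum.image_gen[of "{..<n}" "\<lambda>_. 1::nat" \<mu>s] by (simp add: A_def)
  also have "\<dots> = (\<Sum>\<mu>\<in>A. enat (card {i\<in>{..<n}. \<mu>s i = \<mu>}))"
    using A(1) by (induction A rule: finite_induct) (auto simp: zero_enat_def simp flip: plus_enat_simps(1))
  also have "\<dots> \<le> (\<Sum>\<mu>\<in>A. robin_mult \<sigma> \<mu>)"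
  proof (rule sum_mono)
    fix \<mu>
    show "enat (card {i\<in>{..<n}. \<mu>s i = \<mu>}) \<le> robin_mult \<sigma> \<mu>"
      unfolding mult_ge_iff onb_iff_esys by (rule esys_restrict[OF e]) auto
  qed
  also have "\<dots> \<le> robin_count \<sigma> I" unfolding robin_count_def by (rule SUP_upper) (use A in auto)
  finally show "enat n \<le> robin_count \<sigma> I" .
qed

lemma mult_eq_count: "robin_mult \<sigma> \<mu> = robin_count \<sigma> {\<mu>}"
  by (rule enat_eqI) (simp add: mult_ge_iff count_ge_iff onb_iff_esys)

lemma count_mono: "I \<subseteq> K \<Longrightarrow> robin_count \<sigma> I \<le> robin_count \<sigma> K"
  unfolding robin_count_def by (rule SUP_subset_mono) auto

lemma count_gap:
  assumes g: "F.gap l t"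
  shows "robin_count \<sigma> {..t} = enat (card (Jset l))"
proof (rule enat_eqI)
  fix k
  have "\<exists>us \<mu>s. esys_in k us \<mu>s {..t}" if "k \<le> card (Jset l)"
    using F.esys_exists[OF g that] unfolding esys_in_def by (auto intro: less_imp_le)
  moreover have "k \<le> card (Jset l)" if "esys_in k us \<mu>s {..t}" for us \<mu>s
    using F.esys_card_le[OF g, of k us \<mu>s] that by (auto simp: esys_in_def)
  ultimately show "enat k \<le> robin_count \<sigma> {..t} \<longleftrightarrow> enat k \<le> enat (card (Jset l))"
    unfolding count_ge_iff by auto
qed

section \<open>The sorted list of eigenvalues below a gap\<close>

text \<open>One maximal orthonormal system up to \<open>t\<close> determines the count of every
  subset \<open>I\<close>. A larger system in \<open>I\<close>, joined with the part of the maximal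
  system outside \<open>I\<close>, would exceed the total count at the gap.\<close>

lemma sorted_spectrum:
  assumes g: "F.gap l t"
  obtains xs where "sorted xs" "length xs = card (Jset l)"
    "\<And>I. I \<subseteq> {..t} \<Longrightarrow> robin_count \<sigma> I = enat (card {i. i < length xs \<and> xs ! i \<in> I})"
    "\<And>x. x \<in> set xs \<Longrightarrow> x \<le> t \<and> is_robin_eigenvalue \<sigma> x"
proof -
  define n where "n = card (Jset l)"
  have "enat n \<le> robin_count \<sigma> {..t}" by (simp add: count_gap[OF g] n_def)
  then obtain us \<mu>s where e: "esys_in n us \<mu>s {..t}" unfolding count_ge_iff by blast
  define xs where "xs = sort (map \<mu>s [0..<n])"
  have count: "robin_count \<sigma> I = enat (card {i\<in>{..<n}. \<mu>s i \<in> I})" if I: "I \<subseteq> {..t}" for I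
  proof (rule enat_eqI)
    fix k
    have "\<exists>us \<mu>s. esys_in k us \<mu>s I" if k: "k \<le> card {i\<in>{..<n}. \<mu>s i \<in> I}"
    proof -
      obtain A where "A \<subseteq> {i\<in>{..<n}. \<mu>s i \<in> I}" "card A = k"
        using obtain_subset_with_card_n[OF k] by metis
      then show ?thesis using esys_restrict[OF e, of A I] by auto
    qed
    moreover have "k \<le> card {i\<in>{..<n}. \<mu>s i \<in> I}" if k: "esys_in k vs \<nu>s I" for vs \<nu>s
    proof -
      have "\<exists>ws \<rho>s. esys_in (card {i\<in>{..<n}. \<mu>s i \<notin> I}) ws \<rho>s ({..t} - I)"
        by (rule esys_restrict[OF e]) (use e in \<open>auto simp: esys_in_def\<close>)
      then obtain ws \<rho>s where "esys_in (card {i\<in>{..<n}. \<mu>s i \<notin> I}) ws \<rho>s ({..t} - I)" by blast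
      from esys_append[OF k this] obtain ws \<rho>s where "esys_in (k + card {i\<in>{..<n}. \<mu>s i \<notin> I}) ws \<rho>s (I \<union> ({..t} - I))"
        by auto
      then have "esys_in (k + card {i\<in>{..<n}. \<mu>s i \<notin> I}) ws \<rho>s {..t}" using I by (simp add: Un_absorb1 sup.absorb2)
      then have "enat (k + card {i\<in>{..<n}. \<mu>s i \<notin> I}) \<le> robin_count \<sigma> {..t}" unfolding count_ge_iff by blast
      then have "k + card {i\<in>{..<n}. \<mu>s i \<notin> I} \<le> n" by (simp add: count_gap[OF g] n_def)
      moreover have "card {i\<in>{..<n}. \<mu>s i \<in> I} + card {i\<in>{..<n}. \<mu>s i \<notin> I} = n"
      proof -
        have "{i\<in>{..<n}. \<mu>s i \<in> I} \<union> {i\<in>{..<n}. \<mu>s i \<notin> I} = {..<n}" by auto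
        then show ?thesis by (subst card_Un_disjoint[symmetric]) auto
      qed
      ultimately show ?thesis by simp
    qed
    ultimately show "enat k \<le> robin_count \<sigma> I \<longleftrightarrow> enat k \<le> enat (card {i\<in>{..<n}. \<mu>s i \<in> I})"
      unfolding count_ge_iff by auto
  qed
  have len: "length xs = n" by (simp add: xs_def)
  have card_eq: "card {i. i < length xs \<and> xs ! i \<in> I} = card {i\<in>{..<n}. \<mu>s i \<in> I}" for I
  proof -
    have "card {i. i < length xs \<and> xs ! i \<in> I} = length (filter (\<lambda>x. x \<in> I) xs)"
      by (simp add: length_filter_conv_card)
    also have "\<dots> = length (filter (\<lambda>x. x \<in> I) (map \<mu>s [0..<n]))"
      unfolding xs_def by (metis mset_filter mset_sort size_mset)
    also have "\<dots> = card {i. i < n \<and> \<mu>s i \<in> I}"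
      unfolding length_filter_conv_card by (intro arg_cong[where f=card]) auto
    finally show ?thesis by simp
  qed
  have "x \<le> t \<and> is_robin_eigenvalue \<sigma> x" if x: "x \<in> set xs" for x
  proof -
    obtain i where i: "i < n" "x = \<mu>s i" using x by (auto simp: xs_def)
    have ei: "F.eig x (us i)" "L2_inner (us i) (us i) = 1" "x \<le> t" using e i by (auto simp: esys_in_def F.esys_def)
    have "\<not> (AE z in hemi. us i z = 0)"
      using L2_q_eq_0[OF W21_L2[OF eig_W21[OF ei(1)]]] ei(2) by simp
    then show ?thesis using ei unfolding is_robin_eigenvalue_def eigenspace_iff[symmetric] by blast
  qed
  then show ?thesis using that[of xs] len count card_eq by (simp add: xs_def n_def)
qed

text \<open>\<open>robin_ev\<close> counts from 1, list positions from 0. For \<open>r\<close>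
  beyond \<open>t\<close> the list does not give the count, but monotonicity bounds it below by the
  length of the list, which is all that the infimum needs.\<close>

lemma robin_ev_sorted:
  assumes s: "sorted xs" and c: "\<And>I. I \<subseteq> {..t} \<Longrightarrow> robin_count \<sigma> I = enat (card {i. i < length xs \<and> xs ! i \<in> I})"
    and le: "\<And>x. x \<in> set xs \<Longrightarrow> x \<le> t" and k: "k < length xs"
  shows "robin_ev \<sigma> (Suc k) = xs ! k"
proof -
  have iff: "enat (Suc k) \<le> robin_count \<sigma> {..r} \<longleftrightarrow> xs ! k \<le> r" for r
  proof (cases "r \<le> t")
    case True
    then have cr: "robin_count \<sigma> {..r} = enat (card {i. i < length xs \<and> xs ! i \<le> r})" using c[of "{..r}"] by auto
    show ?thesis
    proof (cases "xs ! k \<le> r")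
      case le: True
      have "{..k} \<subseteq> {i. i < length xs \<and> xs ! i \<le> r}"
      proof
        fix i assume "i \<in> {..k}"
        then have i: "i \<le> k" by simp
        then have "xs ! i \<le> xs ! k" using k by (intro sorted_nth_mono[OF s])
        then show "i \<in> {i. i < length xs \<and> xs ! i \<le> r}" using i k le by auto
      qed
      then have "card {..k} \<le> card {i. i < length xs \<and> xs ! i \<le> r}" by (intro card_mono) auto
      then show ?thesis using le cr by simp
    next
      case gt: False
      have "{i. i < length xs \<and> xs ! i \<le> r} \<subseteq> {..<k}"
      proof
        fix i assume i: "i \<in> {i. i < length xs \<and> xs ! i \<le> r}"
        show "i \<in> {..<k}"
        proof (rule ccontr)
          assume "i \<notin> {..<k}"
          then have "xs ! k \<le> xs ! i" using i sorted_nth_mono[OF s, of k i] by simp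
          then show False using i gt by simp
        qed
      qed
      then have "card {i. i < length xs \<and> xs ! i \<le> r} \<le> card {..<k}" by (intro card_mono) auto
      then show ?thesis using gt cr by simp
    qed
  next
    case False
    have "xs ! k \<le> t" using le k by simp
    moreover have "enat (Suc k) \<le> robin_count \<sigma> {..t}"
    proof -
      have "{i. i < length xs \<and> xs ! i \<le> t} = {..<length xs}" using le by auto
      then show ?thesis using c[of "{..t}"] k by simp
    qed
    then have "enat (Suc k) \<le> robin_count \<sigma> {..r}"
      by (rule order_trans[OF _ count_mono]) (use False in auto)
    ultimately show ?thesis using False by simp
  qed
  have "{r. enat (Suc k) \<le> robin_count \<sigma> {..r}} = {xs ! k..}" unfolding iff by auto
  then show ?thesis unfolding robin_ev_def by simp
qed

end

section \<open>Clusters\<close>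

lemma not_in_cluster_iff: "t \<notin> cluster C l \<longleftrightarrow> C * sqrt (real (l + 1)) \<le> \<bar>ev l - t\<bar>"
  unfolding cluster_def ev_def[symmetric] by auto

lemma down_closed_nat:
  assumes "finite D" "\<And>i k. i \<in> D \<Longrightarrow> k \<le> i \<Longrightarrow> k \<in> D"
  shows "D = {..<card D}"
proof (rule card_subset_eq)
  show "D \<subseteq> {..<card D}"
  proof
    fix i assume "i \<in> D"
    then have "{..i} \<subseteq> D" using assms(2) by auto
    then have "card {..i} \<le> card D" by (rule card_mono[OF assms(1)])
    then show "i \<in> {..<card D}" by simp
  qed
qed simp_all

locale robin_clusters = robin +
  fixes C :: real
  assumes C_ge_1: "C \<ge> 1" and C_ge_S: "176 * S \<le> sqrt (sqrt C)"
begin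

text \<open>The least degree with eigenvalue above \<open>t\<close> is the cut between low and high
  modes. Since \<open>sqrt (l + 1)\<close> is at least 1, the distance to every unperturbed
  eigenvalue is at least \<open>C\<close>, which serves as the uniform margin.\<close>

lemma gap_off_clusters:
  assumes t: "t \<notin> (\<Union>l. cluster C l)"
  shows "F.gap (LEAST l. t < ev l) t"
proof -
  define l where "l = (LEAST l. t < ev l)"
  obtain n where "t < real n" using reals_Archimedean2 by blast
  moreover have "real n \<le> ev n" unfolding ev_def of_nat_le_iff by simp
  ultimately have "t < ev n" by simp
  then have l: "t < ev l" unfolding l_def by (rule LeastI)
  have below: "ev k \<le> t" if "k < l" for k using not_less_Least[of k "\<lambda>l. t < ev l"] that by (simp add: l_def)
  have d: "C * sqrt (real (k + 1)) \<le> \<bar>ev k - t\<bar>" for k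
    unfolding not_in_cluster_iff[symmetric] using t by blast
  have dC: "C \<le> \<bar>ev k - t\<bar>" for k
  proof -
    have "C * 1 \<le> C * sqrt (real (k + 1))" using C_ge_1 by (intro mult_left_mono) auto
    then show ?thesis using d[of k] by linarith
  qed
  have sep: "basis.separates l t"
    unfolding basis.separates_def
  proof (intro exI[of _ C] conjI allI ballI impI)
    show "0 < C" using C_ge_1 by simp
    show "lamb j \<le> t - C" if "j \<in> Jset l" for j
      using that below[of "fst j + snd j"] dC[of "fst j + snd j"] by (simp add: Jset_def lamb_def)
    show "t + C \<le> lamb j" if "j \<notin> Jset l" for j
    proof -
      have "ev l \<le> ev (fst j + snd j)" using that by (intro ev_mono) (simp add: Jset_def)
      then show ?thesis using l dC[of "fst j + snd j"] by (simp add: lamb_def)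
    qed
  qed
  show ?thesis unfolding F.gap_def l_def[symmetric] using sep rb_gap[OF C_ge_1 C_ge_S d sep] by blast
qed

lemma eigenvalue_in_cluster:
  assumes "is_robin_eigenvalue \<sigma> \<mu>"
  shows "\<mu> \<in> (\<Union>l. cluster C l)"
proof (rule ccontr)
  assume n: "\<mu> \<notin> (\<Union>l. cluster C l)"
  obtain u where u: "F.eig \<mu> u" "\<not> (AE x in hemi. u x = 0)"
    using assms unfolding is_robin_eigenvalue_def eigenspace_iff[symmetric] by blast
  have "Wip.q u = 0" by (rule F.gap_no_eigenvalue[OF gap_off_clusters[OF n] u(1)])
  then show False using u(2) L2_q_eq_0[OF W21_L2[OF eig_W21[OF u(1)]]] by simp
qed

section \<open>Thresholds between consecutive clusters\<close>

definition threshold :: "nat \<Rightarrow> real" where "threshold l = ev l - C * sqrt (real (l + 1))"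

text \<open>From this index on
  \<open>C\<^sup>2 * (l + 1) \<le> 2 * C\<^sup>2 * l \<le> l\<^sup>2\<close>, so the radius of
  cluster \<open>l\<close> is at most \<open>l\<close>, half the distance between its centre and the
  previous one.\<close>

definition threshold0 :: nat where "threshold0 = Suc (nat \<lceil>2 * C\<^sup>2\<rceil>)"

lemma sqrt_le_of_threshold0:
  assumes "threshold0 \<le> l"
  shows "C * sqrt (real (l + 1)) \<le> real l"
proof -
  have l: "1 \<le> real l" "2 * C\<^sup>2 \<le> real l" using assms unfolding threshold0_def by linarith+
  have "C\<^sup>2 * real (l + 1) \<le> C\<^sup>2 * (2 * real l)" using l by (intro mult_left_mono) auto
  also have "\<dots> = (2 * C\<^sup>2) * real l" by simp
  also have "\<dots> \<le> real l * real l" using l by (intro mult_right_mono) auto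
  finally have "(C * sqrt (real (l + 1)))\<^sup>2 \<le> (real l)\<^sup>2"
    by (simp add: power_mult_distrib power2_eq_square[of "real l"])
  then show ?thesis by (rule power2_le_imp_le) simp
qed

text \<open>The centre \<open>ev (l - 1)\<close> lies \<open>2 * l\<close> below
  \<open>ev l\<close>, which leaves room for two radii of size at most \<open>l\<close>. Smaller
  clusters end even earlier.\<close>

lemma threshold_ge:
  assumes "threshold0 \<le> l" "k < l"
  shows "ev k + C * sqrt (real (k + 1)) \<le> threshold l"
proof -
  obtain p where p: "l = Suc p" using assms(2) by (cases l) auto
  have "ev k \<le> ev p" by (rule ev_mono) (use assms(2) p in simp)
  moreover have "ev p = ev l - 2 * real l" by (simp add: p ev_def algebra_simps)
  moreover have "C * sqrt (real (k + 1)) \<le> C * sqrt (real (l + 1))"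
    using C_ge_1 assms(2) by (intro mult_left_mono) auto
  ultimately show ?thesis using sqrt_le_of_threshold0[OF assms(1)] unfolding threshold_def by linarith
qed

lemma threshold_mono:
  assumes "threshold0 \<le> l" "l \<le> k"
  shows "threshold l \<le> threshold k"
  using assms(2)
proof (induction k rule: dec_induct)
  case (step k)
  have "C * sqrt (real (k + 1)) \<ge> 0" using C_ge_1 by simp
  then have "threshold k \<le> ev k + C * sqrt (real (k + 1))" by (simp add: threshold_def)
  also have "\<dots> \<le> threshold (Suc k)" by (rule threshold_ge) (use assms(1) step in auto)
  finally show ?case using step by simp
qed simp

lemma cluster_less_threshold:
  assumes "threshold0 \<le> l" "k < l" "x \<in> cluster C k"
  shows "x < threshold l"
  using threshold_ge[OF assms(1,2)] assms(3) unfolding cluster_def ev_def by simp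

lemma threshold_less_cluster:
  assumes "threshold0 \<le> l" "l \<le> k" "x \<in> cluster C k"
  shows "threshold l < x"
  using threshold_mono[OF assms(1,2)] assms(3) unfolding cluster_def threshold_def ev_def by simp

text \<open>Clusters are open intervals, so the left end of cluster \<open>l\<close> is outside it;
  the clusters before end at or below this point, and later ones begin at or above it.\<close>

lemma gap_threshold:
  assumes l: "threshold0 \<le> l"
  shows "F.gap l (threshold l)"
proof -
  have "threshold l \<notin> cluster C k" for k
    using cluster_less_threshold[OF l, of k "threshold l"] threshold_less_cluster[OF l, of k "threshold l"] by (cases "k < l") auto
  then have "F.gap (LEAST k. threshold l < ev k) (threshold l)" by (intro gap_off_clusters) blast
  moreover have "(LEAST k. threshold l < ev k) = l"
  proof (rule Least_equality)
    show "threshold l < ev l" using C_ge_1 by (simp add: threshold_def)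
    fix k assume k: "threshold l < ev k"
    show "l \<le> k"
    proof (rule ccontr)
      assume "\<not> l \<le> k"
      then have "ev k + C * sqrt (real (k + 1)) \<le> threshold l" by (intro threshold_ge l) simp
      moreover have "0 \<le> C * sqrt (real (k + 1))" using C_ge_1 by simp
      ultimately show False using k by linarith
    qed
  qed
  ultimately show ?thesis by simp
qed

lemma count_threshold: "threshold0 \<le> l \<Longrightarrow> robin_count \<sigma> {..threshold l} = enat (l * (l + 1) div 2)"
  using count_gap[OF gap_threshold] by (simp add: card_Jset)

lemma robin_ev_ge_threshold:
  assumes l: "threshold0 \<le> l" and j: "l * (l + 1) div 2 < j"
  shows "threshold l \<le> robin_ev \<sigma> j"
  unfolding robin_ev_def
proof (rule cInf_greatest)
  \<comment> \<open>An infimum over the empty set would be meaningless. This index passes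
    \<open>threshold0\<close>, and there are at least \<open>j\<close> eigenvalues up to its
    threshold.\<close>
  define m where "m = Suc (j + threshold0)"
  have "j \<le> m * (m + 1) div 2"
  proof -
    have "2 * j \<le> m * (m + 1)" unfolding m_def by simp
    then show ?thesis by simp
  qed
  then have "enat j \<le> robin_count \<sigma> {..threshold m}" by (subst count_threshold) (auto simp: m_def)
  then show "{t. enat j \<le> robin_count \<sigma> {..t}} \<noteq> {}" by blast
  fix t assume t: "t \<in> {t. enat j \<le> robin_count \<sigma> {..t}}"
  show "threshold l \<le> t"
  proof (rule ccontr)
    assume "\<not> threshold l \<le> t"
    then have "robin_count \<sigma> {..t} \<le> robin_count \<sigma> {..threshold l}" by (intro count_mono) auto
    then have "enat j \<le> robin_count \<sigma> {..threshold l}" using t by (simp add: order_trans)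
    then show False using j by (simp add: count_threshold[OF l])
  qed
qed

text \<open>Everything is read off the sorted list of eigenvalues up to
  \<open>threshold (l + 1)\<close>. It has \<open>L + (l + 1)\<close> entries, the first
  \<open>L\<close> of which are exactly those up to \<open>threshold l\<close>; both thresholds
  separate clusters, so the cluster of an entry is decided by its position.\<close>

lemma cluster_counts:
  assumes l: "threshold0 \<le> l"
  defines "L \<equiv> l * (l + 1) div 2"
  shows "robin_count \<sigma> (\<Union>k<l. cluster C k) = enat L"
    and "robin_count \<sigma> (cluster C l) = enat (l + 1)"
    and "{j. 1 \<le> j \<and> robin_ev \<sigma> j \<in> cluster C l} = (\<lambda>k. L + k) ` {1..l + 1}"
    and "\<And>\<mu>. \<mu> \<in> cluster C l \<Longrightarrow>
      robin_mult \<sigma> \<mu> = enat (card {k \<in> {1..l + 1}. robin_ev \<sigma> (L + k) = \<mu>})"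
proof -
  have l': "threshold0 \<le> l + 1" using l by simp
  have mono: "threshold l \<le> threshold (l + 1)" by (rule threshold_mono[OF l]) simp
  obtain xs where xs: "sorted xs" "length xs = card (Jset (l + 1))"
    and c: "\<And>I. I \<subseteq> {..threshold (l + 1)} \<Longrightarrow> robin_count \<sigma> I = enat (card {i. i < length xs \<and> xs ! i \<in> I})"
    and ev: "\<And>x. x \<in> set xs \<Longrightarrow> x \<le> threshold (l + 1) \<and> is_robin_eigenvalue \<sigma> x"
    by (rule sorted_spectrum[OF gap_threshold[OF l']]) (rule that)
  have dbl: "2 * L = l * (l + 1)" unfolding L_def by simp
  have "2 * ((l + 1) * (l + 1 + 1) div 2) = (l + 1) * (l + 1 + 1)" by simp
  then have n: "length xs = L + (l + 1)" unfolding xs(2) card_Jset using dbl by simp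
  define D where "D = {i. i < length xs \<and> xs ! i \<in> {..threshold l}}"
  have "robin_count \<sigma> {..threshold l} = enat (card D)" unfolding D_def by (rule c) (use mono in auto)
  then have cD: "card D = L" using count_threshold[OF l] by (simp add: L_def)
  \<comment> \<open>The entries up to \<open>threshold l\<close> form an initial segment of the
    sorted list, and their number is the known count at that gap.\<close>
  have D: "D = {..<L}"
    unfolding cD[symmetric]
  proof (rule down_closed_nat)
    fix i k assume i: "i \<in> D" and k: "k \<le> i"
    have "xs ! k \<le> xs ! i" using i k by (intro sorted_nth_mono[OF xs(1)]) (auto simp: D_def)
    then show "k \<in> D" using i k by (auto simp: D_def)
  qed (simp add: D_def)
  have low: "xs ! i \<le> threshold l \<longleftrightarrow> i < L" if "i < length xs" for i
    using D that unfolding D_def by auto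
  have ex: "(i < L \<and> (\<exists>k<l. xs ! i \<in> cluster C k)) \<or> (L \<le> i \<and> xs ! i \<in> cluster C l)" if i: "i < length xs" for i
  proof -
    have e: "xs ! i \<le> threshold (l + 1)" "is_robin_eigenvalue \<sigma> (xs ! i)" using ev[of "xs ! i"] i by auto
    obtain k where k: "xs ! i \<in> cluster C k" using eigenvalue_in_cluster[OF e(2)] by blast
    consider "k < l" | "k = l" | "l + 1 \<le> k" by linarith
    then show ?thesis
    proof cases
      case 1
      then show ?thesis using k low[OF i] cluster_less_threshold[OF l 1 k] by auto
    next
      case 2
      then show ?thesis using k low[OF i] threshold_less_cluster[OF l _ k] by force
    next
      case 3
      then show ?thesis using threshold_less_cluster[OF l' 3 k] e(1) by simp
    qed
  qed
  have disj: "xs ! i \<notin> cluster C l" if "i < length xs" "i < L" for i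
    using low[OF that(1)] that threshold_less_cluster[OF l order_refl, of "xs ! i"] by force
  have disj': "xs ! i \<notin> cluster C k" if "i < length xs" "L \<le> i" "k < l" for i k
    using low[OF that(1)] that cluster_less_threshold[OF l that(3), of "xs ! i"] by force
  have sub1: "(\<Union>k<l. cluster C k) \<subseteq> {..threshold (l + 1)}"
    using cluster_less_threshold[OF l] mono by force
  have sub2: "cluster C l \<subseteq> {..threshold (l + 1)}"
    using cluster_less_threshold[OF l', of l] by force
  have "{i. i < length xs \<and> xs ! i \<in> (\<Union>k<l. cluster C k)} = {..<L}"
  proof (intro set_eqI iffI)
    fix i assume "i \<in> {i. i < length xs \<and> xs ! i \<in> (\<Union>k<l. cluster C k)}"
    then show "i \<in> {..<L}" using disj'[of i] by force
  next
    fix i assume "i \<in> {..<L}"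
    then show "i \<in> {i. i < length xs \<and> xs ! i \<in> (\<Union>k<l. cluster C k)}" using ex[of i] n by auto
  qed
  then show "robin_count \<sigma> (\<Union>k<l. cluster C k) = enat L" using c[OF sub1] by simp
  have in_l: "xs ! i \<in> cluster C l \<longleftrightarrow> L \<le> i" if "i < length xs" for i
    using ex[OF that] disj[OF that] by auto
  have "{i. i < length xs \<and> xs ! i \<in> cluster C l} = {L..<length xs}" using in_l by auto
  then show "robin_count \<sigma> (cluster C l) = enat (l + 1)" using c[OF sub2] n by simp
  have rev: "robin_ev \<sigma> (Suc k) = xs ! k" if "k < length xs" for k
    by (rule robin_ev_sorted[OF xs(1) c _ that]) (use ev in auto)
  show "{j. 1 \<le> j \<and> robin_ev \<sigma> j \<in> cluster C l} = (\<lambda>k. L + k) ` {1..l + 1}"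
  proof (intro set_eqI iffI)
    fix j assume j: "j \<in> {j. 1 \<le> j \<and> robin_ev \<sigma> j \<in> cluster C l}"
    then obtain i where i: "j = Suc i" by (cases j) auto
    \<comment> \<open>Eigenvalues beyond the list are at least \<open>threshold (l + 1)\<close> and
      therefore to the right of cluster \<open>l\<close>.\<close>
    have "i < length xs"
    proof (rule ccontr)
      assume "\<not> i < length xs"
      then have "(l + 1) * (l + 1 + 1) div 2 < j" using i xs(2) by (simp add: card_Jset)
      then have "threshold (l + 1) \<le> robin_ev \<sigma> j" by (rule robin_ev_ge_threshold[OF l'])
      then show False using j cluster_less_threshold[OF l', of l "robin_ev \<sigma> j"] by simp
    qed
    moreover from this have "L \<le> i" using j in_l rev i by simp
    ultimately have "j - L \<in> {1..l + 1}" "j = L + (j - L)" using i n by auto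
    then show "j \<in> (\<lambda>k. L + k) ` {1..l + 1}" by blast
  next
    fix j assume "j \<in> (\<lambda>k. L + k) ` {1..l + 1}"
    then obtain k where k: "k \<in> {1..l + 1}" "j = L + k" by blast
    then obtain i where i: "k = Suc i" by (cases k) auto
    have "L + i < length xs" using k i n by simp
    then show "j \<in> {j. 1 \<le> j \<and> robin_ev \<sigma> j \<in> cluster C l}"
      using rev[of "L + i"] in_l[of "L + i"] k i by simp
  qed
  fix \<mu> assume mu: "\<mu> \<in> cluster C l"
  have "robin_mult \<sigma> \<mu> = enat (card {i. i < length xs \<and> xs ! i \<in> {\<mu>}})"
    unfolding mult_eq_count using mu sub2 by (intro c) auto
  also have "card {i. i < length xs \<and> xs ! i \<in> {\<mu>}} = card {k \<in> {1..l + 1}. robin_ev \<sigma> (L + k) = \<mu>}"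
  \<comment> \<open>The index \<open>L + k\<close> of an eigenvalue, counted from 1, is list
    position \<open>L + k - 1\<close>.\<close>
  proof (rule bij_betw_same_card[symmetric], rule bij_betw_imageI)
    show "inj_on (\<lambda>k. L + k - 1) {k \<in> {1..l + 1}. robin_ev \<sigma> (L + k) = \<mu>}"
      by (auto simp: inj_on_def)
    show "(\<lambda>k. L + k - 1) ` {k \<in> {1..l + 1}. robin_ev \<sigma> (L + k) = \<mu>} = {i. i < length xs \<and> xs ! i \<in> {\<mu>}}"
    proof (intro set_eqI iffI)
      fix i assume "i \<in> (\<lambda>k. L + k - 1) ` {k \<in> {1..l + 1}. robin_ev \<sigma> (L + k) = \<mu>}"
      then obtain k where k: "1 \<le> k" "k \<le> l + 1" "robin_ev \<sigma> (L + k) = \<mu>" "i = L + k - 1" by auto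
      have "i < length xs" "L + k = Suc i" using k n by auto
      then show "i \<in> {i. i < length xs \<and> xs ! i \<in> {\<mu>}}" using rev[of i] k(3) by simp
    next
      fix i assume i: "i \<in> {i. i < length xs \<and> xs ! i \<in> {\<mu>}}"
      then have "L \<le> i" using in_l[of i] mu by simp
      then have "Suc i - L \<in> {k \<in> {1..l + 1}. robin_ev \<sigma> (L + k) = \<mu>}" "i = L + (Suc i - L) - 1"
        using i n rev[of i] by auto
      then show "i \<in> (\<lambda>k. L + k - 1) ` {k \<in> {1..l + 1}. robin_ev \<sigma> (L + k) = \<mu>}" by blast
    qed
  qed
  finally show "robin_mult \<sigma> \<mu> = enat (card {k \<in> {1..l + 1}. robin_ev \<sigma> (L + k) = \<mu>})" .
qed

end

theorem theorem1p1:
  fixes \<sigma> :: "real \<Rightarrow> real"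
  assumes "\<sigma> C1_differentiable_on UNIV"
    and "\<forall>\<phi>. \<sigma> (\<phi> + 2 * pi) = \<sigma> \<phi>"
  shows "\<exists>C>0.
    (\<forall>\<mu>. is_robin_eigenvalue \<sigma> \<mu> \<longrightarrow> \<mu> \<in> (\<Union>l. cluster C l)) \<and>
    (\<forall>\<^sub>F l in sequentially.
       robin_count \<sigma> (\<Union>k<l. cluster C k) = enat (l * (l + 1) div 2) \<and>
       robin_count \<sigma> (cluster C l) = enat (l + 1) \<and>
       {j. 1 \<le> j \<and> robin_ev \<sigma> j \<in> cluster C l} =
         (\<lambda>k. l * (l + 1) div 2 + k) ` {1..l + 1} \<and>
       (\<forall>\<mu>\<in>cluster C l. robin_mult \<sigma> \<mu> =
          enat (card {k \<in> {1..l + 1}. robin_ev \<sigma> (l * (l + 1) div 2 + k) = \<mu>})))"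
proof -
  have cont: "continuous_on UNIV \<sigma>" by (rule C1_differentiable_imp_continuous_on[OF assms(1)])
  have "compact (\<sigma> ` {-pi..pi})"
    by (intro compact_continuous_image continuous_on_subset[OF cont]) auto
  then obtain S where S: "S > 0" "\<And>x. x \<in> \<sigma> ` {-pi..pi} \<Longrightarrow> norm x \<le> S"
    using compact_imp_bounded bounded_pos by metis
  \<comment> \<open>The fourth power answers the fourth root of \<open>C\<close> in the trace
    estimate; the maximum with 1 provides \<open>C_ge_1\<close>.\<close>
  define C where "C = max 1 ((176 * S) ^ 4)"
  have C2: "176 * S \<le> sqrt (sqrt C)"
  proof (intro real_le_rsqrt)
    show "((176 * S)\<^sup>2)\<^sup>2 \<le> C" unfolding C_def by (simp flip: power_mult)
  qed
  interpret robin_clusters \<sigma> S C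
  proof
    show "\<bar>\<sigma> y\<bar> \<le> S" if "-pi < y" "y \<le> pi" for y
      using S(2)[of "\<sigma> y"] that by simp
  qed (use cont S C2 in \<open>auto simp: C_def\<close>)
  show ?thesis
  proof (intro exI[of _ C] conjI allI impI)
    show "C > 0" using C_ge_1 by simp
    show "\<mu> \<in> (\<Union>l. cluster C l)" if "is_robin_eigenvalue \<sigma> \<mu>" for \<mu>
      by (rule eigenvalue_in_cluster[OF that])
    show "\<forall>\<^sub>F l in sequentially.
       robin_count \<sigma> (\<Union>k<l. cluster C k) = enat (l * (l + 1) div 2) \<and>
       robin_count \<sigma> (cluster C l) = enat (l + 1) \<and>
       {j. 1 \<le> j \<and> robin_ev \<sigma> j \<in> cluster C l} =
         (\<lambda>k. l * (l + 1) div 2 + k) ` {1..l + 1} \<and>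
       (\<forall>\<mu>\<in>cluster C l. robin_mult \<sigma> \<mu> =
          enat (card {k \<in> {1..l + 1}. robin_ev \<sigma> (l * (l + 1) div 2 + k) = \<mu>}))"
      unfolding eventually_sequentially
      by (intro exI[of _ threshold0] allI impI conjI ballI cluster_counts)
  qed
qed

end
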